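(* Let $\hat R, R_1, T_0>0$, let $R>\hat R+R_1$, and set $T:=T_0+\hat R+R_1+R$. Let $\Gamma_R=\{\boldsymbol x\in\mathbb R^3:|\boldsymbol x|=R\}$ with unit normal vector $\boldsymbol\nu$, and let $\Gamma\subset\Gamma_R$ be a (relatively) open subset of positive Lebesgue (surface) measure. Let $\boldsymbol J\in H^2(\mathbb R^3)^3$ be a given $\mathbb R^3$-valued function, not identically zero, compactly supported in $B_{\hat R}=\{\boldsymbol x:|\boldsymbol x|<\hat R\}$ and with $\mathrm{div}\,\boldsymbol J=0$ in $\mathbb R^3$. Let $g\in C^1(\mathbb R_+;\mathbb R)$ be given with $g(t)=0$ for $t\ge T_0$ and for $t\le 0$, and with $\mathrm{supp}(g)=[0,T_0]$. Then, among orbit functions whose initial position is the origin and whose components have speed less than one on $[0,T_0]$, the orbit function is uniquely determined on $[0,T_0]$ by the data $\{\boldsymbol E(\boldsymbol x,t)\times\boldsymbol\nu:\boldsymbol x\in\Gamma,\ t\in(0,T)\}$. That is: let $\boldsymbol a=(a_1,a_2,a_3)$ and $\boldsymbol b=(b_1,b_2,b_3)$ in $C^1(\mathbb R_+;\mathbb R^3)$ satisfy $|\boldsymbol a(t)|<R_1$ and $|\boldsymbol b(t)|<R_1$ for all $t\in\mathbb R_+$, $\boldsymbol a(0)=\boldsymbol b(0)=\boldsymbol 0$, and $|a_j'(t)|<1$, $|b_j'(t)|<1$ for all $t\in[0,T_0]$ and $j=1,2,3$. Let $\boldsymbol E_1,\boldsymbol E_2$ be the solutions of $$\partial_t^2\boldsymbol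 E_i(\boldsymbol x,t)+\nabla\times(\nabla\times\boldsymbol E_i(\boldsymbol x,t))=\boldsymbol F_i(\boldsymbol x,t),\quad \boldsymbol x\in\mathbb R^3,\ t>0,\qquad \boldsymbol E_i(\boldsymbol x,0)=\partial_t\boldsymbol E_i(\boldsymbol x,0)=0,\quad\boldsymbol x\in\mathbb R^3,$$ with $\boldsymbol F_1(\boldsymbol x,t)=\boldsymbol J(\boldsymbol x-\boldsymbol a(t))g(t)$ and $\boldsymbol F_2(\boldsymbol x,t)=\boldsymbol J(\boldsymbol x-\boldsymbol b(t))g(t)$. If $\boldsymbol E_1(\boldsymbol x,t)\times\boldsymbol\nu=\boldsymbol E_2(\boldsymbol x,t)\times\boldsymbol\nu$ for all $\boldsymbol x\in\Gamma$ and $t\in(0,T)$, then $\boldsymbol a(t)=\boldsymbol b(t)$ for all $t\in[0,T_0]$.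
   Context: $\mathbb R_+$ denotes the nonnegative time half-line and $B_r$ the open ball of radius $r$ in $\mathbb R^3$ centred at the origin. For sources as in the claim, "the solution" of the initial value problem for the Maxwell system means the unique solution with $\boldsymbol E\in C([0,\tau];H^2(\mathbb R^3))^3\cap C^2([0,\tau];L^2(\mathbb R^3))^3$ for every $\tau>0$. Since the profile is divergence free, $\nabla\cdot\boldsymbol E=0$, and the system is equivalent to the componentwise wave equation $\partial_t^2\boldsymbol E-\Delta\boldsymbol E=\boldsymbol F$ with zero initial data. *)

theory Defs
  imports "HOL-Analysis.Analysis"
begin

text \<open>Elements of \<open>L\<^sup>2\<close> and \<open>H\<^sup>2\<close> are represented by functions; all notions below except
  pointwise evaluation are invariant under changes on null sets.  Vector-valued functions are
  treated at once; for \<open>'b = real^3\<close> everything is equivalent to the componentwise notion.\<close>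

subsection \<open>Test functions and weak derivatives\<close>

primrec iter_pderiv :: "'n list \<Rightarrow> (real^'n \<Rightarrow> real) \<Rightarrow> real^'n \<Rightarrow> real" where
  "iter_pderiv [] \<phi> = \<phi>"
| "iter_pderiv (i # \<alpha>) \<phi> = (\<lambda>x. frechet_derivative (iter_pderiv \<alpha> \<phi>) (at x) (axis i 1))"

text \<open>Differentiability of all iterated partial derivatives includes their continuity, so this is
  \<open>C\<^sub>c\<^sup>\<infinity>\<close>.\<close>

definition test_functions :: "(real^'n \<Rightarrow> real) set" where
  "test_functions = {\<phi>. (\<forall>\<alpha> x. iter_pderiv \<alpha> \<phi> differentiable (at x))
                      \<and> compact (closure {x. \<phi> x \<noteq> 0})}"

definition locally_integrable :: "(real^'n \<Rightarrow> 'b::euclidean_space) \<Rightarrow> bool" where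
  "locally_integrable u \<longleftrightarrow> (\<forall>K. compact K \<longrightarrow> u absolutely_integrable_on K)"

text \<open>A list \<open>\<alpha> = [i, j, \<dots>]\<close> stands for the derivative \<open>\<partial>\<^sub>i \<partial>\<^sub>j \<dots>\<close> of order \<open>length \<alpha>\<close>.\<close>

definition has_weak_pderiv ::
  "'n list \<Rightarrow> (real^'n \<Rightarrow> 'b::euclidean_space) \<Rightarrow> (real^'n \<Rightarrow> 'b) \<Rightarrow> bool" where
  "has_weak_pderiv \<alpha> u v \<longleftrightarrow> locally_integrable u \<and> locally_integrable v \<and>
     (\<forall>\<phi>\<in>test_functions.
        (LINT x|lebesgue. iter_pderiv \<alpha> \<phi> x *\<^sub>R u x)
        = (-1) ^ length \<alpha> *\<^sub>R (LINT x|lebesgue. \<phi> x *\<^sub>R v x))"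

text \<open>Determined up to a null set whenever the weak derivative exists, and meaningless otherwise.\<close>

definition weak_pderiv ::
  "'n list \<Rightarrow> (real^'n \<Rightarrow> 'b::euclidean_space) \<Rightarrow> real^'n \<Rightarrow> 'b" where
  "weak_pderiv \<alpha> u = (SOME v. has_weak_pderiv \<alpha> u v)"

definition weak_div :: "(real^3 \<Rightarrow> real^3) \<Rightarrow> real^3 \<Rightarrow> real" where
  "weak_div u x = (\<Sum>i\<in>UNIV. weak_pderiv [i] u x $ i)"

definition weak_curl :: "(real^3 \<Rightarrow> real^3) \<Rightarrow> real^3 \<Rightarrow> real^3" where
  "weak_curl u x = vector
     [weak_pderiv [2] u x $ 3 - weak_pderiv [3] u x $ 2,
      weak_pderiv [3] u x $ 1 - weak_pderiv [1] u x $ 3,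
      weak_pderiv [1] u x $ 2 - weak_pderiv [2] u x $ 1]"

subsection \<open>The spaces \<open>L\<^sup>2\<close> and \<open>H\<^sup>2\<close>\<close>

definition L2 :: "(real^'n \<Rightarrow> 'b::euclidean_space) set" where
  "L2 = {u. u \<in> borel_measurable lebesgue \<and> integrable lebesgue (\<lambda>x. (norm (u x))\<^sup>2)}"

definition L2_norm :: "(real^'n \<Rightarrow> 'b::euclidean_space) \<Rightarrow> real" where
  "L2_norm u = sqrt (LINT x|lebesgue. (norm (u x))\<^sup>2)"

definition H2 :: "(real^'n \<Rightarrow> 'b::euclidean_space) set" where
  "H2 = {u \<in> L2. \<forall>\<alpha>. length \<alpha> \<le> 2 \<longrightarrow> (\<exists>v\<in>L2. has_weak_pderiv \<alpha> u v)}"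

text \<open>Lists rather than multi-indices: mixed second derivatives are counted twice, as in the
  Frobenius norm of the Hessian.\<close>

definition H2_norm :: "(real^'n \<Rightarrow> 'b::euclidean_space) \<Rightarrow> real" where
  "H2_norm u = sqrt (\<Sum>\<alpha> | length \<alpha> \<le> 2. (L2_norm (weak_pderiv \<alpha> u))\<^sup>2)"

subsection \<open>Curves in \<open>L\<^sup>2\<close> and \<open>H\<^sup>2\<close>\<close>

definition cont_into_L2 :: "real set \<Rightarrow> (real \<Rightarrow> real^'n \<Rightarrow> 'b::euclidean_space) \<Rightarrow> bool" where
  "cont_into_L2 S u \<longleftrightarrow> (\<forall>t\<in>S. u t \<in> L2 \<and>
     ((\<lambda>s. L2_norm (\<lambda>x. u s x - u t x)) \<longlongrightarrow> 0) (at t within S))"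

definition cont_into_H2 :: "real set \<Rightarrow> (real \<Rightarrow> real^'n \<Rightarrow> 'b::euclidean_space) \<Rightarrow> bool" where
  "cont_into_H2 S u \<longleftrightarrow> (\<forall>t\<in>S. u t \<in> H2 \<and>
     ((\<lambda>s. H2_norm (\<lambda>x. u s x - u t x)) \<longlongrightarrow> 0) (at t within S))"

text \<open>\<open>v\<close> is the derivative in \<open>L\<^sup>2\<close>-norm of the curve \<open>u\<close>, one-sided at the endpoints of \<open>S\<close>.\<close>

definition has_L2_time_deriv ::
  "real set \<Rightarrow> (real \<Rightarrow> real^'n \<Rightarrow> 'b::euclidean_space) \<Rightarrow> (real \<Rightarrow> real^'n \<Rightarrow> 'b) \<Rightarrow> bool" where
  "has_L2_time_deriv S u v \<longleftrightarrow> (\<forall>t\<in>S.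
     ((\<lambda>s. L2_norm (\<lambda>x. (u s x - u t x) /\<^sub>R (s - t) - v t x)) \<longlongrightarrow> 0) (at t within S))"

subsection \<open>The Maxwell system\<close>

text \<open>A solution in \<open>C([0,\<tau>]; H\<^sup>2) \<inter> C\<^sup>2([0,\<tau>]; L\<^sup>2)\<close> for every \<open>\<tau> > 0\<close>; \<open>Et\<close> and \<open>Ett\<close> are its
  first and second time derivatives, and equations between elements of \<open>L\<^sup>2\<close> hold almost
  everywhere.  Since \<open>H\<^sup>2(\<real>\<^sup>3)\<close> embeds into the continuous functions, each \<open>E(\<cdot>,t)\<close> has a unique
  continuous representative; it is the one chosen here, which gives a meaning to point values of
  \<open>E(\<cdot>,t)\<close> on surfaces.\<close>

definition maxwell_solution ::
  "(real^3 \<Rightarrow> real \<Rightarrow> real^3) \<Rightarrow> (real^3 \<Rightarrow> real \<Rightarrow> real^3) \<Rightarrow> bool" where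
  "maxwell_solution F E \<longleftrightarrow>
     (\<forall>t\<ge>0. continuous_on UNIV (\<lambda>x. E x t)) \<and>
     (\<exists>Et Ett.
        (\<forall>\<tau>>0. cont_into_H2 {0..\<tau>} (\<lambda>t x. E x t)
             \<and> cont_into_L2 {0..\<tau>} (\<lambda>t x. E x t)
             \<and> cont_into_L2 {0..\<tau>} Et
             \<and> cont_into_L2 {0..\<tau>} Ett
             \<and> has_L2_time_deriv {0..\<tau>} (\<lambda>t x. E x t) Et
             \<and> has_L2_time_deriv {0..\<tau>} Et Ett) \<and>
        (\<forall>t>0. AE x in lebesgue. Ett t x + weak_curl (weak_curl (\<lambda>y. E y t)) x = F x t) \<and>
        (\<forall>x. E x 0 = 0) \<and>
        (AE x in lebesgue. Et 0 x = 0))"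

subsection \<open>Time-dependent data and the sphere\<close>

text \<open>\<open>C\<^sup>1\<close> on the closed half-line, with the one-sided derivative at \<open>0\<close>.\<close>

abbreviation halfline_deriv :: "(real \<Rightarrow> 'b::real_normed_vector) \<Rightarrow> real \<Rightarrow> 'b" where
  "halfline_deriv f t \<equiv> vector_derivative f (at t within {0..})"

definition C1_halfline :: "(real \<Rightarrow> 'b::real_normed_vector) \<Rightarrow> bool" where
  "C1_halfline f \<longleftrightarrow> f differentiable_on {0..} \<and> continuous_on {0..} (halfline_deriv f)"

text \<open>Surface measure of a subset \<open>A\<close> of the sphere of radius \<open>R\<close> centred at the origin, as cone
  measure: the solid cone over \<open>A\<close> has volume \<open>\<integral>\<^sub>0\<^sup>R (r / R)\<^sup>2 area(A) dr = R / 3 * area(A)\<close>.\<close>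

definition sphere_area :: "real \<Rightarrow> (real^3) set \<Rightarrow> real" where
  "sphere_area R A = 3 / R * measure lebesgue {r *\<^sub>R x |r x. 0 < r \<and> r \<le> 1 \<and> x \<in> A}"

end

theory Submission
  imports Defs "HOL-Complex_Analysis.Conformal_Mappings"
begin

text \<open>Testing the equation with the spherical waves \<open>P(t + |x - x\<^sub>0|) / |x - x\<^sub>0|\<close>, regularised at
  \<open>x\<^sub>0 \<in> \<Gamma>\<close>, expresses the tangential part of the field at \<open>x\<^sub>0\<close> by integrals of the source; a
  grad-div term does not contribute because the source is divergence free.  For \<open>P(t) = exp(-\<sigma>t)\<close>,
  cut off outside the time window in which the source is seen from \<open>x\<^sub>0\<close>, the data force the
  Yukawa potential \<open>N\<close> of the Laplace-averaged source difference \<open>c\<close> to be normal to the sphere on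
  \<open>\<Gamma>\<close>, hence, by analyticity along great circles, on the whole sphere.  An energy identity
  for the divergence-free field \<open>N\<close> in the exterior domain gives \<open>N = 0\<close> there, and its far field
  yields \<open>\<integral> exp(\<xi> \<bullet> y) c(y) dy = 0\<close> whenever \<open>|\<xi>| = \<sigma>\<close>.  This integral is the product of
  \<open>\<integral> exp(\<xi> \<bullet> y) J(y) dy\<close>, which does not vanish on any open set of \<open>\<xi>\<close>, and
  \<open>\<integral> g(s) exp(-|\<xi>|s) (exp(\<xi> \<bullet> a(s)) - exp(\<xi> \<bullet> b(s))) ds\<close>, which therefore vanishes for all
  \<open>\<xi> \<noteq> 0\<close>.  With \<open>\<xi> = -n e\<^sub>j\<close> these are the moments of \<open>exp(-(s + a\<^sub>j(s)))\<close> and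
  \<open>exp(-(s + b\<^sub>j(s)))\<close> weighted by \<open>g\<close>; since both functions are strictly decreasing and \<open>g\<close> has full
  support, equal moments force \<open>a\<^sub>j = b\<^sub>j\<close>.\<close>

section \<open>Smooth functions of one variable\<close>

text \<open>Only the tangential trace is given, and only on a piece of the sphere, so each x0 in
  \<Gamma> becomes the centre of its own singular test function. The choice P(t) = exp(-\<sigma>t)
  is made because it separates: P(t + r) / r = exp(-\<sigma>t) exp(-\<sigma>r) / r. The time factor
  is a Laplace weight and the space factor a Yukawa kernel, so the wave problem turns into an
  elliptic one. A finite T suffices because the source lives in the ball of radius Rhat + R1 up to
  time T0, and its signals have passed the sphere by T0 + Rhat + R1 + R; compactness of the supports
  leaves room for a smooth cut-off.

  The energy identity is div(N \<times> curl N) = |curl N|^2 + \<sigma>^2 |N|^2. Its flux density x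
  . (N \<times> curl N) = (x \<times> N) . curl N sees N on the sphere only through x \<times> N,
  which is exactly what the data annihilate.

  In the last part g may change sign, so g(s) ds is a signed measure and equality of distributions
  alone does not order the two curves. The argument therefore compares level sets and uses that no
  primitive of g is constant on an interval.\<close>

fun times_differentiable :: "nat \<Rightarrow> (real \<Rightarrow> real) \<Rightarrow> bool" where
  "times_differentiable 0 f = True"
| "times_differentiable (Suc n) f =
     (\<exists>f'. (\<forall>x. (f has_real_derivative f' x) (at x)) \<and> times_differentiable n f')"

lemma times_differentiable_SucI:
  "(\<And>x. (f has_real_derivative f' x) (at x)) \<Longrightarrow> times_differentiable n f' \<Longrightarrow>
    times_differentiable (Suc n) f"
  by auto

definition smooth :: "(real \<Rightarrow> real) \<Rightarrow> bool" where
  "smooth f \<longleftrightarrow> (\<forall>n. times_differentiable n f)"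

lemma times_differentiable_SucD: "times_differentiable (Suc n) f \<Longrightarrow> times_differentiable n f"
proof (induction n arbitrary: f)
  case (Suc n)
  then obtain f' where "\<forall>x. (f has_real_derivative f' x) (at x)" "times_differentiable (Suc n) f'"
    by auto
  then show ?case using Suc.IH[of f'] by auto
qed simp

lemma times_differentiable_add:
  "times_differentiable n f \<Longrightarrow> times_differentiable n g \<Longrightarrow> times_differentiable n (\<lambda>x. f x + g x)"
proof (induction n arbitrary: f g)
  case (Suc n)
  then obtain f' g' where "\<forall>x. (f has_real_derivative f' x) (at x)" "times_differentiable n f'"
     "\<forall>x. (g has_real_derivative g' x) (at x)" "times_differentiable n g'" by auto
  then show ?case using Suc.IH[of f' g']
    by (auto intro!: exI[of _ "\<lambda>x. f' x + g' x"] derivative_eq_intros)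
qed simp

lemma times_differentiable_mult:
  "times_differentiable n f \<Longrightarrow> times_differentiable n g \<Longrightarrow> times_differentiable n (\<lambda>x. f x * g x)"
proof (induction n arbitrary: f g)
  case (Suc n)
  then obtain f' g' where d: "\<forall>x. (f has_real_derivative f' x) (at x)" "times_differentiable n f'"
     "\<forall>x. (g has_real_derivative g' x) (at x)" "times_differentiable n g'" by auto
  have "times_differentiable n (\<lambda>x. f' x * g x + f x * g' x)"
    using Suc.prems d
    by (intro times_differentiable_add Suc.IH) (auto intro: times_differentiable_SucD simp del: times_differentiable.simps)
  moreover have "((\<lambda>x. f x * g x) has_real_derivative (f' x * g x + f x * g' x)) (at x)" for x
    using d by (auto intro!: derivative_eq_intros)
  ultimately show ?case by (rule times_differentiable_SucI[rotated])
qed simp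

lemma times_differentiable_const [simp]: "times_differentiable n (\<lambda>x. c)"
proof (induction n arbitrary: c)
  case (Suc n)
  then show ?case by (auto intro!: exI[of _ "\<lambda>x. 0"] derivative_eq_intros)
qed simp

text \<open>The quotient may be \<open>0 / 0\<close>, but only where the numerator vanishes identically nearby.\<close>

lemma times_differentiable_divide:
  assumes "times_differentiable n f" "times_differentiable n g"
    and "\<And>x. g x = 0 \<Longrightarrow> eventually (\<lambda>y. f y = 0) (nhds x)"
  shows "times_differentiable n (\<lambda>x. f x / g x)"
  using assms
proof (induction n arbitrary: f)
  case (Suc n)
  then obtain f' g' where d: "\<And>x. (f has_real_derivative f' x) (at x)" "times_differentiable n f'"
     "\<And>x. (g has_real_derivative g' x) (at x)" "times_differentiable n g'" by auto
  \<comment> \<open>The derivative of the quotient is \<open>h / g\<close>. Keeping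
    \<open>f / g\<close> inside \<open>h\<close> leaves \<open>g\<close> as the only denominator, so
    the induction hypothesis applies again.\<close>
  define h where "h x = f' x + (- 1) * (f x / g x * g' x)" for x
  have f'0: "eventually (\<lambda>y. f' y = 0) (nhds x)" if gx: "g x = 0" for x
  proof -
    obtain S where S: "open S" "x \<in> S" "\<And>y. y \<in> S \<Longrightarrow> f y = 0"
      using Suc.prems(3)[OF gx] by (auto simp: eventually_nhds)
    have "f' y = 0" if "y \<in> S" for y
    proof -
      have "(f has_real_derivative 0) (at y)"
        using has_field_derivative_transform_within_open[OF DERIV_const[of 0] S(1) that] S(3)
        by simp
      then show ?thesis using d(1) DERIV_unique by blast
    qed
    then show ?thesis using S by (auto simp: eventually_nhds)
  qed
  have fg: "times_differentiable n (\<lambda>x. f x / g x)"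
    by (rule Suc.IH[OF times_differentiable_SucD[OF Suc.prems(1)]
          times_differentiable_SucD[OF Suc.prems(2)] Suc.prems(3)])
  have "times_differentiable n h"
    unfolding h_def using d fg
    by (intro times_differentiable_add times_differentiable_mult) auto
  then have 1: "times_differentiable n (\<lambda>x. h x / g x)"
  proof (rule Suc.IH)
    show "times_differentiable n g" by (rule times_differentiable_SucD[OF Suc.prems(2)])
    fix x assume "g x = 0"
    then show "\<forall>\<^sub>F y in nhds x. h y = 0"
      using f'0[of x] Suc.prems(3)[of x] unfolding h_def by (auto elim: eventually_elim2)
  qed
  have 2: "((\<lambda>x. f x / g x) has_real_derivative (h x / g x)) (at x)" for x
  proof (cases "g x = 0")
    case True
    then obtain S where S: "open S" "x \<in> S" "\<And>y. y \<in> S \<Longrightarrow> f y = 0"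
      using Suc.prems(3)[OF True] by (auto simp: eventually_nhds)
    show ?thesis
      using has_field_derivative_transform_within_open[OF DERIV_const[of 0] S(1,2), of "\<lambda>x. f x / g x"] S(3) True
        by simp
  next
    case False
    then show ?thesis using d
      by (auto intro!: derivative_eq_intros simp: h_def field_simps)
  qed
  from 2 1 show ?case by (rule times_differentiable_SucI)
qed simp

lemma smoothI:
  assumes "\<And>x. (f has_real_derivative f' x) (at x)" "smooth f'"
  shows "smooth f"
  unfolding smooth_def
proof
  fix n show "times_differentiable n f"
  using assms unfolding smooth_def by (cases n) auto
qed

lemma smoothE:
  assumes "smooth f"
  obtains f' where "\<And>x. (f has_real_derivative f' x) (at x)" "smooth f'"
proof -
  have "times_differentiable (Suc 0) f" using assms unfolding smooth_def by blast
  then obtain f' where f': "\<And>x. (f has_real_derivative f' x) (at x)" by auto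
  have "times_differentiable n f'" for n
  proof -
    have "times_differentiable (Suc n) f" using assms unfolding smooth_def by blast
    then obtain h where "\<And>x. (f has_real_derivative h x) (at x)" "times_differentiable n h" by auto
    moreover from this f' have "h = f'" by (blast intro: DERIV_unique)
    ultimately show ?thesis by simp
  qed
  then show ?thesis using that f' unfolding smooth_def by blast
qed

lemma smooth_deriv: "smooth f \<Longrightarrow> smooth (deriv f)"
proof (erule smoothE)
  fix f' assume f': "\<And>x. (f has_real_derivative f' x) (at x)" and "smooth f'"
  moreover have "deriv f = f'" using f' by (auto intro: DERIV_imp_deriv)
  ultimately show "smooth (deriv f)" by simp
qed

lemma smooth_DERIV: "smooth f \<Longrightarrow> (f has_real_derivative deriv f x) (at x)"
  by (erule smoothE) (metis DERIV_imp_deriv)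

lemma smooth_isCont: "smooth f \<Longrightarrow> isCont f x"
  using smooth_DERIV DERIV_isCont by blast

lemma smooth_continuous_on: "smooth f \<Longrightarrow> continuous_on S f"
  by (simp add: continuous_at_imp_continuous_on smooth_isCont)

lemma smooth_measurable: "smooth f \<Longrightarrow> f \<in> borel_measurable borel"
  by (simp add: borel_measurable_continuous_onI smooth_continuous_on)

lemma smooth_const [simp]: "smooth (\<lambda>x. c)"
  by (simp add: smooth_def)

lemma smooth_add: "smooth f \<Longrightarrow> smooth g \<Longrightarrow> smooth (\<lambda>x. f x + g x)"
  by (simp add: smooth_def times_differentiable_add)

lemma smooth_mult: "smooth f \<Longrightarrow> smooth g \<Longrightarrow> smooth (\<lambda>x. f x * g x)"
  by (simp add: smooth_def times_differentiable_mult)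

lemma smooth_minus: "smooth f \<Longrightarrow> smooth (\<lambda>x. - f x)"
  using smooth_mult[of "\<lambda>x. -1" f] by simp

lemma smooth_diff: "smooth f \<Longrightarrow> smooth g \<Longrightarrow> smooth (\<lambda>x. f x - g x)"
  using smooth_add[of f "\<lambda>x. - g x"] smooth_minus by simp

lemma smooth_divide:
  assumes "smooth f" "smooth g" "\<And>x. g x = 0 \<Longrightarrow> eventually (\<lambda>y. f y = 0) (nhds x)"
  shows "smooth (\<lambda>x. f x / g x)"
  using assms by (simp add: smooth_def times_differentiable_divide)

lemma smooth_ident [simp]: "smooth (\<lambda>x. x)"
  by (rule smoothI[where f'="\<lambda>x. 1"]) (auto intro!: derivative_eq_intros)

lemma times_differentiable_affine:
  "times_differentiable n f \<Longrightarrow> times_differentiable n (\<lambda>x. f (m * x + c))"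
proof (induction n arbitrary: f)
  case (Suc n)
  then obtain f' where d: "\<And>x. (f has_real_derivative f' x) (at x)" "times_differentiable n f'"
    by auto
  have "((\<lambda>x. f (m * x + c)) has_real_derivative f' (m * x + c) * m) (at x)" for x
    by (rule DERIV_chain2[OF d(1)]) (auto intro!: derivative_eq_intros)
  moreover have "times_differentiable n (\<lambda>x. f' (m * x + c) * m)"
    using Suc d by (intro times_differentiable_mult) auto
  ultimately show ?case by (rule times_differentiable_SucI)
qed simp

lemma smooth_affine: "smooth f \<Longrightarrow> smooth (\<lambda>x. f (m * x + c))"
  by (simp add: smooth_def times_differentiable_affine)

lemma smooth_shift: "smooth f \<Longrightarrow> smooth (\<lambda>x. f (x + c))"
  using smooth_affine[of f 1 c] by simp

lemma smooth_exp: "smooth (\<lambda>x. exp (c * x))"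
proof -
  \<comment> \<open>Generalised over the coefficient, which every differentiation multiplies by
    \<open>c\<close>.\<close>
  have "times_differentiable n (\<lambda>x. a * exp (c * x))" for n a
  proof (induction n arbitrary: a)
    case (Suc n)
    have "((\<lambda>x. a * exp (c * x)) has_real_derivative (a * c) * exp (c * x)) (at x)" for x
      by (auto intro!: derivative_eq_intros)
    then show ?case using Suc[of "a * c"] by (rule times_differentiable_SucI)
  qed simp
  from this[of _ 1] show ?thesis by (simp add: smooth_def)
qed

text \<open>The case \<open>k = 0\<close> is the classical flat function exp(-1/x). The powers in
  the denominator make the family closed under differentiation up to linear combinations.\<close>

definition flat_exp :: "nat \<Rightarrow> real \<Rightarrow> real" where
  "flat_exp k x = (if x > 0 then exp (- (1 / x)) / x ^ k else 0)"

text \<open>This limit is the derivative at 0, where the two branches meet. The substitution u = 1/h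
  reduces it to the decay of u^(k+1) / exp u.\<close>

lemma flat_exp_over_x_tendsto: "((\<lambda>h. flat_exp k h / h) \<longlongrightarrow> 0) (at 0)"
proof (rule filterlim_split_at)
  show "((\<lambda>h. flat_exp k h / h) \<longlongrightarrow> 0) (at_left 0)"
    by (rule Lim_transform_eventually[of "\<lambda>_. 0"])
      (auto simp: flat_exp_def eventually_at_filter)
  have "((\<lambda>u. u ^ (Suc k) / exp u) \<longlongrightarrow> 0) (at_top :: real filter)"
    by (rule tendsto_power_div_exp_0)
  then have "((\<lambda>h. (inverse h) ^ (Suc k) / exp (inverse h)) \<longlongrightarrow> 0) (at_right (0::real))"
    using filterlim_compose filterlim_inverse_at_top_right by blast
  then show "((\<lambda>h. flat_exp k h / h) \<longlongrightarrow> 0) (at_right 0)"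
    by (rule Lim_transform_eventually)
      (auto simp: flat_exp_def eventually_at_filter exp_minus field_simps)
qed

lemma flat_exp_DERIV:
  "(flat_exp k has_real_derivative (flat_exp (k + 2) x - real k * flat_exp (k + 1) x)) (at x)"
proof -
  consider "x > 0" | "x < 0" | "x = 0" by linarith
  then show ?thesis
  proof cases
    case 1
    have "((\<lambda>x. exp (- (1 / x)) / x ^ k) has_real_derivative
       (flat_exp (k + 2) x - real k * flat_exp (k + 1) x)) (at x)"
      using 1 by (auto intro!: derivative_eq_intros simp: flat_exp_def power2_eq_square)
        (cases k; simp add: field_simps)
    then show ?thesis
      by (rule has_field_derivative_transform_within_open[of _ _ _ "{0<..}"]) (use 1 in \<open>auto simp: flat_exp_def\<close>)
  next
    case 2
    then show ?thesis
      using has_field_derivative_transform_within_open[OF DERIV_const[of 0], of "{..<0}" x "flat_exp k"]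
      by (auto simp: flat_exp_def)
  next
    case 3
    then show ?thesis using flat_exp_over_x_tendsto[of k]
      by (simp add: DERIV_def flat_exp_def)
  qed
qed

lemma smooth_flat_exp: "smooth (flat_exp k)"
proof -
  have "times_differentiable n (flat_exp k)" for n
  proof (induction n arbitrary: k)
    case (Suc n)
    have "times_differentiable n (\<lambda>x. flat_exp (k + 2) x + (- real k) * flat_exp (k + 1) x)"
      by (intro times_differentiable_add times_differentiable_mult Suc) auto
    then show ?case using flat_exp_DERIV[of k] 
      by (auto intro!: exI[of _ "\<lambda>x. flat_exp (k + 2) x - real k * flat_exp (k + 1) x"])
  qed simp
  then show ?thesis by (simp add: smooth_def)
qed

text \<open>A smooth transition from 0 to 1. It takes place on [1, 2], away from 0, so that a
  rescaled \<open>step\<close> vanishes in a neighbourhood of the origin.\<close>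

definition step :: "real \<Rightarrow> real" where
  "step x = flat_exp 0 (x - 1) / (flat_exp 0 (x - 1) + flat_exp 0 (2 - x))"

lemma flat_exp_nonneg: "flat_exp k x \<ge> 0"
  by (auto simp: flat_exp_def)

lemma step_denominator_pos: "flat_exp 0 (x - 1) + flat_exp 0 (2 - x) > 0"
  by (cases "x > 1") (auto simp: flat_exp_def intro!: add_pos_nonneg)

lemma smooth_step: "smooth step"
proof -
  have 1: "smooth (\<lambda>x. flat_exp 0 (x - 1))"
    using smooth_affine[OF smooth_flat_exp, of 0 1 "-1"] by simp
  have 2: "smooth (\<lambda>x. flat_exp 0 (2 - x))"
    using smooth_affine[OF smooth_flat_exp, of 0 "-1" 2] by simp
  show ?thesis unfolding step_def[abs_def]
    by (rule smooth_divide[OF 1 smooth_add[OF 1 2]]) (simp add: step_denominator_pos less_imp_neq[THEN not_sym])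
qed

lemma step_eq_0: "x \<le> 1 \<Longrightarrow> step x = 0"
  by (simp add: step_def flat_exp_def)

lemma step_eq_1: "x \<ge> 2 \<Longrightarrow> step x = 1"
  by (simp add: step_def flat_exp_def)

lemma step_bounds: "0 \<le> step x" "step x \<le> 1"
  using step_denominator_pos[of x] flat_exp_nonneg[of 0] by (auto simp: step_def)

lemma flat_exp_0_mono: "x \<le> y \<Longrightarrow> flat_exp 0 x \<le> flat_exp 0 y"
  by (auto simp: flat_exp_def frac_le)

lemma step_mono: assumes "x \<le> y" shows "step x \<le> step y"
proof -
  have "flat_exp 0 (x - 1) * flat_exp 0 (2 - y) \<le> flat_exp 0 (y - 1) * flat_exp 0 (2 - x)"
    using assms by (intro mult_mono flat_exp_0_mono flat_exp_nonneg) auto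
  moreover have "a / (a + b) \<le> c / (c + d)" if "a * d \<le> c * b" "a + b > 0" "c + d > 0" for a b c d :: real
    using that by (simp add: divide_simps) (simp add: algebra_simps)
  ultimately show ?thesis unfolding step_def using step_denominator_pos by simp
qed

text \<open>The sign is used later in its own right: it allows terms to be dropped from estimates,
  and it makes \<open>kappa\<close> positive.\<close>

lemma deriv_step_nonneg: "deriv step x \<ge> 0"
proof (rule ccontr)
  assume "\<not> ?thesis"
  then have "deriv step x < 0" by simp
  from DERIV_neg_dec_right[OF smooth_DERIV[OF smooth_step] this]
  obtain d where "d > 0" "\<And>h. 0 < h \<Longrightarrow> h < d \<Longrightarrow> step (x + h) < step x" by blast
  from this(2)[of "d/2"] \<open>d > 0\<close> show False using step_mono[of x "x + d/2"] by simp
qed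

lemma deriv_eq_0_locally_const:
  assumes "open S" "x \<in> S" "\<And>y. y \<in> S \<Longrightarrow> f y = (c::real)"
  shows "deriv f x = 0"
  using has_field_derivative_transform_within_open[OF DERIV_const[of c] assms(1,2), of f] assms(3)
  by (simp add: DERIV_imp_deriv)

lemma deriv_step_eq_0: "x < 1 \<or> x > 2 \<Longrightarrow> deriv step x = 0"
  using deriv_eq_0_locally_const[of "{..<1}" x step 0] deriv_eq_0_locally_const[of "{2<..}" x step 1]
  by (auto simp: step_eq_0 step_eq_1)

section \<open>Radial test functions\<close>

text \<open>Vanishing for all r below some positive \<delta> makes x -> h(|x|) smooth at the origin
  in spite of the norm, and makes division by any power of r harmless. Vanishing for large r gives
  compact support.\<close>

definition annular :: "(real \<Rightarrow> real) \<Rightarrow> bool" where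
  "annular h \<longleftrightarrow> smooth h \<and> (\<exists>\<delta>>0. \<forall>r<\<delta>. h r = 0) \<and> (\<exists>M. \<forall>r>M. h r = 0)"

lemma annular_smooth: "annular h \<Longrightarrow> smooth h"
  by (simp add: annular_def)

lemma annular_const_0 [simp]: "annular (\<lambda>r. 0)"
  by (auto simp: annular_def intro: exI[of _ 1])

lemma annularE:
  assumes "annular h"
  obtains \<delta> M where "\<delta> > 0" "\<delta> < M" "\<And>r. r < \<delta> \<Longrightarrow> h r = 0" "\<And>r. r > M \<Longrightarrow> h r = 0"
proof -
  obtain \<delta> M where "\<delta> > 0" "\<And>r. r < \<delta> \<Longrightarrow> h r = 0" "\<And>r. r > M \<Longrightarrow> h r = 0"
    using assms unfolding annular_def by blast
  then show ?thesis using that[of \<delta> "max M (\<delta> + 1)"] by auto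
qed

lemma annularI:
  assumes "smooth h" "\<delta> > 0" "\<And>r. r < \<delta> \<Longrightarrow> h r = 0" "\<And>r. r > M \<Longrightarrow> h r = 0"
  shows "annular h"
  using assms unfolding annular_def by blast

lemma annular_mult: "annular h \<Longrightarrow> smooth g \<Longrightarrow> annular (\<lambda>r. h r * g r)"
  by (auto simp: annular_def intro: smooth_mult)

lemma annular_mult_left: "annular h \<Longrightarrow> smooth g \<Longrightarrow> annular (\<lambda>r. g r * h r)"
  using annular_mult[of h g] by (simp add: mult.commute)

lemma annular_add: assumes "annular h" "annular g" shows "annular (\<lambda>r. h r + g r)"
proof -
  obtain \<delta> M where 1: "\<delta> > 0" "\<delta> < M" "\<And>r. r < \<delta> \<Longrightarrow> h r = 0" "\<And>r. r > M \<Longrightarrow> h r = 0"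
    by (rule annularE[OF assms(1) that])
  obtain \<delta>' M' where 2: "\<delta>' > 0" "\<delta>' < M'" "\<And>r. r < \<delta>' \<Longrightarrow> g r = 0" "\<And>r. r > M' \<Longrightarrow> g r = 0"
    by (rule annularE[OF assms(2) that])
  show ?thesis
    by (rule annularI[of _ "min \<delta> \<delta>'" "max M M'"])
      (use 1 2 in \<open>auto intro: smooth_add annular_smooth assms\<close>)
qed

lemma annular_minus: "annular h \<Longrightarrow> annular (\<lambda>r. - h r)"
  using annular_mult[of h "\<lambda>_. -1"] by simp

lemma annular_deriv:
  assumes "annular h" shows "annular (deriv h)"
proof -
  obtain \<delta> M where 1: "\<delta> > 0" "\<delta> < M" "\<And>r. r < \<delta> \<Longrightarrow> h r = 0" "\<And>r. r > M \<Longrightarrow> h r = 0"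
    by (rule annularE[OF assms that])
  show ?thesis
  proof (rule annularI[OF _ 1(1), of _ M])
    show "deriv h r = 0" if "r < \<delta>" for r
      by (rule deriv_eq_0_locally_const[of "{..<\<delta>}"]) (use 1 that in auto)
    show "deriv h r = 0" if "r > M" for r
      by (rule deriv_eq_0_locally_const[of "{M<..}"]) (use 1 that in auto)
  qed (use assms in \<open>auto intro: smooth_deriv annular_smooth\<close>)
qed

lemma smooth_power: "smooth f \<Longrightarrow> smooth (\<lambda>x. f x ^ n)"
  by (induction n) (auto intro: smooth_mult)

lemma annular_divide:
  assumes "annular h" shows "annular (\<lambda>r. h r / r ^ n)"
proof -
  obtain \<delta> M where 1: "\<delta> > 0" "\<delta> < M" "\<And>r. r < \<delta> \<Longrightarrow> h r = 0" "\<And>r. r > M \<Longrightarrow> h r = 0"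
    by (rule annularE[OF assms that])
  show ?thesis
  proof (rule annularI[OF _ 1(1), of _ M])
    show "smooth (\<lambda>r. h r / r ^ n)"
    proof (rule smooth_divide)
      show "smooth h" using assms by (rule annular_smooth)
      show "smooth (\<lambda>r::real. r ^ n)" by (rule smooth_power) simp
      fix x :: real assume "x ^ n = 0"
      then have "x \<in> {..<\<delta>}" using 1 by (cases n) auto
      then show "\<forall>\<^sub>F y in nhds x. h y = 0"
        unfolding eventually_nhds using 1(3) by (intro exI[of _ "{..<\<delta>}"]) auto
    qed
  qed (use 1 in auto)
qed

text \<open>A partial derivative of h(r) is (x - x0)_j times h'(r) / r, and h'(r) / r is annular
  again, so these three rules generate a class closed under differentiation. Smoothness, compact
  support and symmetry of second derivatives become inductions over three cases.\<close>

inductive radial :: "real^'n \<Rightarrow> (real^'n \<Rightarrow> real) \<Rightarrow> bool" for x0 where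
  base: "annular h \<Longrightarrow> radial x0 (\<lambda>x. h (norm (x - x0)))"
| add: "radial x0 f \<Longrightarrow> radial x0 g \<Longrightarrow> radial x0 (\<lambda>x. f x + g x)"
| coord: "radial x0 f \<Longrightarrow> radial x0 (\<lambda>x. (x - x0) $ i * f x)"

lemma radial_0: "radial x0 (\<lambda>x. 0)"
  using radial.base[of "\<lambda>_. 0"] by simp

lemma annular_norm_has_derivative:
  fixes x0 :: "real^'n"
  assumes "annular h"
  shows "((\<lambda>x. h (norm (x - x0))) has_derivative
      (\<lambda>v. \<Sum>j\<in>UNIV. v $ j * ((x - x0) $ j * (deriv h (norm (x - x0)) / norm (x - x0))))) (at x)"
proof (cases "x = x0")
  case True
  obtain \<delta> M where 1: "\<delta> > 0" "\<delta> < M" "\<And>r. r < \<delta> \<Longrightarrow> h r = 0" "\<And>r. r > M \<Longrightarrow> h r = 0"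
    by (rule annularE[OF assms that])
  show ?thesis
    by (rule has_derivative_transform_within_open[of "\<lambda>_. 0" _ _ _ "ball x0 \<delta>"])
      (use 1 True in \<open>auto simp: dist_norm norm_minus_commute\<close>)
next
  case False
  have "(h has_derivative (\<lambda>v. deriv h (norm (x - x0)) * v)) (at (norm (x - x0)))"
    using smooth_DERIV[OF annular_smooth[OF assms]] has_field_derivative_imp_has_derivative by blast
  moreover have "((\<lambda>x. norm (x - x0)) has_derivative (\<lambda>v. v \<bullet> sgn (x - x0))) (at x)"
    using has_derivative_compose[OF has_derivative_diff[OF has_derivative_ident has_derivative_const]
        has_derivative_norm[of "x - x0"]] False by simp
  ultimately have "((\<lambda>x. h (norm (x - x0))) has_derivative
      (\<lambda>v. deriv h (norm (x - x0)) * (v \<bullet> sgn (x - x0)))) (at x)"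
    by (rule has_derivative_compose[rotated])
  then show ?thesis
    by (simp add: inner_vec_def sgn_div_norm sum_distrib_left divide_inverse mult_ac del: vector_minus_component)
qed

lemma iter_pderiv_eqI:
  assumes "\<And>x. (f has_derivative (\<lambda>v. \<Sum>j\<in>UNIV. v $ j * D j x)) (at x)"
  shows "iter_pderiv [j] f = D j"
proof
  fix x
  have "frechet_derivative f (at x) = (\<lambda>v. \<Sum>j\<in>UNIV. v $ j * D j x)"
    using frechet_derivative_at[OF assms] by simp
  then show "iter_pderiv [j] f x = D j x"
    by (simp add: axis_def if_distrib if_distribR sum.delta cong: if_cong)
qed

lemma iter_pderiv_annular:
  assumes "annular h"
  shows "iter_pderiv [j] (\<lambda>x. h (norm (x - x0))) =
           (\<lambda>x. (x - x0) $ j * (deriv h (norm (x - x0)) / norm (x - x0)))"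
  by (rule iter_pderiv_eqI[OF annular_norm_has_derivative[OF assms]])

lemma component_minus_has_derivative:
  "((\<lambda>x::real^'n. (x - x0) $ i) has_derivative (\<lambda>v. v $ i)) (at x)"
proof -
  have "((\<lambda>x. x $ i - x0 $ i) has_derivative (\<lambda>v. v $ i - 0)) (at x)"
    by (intro has_derivative_diff has_derivative_const bounded_linear_imp_has_derivative bounded_linear_vec_nth)
  then show ?thesis by simp
qed

lemma radial_has_derivative:
  "radial x0 f \<Longrightarrow> \<exists>D. (\<forall>x. (f has_derivative (\<lambda>v. \<Sum>j\<in>UNIV. v $ j * D j x)) (at x)) \<and>
     (\<forall>j. radial x0 (D j))"
proof (induction rule: radial.induct)
  case (base h)
  have "annular (\<lambda>r. deriv h r / r)" using annular_divide[OF annular_deriv[OF base], of 1] by simp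
  then have "radial x0 (\<lambda>x. (x - x0) $ j * (deriv h (norm (x - x0)) / norm (x - x0)))" for j
    by (rule radial.coord[OF radial.base])
  then show ?case using annular_norm_has_derivative[OF base]
    by (intro exI[of _ "\<lambda>j x. (x - x0) $ j * (deriv h (norm (x - x0)) / norm (x - x0))"]) auto
next
  case (add f g)
  then obtain D D' where "\<And>x. (f has_derivative (\<lambda>v. \<Sum>j\<in>UNIV. v $ j * D j x)) (at x)" "\<And>j. radial x0 (D j)"
    "\<And>x. (g has_derivative (\<lambda>v. \<Sum>j\<in>UNIV. v $ j * D' j x)) (at x)" "\<And>j. radial x0 (D' j)"
    by blast
  then show ?case
    by (intro exI[of _ "\<lambda>j x. D j x + D' j x"])
      (auto intro!: derivative_eq_intros radial.add simp: sum.distrib algebra_simps)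
next
  case (coord f i)
  then obtain D where D: "\<And>x. (f has_derivative (\<lambda>v. \<Sum>j\<in>UNIV. v $ j * D j x)) (at x)" "\<And>j. radial x0 (D j)"
    by blast
  have "((\<lambda>x. (x - x0) $ i * f x) has_derivative (\<lambda>v. \<Sum>j\<in>UNIV. v $ j *
     ((if j = i then f x else 0) + (x - x0) $ i * D j x))) (at x)" for x
  proof -
    have "((\<lambda>x. (x - x0) $ i * f x) has_derivative
       (\<lambda>v. (x - x0) $ i * (\<Sum>j\<in>UNIV. v $ j * D j x) + v $ i * f x)) (at x)"
      using has_derivative_mult[OF component_minus_has_derivative D(1)] .
    also have "(\<lambda>v. (x - x0) $ i * (\<Sum>j\<in>UNIV. v $ j * D j x) + v $ i * f x) =
      (\<lambda>v. \<Sum>j\<in>UNIV. v $ j * ((if j = i then f x else 0) + (x - x0) $ i * D j x))"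
    proof
      fix v
      have "(\<Sum>j\<in>UNIV. v $ j * ((if j = i then f x else 0) + c * D j x)) =
        (\<Sum>j\<in>UNIV. (if j = i then v $ j * f x else 0) + c * (v $ j * D j x))" for c
        by (rule sum.cong) (auto simp: algebra_simps)
      then show "(x - x0) $ i * (\<Sum>j\<in>UNIV. v $ j * D j x) + v $ i * f x =
         (\<Sum>j\<in>UNIV. v $ j * ((if j = i then f x else 0) + (x - x0) $ i * D j x))"
        by (simp add: sum.distrib sum_distrib_left del: vector_minus_component)
    qed
    finally show ?thesis .
  qed
  moreover have "radial x0 (\<lambda>x. (if j = i then f x else 0) + (x - x0) $ i * D j x)" for j
    using coord D radial_0 by (cases "j = i") (auto intro!: radial.add radial.coord simp del: vector_minus_component)
  ultimately show ?case
    by (intro exI[of _ "\<lambda>j x. (if j = i then f x else 0) + (x - x0) $ i * D j x"] conjI allI)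
qed

lemma radial_iter_pderiv1:
  assumes "radial x0 f" shows "radial x0 (iter_pderiv [j] f)"
proof -
  obtain D where D: "\<And>x. (f has_derivative (\<lambda>v. \<Sum>j\<in>UNIV. v $ j * D j x)) (at x)" "\<And>j. radial x0 (D j)"
    using radial_has_derivative[OF assms] by blast
  show ?thesis unfolding iter_pderiv_eqI[OF D(1)] by (rule D(2))
qed

lemma radial_differentiable: "radial x0 f \<Longrightarrow> f differentiable (at x)"
  using radial_has_derivative[of x0 f] by (auto simp: differentiable_def)

lemma radial_has_derivative_iter_pderiv:
  assumes "radial x0 f"
  shows "(f has_derivative (\<lambda>v. \<Sum>j\<in>UNIV. v $ j * iter_pderiv [j] f x)) (at x)"
proof -
  obtain D where D: "\<And>x. (f has_derivative (\<lambda>v. \<Sum>j\<in>UNIV. v $ j * D j x)) (at x)"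
    using radial_has_derivative[OF assms] by blast
  show ?thesis unfolding iter_pderiv_eqI[OF D] by (rule D)
qed

lemma radial_continuous_on: "radial x0 f \<Longrightarrow> continuous_on S f"
  by (simp add: continuous_at_imp_continuous_on differentiable_imp_continuous_within radial_differentiable)

lemma radial_iter_pderiv: "radial x0 f \<Longrightarrow> radial x0 (iter_pderiv \<alpha> f)"
proof (induction \<alpha>)
  case (Cons i \<alpha>)
  then show ?case using radial_iter_pderiv1[of x0 "iter_pderiv \<alpha> f" i] by simp
qed simp

lemma radial_bounded_support: "radial x0 f \<Longrightarrow> \<exists>M. \<forall>x. norm (x - x0) > M \<longrightarrow> f x = 0"
proof (induction rule: radial.induct)
  case (base h)
  then show ?case by (auto elim!: annularE)
next
  case (add f g)
  then obtain M M' where "\<forall>x. norm (x - x0) > M \<longrightarrow> f x = 0" "\<forall>x. norm (x - x0) > M' \<longrightarrow> g x = 0" by blast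
  then show ?case by (intro exI[of _ "max M M'"]) auto
qed auto

lemma radial_test_function:
  assumes "radial x0 f" shows "f \<in> test_functions"
proof -
  obtain M where M: "\<forall>x. norm (x - x0) > M \<longrightarrow> f x = 0" using radial_bounded_support[OF assms] by blast
  have "closure {x. f x \<noteq> 0} \<subseteq> closure (cball x0 M)"
    by (intro closure_mono) (use M in \<open>force simp: dist_norm norm_minus_commute not_less\<close>)
  then have "compact (closure {x. f x \<noteq> 0})"
    by (meson bounded_cball bounded_closure bounded_subset closed_closure compact_eq_bounded_closed)
  then show ?thesis unfolding test_functions_def
    using assms radial_differentiable radial_iter_pderiv by blast
qed

lemma iter_pderiv_add:
  assumes "f differentiable (at x)" "g differentiable (at x)"
  shows "iter_pderiv [i] (\<lambda>x. f x + g x) x = iter_pderiv [i] f x + iter_pderiv [i] g x"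
  using frechet_derivative_at[OF has_derivative_add[OF assms[unfolded frechet_derivative_works]], symmetric]
  by simp

lemma iter_pderiv_coord:
  fixes f :: "real^'n \<Rightarrow> real"
  assumes "f differentiable (at x)"
  shows "iter_pderiv [i] (\<lambda>x. (x - x0) $ j * f x) x =
     (if i = j then f x else 0) + (x - x0) $ j * iter_pderiv [i] f x"
proof -
  have "(f has_derivative frechet_derivative f (at x)) (at x)"
    using assms frechet_derivative_works by blast
  then have "((\<lambda>x. (x - x0) $ j * f x) has_derivative
     (\<lambda>v. (x - x0) $ j * frechet_derivative f (at x) v + v $ j * f x)) (at x)"
    using has_derivative_mult[OF component_minus_has_derivative] by blast
  then have "frechet_derivative (\<lambda>x. (x - x0) $ j * f x) (at x) =
     (\<lambda>v. (x - x0) $ j * frechet_derivative f (at x) v + v $ j * f x)"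
    by (rule frechet_derivative_at[symmetric])
  then show ?thesis by (simp add: axis_def)
qed

lemma iter_pderiv2_annular:
  assumes "annular h"
  defines "k \<equiv> \<lambda>r. deriv h r / r"
  shows "iter_pderiv [i, j] (\<lambda>x. h (norm (x - x0))) x =
    (if i = j then k (norm (x - x0)) else 0) +
      (x - x0) $ j * ((x - x0) $ i * (deriv k (norm (x - x0)) / norm (x - x0)))"
proof -
  have k: "annular k" using annular_divide[OF annular_deriv[OF assms(1)], of 1] by (simp add: k_def)
  have "iter_pderiv [i, j] (\<lambda>x. h (norm (x - x0))) x = 
     iter_pderiv [i] (iter_pderiv [j] (\<lambda>x. h (norm (x - x0)))) x" by simp
  also have "\<dots> = iter_pderiv [i] (\<lambda>x. (x - x0) $ j * k (norm (x - x0))) x"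
    unfolding iter_pderiv_annular[OF assms(1)] k_def ..
  also have "\<dots> = (if i = j then k (norm (x - x0)) else 0) +
      (x - x0) $ j * iter_pderiv [i] (\<lambda>x. k (norm (x - x0))) x"
    by (rule iter_pderiv_coord) (rule radial_differentiable[OF radial.base[OF k]])
  finally show ?thesis unfolding iter_pderiv_annular[OF k] .
qed

text \<open>The explicit Hessian of a function of r is symmetric, and sums and coordinate factors
  preserve the symmetry.\<close>

lemma iter_pderiv_radial_commute:
  "radial x0 f \<Longrightarrow> iter_pderiv [i, j] f = iter_pderiv [j, i] f"
proof (induction rule: radial.induct)
  case (base h)
  then show ?case by (auto simp: iter_pderiv2_annular simp del: iter_pderiv.simps)
next
  case (add f g)
  have "iter_pderiv [i, j] (\<lambda>x. f x + g x) x = iter_pderiv [i, j] f x + iter_pderiv [i, j] g x" for i j x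
  proof -
    have "iter_pderiv [i, j] (\<lambda>x. f x + g x) x = iter_pderiv [i] (iter_pderiv [j] (\<lambda>x. f x + g x)) x"
      by simp
    also have "iter_pderiv [j] (\<lambda>x. f x + g x) = (\<lambda>x. iter_pderiv [j] f x + iter_pderiv [j] g x)"
      using add radial_differentiable by (blast intro: iter_pderiv_add)
    also have "iter_pderiv [i] \<dots> x = iter_pderiv [i] (iter_pderiv [j] f) x + iter_pderiv [i] (iter_pderiv [j] g) x"
      by (intro iter_pderiv_add radial_differentiable[of x0] radial_iter_pderiv1 add)
    finally show ?thesis by simp
  qed
  then show ?case using add.IH by (metis (no_types, lifting) ext)
next
  case (coord f l)
  have "iter_pderiv [i, j] (\<lambda>x. (x - x0) $ l * f x) x = 
    (if j = l then iter_pderiv [i] f x else 0) + (if i = l then iter_pderiv [j] f x else 0)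
     + (x - x0) $ l * iter_pderiv [i, j] f x" for i j x
  proof -
    have "iter_pderiv [i, j] (\<lambda>x. (x - x0) $ l * f x) x = iter_pderiv [i] (iter_pderiv [j] (\<lambda>x. (x - x0) $ l * f x)) x"
      by simp
    also have "iter_pderiv [j] (\<lambda>x. (x - x0) $ l * f x) =
       (\<lambda>x. (if j = l then f x else 0) + (x - x0) $ l * iter_pderiv [j] f x)"
      using coord radial_differentiable by (blast intro: iter_pderiv_coord)
    also have "iter_pderiv [i] \<dots> x = iter_pderiv [i] (\<lambda>x. if j = l then f x else 0) x +
        iter_pderiv [i] (\<lambda>x. (x - x0) $ l * iter_pderiv [j] f x) x"
      by (rule iter_pderiv_add; cases "j = l")
       (auto intro!: radial_differentiable[of x0] coord radial.coord radial_0 radial_iter_pderiv1 simp del: iter_pderiv.simps vector_minus_component)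
    also have "iter_pderiv [i] (\<lambda>x. (x - x0) $ l * iter_pderiv [j] f x) x =
       (if i = l then iter_pderiv [j] f x else 0) + (x - x0) $ l * iter_pderiv [i] (iter_pderiv [j] f) x"
      by (intro iter_pderiv_coord radial_differentiable[of x0] radial_iter_pderiv1 coord)
    also have "iter_pderiv [i] (\<lambda>x. if j = l then f x else 0) x = (if j = l then iter_pderiv [i] f x else 0)"
      by simp
    finally show ?thesis by simp
  qed
  then show ?case using coord.IH by (auto simp: fun_eq_iff simp del: iter_pderiv.simps)
qed

declare iter_pderiv.simps(2) [simp del]

lemma iter_pderiv_Cons: "iter_pderiv (i # \<alpha>) f = iter_pderiv [i] (iter_pderiv \<alpha> f)"
  by (simp add: iter_pderiv.simps)

text \<open>Special to dimension three: after multiplication by r the radial Laplacian is the second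
  derivative in r. With h = w / r and k = h' / r, the gradient of h is (x - x0) k, and its
  divergence is 3 k + r k'.\<close>

lemma laplacian_annular:
  fixes x0 :: "real^3"
  assumes "annular w"
  shows "(\<Sum>i\<in>UNIV. iter_pderiv [i, i] (\<lambda>x. w (norm (x - x0)) / norm (x - x0)) x) =
            deriv (deriv w) (norm (x - x0)) / norm (x - x0)"
proof -
  define h where "h r = w r / r" for r
  define k where "k r = deriv h r / r" for r
  define r where "r = norm (x - x0)"
  have h: "annular h" using annular_divide[OF assms, of 1] by (simp add: h_def[abs_def])
  have "(\<Sum>i\<in>UNIV. iter_pderiv [i, i] (\<lambda>x. w (norm (x - x0)) / norm (x - x0)) x) =
     (\<Sum>i\<in>UNIV. k r + (x - x0) $ i * ((x - x0) $ i * (deriv k r / r)))"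
    unfolding h_def[symmetric] k_def r_def
    by (simp add: iter_pderiv2_annular[OF h] del: vector_minus_component)
  also have "\<dots> = 3 * k r + ((x - x0) \<bullet> (x - x0)) * (deriv k r / r)"
    by (simp add: sum.distrib inner_vec_def sum_distrib_right sum_divide_distrib mult.assoc)
  also have "(x - x0) \<bullet> (x - x0) = r * r" by (simp add: r_def dot_square_norm power2_eq_square)
  finally have eq: "(\<Sum>i\<in>UNIV. iter_pderiv [i, i] (\<lambda>x. w (norm (x - x0)) / norm (x - x0)) x) =
    3 * k r + r * deriv k r" by simp
  have W: "(w has_real_derivative deriv w s) (at s)" 
       "(deriv w has_real_derivative deriv (deriv w) s) (at s)" for s
    using smooth_DERIV annular_smooth assms smooth_deriv by blast+
  show ?thesis
  proof (cases "r = 0")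
    \<comment> \<open>At the centre both sides are 0, since division by 0 yields 0.\<close>
    case True
    then show ?thesis unfolding eq by (simp add: k_def flip: r_def)
  next
    case False
    then have "r > 0" by (simp add: r_def)
    have dh: "deriv h s = deriv w s / s - w s / s^2" if "s > 0" for s unfolding h_def
      by (rule DERIV_imp_deriv) (use that in \<open>auto intro!: derivative_eq_intros W simp: field_simps power2_eq_square\<close>)
    have "((\<lambda>s. deriv w s / s^2 - w s / s^3) has_real_derivative
        deriv (deriv w) r / r^2 - 3 * deriv w r / r^3 + 3 * w r / r^4) (at r)"
      using \<open>r > 0\<close> by (auto intro!: derivative_eq_intros W simp: field_simps eval_nat_numeral)
    then have "(k has_real_derivative
        deriv (deriv w) r / r^2 - 3 * deriv w r / r^3 + 3 * w r / r^4) (at r)"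
      by (rule has_field_derivative_transform_within_open[of _ _ _ "{0<..}"])
        (use \<open>r > 0\<close> in \<open>auto simp: k_def dh field_simps eval_nat_numeral\<close>)
    then show ?thesis unfolding eq using \<open>r > 0\<close>
      by (simp add: DERIV_imp_deriv k_def dh flip: r_def) (simp add: field_simps eval_nat_numeral)
  qed
qed

section \<open>Translation invariance and integrals of partial derivatives\<close>

lemma lebesgue_translation:
  fixes c :: "'a::euclidean_space"
  shows "(\<lambda>x. x + c) \<in> lebesgue \<rightarrow>\<^sub>M lebesgue" "distr lebesgue lebesgue (\<lambda>x. x + c) = lebesgue"
proof -
  have eq: "(\<lambda>x. c + (\<Sum>j\<in>Basis. (1 * (x \<bullet> j)) *\<^sub>R j)) = (\<lambda>x. x + c)"
    by (simp add: euclidean_representation add.commute)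
  show "(\<lambda>x. x + c) \<in> lebesgue \<rightarrow>\<^sub>M lebesgue"
    using lebesgue_affine_measurable[of "\<lambda>_. 1" c] unfolding eq by simp
  show "distr lebesgue lebesgue (\<lambda>x. x + c) = lebesgue"
    using lebesgue_affine_euclidean[of "\<lambda>_. 1" c] unfolding eq by (simp add: density_1)
qed

lemma lebesgue_integral_translate:
  fixes f :: "'a::euclidean_space \<Rightarrow> 'b::{banach, second_countable_topology}"
  assumes "f \<in> borel_measurable lebesgue"
  shows "(LINT x|lebesgue. f (x + c)) = (LINT x|lebesgue. f x)"
  using integral_distr[OF lebesgue_translation(1) assms, of c] lebesgue_translation(2)[of c] by simp

lemma lebesgue_integrable_translate:
  fixes f :: "'a::euclidean_space \<Rightarrow> 'b::{banach, second_countable_topology}"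
  assumes "integrable lebesgue f"
  shows "integrable lebesgue (\<lambda>x. f (x + c))"
  using integrable_distr_eq[OF lebesgue_translation(1) borel_measurable_integrable[OF assms], of c]
    lebesgue_translation(2)[of c] assms by simp

lemma AE_lebesgue_translate:
  assumes "AE x in lebesgue. P x"
  shows "AE x in lebesgue. P (x + c :: 'a::euclidean_space)"
proof -
  have "AE x in distr lebesgue lebesgue (\<lambda>x. x + c). P x" unfolding lebesgue_translation(2)[of c] by (rule assms)
  then show ?thesis
    using AE_distrD[OF lebesgue_translation(1)] by blast
qed

lemma integrable_lebesgue_cball: "integrable lebesgue (\<lambda>x. indicator (cball x0 M) x *\<^sub>R (B::real))"
  by (intro integrable_scaleR_left integrable_real_indicator)
    (use lmeasurable_cball[of x0 M] in \<open>auto simp: fmeasurable_def\<close>)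

lemma integrable_lebesgue_compact_support:
  fixes f :: "real^'n \<Rightarrow> real"
  assumes "f \<in> borel_measurable borel" "\<And>x. \<bar>f x\<bar> \<le> B" "\<And>x. norm (x - x0) > M \<Longrightarrow> f x = 0"
  shows "integrable lebesgue f"
proof (rule Bochner_Integration.integrable_bound)
  show "integrable lebesgue (\<lambda>x. indicator (cball x0 M) x *\<^sub>R B)"
    by (rule integrable_lebesgue_cball)
  show "f \<in> borel_measurable lebesgue" using assms(1) by (simp add: measurable_completion)
  show "AE x in lebesgue. norm (f x) \<le> norm (indicator (cball x0 M) x *\<^sub>R B)"
    using assms(2,3) by (intro AE_I2) (force simp: indicator_def dist_norm norm_minus_commute intro: order_trans[OF _ abs_ge_self])
qed

text \<open>Difference quotients along \<open>e\<close> have integral 0 by translation invariance.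
  The mean value theorem bounds them by \<open>B\<close> and they live in a fixed ball, so dominated
  convergence passes to the derivative.\<close>

lemma integral_partial_derivative_eq_0:
  fixes f :: "real^'n \<Rightarrow> real"
  assumes D: "\<And>x. ((\<lambda>t. f (x + t *\<^sub>R e)) has_real_derivative D x) (at 0)"
    and B: "\<And>x. \<bar>D x\<bar> \<le> B"
    and M: "\<And>x. norm x > M \<Longrightarrow> f x = 0"
    and f: "f \<in> borel_measurable borel" "integrable lebesgue f"
    and e: "norm e \<le> 1"
  shows "integrable lebesgue D" "(LINT x|lebesgue. D x) = 0"
proof -
  define s where "s n x = (f (x + inverse (real (Suc n)) *\<^sub>R e) - f x) * real (Suc n)" for n x
  have line: "((\<lambda>t. f (x + t *\<^sub>R e)) has_real_derivative D (x + u *\<^sub>R e)) (at u)" for x u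
  proof -
    have "((\<lambda>t. f ((x + u *\<^sub>R e) + (t - u) *\<^sub>R e)) has_real_derivative D (x + u *\<^sub>R e) * 1) (at u)"
      by (rule DERIV_chain2[where g = "\<lambda>t. t - u"]) (auto intro!: derivative_eq_intros D)
    then show ?thesis by (simp add: algebra_simps)
  qed
  have B0: "B \<ge> 0" using B[of 0] by linarith
  have bound: "\<bar>s n x\<bar> \<le> B" for n x
  proof -
    let ?h = "inverse (real (Suc n))"
    obtain z where "f (x + ?h *\<^sub>R e) - f (x + 0 *\<^sub>R e) = (?h - 0) * D (x + z *\<^sub>R e)"
      using MVT2[of 0 ?h "\<lambda>t. f (x + t *\<^sub>R e)" "\<lambda>u. D (x + u *\<^sub>R e)"] line by auto
    then have "s n x = D (x + z *\<^sub>R e)" by (simp add: s_def field_simps)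
    then show ?thesis using B by simp
  qed
  have lim: "(\<lambda>n. s n x) \<longlonglongrightarrow> D x" for x
  proof -
    have "((\<lambda>h. (f (x + h *\<^sub>R e) - f x) / h) \<longlongrightarrow> D x) (at 0)"
      using D[of x] by (simp add: DERIV_def)
    moreover have "filterlim (\<lambda>n. inverse (real (Suc n))) (at 0) sequentially"
      using LIMSEQ_inverse_real_of_nat by (auto simp: filterlim_at simp del: of_nat_Suc)
    ultimately show ?thesis
      using filterlim_compose[of "\<lambda>h. (f (x + h *\<^sub>R e) - f x) / h" _ "at 0"]
      unfolding s_def by (fastforce simp: divide_inverse)
  qed
  have smeas: "s n \<in> borel_measurable lebesgue" for n
  proof -
    have "(\<lambda>x. f (x + inverse (real (Suc n)) *\<^sub>R e)) \<in> borel_measurable borel"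
      by (rule measurable_compose[OF _ f(1)]) simp
    then have "s n \<in> borel_measurable borel"
      using f(1) unfolding s_def[abs_def] by (intro borel_measurable_times borel_measurable_diff) auto
    then show ?thesis by (simp add: measurable_completion)
  qed
  \<comment> \<open>The increments have length at most 1, which accounts for the enlargement of the
    radius by 1.\<close>
  have supp: "\<bar>s n x\<bar> \<le> indicator (cball 0 (\<bar>M\<bar> + 1)) x *\<^sub>R B" for n x
  proof (cases "x \<in> cball 0 (\<bar>M\<bar> + 1)")
    case False
    have 1: "norm (inverse (real (Suc n)) *\<^sub>R e) \<le> 1 * 1"
      unfolding norm_scaleR by (rule mult_mono) (use e in \<open>auto simp: field_simps\<close>)
    have "norm x \<le> norm (x + inverse (real (Suc n)) *\<^sub>R e) + norm (inverse (real (Suc n)) *\<^sub>R e)"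
      using norm_triangle_ineq4[of "x + inverse (real (Suc n)) *\<^sub>R e" "inverse (real (Suc n)) *\<^sub>R e"] by simp
    then have "norm (x + inverse (real (Suc n)) *\<^sub>R e) > M" "norm x > M" using 1 False by auto
    then show ?thesis using M B0 by (simp add: s_def)
  qed (use bound in auto)
  have int: "integrable lebesgue (\<lambda>x. indicator (cball 0 (\<bar>M\<bar> + 1)) x *\<^sub>R B :: real)" 
    by (rule integrable_lebesgue_cball)
  have Dm: "D \<in> borel_measurable lebesgue"
    by (rule borel_measurable_LIMSEQ_real[OF lim smeas])
  have "(LINT x|lebesgue. s n x) = 0" for n
    unfolding s_def
    using lebesgue_integrable_translate[OF f(2)] lebesgue_integral_translate[OF borel_measurable_integrable[OF f(2)]] f(2)
    by simp
  moreover have "(\<lambda>n. integral\<^sup>L lebesgue (s n)) \<longlonglongrightarrow> integral\<^sup>L lebesgue D"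
    by (rule integral_dominated_convergence[where s = s, OF Dm smeas int]) (use lim supp in auto)
  ultimately show "(LINT x|lebesgue. D x) = 0"
    by (simp add: LIMSEQ_const_iff)
  show "integrable lebesgue D"
    by (rule integrable_dominated_convergence[where s = s, OF Dm smeas int]) (use lim supp in auto)
qed

lemma radial_bounded:
  assumes "radial x0 f" obtains B M where "\<And>x. \<bar>f x\<bar> \<le> B" "\<And>x. norm (x - x0) > M \<Longrightarrow> f x = 0"
proof -
  obtain M where M: "\<And>x. norm (x - x0) > M \<Longrightarrow> f x = 0" using radial_bounded_support[OF assms] by blast
  have "compact (f ` cball x0 M)" by (intro compact_continuous_image radial_continuous_on[OF assms]) auto
  then obtain B where "\<forall>x\<in>cball x0 M. \<bar>f x\<bar> \<le> B"
    using compact_imp_bounded by (fastforce simp: bounded_iff)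
  then have "\<bar>f x\<bar> \<le> max B 0" for x
    using M[of x] by (cases "x \<in> cball x0 M") (force simp: dist_norm norm_minus_commute)+
  then show ?thesis using that M by blast
qed

lemma radial_measurable: "radial x0 f \<Longrightarrow> f \<in> borel_measurable borel"
  using radial_continuous_on borel_measurable_continuous_onI by blast

lemma radial_integrable: "radial x0 f \<Longrightarrow> integrable lebesgue f"
  by (metis integrable_lebesgue_compact_support radial_bounded radial_measurable)

lemma radial_integral_iter_pderiv:
  assumes "radial x0 f"
  shows "(LINT x|lebesgue. iter_pderiv [i] f x) = 0"
proof -
  obtain M where M: "\<And>x. norm (x - x0) > M \<Longrightarrow> f x = 0" using radial_bounded_support[OF assms] by blast
  obtain B where B: "\<And>x. \<bar>iter_pderiv [i] f x\<bar> \<le> B"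
    using radial_bounded[OF radial_iter_pderiv1[OF assms]] by metis
  show ?thesis
  proof (rule integral_partial_derivative_eq_0(2))
    show "((\<lambda>t. f (x + t *\<^sub>R axis i 1)) has_real_derivative iter_pderiv [i] f x) (at 0)" for x
    proof -
      have "(f has_derivative (\<lambda>v. \<Sum>j\<in>UNIV. v $ j * iter_pderiv [j] f x)) (at (x + 0 *\<^sub>R axis i 1))"
        using radial_has_derivative_iter_pderiv[OF assms] by simp
      then have "((\<lambda>t. f (x + t *\<^sub>R axis i 1)) has_derivative
         (\<lambda>h. \<Sum>j\<in>UNIV. (h *\<^sub>R axis i 1) $ j * iter_pderiv [j] f x)) (at 0)"
        by (rule has_derivative_compose[rotated]) (auto intro!: derivative_eq_intros)
      moreover have "(\<Sum>j\<in>UNIV. (h *\<^sub>R axis i 1) $ j * iter_pderiv [j] f x) = iter_pderiv [i] f x * h" for h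
        by (simp add: axis_def if_distrib if_distribR sum.delta mult.commute cong: if_cong)
      ultimately show ?thesis by (simp add: has_field_derivative_def)
    qed
    show "f x = 0" if "norm x > M + norm x0" for x
      using M[of x] norm_triangle_sub[of x x0] that by (simp add: add.commute)
  qed (use B radial_measurable[OF assms] radial_integrable[OF assms] in auto)
qed

section \<open>Integrals of radial functions and the constant \<open>kappa\<close>\<close>

definition radial_integral :: "(real \<Rightarrow> real) \<Rightarrow> real" where
  "radial_integral h = (LINT x|lebesgue. h (norm (x :: real^3)))"

lemma annular_radial: "annular h \<Longrightarrow> radial 0 (\<lambda>x. h (norm x))"
  using radial.base[of h 0] by simp

lemma radial_integral_shift:
  assumes "h \<in> borel_measurable borel"
  shows "(LINT x|lebesgue. h (norm (x - x0 :: real^3))) = radial_integral h"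
proof -
  have "(\<lambda>x::real^3. h (norm x)) \<in> borel_measurable lebesgue"
    by (intro measurable_completion) (use assms in measurable)
  from lebesgue_integral_translate[OF this, of "- x0"] show ?thesis
    by (simp add: radial_integral_def)
qed

lemma annular_integrable: "annular h \<Longrightarrow> integrable lebesgue (\<lambda>x::real^3. h (norm x))"
  using radial_integrable[OF annular_radial] .

lemma radial_integral_add:
  "annular h \<Longrightarrow> annular k \<Longrightarrow> radial_integral (\<lambda>r. h r + k r) = radial_integral h + radial_integral k"
  by (simp add: radial_integral_def annular_integrable)

text \<open>The integrand is the divergence of the field x h(|x|). The identity takes the place of
  polar coordinates in what follows.\<close>

lemma radial_integral_divergence:
  assumes "annular h"
  shows "radial_integral (\<lambda>r. 3 * h r + r * deriv h r) = 0"
proof -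
  have R: "radial 0 (\<lambda>x::real^3. (x - 0) $ i * h (norm (x - 0)))" for i
    by (rule radial.coord[OF radial.base[OF assms]])
  have D: "radial 0 (\<lambda>x::real^3. h (norm (x - 0)))" by (rule radial.base[OF assms])
  have eq: "3 * h (norm x) + norm x * deriv h (norm x) =
    (\<Sum>i\<in>UNIV. iter_pderiv [i] (\<lambda>x. (x - 0) $ i * h (norm (x - 0))) x)" for x :: "real^3"
  proof -
    have "(\<Sum>i\<in>UNIV. iter_pderiv [i] (\<lambda>x. (x - 0) $ i * h (norm (x - 0))) x) =
      (\<Sum>i\<in>UNIV. h (norm x) + x $ i * (x $ i * (deriv h (norm x) / norm x)))"
      by (intro sum.cong refl, subst iter_pderiv_coord[OF radial_differentiable[OF D]], 
         subst iter_pderiv_annular[OF assms]) simp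
    also have "\<dots> = 3 * h (norm x) + (x \<bullet> x) * (deriv h (norm x) / norm x)"
      by (simp add: sum.distrib inner_vec_def sum_distrib_right sum_divide_distrib mult.assoc)
    also have "(x \<bullet> x) * (deriv h (norm x) / norm x) = norm x * deriv h (norm x)"
      by (simp add: dot_square_norm power2_eq_square)
    finally show ?thesis by simp
  qed
  show ?thesis unfolding radial_integral_def eq
    using radial_integral_iter_pderiv[OF R] radial_integrable[OF radial_iter_pderiv1[OF R]]
    by (simp add: Bochner_Integration.integral_sum)
qed

lemma deriv_annular_divide:
  assumes "annular w" "r > 0"
  shows "deriv (\<lambda>r. w r / r ^ n) r = deriv w r / r ^ n - real n * w r / r ^ (n + 1)"
proof -
  have "(w has_real_derivative deriv w r) (at r)" using smooth_DERIV annular_smooth assms by blast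
  then have "((\<lambda>r. w r / r ^ n) has_real_derivative (deriv w r / r ^ n - real n * w r / r ^ (n + 1))) (at r)"
    using assms(2) by (auto intro!: derivative_eq_intros) (cases n; simp add: field_simps)
  then show ?thesis by (rule DERIV_imp_deriv)
qed

lemma radial_integral_cong:
  assumes "\<And>r. r \<ge> 0 \<Longrightarrow> h r = k r"
  shows "radial_integral h = radial_integral k"
  unfolding radial_integral_def using assms by simp

text \<open>The divergence identity for w / r^3. In polar coordinates: the weight r^(-2) cancels the
  growth of the spheres, and what remains is the integral of w' over the half-line.\<close>

lemma radial_integral_deriv_over_square:
  assumes "annular w" shows "radial_integral (\<lambda>r. deriv w r / r ^ 2) = 0"
proof -
  have "radial_integral (\<lambda>r. deriv w r / r ^ 2) =
    radial_integral (\<lambda>r. 3 * (w r / r ^ 3) + r * deriv (\<lambda>r. w r / r ^ 3) r)"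
  proof (rule radial_integral_cong)
    fix r :: real assume "r \<ge> 0"
    show "deriv w r / r ^ 2 = 3 * (w r / r ^ 3) + r * deriv (\<lambda>r. w r / r ^ 3) r"
    proof (cases "r = 0")
      case False
      then show ?thesis using \<open>r \<ge> 0\<close>
        by (simp add: deriv_annular_divide[OF assms]) (simp add: field_simps eval_nat_numeral)
    qed simp
  qed
  then show ?thesis using radial_integral_divergence[OF annular_divide[OF assms]] by simp
qed

text \<open>The divergence identity for w / r^2, that is, an integration by parts in the
  radius.\<close>

lemma radial_integral_over_square:
  assumes "annular w"
  shows "radial_integral (\<lambda>r. w r / r ^ 2) = - radial_integral (\<lambda>r. deriv w r / r)"
proof -
  have "radial_integral (\<lambda>r. w r / r ^ 2 + deriv w r / r ^ 1) =
    radial_integral (\<lambda>r. 3 * (w r / r ^ 2) + r * deriv (\<lambda>r. w r / r ^ 2) r)"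
  proof (rule radial_integral_cong)
    fix r :: real assume "r \<ge> 0"
    show "w r / r ^ 2 + deriv w r / r ^ 1 = 3 * (w r / r ^ 2) + r * deriv (\<lambda>r. w r / r ^ 2) r"
    proof (cases "r = 0")
      case False
      then show ?thesis using \<open>r \<ge> 0\<close>
        by (simp add: deriv_annular_divide[OF assms]) (simp add: field_simps eval_nat_numeral)
    qed simp
  qed
  then show ?thesis using radial_integral_divergence[OF annular_divide[OF assms]]
      radial_integral_add[OF annular_divide[OF assms, of 2] annular_divide[OF annular_deriv[OF assms], of 1]]
    by simp
qed

definition scaled_step :: "real \<Rightarrow> real \<Rightarrow> real" where
  "scaled_step \<delta> r = step (r / \<delta>)"

lemma smooth_scaled_step: "smooth (scaled_step \<delta>)"
  using smooth_affine[OF smooth_step, of "1 / \<delta>" 0] by (simp add: scaled_step_def[abs_def])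

lemma deriv_scaled_step: "deriv (scaled_step \<delta>) r = deriv step (r / \<delta>) / \<delta>"
proof (rule DERIV_imp_deriv)
  have "((\<lambda>r. step (r / \<delta>)) has_real_derivative deriv step (r / \<delta>) * (1 / \<delta>)) (at r)"
    by (rule DERIV_chain2[where g = "\<lambda>r. r / \<delta>", OF smooth_DERIV[OF smooth_step] DERIV_cdivide[OF DERIV_ident]])
  then show "(scaled_step \<delta> has_real_derivative deriv step (r / \<delta>) / \<delta>) (at r)"
    by (simp add: scaled_step_def[abs_def])
qed

lemma deriv2_scaled_step: "deriv (deriv (scaled_step \<delta>)) r = deriv (deriv step) (r / \<delta>) / \<delta>^2"
proof (rule DERIV_imp_deriv)
  have "((\<lambda>r. deriv step (r / \<delta>) / \<delta>) has_real_derivative deriv (deriv step) (r / \<delta>) * (1 / \<delta>) / \<delta>) (at r)"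
    by (rule DERIV_cdivide, rule DERIV_chain2[where g = "\<lambda>r. r / \<delta>", OF smooth_DERIV[OF smooth_deriv[OF smooth_step]] DERIV_cdivide[OF DERIV_ident]])
  then show "(deriv (scaled_step \<delta>) has_real_derivative deriv (deriv step) (r / \<delta>) / \<delta>^2) (at r)"
    by (simp add: deriv_scaled_step[abs_def] power2_eq_square)
qed

lemma scaled_step_eq_0: "\<delta> > 0 \<Longrightarrow> r \<le> \<delta> \<Longrightarrow> scaled_step \<delta> r = 0"
  by (simp add: scaled_step_def step_eq_0)

lemma scaled_step_eq_1: "\<delta> > 0 \<Longrightarrow> r \<ge> 2 * \<delta> \<Longrightarrow> scaled_step \<delta> r = 1"
  by (simp add: scaled_step_def step_eq_1 field_simps)

lemma annular_deriv_scaled_step: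
  assumes "\<delta> > 0" shows "annular (deriv (scaled_step \<delta>))"
  by (rule annularI[of _ \<delta> "2 * \<delta>"])
    (use assms in \<open>auto simp: deriv_scaled_step field_simps intro!: deriv_step_eq_0 smooth_deriv smooth_scaled_step\<close>)

text \<open>In polar coordinates this is 4\<pi>, the mass of the Laplacian of -1/r. The proof relies
  on its positivity and on its independence of the scale of the step.\<close>

definition kappa :: real where
  "kappa = radial_integral (\<lambda>r. deriv step r / r ^ 2)"

text \<open>Two scalings of \<open>step\<close> differ by an annular function, whose derivative over
  r^2 integrates to 0.\<close>

lemma radial_integral_scaled_step:
  assumes "\<delta> > 0"
  shows "radial_integral (\<lambda>r. deriv (scaled_step \<delta>) r / r ^ 2) = kappa"
proof -
  have ss: "scaled_step 1 = step" by (simp add: scaled_step_def fun_eq_iff)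
  define w where "w r = scaled_step \<delta> r - step r" for r
  have "annular w"
    by (rule annularI[of _ "min \<delta> 1" "max (2 * \<delta>) 2"])
      (use assms in \<open>auto simp: w_def[abs_def] scaled_step_eq_0 scaled_step_eq_1 step_eq_0 step_eq_1 intro!: smooth_diff smooth_scaled_step smooth_step\<close>)
  moreover have "deriv w r = deriv (scaled_step \<delta>) r - deriv step r" for r
    unfolding w_def
    by (intro DERIV_imp_deriv DERIV_diff smooth_DERIV smooth_scaled_step smooth_step)
  ultimately have "radial_integral (\<lambda>r. deriv (scaled_step \<delta>) r / r ^ 2 - deriv step r / r ^ 2) = 0"
    using radial_integral_deriv_over_square[of w] by (simp add: diff_divide_distrib)
  then show ?thesis
    using annular_integrable[OF annular_divide[OF annular_deriv_scaled_step[OF assms], of 2]]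
      annular_integrable[OF annular_divide[OF annular_deriv_scaled_step[of 1], of 2]]
    by (simp add: radial_integral_def kappa_def ss)
qed

text \<open>By the formula for w(r) / r the integrand is the Laplacian of 1/r smoothed near the
  origin, a smooth version of -4\<pi> times a point mass.\<close>

lemma radial_integral_deriv2_scaled_step:
  assumes "\<delta> > 0"
  shows "radial_integral (\<lambda>r. deriv (deriv (scaled_step \<delta>)) r / r) = - kappa"
  using radial_integral_over_square[OF annular_deriv_scaled_step[OF assms]]
    radial_integral_scaled_step[OF assms] by simp

lemma continuous_nonneg_integral_0:
  fixes f :: "'a::euclidean_space \<Rightarrow> real"
  assumes "continuous_on UNIV f" "\<And>x. f x \<ge> 0" "integrable lebesgue f" "(LINT x|lebesgue. f x) = 0"
  shows "f x = 0"
proof (rule ccontr)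
  assume "f x \<noteq> 0"
  have op: "open {x. f x \<noteq> 0}"
    using open_Collect_neq[OF assms(1) continuous_on_const] by simp
  have "AE x in lebesgue. f x = 0"
    using integral_nonneg_eq_0_iff_AE[OF assms(3)] assms by simp
  then have "negligible {x. f x \<noteq> 0}"
    by (simp add: negligible_iff_null_sets AE_iff_null_sets[OF lborelD] AE_iff_null op[THEN borel_open])
  then show False using open_not_negligible[OF op] \<open>f x \<noteq> 0\<close> by auto
qed

text \<open>A nonnegative continuous integrand with integral 0 vanishes identically;
  \<open>step\<close> would then have derivative 0 on the positive axis, although it rises from 0 at
  1 to 1 at 2.\<close>

lemma kappa_pos: "kappa > 0"
proof -
  have ss: "scaled_step 1 = step" by (simp add: scaled_step_def fun_eq_iff)
  have ann: "annular (\<lambda>r. deriv step r / r ^ 2)"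
    using annular_divide[OF annular_deriv_scaled_step[of 1], of 2] by (simp add: ss)
  have nn: "deriv step r / r ^ 2 \<ge> 0" for r using deriv_step_nonneg by simp
  have "kappa \<ge> 0" unfolding kappa_def radial_integral_def
    by (rule integral_nonneg_AE) (use nn in auto)
  moreover have "kappa \<noteq> 0"
  proof
    assume "kappa = 0"
    then have 0: "deriv step (norm x) / norm x ^ 2 = 0" for x :: "real^3"
      using continuous_nonneg_integral_0[OF radial_continuous_on[OF annular_radial[OF ann]] nn annular_integrable[OF ann]]
      unfolding kappa_def radial_integral_def by blast
    have "deriv step r = 0" if "r > 0" for r
      using 0[of "r *\<^sub>R axis 1 1"] that by simp
    moreover obtain z where "1 < z" "step 2 - step 1 = (2 - 1) * deriv step z"
      using MVT2[of 1 2 step "deriv step"] smooth_DERIV[OF smooth_step] by auto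
    ultimately show False by (simp add: step_eq_0 step_eq_1)
  qed
  ultimately show ?thesis by simp
qed

section \<open>Recognising null functions from their integrals\<close>

lemma integral_open_sets_0_imp_AE_0:
  fixes w :: "'a::euclidean_space \<Rightarrow> 'b::euclidean_space"
  assumes w: "integrable lebesgue w"
    and U: "\<And>U. open U \<Longrightarrow> (LINT x|lebesgue. indicator U x *\<^sub>R w x) = 0"
  shows "AE x in lebesgue. w x = 0"
proof -
  have "(LINT x|lebesgue. indicator A x *\<^sub>R w x) = 0" if A: "A \<in> sets lebesgue" for A
  proof -
    have "\<exists>T. open T \<and> A \<subseteq> T \<and> (T - A) \<in> lmeasurable \<and> emeasure lebesgue (T - A) < ennreal (inverse (Suc n))" for n
      using sets_lebesgue_outer_open[OF A, of "inverse (Suc n)"] by (metis inverse_positive_iff_positive of_nat_0_less_iff zero_less_Suc)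
    then obtain T where T: "\<And>n. open (T n)" "\<And>n. A \<subseteq> T n" "\<And>n. T n - A \<in> lmeasurable"
      "\<And>n. emeasure lebesgue (T n - A) < ennreal (inverse (Suc n))"
      by metis
    \<comment> \<open>Outer regularity gives open sets around \<open>A\<close> with small excess.
      Their finite intersections are still open and decrease to \<open>A\<close> up to a null set,
      so dominated convergence carries the hypothesis from open to measurable sets.\<close>
    define V where "V n = (\<Inter>k\<le>n. T k)" for n
    have V: "open (V n)" for n unfolding V_def using T(1) by (intro open_INT) auto
    have null: "negligible ((\<Inter>n. V n) - A)"
    proof -
      have m: "(\<Inter>n. V n) - A \<in> sets lebesgue"
        using A V by (intro sets.Diff sets.countable_INT) (auto simp: borel_open)
      have "emeasure lebesgue ((\<Inter>n. V n) - A) \<le> ennreal (inverse (Suc n))" for n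
      proof -
        have "emeasure lebesgue ((\<Inter>n. V n) - A) \<le> emeasure lebesgue (T n - A)"
          using T(3) by (intro emeasure_mono) (auto simp: V_def fmeasurable_def)
        then show ?thesis using T(4)[of n] by simp
      qed
      then have "emeasure lebesgue ((\<Inter>n. V n) - A) = 0"
      proof (intro antisym tendsto_lowerbound[where F = sequentially])
        show "(\<lambda>n. ennreal (inverse (Suc n))) \<longlonglongrightarrow> 0"
          using LIMSEQ_inverse_real_of_nat tendsto_ennrealI[of _ 0] by (simp add: ennreal_0[symmetric] del: ennreal_0)
      qed auto
      then show ?thesis using m by (simp add: negligible_iff_emeasure0)
    qed
    have lim: "(\<lambda>n. LINT x|lebesgue. indicator (V n) x *\<^sub>R w x) \<longlonglongrightarrow> (LINT x|lebesgue. indicator A x *\<^sub>R w x)"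
    proof (rule integral_dominated_convergence[where w = "\<lambda>x. norm (w x)"])
      show "AE x in lebesgue. (\<lambda>n. indicator (V n) x *\<^sub>R w x) \<longlonglongrightarrow> indicator A x *\<^sub>R w x"
      proof -
        have "AE x in lebesgue. x \<notin> (\<Inter>n. V n) - A"
          using null by (intro AE_not_in) (simp add: negligible_iff_null_sets)
        then show ?thesis
        proof eventually_elim
          case (elim x)
          show ?case
          proof (cases "x \<in> A")
            case True
            then have "x \<in> V n" for n using T(2) by (auto simp: V_def)
            then show ?thesis using True by simp
          next
            case False
            then obtain n where n: "x \<notin> V n" using elim by blast
            then have "x \<notin> V m" if "m \<ge> n" for m using that by (auto simp: V_def)
            then have "\<forall>\<^sub>F m in sequentially. indicator (V m) x *\<^sub>R w x = indicator A x *\<^sub>R w x"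
              using False by (auto simp: eventually_sequentially intro!: exI[of _ n])
            then show ?thesis by (rule tendsto_eventually)
          qed
        qed
      qed
    qed (use w A V in \<open>auto simp: borel_open intro!: borel_measurable_scaleR borel_measurable_indicator split: split_indicator\<close>)
    then show ?thesis using U[OF V] by (simp add: LIMSEQ_const_iff)
  qed
  note sets0 = this
  \<comment> \<open>Both functions are densities with the same integral over every measurable
    set.\<close>
  have "AE x in lebesgue. w x \<bullet> b = 0" for b
  proof (rule density_unique_real[of lebesgue "\<lambda>x. w x \<bullet> b" "\<lambda>_. 0"])
    fix A assume A: "A \<in> sets (lebesgue :: 'a measure)"
    then have "integrable lebesgue (\<lambda>x. indicator A x *\<^sub>R w x)" using w by (rule integrable_mult_indicator)
    then have "(LINT x|lebesgue. (indicator A x *\<^sub>R w x) \<bullet> b) = 0"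
      using sets0[OF A] by (simp only: integral_inner_left inner_zero_left)
    then show "(LINT x:A|lebesgue. w x \<bullet> b) = (LINT x:A|lebesgue. 0)"
      by (simp add: set_lebesgue_integral_def)
  qed (use w in \<open>auto intro: integrable_inner_left\<close>)
  then have "AE x in lebesgue. \<forall>b\<in>Basis. w x \<bullet> b = 0"
    by (simp add: AE_finite_all)
  then show ?thesis by eventually_elim (auto intro: euclidean_eqI)
qed

text \<open>These functions converge to the indicator of a ball. The first factor is imposed by the
  class, whose members vanish at the centre; only that one point is lost in the limit.\<close>

lemma annular_ball_approx:
  assumes "r > 0"
  shows "annular (\<lambda>s. step (real (Suc n) * s) * step (real (Suc n) * (r - s)))"
proof (rule annularI[of _ "inverse (real (Suc n))" r])
  have "smooth (\<lambda>s. step (real (Suc n) * s))"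
    using smooth_affine[OF smooth_step, of "real (Suc n)" 0] by simp
  moreover have "smooth (\<lambda>s. step (real (Suc n) * (r - s)))"
    using smooth_affine[OF smooth_step, of "- real (Suc n)" "real (Suc n) * r"] by (simp add: algebra_simps)
  ultimately show "smooth (\<lambda>s. step (real (Suc n) * s) * step (real (Suc n) * (r - s)))"
    by (rule smooth_mult)
  show "step (real (Suc n) * s) * step (real (Suc n) * (r - s)) = 0" if "s < inverse (real (Suc n))" for s
    using that by (subst step_eq_0) (auto simp: field_simps)
  show "step (real (Suc n) * s) * step (real (Suc n) * (r - s)) = 0" if "s > r" for s
  proof -
    have "real (Suc n) * (r - s) \<le> 0" using that by (intro mult_nonneg_nonpos) auto
    then show ?thesis by (simp add: step_eq_0)
  qed
qed simp

lemma ball_approx_tendsto: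
  assumes "s \<ge> 0" "r > 0"
  shows "(\<lambda>n. step (real (Suc n) * s) * step (real (Suc n) * (r - s))) \<longlonglongrightarrow> (if 0 < s \<and> s < r then 1 else 0)"
proof (rule tendsto_eventually)
  show "\<forall>\<^sub>F n in sequentially. step (real (Suc n) * s) * step (real (Suc n) * (r - s)) = (if 0 < s \<and> s < r then 1 else 0)"
  proof (cases "0 < s \<and> s < r")
    case True
    obtain N :: nat where N: "real N \<ge> 2 / s" "real N \<ge> 2 / (r - s)"
      by (metis (no_types) linear order_trans real_arch_simple)
    have "step (real (Suc n) * s) = 1 \<and> step (real (Suc n) * (r - s)) = 1" if "n \<ge> N" for n
    proof -
      have "real (Suc n) \<ge> 2 / s" "real (Suc n) \<ge> 2 / (r - s)" using N that by linarith+
      then show ?thesis using True by (auto intro!: step_eq_1 simp: pos_divide_le_eq)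
    qed
    then have "\<forall>n\<ge>N. step (real (Suc n) * s) * step (real (Suc n) * (r - s)) = 1" by simp
    then show ?thesis using True unfolding eventually_sequentially by auto
  next
    case False
    then have "s = 0 \<or> r - s \<le> 0" using assms by auto
    moreover have "step (real (Suc n) * (r - s)) = 0" if "r - s \<le> 0" for n
      using that by (intro step_eq_0 order_trans[OF mult_nonneg_nonpos]) auto
    moreover have "step (real (Suc n) * 0) = 0" for n by (simp add: step_eq_0)
    ultimately have "step (real (Suc n) * s) * step (real (Suc n) * (r - s)) = 0" for n by auto
    then show ?thesis unfolding if_not_P[OF False] by (intro always_eventually allI)
  qed
qed

lemma locally_integrable_cball:
  "locally_integrable w \<Longrightarrow> integrable lebesgue (\<lambda>x. indicator (cball x0 r) x *\<^sub>R w x)"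
  using compact_cball unfolding locally_integrable_def set_integrable_def by blast

lemma locally_integrable_measurable:
  fixes w :: "real^'n \<Rightarrow> 'b::euclidean_space"
  assumes "locally_integrable w" shows "w \<in> borel_measurable lebesgue"
proof (rule borel_measurable_LIMSEQ_metric)
  show "(\<lambda>x. indicator (cball 0 (real n)) x *\<^sub>R w x) \<in> borel_measurable lebesgue" for n
    using locally_integrable_cball[OF assms] by (rule borel_measurable_integrable)
  show "(\<lambda>n. indicator (cball 0 (real n)) x *\<^sub>R w x) \<longlonglongrightarrow> w x" for x
  proof (rule tendsto_eventually)
    obtain N :: nat where "norm x \<le> real N" using real_arch_simple by blast
    then show "\<forall>\<^sub>F n in sequentially. indicator (cball 0 (real n)) x *\<^sub>R w x = w x"
      by (auto simp: eventually_sequentially indicator_def intro!: exI[of _ N])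
  qed
qed

lemma locally_integrable_radial:
  fixes w :: "real^'n \<Rightarrow> 'b::euclidean_space"
  assumes "locally_integrable w" "radial x0 f"
  shows "integrable lebesgue (\<lambda>x. f x *\<^sub>R w x)"
proof -
  obtain B M where BM: "\<And>x. \<bar>f x\<bar> \<le> B" "\<And>x. norm (x - x0) > M \<Longrightarrow> f x = 0"
    using radial_bounded[OF assms(2)] by metis
  show ?thesis
  proof (rule Bochner_Integration.integrable_bound)
    show "integrable lebesgue (\<lambda>x. B *\<^sub>R (indicator (cball x0 M) x *\<^sub>R w x))"
      by (intro integrable_scaleR_right locally_integrable_cball assms(1))
    show "(\<lambda>x. f x *\<^sub>R w x) \<in> borel_measurable lebesgue"
      using measurable_completion[of f lborel borel] radial_measurable[OF assms(2)]
        locally_integrable_measurable[OF assms(1)]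
      by (intro borel_measurable_scaleR) auto
    show "AE x in lebesgue. norm (f x *\<^sub>R w x) \<le> norm (B *\<^sub>R (indicator (cball x0 M) x *\<^sub>R w x))"
    proof (intro AE_I2)
      fix x
      show "norm (f x *\<^sub>R w x) \<le> norm (B *\<^sub>R (indicator (cball x0 M) x *\<^sub>R w x))"
      proof (cases "x \<in> cball x0 M")
        case True
        have "\<bar>f x\<bar> \<le> \<bar>B\<bar>" using BM(1)[of x] by linarith
        then show ?thesis using True by (simp add: mult_right_mono)
      next
        case False
        then show ?thesis using BM(2)[of x] by (simp add: dist_norm norm_minus_commute)
      qed
    qed
  qed
qed

lemma radial_tests_imp_ball_integral_0:
  fixes w :: "real^'n \<Rightarrow> 'b::euclidean_space"
  assumes w: "locally_integrable w"
    and 0: "\<And>x0 f. radial x0 f \<Longrightarrow> (LINT x|lebesgue. f x *\<^sub>R w x) = 0"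
    and r: "r > 0"
  shows "(LINT x|lebesgue. indicator (ball x0 r) x *\<^sub>R w x) = 0"
proof -
  let ?f = "\<lambda>n x. step (real (Suc n) * norm (x - x0)) * step (real (Suc n) * (r - norm (x - x0)))"
  have rad: "radial x0 (?f n)" for n using radial.base[OF annular_ball_approx[OF r, of n], of x0] by simp
  have ne: "AE x in lebesgue. x \<noteq> x0" by (simp add: AE_completion AE_lborel_singleton)
  have "(\<lambda>n. LINT x|lebesgue. ?f n x *\<^sub>R w x) \<longlonglongrightarrow> (LINT x|lebesgue. indicator (ball x0 r) x *\<^sub>R w x)"
  proof (rule integral_dominated_convergence[where w = "\<lambda>x. norm (indicator (cball x0 r) x *\<^sub>R w x)"])
    show "AE x in lebesgue. (\<lambda>n. ?f n x *\<^sub>R w x) \<longlonglongrightarrow> indicator (ball x0 r) x *\<^sub>R w x"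
      using ne
    proof eventually_elim
      case (elim x)
      have "(\<lambda>n. ?f n x *\<^sub>R w x) \<longlonglongrightarrow> (if 0 < norm (x - x0) \<and> norm (x - x0) < r then 1 else 0) *\<^sub>R w x"
        by (intro tendsto_scaleR ball_approx_tendsto r tendsto_const) simp
      then show ?case using elim by (auto simp: indicator_def dist_norm norm_minus_commute split: if_splits)
    qed
    show "AE x in lebesgue. norm (?f n x *\<^sub>R w x) \<le> norm (indicator (cball x0 r) x *\<^sub>R w x)" for n
    proof (intro AE_I2)
      fix x
      show "norm (?f n x *\<^sub>R w x) \<le> norm (indicator (cball x0 r) x *\<^sub>R w x)"
      proof (cases "x \<in> cball x0 r")
        case True
        have "\<bar>?f n x\<bar> \<le> 1 * 1" unfolding abs_mult
          by (intro mult_mono) (use step_bounds in \<open>auto simp: abs_le_iff intro: order_trans[of _ 0]\<close>)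
        then show ?thesis using True mult_right_mono[of "\<bar>?f n x\<bar>" 1 "norm (w x)"] by simp
      next
        case False
        then have "real (Suc n) * (r - norm (x - x0)) \<le> 0"
          by (intro mult_nonneg_nonpos) (auto simp: dist_norm norm_minus_commute)
        then show ?thesis by (simp add: step_eq_0 del: of_nat_Suc)
      qed
    qed
    show "integrable lebesgue (\<lambda>x. norm (indicator (cball x0 r) x *\<^sub>R w x))"
      by (intro integrable_norm locally_integrable_cball w)
    show "(\<lambda>x. ?f n x *\<^sub>R w x) \<in> borel_measurable lebesgue" for n
      using locally_integrable_radial[OF w rad] by (rule borel_measurable_integrable)
    show "(\<lambda>x. indicator (ball x0 r) x *\<^sub>R w x) \<in> borel_measurable lebesgue"
      using locally_integrable_measurable[OF w] by (intro borel_measurable_scaleR borel_measurable_indicator) auto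
  qed
  then show ?thesis using 0[OF rad] by (simp add: LIMSEQ_const_iff)
qed

text \<open>Radial test functions determine the integrals over balls, and by Vitali's theorem balls
  exhaust every open set up to a null set.\<close>

lemma radial_tests_imp_AE_0:
  fixes w :: "real^'n \<Rightarrow> 'b::euclidean_space"
  assumes w: "locally_integrable w"
    and 0: "\<And>x0 f. radial x0 f \<Longrightarrow> (LINT x|lebesgue. f x *\<^sub>R w x) = 0"
  shows "AE x in lebesgue. w x = 0"
proof -
  \<comment> \<open>The closed ball supplies integrability, while the open ball turns the part of
    \<open>U\<close> to be covered into an open set, as the covering by balls requires.\<close>
  have "AE x in lebesgue. indicator (cball 0 (real n)) x *\<^sub>R indicator (ball 0 (real n)) x *\<^sub>R w x = 0" for n
  proof (rule integral_open_sets_0_imp_AE_0)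
    let ?w = "\<lambda>x. indicator (cball 0 (real n)) x *\<^sub>R indicator (ball 0 (real n)) x *\<^sub>R w x"
    have weq: "?w = (\<lambda>x. indicator (ball 0 (real n)) x *\<^sub>R (indicator (cball 0 (real n)) x *\<^sub>R w x))"
      by (auto simp: fun_eq_iff)
    show wi: "integrable lebesgue ?w"
      unfolding weq by (intro integrable_mult_indicator locally_integrable_cball w) auto
    fix U :: "(real^'n) set" assume U: "open U"
    define S where "S = U \<inter> ball 0 (real n)"
    have S: "open S" "S \<subseteq> ball 0 (real n)" using U by (auto simp: S_def)
    obtain C where C: "countable C" "C \<subseteq> {(x, r). r > 0 \<and> ball x r \<subseteq> S}"
       "pairwise (\<lambda>i j. disjnt (ball (fst i) (snd i)) (ball (fst j) (snd j))) C"
       "negligible (S - (\<Union>i \<in> C. ball (fst i) (snd i)))"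
    proof (rule Vitali_covering_theorem_balls[of S "{(x, r). r > 0 \<and> ball x r \<subseteq> S}" fst snd])
      fix x d assume "x \<in> S" "0 < (d::real)"
      then obtain e where "e > 0" "ball x e \<subseteq> S" using S openE by blast
      then show "\<exists>i. i \<in> {(x, r). 0 < r \<and> ball x r \<subseteq> S} \<and> x \<in> ball (fst i) (snd i) \<and> snd i < d"
        using \<open>0 < d\<close> by (intro exI[of _ "(x, min e (d/2))"]) auto
    qed blast
    define A where "A k = (if k \<in> to_nat_on C ` C then (let i = from_nat_into C k in ball (fst i) (snd i)) else {})" for k
    have Aim: "k \<in> to_nat_on C ` C \<Longrightarrow> from_nat_into C k \<in> C" for k
      using C(1) by (auto simp: from_nat_into_to_nat_on)
    have UA: "(\<Union>k. A k) = (\<Union>i \<in> C. ball (fst i) (snd i))"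
    proof (intro equalityI subsetI)
      fix x assume "x \<in> (\<Union>i \<in> C. ball (fst i) (snd i))"
      then obtain i where "i \<in> C" "x \<in> ball (fst i) (snd i)" by blast
      then have "x \<in> A (to_nat_on C i)" using C(1) by (simp add: A_def)
      then show "x \<in> (\<Union>k. A k)" by blast
    qed (use Aim in \<open>force simp: A_def Let_def split: if_splits\<close>)
    have disj: "disjoint_family A"
    proof (unfold disjoint_family_on_def, intro ballI impI)
      fix k l :: nat assume "k \<noteq> l"
      show "A k \<inter> A l = {}"
      proof (cases "k \<in> to_nat_on C ` C \<and> l \<in> to_nat_on C ` C")
        case True
        then obtain i j where ij: "i \<in> C" "j \<in> C" "k = to_nat_on C i" "l = to_nat_on C j" by blast
        then have "i \<noteq> j" using \<open>k \<noteq> l\<close> by blast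
        then have "disjnt (ball (fst i) (snd i)) (ball (fst j) (snd j))"
          using C(3) ij by (auto simp: pairwise_def)
        then show ?thesis using ij C(1) by (simp add: A_def disjnt_def)
      qed (auto simp: A_def)
    qed
    have Aint: "(LINT x:A k|lebesgue. ?w x) = 0" for k
    proof (cases "k \<in> to_nat_on C ` C")
      case True
      define i where "i = from_nat_into C k"
      have "i \<in> {(x, r). 0 < r \<and> ball x r \<subseteq> S}" using Aim[OF True] C(2) by (auto simp: i_def)
      then have i: "snd i > 0" "ball (fst i) (snd i) \<subseteq> S" by (simp_all add: case_prod_unfold)
      have "(LINT x:A k|lebesgue. ?w x) = (LINT x|lebesgue. indicator (ball (fst i) (snd i)) x *\<^sub>R w x)"
      proof -
        have Ak: "A k = ball (fst i) (snd i)" using True by (simp add: A_def i_def Let_def)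
        have "x \<in> ball 0 (real n)" "x \<in> cball 0 (real n)" if "x \<in> ball (fst i) (snd i)" for x
          using that i S(2) ball_subset_cball[of 0 "real n"] by blast+
        then show ?thesis unfolding set_lebesgue_integral_def Ak
          by (intro Bochner_Integration.integral_cong refl) (auto split: split_indicator)
      qed
      also have "\<dots> = 0" by (rule radial_tests_imp_ball_integral_0[OF w 0 i(1)])
      finally show ?thesis .
    qed (simp add: A_def set_lebesgue_integral_def)
    have "(LINT x|lebesgue. indicator U x *\<^sub>R ?w x) = (LINT x:(\<Union>k. A k)|lebesgue. ?w x)"
      unfolding set_lebesgue_integral_def
    proof (rule integral_cong_AE)
      have "AE x in lebesgue. x \<notin> S - (\<Union>i \<in> C. ball (fst i) (snd i))"
        using C(4) by (intro AE_not_in) (simp add: negligible_iff_null_sets)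
      then show "AE x in lebesgue. indicator U x *\<^sub>R ?w x = indicator (\<Union>k. A k) x *\<^sub>R ?w x"
      proof eventually_elim
        case (elim x)
        then show ?case using C(2) unfolding UA S_def by (force split: split_indicator)
      qed
      show "(\<lambda>x. indicator U x *\<^sub>R ?w x) \<in> borel_measurable lebesgue"
        using wi U by (intro borel_measurable_scaleR borel_measurable_indicator borel_measurable_integrable) (auto simp: borel_open)
      have "A k \<in> sets lebesgue" for k by (auto simp: A_def Let_def)
      then show "(\<lambda>x. indicator (\<Union>k. A k) x *\<^sub>R ?w x) \<in> borel_measurable lebesgue"
        using wi by (intro borel_measurable_scaleR borel_measurable_indicator borel_measurable_integrable) auto
    qed
    also have "\<dots> = (\<Sum>k. LINT x:A k|lebesgue. ?w x)"
    proof (rule lebesgue_integral_countable_add)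
      show "A k \<in> sets lebesgue" for k by (auto simp: A_def Let_def)
      show "i \<noteq> j \<Longrightarrow> A i \<inter> A j = {}" for i j using disj by (auto simp: disjoint_family_on_def)
      show "set_integrable lebesgue (\<Union> (range A)) ?w"
        unfolding set_integrable_def
      proof (rule integrable_mult_indicator[OF _ wi])
        have "A k \<in> sets lebesgue" for k by (auto simp: A_def Let_def)
        then show "\<Union> (range A) \<in> sets lebesgue" by blast
      qed
    qed
    finally show "(LINT x|lebesgue. indicator U x *\<^sub>R ?w x) = 0" using Aint by simp
  qed
  then have "AE x in lebesgue. \<forall>n. indicator (cball 0 (real n)) x *\<^sub>R indicator (ball 0 (real n)) x *\<^sub>R w x = 0"
    by (simp add: AE_all_countable)
  then show ?thesis
  proof eventually_elim
    case (elim x)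
    obtain n :: nat where "norm x < real n" using reals_Archimedean2 by blast
    then show ?case using spec[OF elim, of n] by (auto simp: indicator_def)
  qed
qed

section \<open>Uniqueness of weak derivatives\<close>

lemma has_weak_pderiv_radial:
  "has_weak_pderiv \<alpha> u v \<Longrightarrow> radial x0 f \<Longrightarrow>
    (LINT x|lebesgue. iter_pderiv \<alpha> f x *\<^sub>R u x) = (-1) ^ length \<alpha> *\<^sub>R (LINT x|lebesgue. f x *\<^sub>R v x)"
  unfolding has_weak_pderiv_def using radial_test_function by blast

text \<open>Radial tests already separate locally integrable functions. The lemma links the
  arbitrary choice made in \<open>weak_pderiv\<close> to any derivative that is known
  explicitly.\<close>

lemma has_weak_pderiv_unique:
  fixes u :: "real^'n \<Rightarrow> 'b::euclidean_space"
  assumes v: "has_weak_pderiv \<alpha> u v" and v': "has_weak_pderiv \<alpha> u v'"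
  shows "AE x in lebesgue. v x = v' x"
proof -
  have l: "locally_integrable v" "locally_integrable v'" using assms by (auto simp: has_weak_pderiv_def)
  have "AE x in lebesgue. v x - v' x = 0"
  proof (rule radial_tests_imp_AE_0)
    show "locally_integrable (\<lambda>x. v x - v' x)"
      using l unfolding locally_integrable_def by (auto intro: set_integral_diff)
    fix x0 and f :: "real^'n \<Rightarrow> real" assume f: "radial x0 f"
    show "(LINT x|lebesgue. f x *\<^sub>R (v x - v' x)) = 0"
      using has_weak_pderiv_radial[OF v f] has_weak_pderiv_radial[OF v' f]
        locally_integrable_radial[OF l(1) f] locally_integrable_radial[OF l(2) f]
      by (simp add: scaleR_diff_right)
  qed
  then show ?thesis by simp
qed

lemma has_weak_pderiv_weak_pderiv:
  "has_weak_pderiv \<alpha> u v \<Longrightarrow> has_weak_pderiv \<alpha> u (weak_pderiv \<alpha> u)"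
  unfolding weak_pderiv_def by (rule someI[of "has_weak_pderiv \<alpha> u"])

section \<open>The spaces \<open>L\<^sup>2\<close> and \<open>H\<^sup>2\<close>\<close>

lemma L2_measurable: "u \<in> L2 \<Longrightarrow> u \<in> borel_measurable lebesgue"
  and L2_integrable_square: "u \<in> L2 \<Longrightarrow> integrable lebesgue (\<lambda>x. (norm (u x))\<^sup>2)"
  by (auto simp: L2_def)

lemma L2_integrable_scaleR:
  fixes f :: "real^'n \<Rightarrow> real" and u :: "real^'n \<Rightarrow> 'b::euclidean_space"
  assumes "f \<in> L2" "u \<in> L2"
  shows "integrable lebesgue (\<lambda>x. f x *\<^sub>R u x)"
proof (rule Bochner_Integration.integrable_bound)
  show "integrable lebesgue (\<lambda>x. (norm (f x))\<^sup>2 + (norm (u x))\<^sup>2)"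
    using assms by (intro Bochner_Integration.integrable_add L2_integrable_square)
  show "(\<lambda>x. f x *\<^sub>R u x) \<in> borel_measurable lebesgue"
    using assms by (intro borel_measurable_scaleR L2_measurable)
  show "AE x in lebesgue. norm (f x *\<^sub>R u x) \<le> norm ((norm (f x))\<^sup>2 + (norm (u x))\<^sup>2)"
  proof (intro AE_I2)
    fix x
    have "2 * (\<bar>f x\<bar> * norm (u x)) \<le> \<bar>f x\<bar>\<^sup>2 + (norm (u x))\<^sup>2"
      using sum_squares_bound[of "\<bar>f x\<bar>" "norm (u x)"] by simp
    moreover have "0 \<le> \<bar>f x\<bar> * norm (u x)" by simp
    ultimately have "\<bar>f x\<bar> * norm (u x) \<le> \<bar>f x\<bar>\<^sup>2 + (norm (u x))\<^sup>2" by linarith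
    then show "norm (f x *\<^sub>R u x) \<le> norm ((norm (f x))\<^sup>2 + (norm (u x))\<^sup>2)" by simp
  qed
qed

lemma L2_norm_nonneg: "L2_norm u \<ge> 0"
  by (simp add: L2_norm_def)

lemma L2_norm_square: "(L2_norm u)\<^sup>2 = (LINT x|lebesgue. (norm (u x))\<^sup>2)"
  by (simp add: L2_norm_def)

text \<open>Young's inequality |f| |u| \<le> t/2 |f|^2 + |u|^2 / (2t) is integrated with t close to
  the quotient of the two norms.\<close>

lemma L2_Cauchy_Schwarz:
  fixes f :: "real^'n \<Rightarrow> real" and u :: "real^'n \<Rightarrow> 'b::euclidean_space"
  assumes "f \<in> L2" "u \<in> L2"
  shows "norm (LINT x|lebesgue. f x *\<^sub>R u x) \<le> L2_norm f * L2_norm u"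
proof (rule field_le_epsilon)
  fix e :: real assume "e > 0"
  define a b where "a = L2_norm f" and "b = L2_norm u"
  have ab: "a \<ge> 0" "b \<ge> 0" by (simp_all add: a_def b_def L2_norm_nonneg)
  \<comment> \<open>The shift keeps \<open>t\<close> defined and positive when a norm is 0. It costs
    \<epsilon> (a + b) / 2 in the final bound, which this choice keeps below
    \<open>e\<close>.\<close>
  define \<epsilon> where "\<epsilon> = e / (a + b + 1)"
  have \<epsilon>: "\<epsilon> > 0" using \<open>e > 0\<close> ab by (simp add: \<epsilon>_def)
  define t where "t = (b + \<epsilon>) / (a + \<epsilon>)"
  have t: "t > 0" using ab \<epsilon> by (simp add: t_def add_nonneg_pos)
  have "norm (LINT x|lebesgue. f x *\<^sub>R u x) \<le> (LINT x|lebesgue. norm (f x *\<^sub>R u x))"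
    by (rule integral_norm_bound)
  also have "\<dots> \<le> (LINT x|lebesgue. t / 2 * (norm (f x))\<^sup>2 + 1 / (2 * t) * (norm (u x))\<^sup>2)"
  proof (rule integral_mono)
    show "integrable lebesgue (\<lambda>x. norm (f x *\<^sub>R u x))"
      using L2_integrable_scaleR[OF assms] by (rule integrable_norm)
    show "integrable lebesgue (\<lambda>x. t / 2 * (norm (f x))\<^sup>2 + 1 / (2 * t) * (norm (u x))\<^sup>2)"
      using assms by (intro Bochner_Integration.integrable_add integrable_mult_right L2_integrable_square)
    fix x
    have "0 \<le> (t * \<bar>f x\<bar> - norm (u x))\<^sup>2 / (2 * t)" using t by simp
    also have "(t * \<bar>f x\<bar> - norm (u x))\<^sup>2 / (2 * t) =
        t / 2 * \<bar>f x\<bar>\<^sup>2 + 1 / (2 * t) * (norm (u x))\<^sup>2 - \<bar>f x\<bar> * norm (u x)"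
      using t by (simp add: power2_eq_square field_simps)
    finally show "norm (f x *\<^sub>R u x) \<le> t / 2 * (norm (f x))\<^sup>2 + 1 / (2 * t) * (norm (u x))\<^sup>2" by simp
  qed
  also have "\<dots> = t / 2 * a\<^sup>2 + 1 / (2 * t) * b\<^sup>2"
    using L2_integrable_square[OF assms(1)] L2_integrable_square[OF assms(2)]
    by (simp add: a_def b_def L2_norm_square)
  also have "t / 2 * a\<^sup>2 \<le> (b + \<epsilon>) * a / 2"
  proof -
    have "a / (a + \<epsilon>) \<le> 1" using ab \<epsilon> by simp
    then have "(b + \<epsilon>) * a / 2 * (a / (a + \<epsilon>)) \<le> (b + \<epsilon>) * a / 2 * 1" using ab \<epsilon>
      by (intro mult_left_mono) auto
    moreover have "t / 2 * a\<^sup>2 = (b + \<epsilon>) * a / 2 * (a / (a + \<epsilon>))"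
      unfolding t_def power2_eq_square by (simp only: times_divide_eq_left times_divide_eq_right divide_divide_eq_left divide_divide_eq_right mult_ac mult_1_left mult_1_right)
    ultimately show ?thesis by (simp only: mult_1_right)
  qed
  also have "1 / (2 * t) * b\<^sup>2 \<le> (a + \<epsilon>) * b / 2"
  proof -
    have "b / (b + \<epsilon>) \<le> 1" using ab \<epsilon> by simp
    then have "(a + \<epsilon>) * b / 2 * (b / (b + \<epsilon>)) \<le> (a + \<epsilon>) * b / 2 * 1" using ab \<epsilon>
      by (intro mult_left_mono) auto
    moreover have "1 / (2 * t) * b\<^sup>2 = (a + \<epsilon>) * b / 2 * (b / (b + \<epsilon>))"
      unfolding t_def power2_eq_square by (simp only: times_divide_eq_left times_divide_eq_right divide_divide_eq_left divide_divide_eq_right mult_ac mult_1_left mult_1_right)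
    ultimately show ?thesis by (simp only: mult_1_right)
  qed
  also have "(b + \<epsilon>) * a / 2 + (a + \<epsilon>) * b / 2 = a * b + \<epsilon> * (a + b) / 2"
    by (simp add: field_simps)
  also have "\<epsilon> * (a + b) / 2 \<le> e"
  proof -
    have "\<epsilon> * (a + b) \<le> \<epsilon> * (a + b + 1)" using \<epsilon> by simp
    also have "\<dots> = e" using ab by (simp add: \<epsilon>_def)
    finally show ?thesis using \<epsilon> ab \<open>e > 0\<close> by simp
  qed
  finally show "norm (LINT x|lebesgue. f x *\<^sub>R u x) \<le> L2_norm f * L2_norm u + e"
    by (simp add: a_def b_def)
qed

lemma L2_scaleR: "u \<in> L2 \<Longrightarrow> (\<lambda>x. c *\<^sub>R u x) \<in> L2"
  by (auto simp: L2_def power_mult_distrib)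

lemma L2_add:
  assumes "u \<in> L2" "v \<in> L2" shows "(\<lambda>x. u x + v x) \<in> L2"
  unfolding L2_def
proof (intro CollectI conjI)
  show m: "(\<lambda>x. u x + v x) \<in> borel_measurable lebesgue"
    using assms by (intro borel_measurable_add L2_measurable)
  show "integrable lebesgue (\<lambda>x. (norm (u x + v x))\<^sup>2)"
  proof (rule Bochner_Integration.integrable_bound)
    show "integrable lebesgue (\<lambda>x. 2 * (norm (u x))\<^sup>2 + 2 * (norm (v x))\<^sup>2)"
      using assms by (intro Bochner_Integration.integrable_add integrable_mult_right L2_integrable_square)
    show "(\<lambda>x. (norm (u x + v x))\<^sup>2) \<in> borel_measurable lebesgue" using m by measurable
    have "(norm (u x + v x))\<^sup>2 \<le> 2 * (norm (u x))\<^sup>2 + 2 * (norm (v x))\<^sup>2" for x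
    proof -
      have "(norm (u x + v x))\<^sup>2 \<le> (norm (u x) + norm (v x))\<^sup>2"
        by (intro power_mono norm_triangle_ineq) simp
      also have "\<dots> \<le> 2 * (norm (u x))\<^sup>2 + 2 * (norm (v x))\<^sup>2"
        using sum_squares_bound[of "norm (u x)" "norm (v x)"] by (simp add: power2_sum)
      finally show ?thesis .
    qed
    then show "AE x in lebesgue. norm ((norm (u x + v x))\<^sup>2) \<le> norm (2 * (norm (u x))\<^sup>2 + 2 * (norm (v x))\<^sup>2)"
      by auto
  qed
qed

lemma L2_diff: "u \<in> L2 \<Longrightarrow> v \<in> L2 \<Longrightarrow> (\<lambda>x. u x - v x) \<in> L2"
  using L2_add[of u "\<lambda>x. (-1) *\<^sub>R v x"] L2_scaleR[of v "-1"] by simp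

lemma radial_L2:
  assumes "radial x0 f" shows "f \<in> L2"
proof -
  obtain B M where BM: "\<And>x. \<bar>f x\<bar> \<le> B" "\<And>x. norm (x - x0) > M \<Longrightarrow> f x = 0"
    using radial_bounded[OF assms] by metis
  have "(norm (f x))\<^sup>2 \<le> B\<^sup>2" for x using BM(1)[of x] power_mono[of "\<bar>f x\<bar>" B 2] by simp
  then have "integrable lebesgue (\<lambda>x. (norm (f x))\<^sup>2)"
    using BM(2) radial_measurable[OF assms]
    by (intro integrable_lebesgue_compact_support[of _ "B\<^sup>2" M x0]) auto
  then show ?thesis using measurable_completion[of f lborel borel] radial_measurable[OF assms]
    by (simp add: L2_def)
qed

lemma L2_locally_integrable:
  fixes u :: "real^'n \<Rightarrow> 'b::euclidean_space"
  assumes "u \<in> L2" shows "locally_integrable u"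
  unfolding locally_integrable_def
proof (intro allI impI)
  fix K :: "(real^'n) set" assume K: "compact K"
  then have Km: "K \<in> lmeasurable" by (rule lmeasurable_compact)
  show "u absolutely_integrable_on K" unfolding set_integrable_def
  proof (rule Bochner_Integration.integrable_bound)
    show "integrable lebesgue (\<lambda>x. indicator K x + (norm (u x))\<^sup>2 :: real)"
      using Km assms by (intro Bochner_Integration.integrable_add L2_integrable_square integrable_real_indicator)
        (auto simp: fmeasurable_def)
    show "(\<lambda>x. indicator K x *\<^sub>R u x) \<in> borel_measurable lebesgue"
      using Km assms by (intro borel_measurable_scaleR borel_measurable_indicator L2_measurable) auto
    show "AE x in lebesgue. norm (indicator K x *\<^sub>R u x) \<le> norm (indicator K x + (norm (u x))\<^sup>2 :: real)"
    proof (intro AE_I2)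
      fix x
      have "norm (u x) \<le> 1 + (norm (u x))\<^sup>2"
      proof -
        have "2 * norm (u x) \<le> 1 + (norm (u x))\<^sup>2" using sum_squares_bound[of 1 "norm (u x)"] by simp
        then show ?thesis using norm_ge_zero[of "u x"] by linarith
      qed
      then show "norm (indicator K x *\<^sub>R u x) \<le> norm (indicator K x + (norm (u x))\<^sup>2 :: real)"
        by (auto simp: indicator_def)
    qed
  qed
qed

lemma L2_AE_cong:
  fixes u :: "real^'n \<Rightarrow> 'b::euclidean_space"
  assumes "v \<in> L2" "AE x in lebesgue. u x = v x" "u \<in> borel_measurable lebesgue"
  shows "u \<in> L2" "L2_norm u = L2_norm v"
proof -
  have ae: "AE x in lebesgue. (norm (u x))\<^sup>2 = (norm (v x))\<^sup>2" using assms(2) by eventually_elim simp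
  have m: "(\<lambda>x. (norm (u x))\<^sup>2) \<in> borel_measurable lebesgue" using assms(3) by measurable
  have "(\<lambda>x. (norm (v x))\<^sup>2) \<in> borel_measurable lebesgue" using L2_measurable[OF assms(1)] by measurable
  then show "u \<in> L2" "L2_norm u = L2_norm v"
    using m ae assms integrable_cong_AE[OF m _ ae] integral_cong_AE[OF m _ ae]
    by (auto simp: L2_def L2_norm_def)
qed

lemma H2_L2: "u \<in> H2 \<Longrightarrow> u \<in> L2"
  by (simp add: H2_def)

lemma H2_weak_pderiv:
  fixes u :: "real^'n \<Rightarrow> 'b::euclidean_space"
  assumes "u \<in> H2" "length \<alpha> \<le> 2"
  shows "has_weak_pderiv \<alpha> u (weak_pderiv \<alpha> u)" "weak_pderiv \<alpha> u \<in> L2"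
proof -
  obtain v where v: "v \<in> L2" "has_weak_pderiv \<alpha> u v" using assms by (auto simp: H2_def)
  then show w: "has_weak_pderiv \<alpha> u (weak_pderiv \<alpha> u)" using has_weak_pderiv_weak_pderiv by blast
  then have "locally_integrable (weak_pderiv \<alpha> u)" by (simp add: has_weak_pderiv_def)
  from L2_AE_cong(1)[OF v(1) has_weak_pderiv_unique[OF w v(2)] locally_integrable_measurable[OF this]]
  show "weak_pderiv \<alpha> u \<in> L2" .
qed

lemma L2_norm_weak_pderiv_le_H2_norm:
  fixes u :: "real^'n \<Rightarrow> 'b::euclidean_space"
  assumes "length \<alpha> \<le> 2"
  shows "L2_norm (weak_pderiv \<alpha> u) \<le> H2_norm u"
  unfolding H2_norm_def
proof (rule real_le_rsqrt)
  have "finite {\<alpha> :: 'n list. length \<alpha> \<le> 2}" using finite_lists_length_le[of "UNIV :: 'n set" 2] by simp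
  then show "(L2_norm (weak_pderiv \<alpha> u))\<^sup>2 \<le> (\<Sum>\<alpha> | length \<alpha> \<le> 2. (L2_norm (weak_pderiv \<alpha> u))\<^sup>2)"
    by (intro member_le_sum) (use assms in auto)
qed

lemma has_weak_pderiv_Nil:
  "locally_integrable u \<Longrightarrow> has_weak_pderiv [] u u"
  by (simp add: has_weak_pderiv_def)

lemma L2_norm_le_H2_norm:
  fixes u :: "real^'n \<Rightarrow> 'b::euclidean_space"
  assumes "u \<in> H2" shows "L2_norm u \<le> H2_norm u"
proof -
  have "has_weak_pderiv [] u u"
    using assms by (intro has_weak_pderiv_Nil L2_locally_integrable H2_L2)
  from has_weak_pderiv_unique[OF this H2_weak_pderiv(1)[OF assms]]
  have "L2_norm u = L2_norm (weak_pderiv [] u)"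
    by (intro L2_AE_cong(2) H2_weak_pderiv assms L2_measurable H2_L2) auto
  then show ?thesis using L2_norm_weak_pderiv_le_H2_norm[of "[]" u] by simp
qed

lemma test_function_bounded:
  assumes "f \<in> test_functions"
  obtains B M where "\<And>x. \<bar>f x\<bar> \<le> B" "\<And>x. norm x > M \<Longrightarrow> f x = 0" "f \<in> borel_measurable borel"
proof -
  have "iter_pderiv [] f differentiable (at x)" for x using assms unfolding test_functions_def by blast
  then have c: "continuous_on S f" for S
    by (simp add: continuous_at_imp_continuous_on differentiable_imp_continuous_within)
  have K: "compact (closure {x. f x \<noteq> 0})" using assms by (simp add: test_functions_def)
  then obtain M where M: "\<And>x. x \<in> closure {x. f x \<noteq> 0} \<Longrightarrow> norm x \<le> M"
    using compact_imp_bounded bounded_iff by metis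
  have 0: "f x = 0" if "norm x > M" for x
    using M[of x] closure_subset[of "{x. f x \<noteq> 0}"] that by force
  have "bounded (f ` closure {x. f x \<noteq> 0})" using K by (intro compact_imp_bounded compact_continuous_image c)
  then obtain B where "\<forall>y \<in> f ` closure {x. f x \<noteq> 0}. norm y \<le> B"
    unfolding bounded_iff by blast
  then have B: "x \<in> closure {x. f x \<noteq> 0} \<Longrightarrow> norm (f x) \<le> B" for x by blast
  have "\<bar>f x\<bar> \<le> max B 0" for x
  proof (cases "f x = 0")
    case False
    then have "x \<in> closure {x. f x \<noteq> 0}" using closure_subset[of "{x. f x \<noteq> 0}"] by blast
    then show ?thesis using B[of x] by simp
  qed simp
  then show ?thesis using that 0 borel_measurable_continuous_onI[OF c] by blast
qed

lemma test_function_iter_pderiv: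
  assumes "f \<in> test_functions" shows "iter_pderiv [i] f \<in> test_functions"
proof -
  have d: "iter_pderiv \<alpha> f differentiable (at x)" for \<alpha> x using assms unfolding test_functions_def by blast
  have app: "iter_pderiv \<alpha> (iter_pderiv [i] f) = iter_pderiv (\<alpha> @ [i]) f" for \<alpha>
  proof (induction \<alpha>)
    case (Cons j \<alpha>)
    then show ?case by (simp only: append_Cons iter_pderiv.simps(2)[of j])
  qed simp
  have K: "compact (closure {x. f x \<noteq> 0})" using assms by (simp add: test_functions_def)
  have sub: "{x. iter_pderiv [i] f x \<noteq> 0} \<subseteq> closure {x. f x \<noteq> 0}"
  proof (rule ccontr)
    assume "\<not> ?thesis"
    then obtain x where x: "iter_pderiv [i] f x \<noteq> 0" "x \<in> - closure {x. f x \<noteq> 0}" by blast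
    have "(f has_derivative (\<lambda>_. 0)) (at x)"
      by (rule has_derivative_transform_within_open[of "\<lambda>_. 0" _ _ _ "- closure {x. f x \<noteq> 0}"])
        (use x(2) closure_subset[of "{x. f x \<noteq> 0}"] in auto)
    then have "frechet_derivative f (at x) = (\<lambda>_. 0)" using frechet_derivative_at by metis
    then show False using x(1) by (simp add: iter_pderiv.simps)
  qed
  then have "compact (closure {x. iter_pderiv [i] f x \<noteq> 0})"
    using bounded_subset[OF compact_imp_bounded[OF K]] by (simp add: compact_closure)
  then show ?thesis using d unfolding test_functions_def by (simp add: app)
qed

lemma test_function_iter_pderivs:
  "f \<in> test_functions \<Longrightarrow> iter_pderiv \<alpha> f \<in> test_functions"
proof (induction \<alpha>)
  case (Cons i \<alpha>)
  then show ?case by (subst iter_pderiv_Cons) (rule test_function_iter_pderiv)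
qed simp

lemma locally_integrable_test_function:
  fixes w :: "real^'n \<Rightarrow> 'b::euclidean_space"
  assumes "locally_integrable w" "f \<in> test_functions"
  shows "integrable lebesgue (\<lambda>x. f x *\<^sub>R w x)"
proof -
  obtain B M where BM: "\<And>x. \<bar>f x\<bar> \<le> B" "\<And>x. norm x > M \<Longrightarrow> f x = 0" "f \<in> borel_measurable borel"
    using test_function_bounded[OF assms(2)] by metis
  show ?thesis
  proof (rule Bochner_Integration.integrable_bound)
    show "integrable lebesgue (\<lambda>x. B *\<^sub>R (indicator (cball 0 M) x *\<^sub>R w x))"
      by (intro integrable_scaleR_right locally_integrable_cball assms(1))
    show "(\<lambda>x. f x *\<^sub>R w x) \<in> borel_measurable lebesgue"
      using measurable_completion[of f lborel borel] BM(3)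
        locally_integrable_measurable[OF assms(1)]
      by (intro borel_measurable_scaleR) auto
    show "AE x in lebesgue. norm (f x *\<^sub>R w x) \<le> norm (B *\<^sub>R (indicator (cball 0 M) x *\<^sub>R w x))"
    proof (intro AE_I2)
      fix x
      show "norm (f x *\<^sub>R w x) \<le> norm (B *\<^sub>R (indicator (cball 0 M) x *\<^sub>R w x))"
      proof (cases "x \<in> cball 0 M")
        case True
        have "\<bar>f x\<bar> \<le> \<bar>B\<bar>" using BM(1)[of x] by linarith
        then show ?thesis using True by (simp add: mult_right_mono)
      next
        case False
        then show ?thesis using BM(2)[of x] by simp
      qed
    qed
  qed
qed

lemma has_weak_pderiv_diff:
  fixes u :: "real^'n \<Rightarrow> 'b::euclidean_space"
  assumes "has_weak_pderiv \<alpha> u u'" "has_weak_pderiv \<alpha> v v'"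
  shows "has_weak_pderiv \<alpha> (\<lambda>x. u x - v x) (\<lambda>x. u' x - v' x)"
proof -
  have l: "locally_integrable u" "locally_integrable u'" "locally_integrable v" "locally_integrable v'"
    using assms by (auto simp: has_weak_pderiv_def)
  show ?thesis unfolding has_weak_pderiv_def
  proof (intro conjI ballI)
    show "locally_integrable (\<lambda>x. u x - v x)" "locally_integrable (\<lambda>x. u' x - v' x)"
      using l unfolding locally_integrable_def by (auto intro: set_integral_diff)
    fix f :: "real^'n \<Rightarrow> real" assume f: "f \<in> test_functions"
    show "(LINT x|lebesgue. iter_pderiv \<alpha> f x *\<^sub>R (u x - v x)) =
       (-1) ^ length \<alpha> *\<^sub>R (LINT x|lebesgue. f x *\<^sub>R (u' x - v' x))"
    proof -
      note i = locally_integrable_test_function[OF _ f]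
        locally_integrable_test_function[OF _ test_function_iter_pderivs[OF f, of \<alpha>]]
      have "(LINT x|lebesgue. iter_pderiv \<alpha> f x *\<^sub>R (u x - v x)) =
         (LINT x|lebesgue. iter_pderiv \<alpha> f x *\<^sub>R u x) - (LINT x|lebesgue. iter_pderiv \<alpha> f x *\<^sub>R v x)"
        using l by (simp add: scaleR_diff_right Bochner_Integration.integral_diff i)
      also have "\<dots> = (-1) ^ length \<alpha> *\<^sub>R ((LINT x|lebesgue. f x *\<^sub>R u' x) - (LINT x|lebesgue. f x *\<^sub>R v' x))"
        using assms f unfolding has_weak_pderiv_def by (simp add: scaleR_diff_right)
      also have "(LINT x|lebesgue. f x *\<^sub>R u' x) - (LINT x|lebesgue. f x *\<^sub>R v' x) =
         (LINT x|lebesgue. f x *\<^sub>R (u' x - v' x))"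
        using l by (simp add: scaleR_diff_right Bochner_Integration.integral_diff i)
      finally show ?thesis .
    qed
  qed
qed

lemma H2_diff:
  fixes u :: "real^'n \<Rightarrow> 'b::euclidean_space"
  assumes "u \<in> H2" "v \<in> H2" shows "(\<lambda>x. u x - v x) \<in> H2"
  unfolding H2_def
proof (intro CollectI conjI allI impI)
  show "(\<lambda>x. u x - v x) \<in> L2" by (intro L2_diff H2_L2 assms)
  fix \<alpha> :: "'n list" assume \<alpha>: "length \<alpha> \<le> 2"
  show "\<exists>w\<in>L2. has_weak_pderiv \<alpha> (\<lambda>x. u x - v x) w"
    by (intro bexI[of _ "\<lambda>x. weak_pderiv \<alpha> u x - weak_pderiv \<alpha> v x"] has_weak_pderiv_diff L2_diff
        H2_weak_pderiv assms \<alpha>)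
qed

section \<open>Pointwise bounds by the norm of \<open>H2\<close>\<close>

lemma annular_bounded:
  assumes "annular h" obtains B where "\<And>r. \<bar>h r\<bar> \<le> B"
proof -
  obtain \<delta> M where 1: "\<delta> > 0" "\<delta> < M" "\<And>r. r < \<delta> \<Longrightarrow> h r = 0" "\<And>r. r > M \<Longrightarrow> h r = 0"
    by (rule annularE[OF assms that])
  have "bounded (h ` {\<delta>..M})"
    by (intro compact_imp_bounded compact_continuous_image smooth_continuous_on annular_smooth assms) auto
  then obtain B where "\<forall>y \<in> h ` {\<delta>..M}. norm y \<le> B"
    unfolding bounded_iff by blast
  then have B: "r \<in> {\<delta>..M} \<Longrightarrow> \<bar>h r\<bar> \<le> B" for r by auto
  have "\<bar>h r\<bar> \<le> max B 0" for r
    using B[of r] 1(3)[of r] 1(4)[of r] by (cases "r < \<delta>"; cases "r > M") auto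
  then show ?thesis by (rule that)
qed

text \<open>A kernel of size \<open>\<delta>\<^sup>-\<^sup>3\<close> supported in a ball of radius \<open>2\<delta>\<close> acts as an
  average, up to a constant.\<close>

lemma concentrated_integral_bound:
  fixes u :: "real^3 \<Rightarrow> 'b::euclidean_space"
  assumes "\<delta> > 0" "\<And>x. x \<in> cball x0 (2 * \<delta>) \<Longrightarrow> \<bar>q x\<bar> \<le> K / \<delta> ^ 3"
    "\<And>x. x \<notin> cball x0 (2 * \<delta>) \<Longrightarrow> q x = 0"
    "\<And>x. x \<in> cball x0 (2 * \<delta>) \<Longrightarrow> norm (u x) \<le> \<omega>"
  shows "norm (LINT x|lebesgue. q x *\<^sub>R u x) \<le> 8 * unit_ball_vol 3 * K * \<omega>"
proof (cases "integrable lebesgue (\<lambda>x. q x *\<^sub>R u x)")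
  case True
  have \<omega>: "\<omega> \<ge> 0" using assms(1) assms(4)[of x0] by (auto intro: order_trans[OF norm_ge_zero])
  have K: "K / \<delta> ^ 3 \<ge> 0" using assms(1) assms(2)[of x0] by (auto intro: order_trans[OF abs_ge_zero])
  have "norm (LINT x|lebesgue. q x *\<^sub>R u x) \<le> (LINT x|lebesgue. norm (q x *\<^sub>R u x))"
    by (rule integral_norm_bound)
  also have "\<dots> \<le> (LINT x|lebesgue. indicator (cball x0 (2 * \<delta>)) x *\<^sub>R (K / \<delta> ^ 3 * \<omega>))"
  proof (rule integral_mono)
    show "integrable lebesgue (\<lambda>x. norm (q x *\<^sub>R u x))" using True by (rule integrable_norm)
    show "integrable lebesgue (\<lambda>x. indicator (cball x0 (2 * \<delta>)) x *\<^sub>R (K / \<delta> ^ 3 * \<omega>))"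
      by (rule integrable_lebesgue_cball)
    fix x show "norm (q x *\<^sub>R u x) \<le> indicator (cball x0 (2 * \<delta>)) x *\<^sub>R (K / \<delta> ^ 3 * \<omega>)"
    proof (cases "x \<in> cball x0 (2 * \<delta>)")
      case True
      then show ?thesis
        using mult_mono[of "\<bar>q x\<bar>" "K / \<delta> ^ 3" "norm (u x)" \<omega>] assms(2,4)[of x] K by simp
    qed (simp add: assms(3))
  qed
  also have "\<dots> = measure lebesgue (cball x0 (2 * \<delta>)) * (K / \<delta> ^ 3 * \<omega>)"
    using lmeasurable_cball[of x0 "2 * \<delta>"] by (simp add: fmeasurable_def)
  also have "measure lebesgue (cball x0 (2 * \<delta>)) = unit_ball_vol 3 * (2 * \<delta>) ^ 3"
    using content_cball[of "2 * \<delta>" x0] assms(1) by simp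
  also have "unit_ball_vol 3 * (2 * \<delta>) ^ 3 * (K / \<delta> ^ 3 * \<omega>) = 8 * unit_ball_vol 3 * K * \<omega>"
    using assms(1) by (simp add: power_mult_distrib)
  finally show ?thesis .
next
  \<comment> \<open>The integral of a non-integrable function is 0, so only the sign of the
    right-hand side matters.\<close>
  case False
  have \<omega>: "\<omega> \<ge> 0" using assms(1) assms(4)[of x0] by (auto intro: order_trans[OF norm_ge_zero])
  have "K / \<delta> ^ 3 \<ge> 0" using assms(1) assms(2)[of x0] by (auto intro: order_trans[OF abs_ge_zero])
  then have "K \<ge> 0" using assms(1) by (simp add: zero_le_divide_iff)
  then show ?thesis using False \<omega> by (simp add: not_integrable_integral_eq)
qed

lemma annular_scaled_step_minus_step:
  assumes "\<delta> > 0" shows "annular (\<lambda>r. scaled_step \<delta> r - step r)"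
  by (rule annularI[of _ "min \<delta> 1" "max (2 * \<delta>) 2"])
    (use assms in \<open>auto simp: scaled_step_eq_0 scaled_step_eq_1 step_eq_0 step_eq_1
       intro!: smooth_diff smooth_scaled_step smooth_step\<close>)

lemma annular_deriv_step: "annular (deriv step)"
proof -
  have "scaled_step 1 = step" by (simp add: scaled_step_def fun_eq_iff)
  then show ?thesis using annular_deriv_scaled_step[of 1] by simp
qed

text \<open>The embedding of \<open>H\<^sup>2\<close> into the bounded functions: the Laplacian of
  \<open>(scaled_step \<delta> r - step r) / r\<close> is, up to a fixed annular function, a multiple of an
  approximate identity, while its \<open>L\<^sup>2\<close> norm stays bounded as \<open>\<delta> \<rightarrow> 0\<close>.\<close>

lemma L2_norm_parametrix:
  assumes \<delta>: "0 < \<delta>" "\<delta> \<le> 1"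
  shows "(L2_norm (\<lambda>x. (scaled_step \<delta> (norm (x - x0)) - step (norm (x - x0))) / norm (x - x0 :: real^3)))\<^sup>2
     \<le> radial_integral (\<lambda>r. 2 * (deriv step r / r ^ 1))"
proof -
  define w where "w r = scaled_step \<delta> r - step r" for r
  have w: "annular w" using annular_scaled_step_minus_step[OF \<delta>(1)] by (simp add: w_def[abs_def])
  have ww: "annular (\<lambda>r. w r * w r)" by (intro annular_mult w annular_smooth)
  have dw: "deriv w r = deriv (scaled_step \<delta>) r - deriv step r" for r
    unfolding w_def by (intro DERIV_imp_deriv DERIV_diff smooth_DERIV smooth_scaled_step smooth_step)
  have dww: "deriv (\<lambda>r. w r * w r) r = 2 * (w r * deriv w r)" for r
    by (rule DERIV_imp_deriv) (auto intro!: derivative_eq_intros smooth_DERIV[OF annular_smooth[OF w]])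
  have w01: "0 \<le> w r" "w r \<le> 1" if "r \<ge> 0" for r
  proof -
    \<comment> \<open>Here \<delta> \<le> 1 enters: the rescaled step is the larger of the
      two.\<close>
    have "r \<le> r / \<delta>" using \<delta> mult_right_mono[of \<delta> 1 r] that by (simp add: field_simps)
    then show "0 \<le> w r" using step_mono by (simp add: w_def scaled_step_def)
    show "w r \<le> 1" using step_bounds[of r] step_bounds[of "r / \<delta>"] by (simp add: w_def scaled_step_def)
  qed
  have "(L2_norm (\<lambda>x. (scaled_step \<delta> (norm (x - x0)) - step (norm (x - x0))) / norm (x - x0 :: real^3)))\<^sup>2
     = (LINT x|lebesgue. w (norm (x - x0)) * w (norm (x - x0)) / norm (x - x0 :: real^3) ^ 2)"
    unfolding L2_norm_square by (simp add: w_def power_divide) (simp add: power2_eq_square)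
  also have "\<dots> = radial_integral (\<lambda>r. w r * w r / r ^ 2)"
    by (rule radial_integral_shift) (intro smooth_measurable annular_smooth annular_divide ww)
  \<comment> \<open>The derivative of w^2 is 2 w times the difference of the derivatives of the two
    steps. The part that depends on \<delta> enters with a favourable sign and is dropped; with w
    \<le> 1 the rest is bounded independently of \<delta>.\<close>
  also have "\<dots> = radial_integral (\<lambda>r. - (deriv (\<lambda>r. w r * w r) r / r ^ 1))"
    using radial_integral_over_square[OF ww] by (simp add: radial_integral_def)
  also have "\<dots> \<le> radial_integral (\<lambda>r. 2 * (deriv step r / r ^ 1))"
    unfolding radial_integral_def
  proof (rule integral_mono)
    show "integrable lebesgue (\<lambda>x::real^3. - (deriv (\<lambda>r. w r * w r) (norm x) / norm x ^ 1))"
      by (rule annular_integrable[OF annular_minus[OF annular_divide[OF annular_deriv[OF ww]]]])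
    show "integrable lebesgue (\<lambda>x::real^3. 2 * (deriv step (norm x) / norm x ^ 1))"
      by (intro integrable_mult_right annular_integrable[OF annular_divide[OF annular_deriv_step]])
    fix x :: "real^3"
    define r where "r = norm x"
    have "w r * deriv step r \<le> 1 * deriv step r"
      by (intro mult_right_mono deriv_step_nonneg w01) (simp add: r_def)
    moreover have "0 \<le> w r * deriv (scaled_step \<delta>) r"
      by (intro mult_nonneg_nonneg w01) (use \<delta> in \<open>auto simp: r_def deriv_scaled_step deriv_step_nonneg\<close>)
    ultimately have "- (2 * (w r * deriv w r)) \<le> 2 * deriv step r"
      by (simp add: dw algebra_simps)
    then have "- (2 * (w r * deriv w r)) / r \<le> 2 * deriv step r / r"
      by (rule divide_right_mono) (simp add: r_def)
    then show "- (deriv (\<lambda>r. w r * w r) (norm x) / norm x ^ 1) \<le> 2 * (deriv step (norm x) / norm x ^ 1)"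
      by (simp add: dww r_def)
  qed
  finally show ?thesis .
qed

text \<open>For small \<delta> the kernel \<open>q\<close> reproduces -kappa u(x0). Since q - p is
  the Laplacian of \<phi>, the pairing of \<open>q\<close> with u equals that of \<open>p\<close>
  with u plus that of \<phi> with the Laplacian of u, and both are bounded by Cauchy-Schwarz. The
  factor 3 counts the pure second derivatives.\<close>

lemma H2_pointwise_bound:
  fixes u :: "real^3 \<Rightarrow> 'b::euclidean_space"
  assumes u: "u \<in> H2" and cont: "continuous_on UNIV u"
  shows "kappa * norm (u x0) \<le> (L2_norm (\<lambda>x::real^3. deriv (deriv step) (norm x) / norm x) +
     3 * sqrt (radial_integral (\<lambda>r. 2 * (deriv step r / r ^ 1)))) * H2_norm u"
    (is "_ \<le> ?C * _")
proof (rule field_le_epsilon)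
  fix e :: real assume e: "e > 0"
  obtain B where B: "\<And>r. \<bar>deriv (deriv step) r\<bar> \<le> B" using annular_bounded[OF annular_deriv[OF annular_deriv_step]] by metis
  have B0: "B \<ge> 0" using B[of 0] by simp
  \<comment> \<open>The constant of \<open>concentrated_integral_bound\<close>, plus 1 so that
    division by it is safe.\<close>
  define V where "V = 8 * unit_ball_vol 3 * B + 1"
  have V: "V > 0" using B0 unit_ball_vol_nonneg[of 3] by (simp add: V_def add_nonneg_pos)
  have "isCont u x0" using cont by (simp add: continuous_on_eq_continuous_at)
  then obtain d where d: "d > 0" "\<And>x. dist x x0 < d \<Longrightarrow> dist (u x) (u x0) < e / V"
    using e V unfolding continuous_at_eps_delta by (metis divide_pos_pos)
  \<comment> \<open>The support of \<open>q\<close>, of radius 2\<delta>, must lie where u is close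
    to u(x0), and the bound on \<phi> requires \<delta> \<le> 1.\<close>
  define \<delta> where "\<delta> = min 1 (d / 4)"
  have \<delta>: "0 < \<delta>" "\<delta> \<le> 1" "2 * \<delta> < d" using d(1) by (auto simp: \<delta>_def)
  define w where "w r = scaled_step \<delta> r - step r" for r
  have w: "annular w" using annular_scaled_step_minus_step[OF \<delta>(1)] by (simp add: w_def[abs_def])
  define \<phi> where "\<phi> x = w (norm (x - x0)) / norm (x - x0)" for x :: "real^3"
  have \<phi>: "radial x0 \<phi>" using radial.base[OF annular_divide[OF w, of 1], of x0] by (simp add: \<phi>_def[abs_def])
  define q where "q x = deriv (deriv (scaled_step \<delta>)) (norm (x - x0)) / norm (x - x0)" for x :: "real^3"
  define p where "p x = deriv (deriv step) (norm (x - x0)) / norm (x - x0)" for x :: "real^3"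
  have q: "radial x0 q" using radial.base[OF annular_divide[OF annular_deriv[OF annular_deriv_scaled_step[OF \<delta>(1)]], of 1], of x0]
    by (simp add: q_def[abs_def])
  have p: "radial x0 p" using radial.base[OF annular_divide[OF annular_deriv[OF annular_deriv_step], of 1], of x0]
    by (simp add: p_def[abs_def])
  have dw: "deriv w = (\<lambda>r. deriv (scaled_step \<delta>) r - deriv step r)"
    unfolding w_def[abs_def] by (intro ext DERIV_imp_deriv DERIV_diff smooth_DERIV smooth_scaled_step smooth_step)
  have ddw: "deriv (deriv w) r = deriv (deriv (scaled_step \<delta>)) r - deriv (deriv step) r" for r
    unfolding dw by (intro DERIV_imp_deriv DERIV_diff smooth_DERIV smooth_deriv smooth_scaled_step smooth_step)
  have lap: "(\<Sum>i\<in>UNIV. iter_pderiv [i, i] \<phi> x) = q x - p x" for x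
    unfolding \<phi>_def laplacian_annular[OF w] ddw q_def p_def by (simp add: diff_divide_distrib)
  have uL: "u \<in> L2" using u by (rule H2_L2)
  note int = L2_integrable_scaleR[OF radial_L2 uL]
  have "(LINT x|lebesgue. q x *\<^sub>R u x) - (LINT x|lebesgue. p x *\<^sub>R u x) = (LINT x|lebesgue. (q x - p x) *\<^sub>R u x)"
    using int[OF q] int[OF p] by (simp add: scaleR_diff_left)
  also have "\<dots> = (\<Sum>i\<in>UNIV. LINT x|lebesgue. iter_pderiv [i, i] \<phi> x *\<^sub>R u x)"
    unfolding lap[symmetric] scaleR_sum_left
    by (rule Bochner_Integration.integral_sum) (rule int[OF radial_iter_pderiv[OF \<phi>]])
  also have "\<dots> = (\<Sum>i\<in>UNIV. LINT x|lebesgue. \<phi> x *\<^sub>R weak_pderiv [i, i] u x)"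
  proof (rule sum.cong[OF refl])
    fix i :: 3
    show "(LINT x|lebesgue. iter_pderiv [i, i] \<phi> x *\<^sub>R u x) = (LINT x|lebesgue. \<phi> x *\<^sub>R weak_pderiv [i, i] u x)"
      using has_weak_pderiv_radial[OF H2_weak_pderiv(1)[OF u, of "[i, i]"] \<phi>] by simp
  qed
  finally have eq: "(LINT x|lebesgue. q x *\<^sub>R u x) = (LINT x|lebesgue. p x *\<^sub>R u x) +
     (\<Sum>i\<in>UNIV. LINT x|lebesgue. \<phi> x *\<^sub>R weak_pderiv [i, i] u x)" by (simp add: algebra_simps)
  have L\<phi>: "L2_norm \<phi> \<le> sqrt (radial_integral (\<lambda>r. 2 * (deriv step r / r ^ 1)))"
    using L2_norm_parametrix[OF \<delta>(1,2), of x0] unfolding \<phi>_def[abs_def] w_def by (rule real_le_rsqrt)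
  have Lp: "L2_norm p = L2_norm (\<lambda>x::real^3. deriv (deriv step) (norm x) / norm x)"
  proof -
    have "(\<lambda>r. (norm (deriv (deriv step) r / r))\<^sup>2) \<in> borel_measurable borel"
      using borel_measurable_power[OF measurable_compose[OF 
          smooth_measurable[OF annular_smooth[OF annular_divide[OF annular_deriv[OF annular_deriv_step], of 1]]] borel_measurable_norm], of 2]
      by (simp only: power_one_right)
    from radial_integral_shift[OF this, of x0] show ?thesis
      by (simp add: L2_norm_def p_def radial_integral_def)
  qed
  have b1: "norm (LINT x|lebesgue. p x *\<^sub>R u x) \<le> L2_norm p * H2_norm u"
    by (rule order_trans[OF L2_Cauchy_Schwarz[OF radial_L2[OF p] uL]])
      (intro mult_left_mono L2_norm_le_H2_norm u L2_norm_nonneg)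
  have b2: "norm (LINT x|lebesgue. \<phi> x *\<^sub>R weak_pderiv [i, i] u x) \<le>
     sqrt (radial_integral (\<lambda>r. 2 * (deriv step r / r ^ 1))) * H2_norm u" for i
    using order_trans[OF L2_Cauchy_Schwarz[OF radial_L2[OF \<phi>] H2_weak_pderiv(2)[OF u, of "[i, i]"]]
      mult_mono[OF L\<phi> L2_norm_weak_pderiv_le_H2_norm[of "[i, i]" u] order_trans[OF L2_norm_nonneg L\<phi>] L2_norm_nonneg]]
    by simp
  have "norm (\<Sum>i\<in>UNIV. LINT x|lebesgue. \<phi> x *\<^sub>R weak_pderiv [i, i] u x) \<le>
     (\<Sum>i\<in>(UNIV :: 3 set). sqrt (radial_integral (\<lambda>r. 2 * (deriv step r / r ^ 1))) * H2_norm u)"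
    by (rule order_trans[OF norm_sum sum_mono]) (rule b2)
  then have b3: "norm (LINT x|lebesgue. q x *\<^sub>R u x) \<le> ?C * H2_norm u"
    unfolding eq using b1 by (intro order_trans[OF norm_triangle_ineq]) (simp add: Lp algebra_simps)
  have qk: "(LINT x|lebesgue. q x) = - kappa"
    unfolding q_def using radial_integral_deriv2_scaled_step[OF \<delta>(1)]
    by (subst radial_integral_shift[where h = "\<lambda>r. deriv (deriv (scaled_step \<delta>)) r / r"])
     (use smooth_measurable[OF annular_smooth[OF annular_divide[OF annular_deriv[OF annular_deriv_scaled_step[OF \<delta>(1)]], of 1]]] in simp_all)
  have "norm (LINT x|lebesgue. q x *\<^sub>R (u x - u x0)) \<le> 8 * unit_ball_vol 3 * B * (e / V)"
  proof (rule concentrated_integral_bound[OF \<delta>(1)])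
    fix x assume x: "x \<in> cball x0 (2 * \<delta>)"
    then have "dist x x0 < d" using \<delta>(3) by (simp add: dist_commute)
    then show "norm (u x - u x0) \<le> e / V" using d(2)[of x] by (simp add: dist_norm)
    show "\<bar>q x\<bar> \<le> B / \<delta> ^ 3"
    proof (cases "norm (x - x0) < \<delta>")
      case True
      have "deriv (deriv (scaled_step \<delta>)) (norm (x - x0)) = 0"
        by (rule deriv_eq_0_locally_const[of "{..<\<delta>}" _ _ 0])
          (use True \<delta>(1) in \<open>auto simp: deriv_scaled_step intro!: deriv_step_eq_0 simp: field_simps\<close>)
      then show ?thesis using B0 \<delta>(1) by (simp add: q_def)
    next
      case False
      then have "\<bar>deriv (deriv step) (norm (x - x0) / \<delta>)\<bar> / \<delta>\<^sup>2 / norm (x - x0) \<le> B / \<delta>\<^sup>2 / \<delta>"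
        using \<delta>(1) B0 B by (intro frac_le divide_right_mono) auto
      then show ?thesis by (simp add: q_def deriv2_scaled_step abs_divide abs_mult power3_eq_cube power2_eq_square mult_ac)
    qed
  next
    fix x assume "x \<notin> cball x0 (2 * \<delta>)"
    then have x: "norm (x - x0) > 2 * \<delta>" by (simp add: dist_norm norm_minus_commute)
    have "deriv (deriv (scaled_step \<delta>)) (norm (x - x0)) = 0"
      by (rule deriv_eq_0_locally_const[of "{2 * \<delta><..}" _ _ 0])
        (use x \<delta>(1) in \<open>auto simp: deriv_scaled_step intro!: deriv_step_eq_0 simp: field_simps\<close>)
    then show "q x = 0" by (simp add: q_def)
  qed
  also have "\<dots> \<le> e"
    using e V B0 unit_ball_vol_nonneg[of 3] by (simp add: V_def field_simps)
  finally have b4: "norm (LINT x|lebesgue. q x *\<^sub>R (u x - u x0)) \<le> e" .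
  have "(LINT x|lebesgue. q x *\<^sub>R (u x - u x0)) = (LINT x|lebesgue. q x *\<^sub>R u x) - (LINT x|lebesgue. q x) *\<^sub>R u x0"
    using int[OF q] radial_integrable[OF q] by (simp add: scaleR_diff_right)
  then have "kappa *\<^sub>R u x0 = (LINT x|lebesgue. q x *\<^sub>R (u x - u x0)) - (LINT x|lebesgue. q x *\<^sub>R u x)"
    by (simp add: qk)
  then have "norm (kappa *\<^sub>R u x0) \<le>
      norm (LINT x|lebesgue. q x *\<^sub>R (u x - u x0)) + norm (LINT x|lebesgue. q x *\<^sub>R u x)"
    by (simp only: norm_triangle_ineq4)
  then have "norm (kappa *\<^sub>R u x0) \<le> e + ?C * H2_norm u"
    by (rule order_trans[OF _ add_mono[OF b4 b3]])
  then show "kappa * norm (u x0) \<le> ?C * H2_norm u + e" using kappa_pos by simp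
qed

section \<open>Differentiation in time of \<open>L2\<close> pairings\<close>

lemma L2_product_has_vector_derivative:
  fixes f :: "real \<Rightarrow> real^'n \<Rightarrow> real" and u :: "real \<Rightarrow> real^'n \<Rightarrow> 'b::euclidean_space"
  assumes f: "cont_into_L2 S f" "has_L2_time_deriv S f f'" "f' t \<in> L2"
    and u: "\<And>t. t \<in> S \<Longrightarrow> u t \<in> L2" "has_L2_time_deriv S u u'" "u' t \<in> L2"
    and t: "t \<in> S"
  shows "((\<lambda>t. LINT x|lebesgue. f t x *\<^sub>R u t x) has_vector_derivative
     (LINT x|lebesgue. f' t x *\<^sub>R u t x) + (LINT x|lebesgue. f t x *\<^sub>R u' t x)) (at t within S)"
proof -
  define G where "G s = (LINT x|lebesgue. f s x *\<^sub>R u s x)" for s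
  define D where "D = (LINT x|lebesgue. f' t x *\<^sub>R u t x) + (LINT x|lebesgue. f t x *\<^sub>R u' t x)"
  define A where "A s = L2_norm (\<lambda>x. (u s x - u t x) /\<^sub>R (s - t) - u' t x)" for s
  define B where "B s = L2_norm (\<lambda>x. (f s x - f t x) /\<^sub>R (s - t) - f' t x)" for s
  define C where "C s = L2_norm (\<lambda>x. f s x - f t x)" for s
  have lim: "(A \<longlongrightarrow> 0) (at t within S)" "(B \<longlongrightarrow> 0) (at t within S)" "(C \<longlongrightarrow> 0) (at t within S)"
    using f u t unfolding A_def B_def C_def cont_into_L2_def has_L2_time_deriv_def by auto
  have fL: "f s \<in> L2" if "s \<in> S" for s using f(1) that by (simp add: cont_into_L2_def)
  have bound: "norm ((1 / norm (s - t)) *\<^sub>R (G s - (G t + (s - t) *\<^sub>R D))) \<le>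
      (L2_norm (f t) + C s) * A s + B s * L2_norm (u t) + C s * L2_norm (u' t)"
    if s: "s \<in> S" "s \<noteq> t" for s
  proof -
    define p where "p x = (u s x - u t x) /\<^sub>R (s - t) - u' t x" for x
    define q where "q x = (f s x - f t x) /\<^sub>R (s - t) - f' t x" for x
    define r where "r x = f s x - f t x" for x
    have L: "p \<in> L2" "q \<in> L2" "r \<in> L2"
      unfolding p_def[abs_def] q_def[abs_def] r_def[abs_def]
      by (intro L2_diff L2_scaleR fL u f s t)+
    note i = L2_integrable_scaleR
    \<comment> \<open>The remainder of the product rule is split so that each pairing contains a
      factor tending to 0 in norm: the error \<open>p\<close> or \<open>q\<close> of a difference
      quotient, or the increment \<open>r\<close>.\<close>
    have eq: "(1 / (s - t)) *\<^sub>R (G s - (G t + (s - t) *\<^sub>R D)) =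
      (LINT x|lebesgue. f t x *\<^sub>R p x) + (LINT x|lebesgue. r x *\<^sub>R p x) +
      (LINT x|lebesgue. q x *\<^sub>R u t x) + (LINT x|lebesgue. r x *\<^sub>R u' t x)"
    proof -
      have "(LINT x|lebesgue. f t x *\<^sub>R p x) + (LINT x|lebesgue. r x *\<^sub>R p x) +
         (LINT x|lebesgue. q x *\<^sub>R u t x) + (LINT x|lebesgue. r x *\<^sub>R u' t x) =
        (LINT x|lebesgue. f t x *\<^sub>R p x + r x *\<^sub>R p x + q x *\<^sub>R u t x + r x *\<^sub>R u' t x)"
        using i[OF fL[OF t] L(1)] i[OF L(3) L(1)] i[OF L(2) u(1)[OF t]] i[OF L(3) u(3)] by simp
      also have "\<dots> = (LINT x|lebesgue. (1 / (s - t)) *\<^sub>R (f s x *\<^sub>R u s x) - (1 / (s - t)) *\<^sub>R (f t x *\<^sub>R u t x)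
          - f' t x *\<^sub>R u t x - f t x *\<^sub>R u' t x)"
      proof (rule Bochner_Integration.integral_cong[OF refl])
        fix x
        have "f t x *\<^sub>R p x + r x *\<^sub>R p x = f s x *\<^sub>R p x" by (simp add: r_def flip: scaleR_add_left)
        then have "f t x *\<^sub>R p x + r x *\<^sub>R p x + q x *\<^sub>R u t x + r x *\<^sub>R u' t x =
           f s x *\<^sub>R p x + q x *\<^sub>R u t x + r x *\<^sub>R u' t x" by simp
        also have "\<dots> = (1 / (s - t)) *\<^sub>R (f s x *\<^sub>R u s x) - (1 / (s - t)) *\<^sub>R (f t x *\<^sub>R u t x)
          - f' t x *\<^sub>R u t x - f t x *\<^sub>R u' t x"
          by (simp add: p_def q_def r_def algebra_simps inverse_eq_divide)
        finally show "f t x *\<^sub>R p x + r x *\<^sub>R p x + q x *\<^sub>R u t x + r x *\<^sub>R u' t x =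
          (1 / (s - t)) *\<^sub>R (f s x *\<^sub>R u s x) - (1 / (s - t)) *\<^sub>R (f t x *\<^sub>R u t x)
          - f' t x *\<^sub>R u t x - f t x *\<^sub>R u' t x" .
      qed
      also have "\<dots> = (1 / (s - t)) *\<^sub>R G s - (1 / (s - t)) *\<^sub>R G t - D"
        using i[OF fL[OF s(1)] u(1)[OF s(1)]] i[OF fL[OF t] u(1)[OF t]] i[OF f(3) u(1)[OF t]] i[OF fL[OF t] u(3)]
        by (simp add: G_def D_def del: scaleR_scaleR)
      also have "\<dots> = (1 / (s - t)) *\<^sub>R (G s - (G t + (s - t) *\<^sub>R D))"
        using s(2) by (simp add: scaleR_diff_right scaleR_add_right)
      finally show ?thesis ..
    qed
    have "norm ((1 / norm (s - t)) *\<^sub>R (G s - (G t + (s - t) *\<^sub>R D))) =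
      norm ((1 / (s - t)) *\<^sub>R (G s - (G t + (s - t) *\<^sub>R D)))" by simp
    also have "\<dots> \<le> norm (LINT x|lebesgue. f t x *\<^sub>R p x) + norm (LINT x|lebesgue. r x *\<^sub>R p x) +
      norm (LINT x|lebesgue. q x *\<^sub>R u t x) + norm (LINT x|lebesgue. r x *\<^sub>R u' t x)"
      unfolding eq by (intro norm_add_rule_thm norm_triangle_mono order_refl)
    also have "\<dots> \<le> L2_norm (f t) * L2_norm p + L2_norm r * L2_norm p + L2_norm q * L2_norm (u t) + L2_norm r * L2_norm (u' t)"
      by (intro add_mono L2_Cauchy_Schwarz fL t L u)
    also have "\<dots> = (L2_norm (f t) + C s) * A s + B s * L2_norm (u t) + C s * L2_norm (u' t)"
      by (simp add: A_def B_def C_def p_def[abs_def] q_def[abs_def] r_def[abs_def] algebra_simps)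
    finally show ?thesis .
  qed
  have "((\<lambda>s. (L2_norm (f t) + C s) * A s + B s * L2_norm (u t) + C s * L2_norm (u' t)) \<longlongrightarrow>
     (L2_norm (f t) + 0) * 0 + 0 * L2_norm (u t) + 0 * L2_norm (u' t)) (at t within S)"
    by (intro tendsto_intros lim)
  then have lim0: "((\<lambda>s. (L2_norm (f t) + C s) * A s + B s * L2_norm (u t) + C s * L2_norm (u' t)) \<longlongrightarrow> 0) (at t within S)"
    by simp
  have "((\<lambda>s. (1 / norm (s - t)) *\<^sub>R (G s - (G t + (s - t) *\<^sub>R D))) \<longlongrightarrow> 0) (at t within S)"
    by (rule Lim_null_comparison[OF _ lim0])
      (use bound in \<open>auto simp: eventually_at_filter simp del: norm_scaleR real_norm_def\<close>)
  then have "(G has_derivative (\<lambda>h. h *\<^sub>R D)) (at t within S)"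
    unfolding has_derivative_within by (auto intro: bounded_linear_scaleR_left)
  then show ?thesis unfolding has_vector_derivative_def G_def[abs_def] D_def .
qed

lemma L2_test_has_vector_derivative:
  fixes f :: "real^'n \<Rightarrow> real" and u :: "real \<Rightarrow> real^'n \<Rightarrow> 'b::euclidean_space"
  assumes f: "f \<in> L2"
    and u: "\<And>t. t \<in> S \<Longrightarrow> u t \<in> L2" "has_L2_time_deriv S u u'" "u' t \<in> L2"
    and t: "t \<in> S"
  shows "((\<lambda>t. LINT x|lebesgue. f x *\<^sub>R u t x) has_vector_derivative (LINT x|lebesgue. f x *\<^sub>R u' t x)) (at t within S)"
proof -
  have "L2_norm (\<lambda>x::real^'n. 0::real) = 0" by (simp add: L2_norm_def)
  moreover have "(\<lambda>x::real^'n. 0::real) \<in> L2" by (simp add: L2_def)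
  ultimately show ?thesis
    using L2_product_has_vector_derivative[of S "\<lambda>_. f" "\<lambda>_ _. 0" t u u'] assms
    by (simp add: cont_into_L2_def has_L2_time_deriv_def)
qed

section \<open>The weak curl and the weak form of curl curl\<close>

lemma bounded_linear_cross3: "bounded_linear (cross3 x)"
  using bilinear_cross by (simp add: bilinear_def linear_conv_bounded_linear)

lemma norm_cross3_le: "norm (cross3 x y) \<le> norm x * norm y"
proof (rule power2_le_imp_le)
  show "(norm (cross3 x y))\<^sup>2 \<le> (norm x * norm y)\<^sup>2" by (simp add: norm_cross power_mult_distrib)
qed simp

lemma cross3_sum_right: "cross3 x (\<Sum>i\<in>A. f i) = (\<Sum>i\<in>A. cross3 x (f i))"
  using bounded_linear.linear[OF bounded_linear_cross3] linear_sum by blast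

text \<open>In this form the curl is a sum of bounded linear images of weak derivatives, to which
  the rules for linear maps and sums apply.\<close>

lemma weak_curl_eq:
  "weak_curl u x = (\<Sum>i\<in>UNIV. cross3 (axis i 1) (weak_pderiv [i] u x))"
  by (simp add: weak_curl_def vec_eq_iff forall_3 sum_3 cross3_def axis_def)

text \<open>In the list \<open>[i, j]\<close> the derivative in direction \<open>j\<close> acts
  first on the test function. Using that derivative as the test function in the first-order identity
  separates the two.\<close>

lemma has_weak_pderiv_Cons:
  fixes u :: "real^'n \<Rightarrow> 'b::euclidean_space"
  assumes "has_weak_pderiv [i, j] u v" "has_weak_pderiv [i] u u'"
  shows "has_weak_pderiv [j] u' v"
proof -
  have "(LINT x|lebesgue. iter_pderiv [j] f x *\<^sub>R u' x) = - (LINT x|lebesgue. f x *\<^sub>R v x)"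
    if f: "f \<in> test_functions" for f
  proof -
    have "(LINT x|lebesgue. iter_pderiv [i, j] f x *\<^sub>R u x) = - (LINT x|lebesgue. iter_pderiv [j] f x *\<^sub>R u' x)"
      using assms(2) test_function_iter_pderiv[OF f, of j] unfolding iter_pderiv_Cons[of i "[j]"] has_weak_pderiv_def by auto
    moreover have "(LINT x|lebesgue. iter_pderiv [i, j] f x *\<^sub>R u x) = (LINT x|lebesgue. f x *\<^sub>R v x)"
      using assms(1) f unfolding has_weak_pderiv_def by auto
    ultimately show ?thesis by (metis minus_equation_iff)
  qed
  then show ?thesis using assms unfolding has_weak_pderiv_def by auto
qed

lemma has_weak_pderiv_linear:
  fixes u :: "real^'n \<Rightarrow> 'b::euclidean_space" and L :: "'b \<Rightarrow> 'c::euclidean_space"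
  assumes "has_weak_pderiv \<alpha> u v" "bounded_linear L"
  shows "has_weak_pderiv \<alpha> (\<lambda>x. L (u x)) (\<lambda>x. L (v x))"
proof -
  interpret L: bounded_linear L by fact
  have l: "locally_integrable u" "locally_integrable v"
    using assms by (auto simp: has_weak_pderiv_def)
  have li: "locally_integrable (\<lambda>x. L (w x))" if "locally_integrable w" for w :: "real^'n \<Rightarrow> 'b"
    using that absolutely_integrable_linear[OF _ assms(2)] unfolding locally_integrable_def o_def by blast
  have ex: "(LINT x|lebesgue. f x *\<^sub>R L (w x)) = L (LINT x|lebesgue. f x *\<^sub>R w x)"
    if "f \<in> test_functions" "locally_integrable w" for f and w :: "real^'n \<Rightarrow> 'b"
    using integral_bounded_linear[OF assms(2) locally_integrable_test_function[OF that(2,1)]] by (simp add: L.scaleR)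
  show ?thesis unfolding has_weak_pderiv_def
  proof (intro conjI ballI li l)
    fix f :: "real^'n \<Rightarrow> real" assume f: "f \<in> test_functions"
    show "(LINT x|lebesgue. iter_pderiv \<alpha> f x *\<^sub>R L (u x)) = (-1) ^ length \<alpha> *\<^sub>R (LINT x|lebesgue. f x *\<^sub>R L (v x))"
      using assms(1) f unfolding ex[OF f l(2)] ex[OF test_function_iter_pderivs[OF f] l(1)] has_weak_pderiv_def
      by (simp add: L.scaleR)
  qed
qed

lemma has_weak_pderiv_sum:
  fixes u :: "'i \<Rightarrow> real^'n \<Rightarrow> 'b::euclidean_space"
  assumes "finite I" "\<And>i. i \<in> I \<Longrightarrow> has_weak_pderiv \<alpha> (u i) (v i)"
  shows "has_weak_pderiv \<alpha> (\<lambda>x. \<Sum>i\<in>I. u i x) (\<lambda>x. \<Sum>i\<in>I. v i x)"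
proof -
  have l: "locally_integrable (u i)" "locally_integrable (v i)" if "i \<in> I" for i
    using assms(2)[OF that] by (auto simp: has_weak_pderiv_def)
  have li: "locally_integrable (\<lambda>x. \<Sum>i\<in>I. w i x)" if "\<And>i. i \<in> I \<Longrightarrow> locally_integrable (w i)" for w :: "'i \<Rightarrow> real^'n \<Rightarrow> 'b"
    using that absolutely_integrable_sum[OF assms(1)] unfolding locally_integrable_def by blast
  show ?thesis unfolding has_weak_pderiv_def
  proof (intro conjI ballI li l)
    fix f :: "real^'n \<Rightarrow> real" assume f: "f \<in> test_functions"
    have "(LINT x|lebesgue. iter_pderiv \<alpha> f x *\<^sub>R (\<Sum>i\<in>I. u i x)) = (\<Sum>i\<in>I. LINT x|lebesgue. iter_pderiv \<alpha> f x *\<^sub>R u i x)"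
      unfolding scaleR_sum_right
      by (rule Bochner_Integration.integral_sum) (rule locally_integrable_test_function[OF l(1) test_function_iter_pderivs[OF f]])
    also have "\<dots> = (\<Sum>i\<in>I. (-1) ^ length \<alpha> *\<^sub>R (LINT x|lebesgue. f x *\<^sub>R v i x))"
      using assms(2) f by (intro sum.cong refl) (auto simp: has_weak_pderiv_def)
    also have "\<dots> = (-1) ^ length \<alpha> *\<^sub>R (LINT x|lebesgue. f x *\<^sub>R (\<Sum>i\<in>I. v i x))"
      unfolding scaleR_sum_right
      by (subst Bochner_Integration.integral_sum) (auto intro: locally_integrable_test_function[OF l(2) f] simp: scaleR_sum_right)
    finally show "(LINT x|lebesgue. iter_pderiv \<alpha> f x *\<^sub>R (\<Sum>i\<in>I. u i x)) =
      (-1) ^ length \<alpha> *\<^sub>R (LINT x|lebesgue. f x *\<^sub>R (\<Sum>i\<in>I. v i x))" .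
  qed
qed

text \<open>The outer curl in \<open>weak_curl (weak_curl u)\<close> refers to chosen weak
  derivatives of the inner one; the second derivatives of \<open>u\<close> show that such
  derivatives exist, so the choice is meaningful.\<close>

lemma weak_curl_has_weak_pderiv:
  fixes u :: "real^3 \<Rightarrow> real^3"
  assumes "u \<in> H2"
  shows "has_weak_pderiv [j] (weak_curl u) (weak_pderiv [j] (weak_curl u))"
proof -
  have "has_weak_pderiv [j] (weak_pderiv [i] u) (weak_pderiv [i, j] u)" for i
    by (rule has_weak_pderiv_Cons[OF H2_weak_pderiv(1) H2_weak_pderiv(1)]) (use assms in auto)
  then have "has_weak_pderiv [j] (weak_curl u) (\<lambda>x. \<Sum>i\<in>UNIV. cross3 (axis i 1) (weak_pderiv [i, j] u x))"
    unfolding weak_curl_eq[abs_def]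
    by (intro has_weak_pderiv_sum has_weak_pderiv_linear[OF _ bounded_linear_cross3]) auto
  then show ?thesis by (rule has_weak_pderiv_weak_pderiv)
qed

lemma cross3_axis_axis:
  "cross3 (axis j 1) (cross3 (axis i 1) v) = (v $ j) *\<^sub>R axis i 1 - (if i = j then v else 0)"
proof -
  have "axis j (1::real) \<bullet> axis i 1 = (if i = j then 1 else 0)" by (auto simp: inner_axis_axis)
  then show ?thesis by (simp add: Lagrange inner_axis inner_axis' inner_commute)
qed

text \<open>The identity curl curl = grad div - Laplacian, with all derivatives moved to the test
  function. It comes from e_j \<times> (e_i \<times> v) = v_j e_i - (e_i . e_j) v.\<close>

lemma integral_test_curl_curl:
  fixes u :: "real^3 \<Rightarrow> real^3"
  assumes u: "u \<in> H2" and f: "radial x0 f"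
  shows "integrable lebesgue (\<lambda>x. f x *\<^sub>R weak_curl (weak_curl u) x)"
    "(LINT x|lebesgue. f x *\<^sub>R weak_curl (weak_curl u) x) =
      (\<Sum>i\<in>UNIV. (\<Sum>j\<in>UNIV. LINT x|lebesgue. iter_pderiv [i, j] f x * u x $ j) *\<^sub>R axis i 1)
      - (LINT x|lebesgue. (\<Sum>i\<in>UNIV. iter_pderiv [i, i] f x) *\<^sub>R u x)"
proof -
  let ?e = "\<lambda>i::3. axis i (1::real)"
  let ?I = "\<lambda>i j. LINT x|lebesgue. iter_pderiv [i, j] f x *\<^sub>R u x"
  note wp = weak_curl_has_weak_pderiv[OF u]
  have l: "locally_integrable (weak_pderiv [j] (weak_curl u))" for j
    using wp by (simp add: has_weak_pderiv_def)
  have i1: "integrable lebesgue (\<lambda>x. f x *\<^sub>R weak_pderiv [j] (weak_curl u) x)" for j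
    by (rule locally_integrable_radial[OF l f])
  have i2: "integrable lebesgue (\<lambda>x. cross3 (?e j) (f x *\<^sub>R weak_pderiv [j] (weak_curl u) x))" for j
    by (rule integrable_bounded_linear[OF bounded_linear_cross3 i1])
  have eq: "f x *\<^sub>R weak_curl (weak_curl u) x = (\<Sum>j\<in>UNIV. cross3 (?e j) (f x *\<^sub>R weak_pderiv [j] (weak_curl u) x))" for x
    by (simp add: weak_curl_eq[of "weak_curl u"] scaleR_sum_right cross_mult_right)
  show "integrable lebesgue (\<lambda>x. f x *\<^sub>R weak_curl (weak_curl u) x)"
    unfolding eq by (rule Bochner_Integration.integrable_sum) (rule i2)
  have D: "(LINT x|lebesgue. iter_pderiv [j] f x *\<^sub>R weak_pderiv [i] u x) = - ?I i j" for i j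
    using has_weak_pderiv_radial[OF H2_weak_pderiv(1)[OF u, of "[i]"] radial_iter_pderiv[OF f, of "[j]"]]
    by (simp add: iter_pderiv_Cons[of i "[j]"])
  have c1: "(LINT x|lebesgue. iter_pderiv [j] f x *\<^sub>R weak_curl u x) = (\<Sum>i\<in>UNIV. cross3 (?e i) (- ?I i j))" for j
  proof -
    have ii: "integrable lebesgue (\<lambda>x. iter_pderiv [j] f x *\<^sub>R weak_pderiv [i] u x)" for i
      by (intro L2_integrable_scaleR radial_L2[OF radial_iter_pderiv[OF f]] H2_weak_pderiv u) simp
    have "(LINT x|lebesgue. iter_pderiv [j] f x *\<^sub>R weak_curl u x) =
      (LINT x|lebesgue. (\<Sum>i\<in>UNIV. cross3 (?e i) (iter_pderiv [j] f x *\<^sub>R weak_pderiv [i] u x)))"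
      by (simp add: weak_curl_eq scaleR_sum_right cross_mult_right)
    also have "\<dots> = (\<Sum>i\<in>UNIV. cross3 (?e i) (LINT x|lebesgue. iter_pderiv [j] f x *\<^sub>R weak_pderiv [i] u x))"
      by (subst Bochner_Integration.integral_sum[OF integrable_bounded_linear[OF bounded_linear_cross3 ii]])
        (simp add: integral_bounded_linear[OF bounded_linear_cross3 ii])
    finally show ?thesis unfolding D .
  qed
  have c2: "?I i j $ j = (LINT x|lebesgue. iter_pderiv [i, j] f x * u x $ j)" for i j
    using integral_bounded_linear[OF bounded_linear_vec_nth[of j] L2_integrable_scaleR[OF radial_L2[OF radial_iter_pderiv[OF f]] H2_L2[OF u]], of "[i, j]"]
    by simp
  have c3: "(\<Sum>j\<in>UNIV. ?I j j) = (LINT x|lebesgue. (\<Sum>i\<in>UNIV. iter_pderiv [i, i] f x) *\<^sub>R u x)"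
    unfolding scaleR_sum_left
    by (rule Bochner_Integration.integral_sum[symmetric])
      (intro L2_integrable_scaleR radial_L2[OF radial_iter_pderiv[OF f]] H2_L2 u)
  have "(LINT x|lebesgue. f x *\<^sub>R weak_curl (weak_curl u) x) =
     (\<Sum>j\<in>UNIV. LINT x|lebesgue. cross3 (?e j) (f x *\<^sub>R weak_pderiv [j] (weak_curl u) x))"
    unfolding eq using i2 by (rule Bochner_Integration.integral_sum)
  also have "\<dots> = (\<Sum>j\<in>UNIV. cross3 (?e j) (LINT x|lebesgue. f x *\<^sub>R weak_pderiv [j] (weak_curl u) x))"
    by (simp only: integral_bounded_linear[OF bounded_linear_cross3 i1])
  also have "\<dots> = (\<Sum>j\<in>UNIV. cross3 (?e j) (- (LINT x|lebesgue. iter_pderiv [j] f x *\<^sub>R weak_curl u x)))"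
    using has_weak_pderiv_radial[OF wp f] by simp
  also have "\<dots> = (\<Sum>j\<in>UNIV. \<Sum>i\<in>UNIV. cross3 (?e j) (cross3 (?e i) (?I i j)))"
    by (simp add: c1 cross_minus_right sum_negf cross3_sum_right)
  also have "\<dots> = (\<Sum>j\<in>UNIV. \<Sum>i\<in>UNIV. (?I i j $ j) *\<^sub>R ?e i - (if i = j then ?I i j else 0))"
    by (simp only: cross3_axis_axis)
  also have "\<dots> = (\<Sum>j\<in>UNIV. \<Sum>i\<in>UNIV. (?I i j $ j) *\<^sub>R ?e i) - (\<Sum>j\<in>UNIV. ?I j j)"
    by (simp add: sum_subtractf)
  also have "(\<Sum>j\<in>UNIV. \<Sum>i\<in>UNIV. (?I i j $ j) *\<^sub>R ?e i) = (\<Sum>i\<in>UNIV. (\<Sum>j\<in>UNIV. ?I i j $ j) *\<^sub>R ?e i)"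
    by (subst sum.swap) (simp only: scaleR_sum_left)
  finally show "(LINT x|lebesgue. f x *\<^sub>R weak_curl (weak_curl u) x) =
      (\<Sum>i\<in>UNIV. (\<Sum>j\<in>UNIV. LINT x|lebesgue. iter_pderiv [i, j] f x * u x $ j) *\<^sub>R axis i 1)
      - (LINT x|lebesgue. (\<Sum>i\<in>UNIV. iter_pderiv [i, i] f x) *\<^sub>R u x)"
    unfolding c2 c3 .
qed

section \<open>Spherical waves\<close>

lemma radial_integral_deriv_step_nonneg: "radial_integral (\<lambda>r. 2 * (deriv step r / r ^ 1)) \<ge> 0"
  unfolding radial_integral_def by (rule integral_nonneg_AE) (simp add: deriv_step_nonneg)

text \<open>The two time derivatives, hidden by an existential quantifier in
  \<open>maxwell_solution\<close>, get names here. The source is kept abstract: square integrable in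
  space and divergence free when tested against radial functions.\<close>

locale maxwell_curve =
  fixes F E :: "real^3 \<Rightarrow> real \<Rightarrow> real^3" and Et Ett :: "real \<Rightarrow> real^3 \<Rightarrow> real^3"
  assumes continuous: "\<And>t. t \<ge> 0 \<Longrightarrow> continuous_on UNIV (\<lambda>x. E x t)"
    and H2: "\<And>\<tau>. \<tau> > 0 \<Longrightarrow> cont_into_H2 {0..\<tau>} (\<lambda>t x. E x t)"
    and L2: "\<And>\<tau>. \<tau> > 0 \<Longrightarrow> cont_into_L2 {0..\<tau>} (\<lambda>t x. E x t)"
      "\<And>\<tau>. \<tau> > 0 \<Longrightarrow> cont_into_L2 {0..\<tau>} Et" "\<And>\<tau>. \<tau> > 0 \<Longrightarrow> cont_into_L2 {0..\<tau>} Ett"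
    and deriv: "\<And>\<tau>. \<tau> > 0 \<Longrightarrow> has_L2_time_deriv {0..\<tau>} (\<lambda>t x. E x t) Et"
      "\<And>\<tau>. \<tau> > 0 \<Longrightarrow> has_L2_time_deriv {0..\<tau>} Et Ett"
    and equation: "\<And>t. t > 0 \<Longrightarrow> AE x in lebesgue. Ett t x + weak_curl (weak_curl (\<lambda>y. E y t)) x = F x t"
    and initial: "\<And>x. E x 0 = 0" "AE x in lebesgue. Et 0 x = 0"
    and F_L2: "\<And>t. t > 0 \<Longrightarrow> (\<lambda>x. F x t) \<in> L2"
    and F_div: "\<And>t x0 \<psi>. t > 0 \<Longrightarrow> radial x0 \<psi> \<Longrightarrow>
       (\<Sum>k\<in>UNIV. LINT x|lebesgue. iter_pderiv [k] \<psi> x * F x t $ k) = 0"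
begin

lemma E_H2: "t \<ge> 0 \<Longrightarrow> (\<lambda>x. E x t) \<in> H2"
  using H2[of "t + 1"] by (auto simp: cont_into_H2_def)

lemma E_L2: "t \<ge> 0 \<Longrightarrow> (\<lambda>x. E x t) \<in> L2"
  using H2_L2[OF E_H2] .

lemma Et_L2: "t \<ge> 0 \<Longrightarrow> Et t \<in> L2"
  using L2(2)[of "t + 1"] by (auto simp: cont_into_L2_def)

lemma Ett_L2: "t \<ge> 0 \<Longrightarrow> Ett t \<in> L2"
  using L2(3)[of "t + 1"] by (auto simp: cont_into_L2_def)

lemma integral_component:
  assumes "f \<in> L2" "u \<in> L2"
  shows "(LINT x|lebesgue. f x * u x $ k) = (LINT x|lebesgue. f x *\<^sub>R u x) $ k"
  using integral_bounded_linear[OF bounded_linear_vec_nth[of k] L2_integrable_scaleR[OF assms]] by simp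

lemma tested_equation:
  assumes t: "t > 0" and f: "radial x0 f"
  shows "(LINT x|lebesgue. f x *\<^sub>R Ett t x) + (LINT x|lebesgue. f x *\<^sub>R weak_curl (weak_curl (\<lambda>y. E y t)) x)
     = (LINT x|lebesgue. f x *\<^sub>R F x t)"
proof -
  have i: "integrable lebesgue (\<lambda>x. f x *\<^sub>R Ett t x)"
    "integrable lebesgue (\<lambda>x. f x *\<^sub>R weak_curl (weak_curl (\<lambda>y. E y t)) x)"
    "integrable lebesgue (\<lambda>x. f x *\<^sub>R F x t)"
    using t by (auto intro!: L2_integrable_scaleR radial_L2[OF f] Ett_L2 F_L2 integral_test_curl_curl(1)[OF _ f] E_H2)
  have "(LINT x|lebesgue. f x *\<^sub>R Ett t x) + (LINT x|lebesgue. f x *\<^sub>R weak_curl (weak_curl (\<lambda>y. E y t)) x)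
     = (LINT x|lebesgue. f x *\<^sub>R Ett t x + f x *\<^sub>R weak_curl (weak_curl (\<lambda>y. E y t)) x)"
    using i by simp
  also have "\<dots> = (LINT x|lebesgue. f x *\<^sub>R F x t)"
  proof (rule integral_cong_AE)
    show "AE x in lebesgue. f x *\<^sub>R Ett t x + f x *\<^sub>R weak_curl (weak_curl (\<lambda>y. E y t)) x = f x *\<^sub>R F x t"
      using equation[OF t] by eventually_elim (simp flip: scaleR_add_right)
  qed (use i in auto)
  finally show ?thesis .
qed

text \<open>The divergence of a curl, tested. Both contributions are sums of third derivatives of
  the test function paired with components of the field; they agree after commuting derivatives and
  exchanging the summation indices.\<close>

lemma divergence_curl_curl:
  assumes t: "t \<ge> 0" and f: "radial x0 f"
  shows "(\<Sum>k\<in>UNIV. (LINT x|lebesgue. iter_pderiv [k] f x *\<^sub>R weak_curl (weak_curl (\<lambda>y. E y t)) x) $ k) = 0"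
proof -
  note u = E_L2[OF t]
  let ?u = "\<lambda>x. E x t"
  have r: "radial x0 (iter_pderiv \<alpha> f)" for \<alpha> by (rule radial_iter_pderiv[OF f])
  have comp: "(LINT x|lebesgue. iter_pderiv [k] f x *\<^sub>R weak_curl (weak_curl ?u) x) $ k =
    (\<Sum>j\<in>UNIV. LINT x|lebesgue. iter_pderiv [k, j, k] f x * ?u x $ j)
    - (\<Sum>j\<in>UNIV. LINT x|lebesgue. iter_pderiv [j, j, k] f x * ?u x $ k)" for k
  proof -
    have "(LINT x|lebesgue. (\<Sum>i\<in>UNIV. iter_pderiv [i, i] (iter_pderiv [k] f) x) *\<^sub>R ?u x) $ k =
      (\<Sum>j\<in>UNIV. LINT x|lebesgue. iter_pderiv [j, j] (iter_pderiv [k] f) x * ?u x $ k)"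
      unfolding scaleR_sum_left
      by (subst Bochner_Integration.integral_sum[OF L2_integrable_scaleR[OF radial_L2[OF radial_iter_pderiv[OF r]] u]])
        (simp add: integral_component[OF radial_L2[OF radial_iter_pderiv[OF r]] u])
    then show ?thesis
      unfolding integral_test_curl_curl(2)[OF E_H2[OF t] r]
      by (simp add: axis_def if_distrib if_distribR sum.delta iter_pderiv.simps cong: if_cong)
  qed
  have "iter_pderiv [k, j, k] f = iter_pderiv [k, k, j] f" for j k
    using iter_pderiv_radial_commute[OF f, of j k] iter_pderiv_Cons[of k "[j, k]" f] iter_pderiv_Cons[of k "[k, j]" f] by simp
  then have "(\<Sum>k\<in>UNIV. \<Sum>j\<in>UNIV. LINT x|lebesgue. iter_pderiv [k, j, k] f x * ?u x $ j) =
     (\<Sum>k\<in>UNIV. \<Sum>j\<in>UNIV. LINT x|lebesgue. iter_pderiv [j, j, k] f x * ?u x $ k)"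
    by (subst sum.swap) simp
  then show ?thesis unfolding comp by (simp add: sum_subtractf)
qed

lemma divergence_free:
  assumes t: "t \<ge> 0" and f: "radial x0 f"
  shows "(\<Sum>k\<in>UNIV. LINT x|lebesgue. iter_pderiv [k] f x * E x t $ k) = 0"
proof (cases "t = 0")
  case False
  then have t0: "t > 0" using t by simp
  have r: "iter_pderiv \<alpha> f \<in> L2" for \<alpha> by (rule radial_L2[OF radial_iter_pderiv[OF f]])
  define d where "d s = (\<Sum>k\<in>UNIV. (LINT x|lebesgue. iter_pderiv [k] f x *\<^sub>R E x s) $ k)" for s
  define d1 where "d1 s = (\<Sum>k\<in>UNIV. (LINT x|lebesgue. iter_pderiv [k] f x *\<^sub>R Et s x) $ k)" for s
  define d2 where "d2 s = (\<Sum>k\<in>UNIV. (LINT x|lebesgue. iter_pderiv [k] f x *\<^sub>R Ett s x) $ k)" for s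
  have comp: "((\<lambda>s. \<Sum>k\<in>UNIV. G k s $ k) has_real_derivative (\<Sum>k\<in>UNIV. G' k $ k)) (at s within S)"
    if "\<And>k. (G k has_vector_derivative (G' k)) (at s within S)" for G :: "3 \<Rightarrow> real \<Rightarrow> real^3" and G' s S
    using that unfolding has_real_derivative_iff_has_vector_derivative
    by (intro has_vector_derivative_sum bounded_linear.has_vector_derivative[OF bounded_linear_vec_nth])
  have D: "(d has_real_derivative d1 s) (at s within {0..t})" if "s \<in> {0..t}" for s
    unfolding d_def[abs_def] d1_def
    by (intro comp L2_test_has_vector_derivative[OF r, where u = "\<lambda>s x. E x s"] deriv t0)
      (use that E_L2 Et_L2 in auto)
  have D1: "(d1 has_real_derivative d2 s) (at s within {0..t})" if "s \<in> {0..t}" for s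
    unfolding d1_def[abs_def] d2_def
    by (intro comp L2_test_has_vector_derivative[OF r, where u = Et] deriv t0)
      (use that Et_L2 Ett_L2 in auto)
  have d2: "d2 s = 0" if s: "s > 0" for s
  proof -
    have "(\<Sum>k\<in>UNIV. (LINT x|lebesgue. iter_pderiv [k] f x *\<^sub>R Ett s x) $ k +
        (LINT x|lebesgue. iter_pderiv [k] f x *\<^sub>R weak_curl (weak_curl (\<lambda>y. E y s)) x) $ k) =
      (\<Sum>k\<in>UNIV. (LINT x|lebesgue. iter_pderiv [k] f x *\<^sub>R F x s) $ k)"
      unfolding vector_add_component[symmetric]
      by (intro sum.cong refl arg_cong[where f = "\<lambda>v. v $ _"] tested_equation[where ?x0.0 = x0] s radial_iter_pderiv[OF f])
    also have "\<dots> = (\<Sum>k\<in>UNIV. LINT x|lebesgue. iter_pderiv [k] f x * F x s $ k)"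
      by (simp add: integral_component[OF r F_L2[OF s]])
    also have "\<dots> = 0" by (rule F_div[OF s f])
    finally show ?thesis using divergence_curl_curl[of s, OF _ f] s by (simp add: sum.distrib d2_def)
  qed
  have int: "(h has_real_derivative h') (at s)" if "(h has_real_derivative h') (at s within {0..t})" "0 < s" "s < t" for h h' s
    using that at_within_interior[of s "{0..t}"] by simp
  have z1: "d1 0 = 0"
  proof -
    have "(LINT x|lebesgue. iter_pderiv [k] f x *\<^sub>R Et 0 x) = 0" for k
      using initial(2) by (intro integral_eq_zero_AE) (auto elim: eventually_mono)
    then show ?thesis by (simp add: d1_def)
  qed
  have c1: "d1 s = 0" if s: "0 < s" "s \<le> t" for s
  proof -
    have "d1 s = d1 0"
    proof (rule DERIV_isconst_end[OF s(1)])
      show "continuous_on {0..s} d1"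
        by (rule continuous_on_subset[of "{0..t}"], rule DERIV_continuous_on[OF D1]) (use s in auto)
      fix z assume z: "0 < z" "z < s"
      show "DERIV d1 z :> 0" using int[OF D1[of z]] d2[of z] z s by simp
    qed
    then show ?thesis using z1 by simp
  qed
  have "d t = d 0"
  proof (rule DERIV_isconst_end[OF t0])
    show "continuous_on {0..t} d" by (rule DERIV_continuous_on[OF D])
    fix z assume z: "0 < z" "z < t"
    show "DERIV d z :> 0" using int[OF D[of z]] c1[of z] z by simp
  qed
  also have "d 0 = 0" by (simp add: d_def initial)
  finally show ?thesis by (simp add: d_def integral_component[OF r E_L2[OF t]])
qed (simp add: initial)

text \<open>The grad-div term is the divergence of the field tested with a partial derivative of
  \<open>f\<close>, hence 0.\<close>

lemma wave_equation:
  assumes t: "t > 0" and f: "radial x0 f"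
  shows "(LINT x|lebesgue. f x *\<^sub>R Ett t x) =
    (LINT x|lebesgue. (\<Sum>i\<in>UNIV. iter_pderiv [i, i] f x) *\<^sub>R E x t) + (LINT x|lebesgue. f x *\<^sub>R F x t)"
proof -
  have "(\<Sum>j\<in>UNIV. LINT x|lebesgue. iter_pderiv [i, j] f x * E x t $ j) = 0" for i
    using divergence_free[of t, OF _ radial_iter_pderiv[OF f, of "[i]"]] t
      iter_pderiv_radial_commute[OF f, of i] iter_pderiv_Cons[of _ "[i]" f] by simp
  then show ?thesis
    using tested_equation[OF t f] integral_test_curl_curl(2)[OF E_H2 f, of t] t
    by (simp add: algebra_simps)
qed

text \<open>The quantity \<langle>f, E'\<rangle> - \<langle>f', E\<rangle> vanishes at 0 by the
  initial conditions and at \<tau> by the final conditions on \<open>f\<close>. In its derivative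
  the two mixed terms cancel, and the wave equation rewrites what is left.\<close>

lemma wave_test_identity:
  assumes \<tau>: "\<tau> > 0"
    and f: "\<And>t. t \<in> {0..\<tau>} \<Longrightarrow> radial x0 (f t)"
    and f'_L2: "\<And>t. t \<in> {0..\<tau>} \<Longrightarrow> f'' t \<in> L2"
    and d: "cont_into_L2 {0..\<tau>} f" "cont_into_L2 {0..\<tau>} f'"
      "has_L2_time_deriv {0..\<tau>} f f'" "has_L2_time_deriv {0..\<tau>} f' f''"
    and final: "\<And>x. f \<tau> x = 0" "\<And>x. f' \<tau> x = 0"
  shows "((\<lambda>t. (LINT x|lebesgue. ((\<Sum>i\<in>UNIV. iter_pderiv [i, i] (f t) x) - f'' t x) *\<^sub>R E x t) +
     (LINT x|lebesgue. f t x *\<^sub>R F x t)) has_integral 0) {0..\<tau>}"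
proof -
  define m where "m t = (LINT x|lebesgue. f t x *\<^sub>R Et t x) - (LINT x|lebesgue. f' t x *\<^sub>R E x t)" for t
  have fL: "f t \<in> L2" "f' t \<in> L2" if "t \<in> {0..\<tau>}" for t
    using d(1,2) that by (auto simp: cont_into_L2_def)
  have D: "(m has_vector_derivative
     ((LINT x|lebesgue. f' t x *\<^sub>R Et t x) + (LINT x|lebesgue. f t x *\<^sub>R Ett t x) -
      ((LINT x|lebesgue. f'' t x *\<^sub>R E x t) + (LINT x|lebesgue. f' t x *\<^sub>R Et t x)))) (at t within {0..\<tau>})"
    if t: "t \<in> {0..\<tau>}" for t
    unfolding m_def[abs_def]
    by (intro has_vector_derivative_diff L2_product_has_vector_derivative[where u = Et]
        L2_product_has_vector_derivative[where u = "\<lambda>t x. E x t"] d fL t deriv \<tau> f'_L2)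
      (use t in \<open>auto intro: E_L2 Et_L2 Ett_L2\<close>)
  have m0: "m 0 = 0"
  proof -
    have "(LINT x|lebesgue. f 0 x *\<^sub>R Et 0 x) = 0"
      using initial(2) by (intro integral_eq_zero_AE) (auto elim: eventually_mono)
    then show ?thesis by (simp add: m_def initial)
  qed
  have m\<tau>: "m \<tau> = 0" by (simp add: m_def final)
  have "((\<lambda>t. (LINT x|lebesgue. ((\<Sum>i\<in>UNIV. iter_pderiv [i, i] (f t) x) - f'' t x) *\<^sub>R E x t) +
     (LINT x|lebesgue. f t x *\<^sub>R F x t)) has_integral (m \<tau> - m 0)) {0..\<tau>}"
  \<comment> \<open>The interior version is used because the equation holds only for positive
    times.\<close>
  proof (rule fundamental_theorem_of_calculus_interior)
    show "continuous_on {0..\<tau>} m"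
      unfolding continuous_on_eq_continuous_within using D has_vector_derivative_continuous by blast
    fix t assume t: "t \<in> {0<..<\<tau>}"
    then have t': "t \<in> {0..\<tau>}" "t > 0" by auto
    have lap: "(\<lambda>x. \<Sum>i\<in>UNIV. iter_pderiv [i, i] (f t) x) \<in> L2"
      unfolding sum_3 using radial_iter_pderiv[OF f[OF t'(1)]]
      by (intro radial_L2[of x0] radial.add) auto
    have "(LINT x|lebesgue. ((\<Sum>i\<in>UNIV. iter_pderiv [i, i] (f t) x) - f'' t x) *\<^sub>R E x t) =
       (LINT x|lebesgue. (\<Sum>i\<in>UNIV. iter_pderiv [i, i] (f t) x) *\<^sub>R E x t) - (LINT x|lebesgue. f'' t x *\<^sub>R E x t)"
      using L2_integrable_scaleR[OF lap E_L2[of t]] L2_integrable_scaleR[OF f'_L2[OF t'(1)] E_L2[of t]] t'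
      by (simp add: scaleR_diff_left)
    then have "(LINT x|lebesgue. f' t x *\<^sub>R Et t x) + (LINT x|lebesgue. f t x *\<^sub>R Ett t x) -
      ((LINT x|lebesgue. f'' t x *\<^sub>R E x t) + (LINT x|lebesgue. f' t x *\<^sub>R Et t x)) =
      (LINT x|lebesgue. ((\<Sum>i\<in>UNIV. iter_pderiv [i, i] (f t) x) - f'' t x) *\<^sub>R E x t) +
     (LINT x|lebesgue. f t x *\<^sub>R F x t)"
      using wave_equation[OF t'(2) f[OF t'(1)]] by simp
    then show "(m has_vector_derivative (LINT x|lebesgue. ((\<Sum>i\<in>UNIV. iter_pderiv [i, i] (f t) x) - f'' t x) *\<^sub>R E x t) +
     (LINT x|lebesgue. f t x *\<^sub>R F x t)) (at t)"
      using D[OF t'(1)] at_within_interior[of t "{0..\<tau>}"] t by simp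
  qed (use \<tau> in auto)
  then show ?thesis by (simp add: m0 m\<tau>)
qed

text \<open>The \<open>H2\<close> norm controls the supremum over space, so continuity of the curve
  in time is uniform in x and combines with continuity in x to joint continuity.\<close>

lemma continuous_E: "continuous_on (UNIV \<times> {0..}) (\<lambda>(x, t). E x t)"
proof -
  define C where "C = (L2_norm (\<lambda>x::real^3. deriv (deriv step) (norm x) / norm x) +
     3 * sqrt (radial_integral (\<lambda>r. 2 * (deriv step r / r ^ 1)))) / kappa"
  have bound: "norm (E x s - E x t) \<le> C * H2_norm (\<lambda>x. E x s - E x t)" if "s \<ge> 0" "t \<ge> 0" for x s t
    using H2_pointwise_bound[OF H2_diff[OF E_H2[OF that(1)] E_H2[OF that(2)]]
       continuous_on_diff[OF continuous[OF that(1)] continuous[OF that(2)]], of x] kappa_pos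
    by (simp add: C_def field_simps)
  have C: "C \<ge> 0"
    unfolding C_def
    by (intro divide_nonneg_pos add_nonneg_nonneg mult_nonneg_nonneg L2_norm_nonneg
        real_sqrt_ge_zero radial_integral_deriv_step_nonneg kappa_pos) simp
  show ?thesis
    unfolding continuous_on_iff
  proof (intro ballI allI impI)
    fix p :: "(real^3) \<times> real" and e :: real assume p: "p \<in> UNIV \<times> {0..}" and e: "e > 0"
    obtain x t where xt: "p = (x, t)" "t \<ge> 0" using p by (cases p) auto
    \<comment> \<open>The interval ends at t + 1 so that it contains all nonnegative times within
      distance 1 of \<open>t\<close>.\<close>
    have "((\<lambda>s. H2_norm (\<lambda>x. E x s - E x t)) \<longlongrightarrow> 0) (at t within {0..t + 1})"
      using H2[of "t + 1"] xt by (auto simp: cont_into_H2_def)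
    then have "eventually (\<lambda>s. H2_norm (\<lambda>x. E x s - E x t) < e / (2 * (C + 1))) (at t within {0..t + 1})"
      by (rule order_tendstoD) (use e C in auto)
    then obtain d1 where d1: "d1 > 0"
      "\<And>s. s \<in> {0..t + 1} \<Longrightarrow> s \<noteq> t \<Longrightarrow> dist s t < d1 \<Longrightarrow> H2_norm (\<lambda>x. E x s - E x t) < e / (2 * (C + 1))"
      unfolding eventually_at by blast
    obtain d2 where d2: "d2 > 0" "\<And>y. dist y x < d2 \<Longrightarrow> dist (E y t) (E x t) < e / 2"
      using continuous[OF xt(2)] e unfolding continuous_on_iff by (metis UNIV_I half_gt_zero)
    show "\<exists>d>0. \<forall>q\<in>UNIV \<times> {0..}. dist q p < d \<longrightarrow>
        dist (case q of (x, t) \<Rightarrow> E x t) (case p of (x, t) \<Rightarrow> E x t) < e"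
    proof (intro exI[of _ "min (min d1 1) d2"] conjI ballI impI)
      fix q :: "(real^3) \<times> real" assume q: "q \<in> UNIV \<times> {0..}" "dist q p < min (min d1 1) d2"
      obtain y s where ys: "q = (y, s)" "s \<ge> 0" using q(1) by (cases q) auto
      have dd: "dist y x < d2" "dist s t < d1" "dist s t < 1"
        using q(2) dist_fst_le[of q p] dist_snd_le[of q p] by (auto simp: ys xt)
      have "norm (E y s - E y t) < e / 2"
      proof (cases "s = t")
        case False
        have "s \<in> {0..t + 1}" using dd(3) ys(2) by (auto simp: dist_real_def)
        then have "H2_norm (\<lambda>x. E x s - E x t) < e / (2 * (C + 1))" using d1 False dd by blast
        then have "C * H2_norm (\<lambda>x. E x s - E x t) \<le> C * (e / (2 * (C + 1)))"
          using C by (intro mult_left_mono) auto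
        also have "\<dots> < e / 2" using C e by (simp add: field_simps)
        finally show ?thesis using bound[OF ys(2) xt(2), of y] by simp
      qed (use e in simp)
      then have "dist (E y s) (E y t) < e / 2" by (simp add: dist_norm)
      moreover have "dist (E y t) (E x t) < e / 2" using d2 dd by blast
      ultimately have "dist (E y s) (E x t) < e" using dist_triangle_half_r[of "E y t" "E y s" e "E x t"] by (simp add: dist_commute)
      then show "dist (case q of (x, t) \<Rightarrow> E x t) (case p of (x, t) \<Rightarrow> E x t) < e" by (simp add: ys xt)
    qed (use d1 d2 in auto)
  qed
qed

end

text \<open>The functions \<open>P (t + r) / r\<close> solve the wave equation away from the origin; cutting them
  off near the origin makes them admissible tests.\<close>

definition spherical_wave :: "(real \<Rightarrow> real) \<Rightarrow> real \<Rightarrow> real^3 \<Rightarrow> real \<Rightarrow> real^3 \<Rightarrow> real" where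
  "spherical_wave P \<delta> x0 t x = P (t + norm (x - x0)) * scaled_step \<delta> (norm (x - x0)) / norm (x - x0)"

lemma annular_spherical_profile:
  assumes P: "annular P" and \<delta>: "\<delta> > 0" and t: "t \<ge> 0"
  shows "annular (\<lambda>r. P (t + r) * scaled_step \<delta> r)"
proof -
  obtain d M where 1: "d > 0" "d < M" "\<And>r. r < d \<Longrightarrow> P r = 0" "\<And>r. r > M \<Longrightarrow> P r = 0"
    by (rule annularE[OF P that])
  show ?thesis
  proof (rule annularI[OF _ \<delta>, of _ M])
    show "smooth (\<lambda>r. P (t + r) * scaled_step \<delta> r)"
      using smooth_shift[OF annular_smooth[OF P], of t] smooth_scaled_step
      by (intro smooth_mult) (simp_all add: add.commute)
  qed (use 1 t \<delta> in \<open>auto simp: scaled_step_eq_0\<close>)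
qed

lemma radial_spherical_wave:
  assumes "annular P" "\<delta> > 0" "t \<ge> 0"
  shows "radial x0 (spherical_wave P \<delta> x0 t)"
  using radial.base[OF annular_divide[OF annular_spherical_profile[OF assms], of 1], of x0]
  by (simp add: spherical_wave_def[abs_def])

text \<open>P(t + r) / r itself solves the wave equation, so only terms with a derivative of the
  cut-off survive. They are supported where \<delta> \<le> r \<le> 2\<delta>.\<close>

lemma laplacian_spherical_wave:
  assumes P: "annular P" and \<delta>: "\<delta> > 0" and t: "t \<ge> 0"
  shows "(\<Sum>i\<in>UNIV. iter_pderiv [i, i] (spherical_wave P \<delta> x0 t) x) - spherical_wave (deriv (deriv P)) \<delta> x0 t x =
    (2 * deriv P (t + norm (x - x0)) * deriv (scaled_step \<delta>) (norm (x - x0)) +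
      P (t + norm (x - x0)) * deriv (deriv (scaled_step \<delta>)) (norm (x - x0))) / norm (x - x0)"
proof -
  define w where "w r = P (t + r) * scaled_step \<delta> r" for r
  have w: "annular w" unfolding w_def[abs_def] by (rule annular_spherical_profile[OF assms])
  have sP: "smooth P" using P by (rule annular_smooth)
  have dP: "((\<lambda>r. P (t + r)) has_real_derivative deriv P (t + r)) (at r)"
    "((\<lambda>r. deriv P (t + r)) has_real_derivative deriv (deriv P) (t + r)) (at r)" for r
    using DERIV_shift[of P "deriv P (t + r)" r t] smooth_DERIV[OF sP, of "t + r"]
      DERIV_shift[of "deriv P" "deriv (deriv P) (t + r)" r t] smooth_DERIV[OF smooth_deriv[OF sP], of "t + r"]
    by (simp_all add: add.commute)
  note dS = smooth_DERIV[OF smooth_scaled_step, of \<delta>] smooth_DERIV[OF smooth_deriv[OF smooth_scaled_step], of \<delta>]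
  have 1: "deriv w = (\<lambda>r. deriv P (t + r) * scaled_step \<delta> r + P (t + r) * deriv (scaled_step \<delta>) r)"
    unfolding w_def[abs_def]
    by (intro ext DERIV_imp_deriv) (auto intro!: derivative_eq_intros dP dS)
  have 2: "deriv (deriv w) r = deriv (deriv P) (t + r) * scaled_step \<delta> r + 2 * deriv P (t + r) * deriv (scaled_step \<delta>) r
     + P (t + r) * deriv (deriv (scaled_step \<delta>)) r" for r
    unfolding 1 by (intro DERIV_imp_deriv) (auto intro!: derivative_eq_intros dP dS)
  have "(\<Sum>i\<in>UNIV. iter_pderiv [i, i] (spherical_wave P \<delta> x0 t) x) = deriv (deriv w) (norm (x - x0)) / norm (x - x0)"
    using laplacian_annular[OF w, of x0 x] by (simp add: spherical_wave_def[abs_def] w_def)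
  then show ?thesis by (simp add: 2 spherical_wave_def diff_divide_distrib[symmetric])
qed

lemma L2_norm_mono:
  fixes u :: "real^'n \<Rightarrow> 'b::euclidean_space" and v :: "real^'n \<Rightarrow> 'c::euclidean_space"
  assumes "v \<in> L2" "\<And>x. norm (u x) \<le> c * norm (v x)" "c \<ge> 0"
  shows "L2_norm u \<le> c * L2_norm v"
proof (cases "integrable lebesgue (\<lambda>x. (norm (u x))\<^sup>2)")
  case True
  have "(L2_norm u)\<^sup>2 \<le> (LINT x|lebesgue. c\<^sup>2 * (norm (v x))\<^sup>2)"
    unfolding L2_norm_square
  proof (rule integral_mono[OF True])
    show "integrable lebesgue (\<lambda>x. c\<^sup>2 * (norm (v x))\<^sup>2)" using L2_integrable_square[OF assms(1)] by simp
    show "(norm (u x))\<^sup>2 \<le> c\<^sup>2 * (norm (v x))\<^sup>2" for x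
      using power_mono[OF assms(2)[of x], of 2] by (simp add: power_mult_distrib)
  qed
  also have "\<dots> = (c * L2_norm v)\<^sup>2" by (simp add: power_mult_distrib L2_norm_square)
  finally show ?thesis by (rule power2_le_imp_le) (simp add: assms(3) L2_norm_nonneg)
next
  case False
  then show ?thesis using assms(3) by (simp add: L2_norm_def not_integrable_integral_eq)
qed

text \<open>Increments of P and errors of its difference quotients are at most a constant times |s -
  t|, uniformly in x. Multiplying one fixed function \<open>k\<close> of \<open>L2\<close> by these
  constants dominates everything.\<close>

lemma spherical_wave_time:
  assumes P: "annular P" and \<delta>: "\<delta> > 0"
  shows "cont_into_L2 {0..\<tau>} (spherical_wave P \<delta> x0)"
    "has_L2_time_deriv {0..\<tau>} (spherical_wave P \<delta> x0) (spherical_wave (deriv P) \<delta> x0)"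
proof -
  obtain d M where 1: "d > 0" "d < M" "\<And>r. r < d \<Longrightarrow> P r = 0" "\<And>r. r > M \<Longrightarrow> P r = 0"
    by (rule annularE[OF P that])
  have dP0: "deriv P r = 0" if "r > M" for r
    by (rule deriv_eq_0_locally_const[of "{M<..}" _ _ 0]) (use that 1 in auto)
  note P' = annular_deriv[OF P]
  note P'' = annular_deriv[OF P']
  obtain B1 where B1: "\<And>r. \<bar>deriv P r\<bar> \<le> B1" by (rule annular_bounded[OF P' that])
  obtain B2 where B2: "\<And>r. \<bar>deriv (deriv P) r\<bar> \<le> B2" by (rule annular_bounded[OF P'' that])
  have B0: "B1 \<ge> 0" "B2 \<ge> 0" using B1[of 0] B2[of 0] by auto
  note dP = smooth_DERIV[OF annular_smooth[OF P]] and ddP = smooth_DERIV[OF annular_smooth[OF P']]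
  have lip: "\<bar>P a - P b\<bar> \<le> B1 * \<bar>a - b\<bar>" for a b
    using field_differentiable_bound[of UNIV P "deriv P" B1 a b] dP B1 by simp
  have lip': "\<bar>deriv P a - deriv P b\<bar> \<le> B2 * \<bar>a - b\<bar>" for a b
    using field_differentiable_bound[of UNIV "deriv P" "deriv (deriv P)" B2 a b] ddP B2 by simp
  have quot: "\<bar>(P a - P b) / (a - b) - deriv P b\<bar> \<le> B2 * \<bar>a - b\<bar>" if ab: "a \<noteq> b" for a b
  proof -
    obtain c where c: "\<bar>c - b\<bar> \<le> \<bar>a - b\<bar>" "(P a - P b) / (a - b) = deriv P c"
    proof (cases "a < b")
      case True
      then obtain z where "a < z" "z < b" "P b - P a = (b - a) * deriv P z"
        using MVT2[of a b P "deriv P"] dP by auto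
      moreover from this have "(P a - P b) / (a - b) = deriv P z" using True by (simp add: field_simps)
      ultimately show ?thesis by (intro that[of z]) auto
    next
      case False
      then obtain z where "b < z" "z < a" "P a - P b = (a - b) * deriv P z"
        using MVT2[of b a P "deriv P"] dP ab by auto
      moreover from this have "(P a - P b) / (a - b) = deriv P z" using False ab by (simp add: field_simps)
      ultimately show ?thesis by (intro that[of z]) auto
    qed
    have "\<bar>deriv P c - deriv P b\<bar> \<le> B2 * \<bar>c - b\<bar>" by (rule lip')
    also have "\<dots> \<le> B2 * \<bar>a - b\<bar>" using c B0 by (intro mult_left_mono) auto
    finally show ?thesis using c by simp
  qed
  \<comment> \<open>The second factor is 1 for r \<le> M, where P(t + r) may be nonzero for t \<ge>
    0, and 0 for r \<ge> M + 1. Without it the dominating function would not have compact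
    support.\<close>
  define K where "K r = scaled_step \<delta> r * step (M + 2 - r)" for r
  have K: "annular K"
  proof (rule annularI[OF _ \<delta>, of _ "M + 1"])
    show "smooth K" unfolding K_def[abs_def]
      using smooth_affine[OF smooth_step, of "-1" "M + 2"] by (intro smooth_mult smooth_scaled_step) simp
  qed (auto simp: K_def \<delta> scaled_step_eq_0 step_eq_0)
  define k where "k x = K (norm (x - x0)) / norm (x - x0)" for x
  have k: "k \<in> L2" unfolding k_def[abs_def]
    using radial.base[OF annular_divide[OF K, of 1], of x0] by (intro radial_L2[of x0]) simp
  have dom: "\<bar>c * scaled_step \<delta> (norm (x - x0)) / norm (x - x0)\<bar> \<le> B * norm (k x)"
    if "\<bar>c\<bar> \<le> B" "norm (x - x0) > M \<Longrightarrow> c = 0" for c B x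
  proof (cases "norm (x - x0) > M")
    case False
    then have "k x = scaled_step \<delta> (norm (x - x0)) / norm (x - x0)" by (simp add: k_def K_def step_eq_1)
    then have "\<bar>c * scaled_step \<delta> (norm (x - x0)) / norm (x - x0)\<bar> = \<bar>c\<bar> * norm (k x)"
      by (simp add: abs_mult)
    then show ?thesis using that by (simp add: mult_right_mono)
  next
    case True
    have "0 \<le> B" using that(1) by linarith
    then show ?thesis using that(2)[OF True] by simp
  qed
  have L: "spherical_wave P \<delta> x0 t \<in> L2" if "t \<ge> 0" for t
    by (rule radial_L2[OF radial_spherical_wave[OF P \<delta> that]])
  have c: "L2_norm (\<lambda>x. spherical_wave P \<delta> x0 s x - spherical_wave P \<delta> x0 t x) \<le> B1 * \<bar>s - t\<bar> * L2_norm k"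
    if "s \<ge> 0" "t \<ge> 0" for s t
  proof (rule L2_norm_mono[OF k])
    fix x
    have "spherical_wave P \<delta> x0 s x - spherical_wave P \<delta> x0 t x =
      (P (s + norm (x - x0)) - P (t + norm (x - x0))) * scaled_step \<delta> (norm (x - x0)) / norm (x - x0)"
      by (simp add: spherical_wave_def diff_divide_distrib left_diff_distrib)
    then show "norm (spherical_wave P \<delta> x0 s x - spherical_wave P \<delta> x0 t x) \<le> B1 * \<bar>s - t\<bar> * norm (k x)"
      using dom[of "P (s + norm (x - x0)) - P (t + norm (x - x0))" "B1 * \<bar>s - t\<bar>" x]
        lip[of "s + norm (x - x0)" "t + norm (x - x0)"] 1(4) that by simp
  qed (use B0 in auto)
  have d: "L2_norm (\<lambda>x. (spherical_wave P \<delta> x0 s x - spherical_wave P \<delta> x0 t x) /\<^sub>R (s - t) - spherical_wave (deriv P) \<delta> x0 t x)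
     \<le> B2 * \<bar>s - t\<bar> * L2_norm k"
    if "s \<ge> 0" "t \<ge> 0" "s \<noteq> t" for s t
  proof (rule L2_norm_mono[OF k])
    fix x
    let ?c = "(P (s + norm (x - x0)) - P (t + norm (x - x0))) / (s - t) - deriv P (t + norm (x - x0))"
    have "(spherical_wave P \<delta> x0 s x - spherical_wave P \<delta> x0 t x) /\<^sub>R (s - t) - spherical_wave (deriv P) \<delta> x0 t x =
      ?c * scaled_step \<delta> (norm (x - x0)) / norm (x - x0)"
      by (simp add: spherical_wave_def diff_divide_distrib left_diff_distrib divide_inverse mult_ac right_diff_distrib)
    then show "norm ((spherical_wave P \<delta> x0 s x - spherical_wave P \<delta> x0 t x) /\<^sub>R (s - t) - spherical_wave (deriv P) \<delta> x0 t x)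
       \<le> B2 * \<bar>s - t\<bar> * norm (k x)"
      using dom[of ?c "B2 * \<bar>s - t\<bar>" x]
        quot[of "s + norm (x - x0)" "t + norm (x - x0)"] 1(4) dP0 that by simp
  qed (use B0 in auto)
  have lim: "((\<lambda>s. B * \<bar>s - t\<bar> * L2_norm k) \<longlongrightarrow> 0) (at t within {0..\<tau>})" for B t
    by (intro tendsto_eq_intros) auto
  show "cont_into_L2 {0..\<tau>} (spherical_wave P \<delta> x0)"
    unfolding cont_into_L2_def
  proof (intro ballI conjI)
    fix t assume t: "t \<in> {0..\<tau>}"
    then show "spherical_wave P \<delta> x0 t \<in> L2" using L by simp
    show "((\<lambda>s. L2_norm (\<lambda>x. spherical_wave P \<delta> x0 s x - spherical_wave P \<delta> x0 t x)) \<longlongrightarrow> 0) (at t within {0..\<tau>})"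
      by (rule Lim_null_comparison[OF _ lim[of B1]])
        (use t in \<open>auto simp: eventually_at_filter L2_norm_nonneg intro!: always_eventually c\<close>)
  qed
  show "has_L2_time_deriv {0..\<tau>} (spherical_wave P \<delta> x0) (spherical_wave (deriv P) \<delta> x0)"
    unfolding has_L2_time_deriv_def
  proof (intro ballI)
    fix t assume t: "t \<in> {0..\<tau>}"
    show "((\<lambda>s. L2_norm (\<lambda>x. (spherical_wave P \<delta> x0 s x - spherical_wave P \<delta> x0 t x) /\<^sub>R (s - t)
        - spherical_wave (deriv P) \<delta> x0 t x)) \<longlongrightarrow> 0) (at t within {0..\<tau>})"
      by (rule Lim_null_comparison[OF _ lim[of B2]])
        (use t in \<open>auto simp: eventually_at_filter L2_norm_nonneg simp del: real_scaleR_def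
            intro!: always_eventually d\<close>)
  qed
qed

lemma (in maxwell_curve) spherical_wave_identity:
  assumes P: "annular P" and \<delta>: "\<delta> > 0" and \<tau>: "\<tau> > 0" and P0: "\<And>r. r \<ge> \<tau> \<Longrightarrow> P r = 0"
  shows "((\<lambda>t. (LINT x|lebesgue. ((2 * deriv P (t + norm (x - x0)) * deriv (scaled_step \<delta>) (norm (x - x0)) +
      P (t + norm (x - x0)) * deriv (deriv (scaled_step \<delta>)) (norm (x - x0))) / norm (x - x0)) *\<^sub>R E x t) +
     (LINT x|lebesgue. spherical_wave P \<delta> x0 t x *\<^sub>R F x t)) has_integral 0) {0..\<tau>}"
proof -
  note P' = annular_deriv[OF P]
  note P'' = annular_deriv[OF P']
  have z: "spherical_wave P \<delta> x0 \<tau> x = 0" for x using P0 by (simp add: spherical_wave_def)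
  \<comment> \<open>Away from x0 the argument lies strictly beyond \<tau>, where P vanishes in a
    neighbourhood. At x0 the division by 0 gives 0.\<close>
  have z': "spherical_wave (deriv P) \<delta> x0 \<tau> x = 0" for x
  proof (cases "norm (x - x0) > 0")
    case True
    have "deriv P (\<tau> + norm (x - x0)) = 0"
      by (rule deriv_eq_0_locally_const[of "{\<tau><..}" _ _ 0]) (use True P0 in auto)
    then show ?thesis by (simp add: spherical_wave_def)
  qed (simp add: spherical_wave_def)
  have "((\<lambda>t. (LINT x|lebesgue. ((\<Sum>i\<in>UNIV. iter_pderiv [i, i] (spherical_wave P \<delta> x0 t) x) -
        spherical_wave (deriv (deriv P)) \<delta> x0 t x) *\<^sub>R E x t) +
     (LINT x|lebesgue. spherical_wave P \<delta> x0 t x *\<^sub>R F x t)) has_integral 0) {0..\<tau>}"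
    by (rule wave_test_identity[OF \<tau> _ _ spherical_wave_time(1)[OF P \<delta>] spherical_wave_time(1)[OF P' \<delta>]
          spherical_wave_time(2)[OF P \<delta>] spherical_wave_time(2)[OF P' \<delta>] z z'])
      (auto intro: radial_spherical_wave[OF P \<delta>] radial_L2[OF radial_spherical_wave[OF P'' \<delta>]])
  then show ?thesis
    by (rule has_integral_eq[rotated]) (simp add: laplacian_spherical_wave[OF P \<delta>])
qed

text \<open>First and second derivatives of the cut-off are of order 1/\<delta> and 1/\<delta>^2 and
  live at r \<ge> \<delta>, so the quotient is of order 1/\<delta>^3: the size at which a kernel on
  a ball of radius 2\<delta> has bounded mass.\<close>

lemma spherical_wave_commutator_bound:
  assumes P: "annular P"
  obtains K where "\<And>\<delta> t x. 0 < \<delta> \<Longrightarrow> \<delta> \<le> 1 \<Longrightarrow>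
      \<bar>(2 * deriv P (t + norm (x - x0)) * deriv (scaled_step \<delta>) (norm (x - x0)) +
      P (t + norm (x - x0)) * deriv (deriv (scaled_step \<delta>)) (norm (x - x0))) / norm (x - x0 :: real^3)\<bar> \<le> K / \<delta> ^ 3"
proof -
  obtain A1 where A1: "\<And>r. \<bar>deriv step r\<bar> \<le> A1" by (rule annular_bounded[OF annular_deriv_step that])
  obtain A2 where A2: "\<And>r. \<bar>deriv (deriv step) r\<bar> \<le> A2" by (rule annular_bounded[OF annular_deriv[OF annular_deriv_step] that])
  obtain B0 where B0: "\<And>r. \<bar>P r\<bar> \<le> B0" by (rule annular_bounded[OF P that])
  obtain B1 where B1: "\<And>r. \<bar>deriv P r\<bar> \<le> B1" by (rule annular_bounded[OF annular_deriv[OF P] that])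
  have nn: "A1 \<ge> 0" "A2 \<ge> 0" "B0 \<ge> 0" "B1 \<ge> 0" using A1[of 0] A2[of 0] B0[of 0] B1[of 0] by linarith+
  show ?thesis
  proof (rule that[of "2 * B1 * A1 + B0 * A2"])
    fix \<delta> t :: real and x :: "real^3" assume \<delta>: "0 < \<delta>" "\<delta> \<le> 1"
    define r where "r = norm (x - x0)"
    have "\<bar>(2 * deriv P (t + r) * deriv (scaled_step \<delta>) r + P (t + r) * deriv (deriv (scaled_step \<delta>)) r) / r\<bar>
      \<le> (2 * B1 * A1 + B0 * A2) / \<delta> ^ 3"
    proof (cases "r < \<delta>")
      case True
      have "deriv (scaled_step \<delta>) r = 0"
        by (rule deriv_eq_0_locally_const[of "{..<\<delta>}" _ _ 0]) (use True \<delta> in \<open>auto simp: scaled_step_eq_0\<close>)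
      moreover have "deriv (deriv (scaled_step \<delta>)) r = 0"
        by (rule deriv_eq_0_locally_const[of "{..<\<delta>}" _ _ 0])
          (use True \<delta> in \<open>auto simp: deriv_scaled_step field_simps intro!: deriv_step_eq_0\<close>)
      ultimately show ?thesis using nn \<delta> by simp
    next
      case False
      have "\<bar>2 * deriv P (t + r) * deriv (scaled_step \<delta>) r + P (t + r) * deriv (deriv (scaled_step \<delta>)) r\<bar>
        \<le> 2 * B1 * (A1 / \<delta>\<^sup>2) + B0 * (A2 / \<delta>\<^sup>2)"
      proof (rule order_trans[OF abs_triangle_ineq add_mono])
        have "\<bar>deriv step (r / \<delta>)\<bar> / \<delta> \<le> A1 / \<delta>\<^sup>2"
          using A1 \<delta> nn by (intro frac_le) (auto simp: power2_eq_square mult_le_one mult_left_le)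
        then show "\<bar>2 * deriv P (t + r) * deriv (scaled_step \<delta>) r\<bar> \<le> 2 * B1 * (A1 / \<delta>\<^sup>2)"
          unfolding abs_mult using B1 nn \<delta> by (intro mult_mono) (auto simp: deriv_scaled_step abs_divide)
        have "\<bar>deriv (deriv step) (r / \<delta>)\<bar> / \<delta>\<^sup>2 \<le> A2 / \<delta>\<^sup>2" using A2 \<delta> by (intro divide_right_mono) auto
        then show "\<bar>P (t + r) * deriv (deriv (scaled_step \<delta>)) r\<bar> \<le> B0 * (A2 / \<delta>\<^sup>2)"
          unfolding abs_mult using B0 nn \<delta> by (intro mult_mono) (auto simp: deriv2_scaled_step abs_divide)
      qed
      then have "\<bar>2 * deriv P (t + r) * deriv (scaled_step \<delta>) r + P (t + r) * deriv (deriv (scaled_step \<delta>)) r\<bar> / r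
         \<le> (2 * B1 * (A1 / \<delta>\<^sup>2) + B0 * (A2 / \<delta>\<^sup>2)) / \<delta>"
        using False \<delta> nn by (intro frac_le) auto
      also have "\<dots> = (2 * B1 * A1 + B0 * A2) / \<delta> ^ 3"
        by (simp add: add_divide_distrib power3_eq_cube power2_eq_square mult.assoc)
      finally show ?thesis using False \<delta> by (simp add: abs_divide)
    qed
    then show "\<bar>(2 * deriv P (t + norm (x - x0)) * deriv (scaled_step \<delta>) (norm (x - x0)) +
      P (t + norm (x - x0)) * deriv (deriv (scaled_step \<delta>)) (norm (x - x0))) / norm (x - x0)\<bar> \<le>
      (2 * B1 * A1 + B0 * A2) / \<delta> ^ 3" by (simp add: r_def)
  qed
qed

text \<open>The cut-off disturbs the wave only within 2\<delta> of x0. There the kernel has bounded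
  mass, while the tangential part of E1 - E2 is jointly continuous and vanishes at x0, so the
  disturbance tends to 0 uniformly in time. The source stays at distance \<open>d\<close> from x0
  and does not feel the cut-off.\<close>

lemma tangential_data_imp_source_integral:
  assumes c1: "maxwell_curve F1 E1 E1t E1tt" and c2: "maxwell_curve F2 E2 E2t E2tt"
    and P: "annular P" and \<tau>: "\<tau> > 0" and P0: "\<And>r. r \<ge> \<tau> \<Longrightarrow> P r = 0"
    and data: "\<And>t. 0 < t \<Longrightarrow> t < \<tau> \<Longrightarrow> cross3 x0 (E1 x0 t) = cross3 x0 (E2 x0 t)"
    and d: "d > 0"
    and away1: "\<And>t. t \<ge> 0 \<Longrightarrow> AE x in lebesgue. norm (x - x0) < d \<longrightarrow> F1 x t = 0"
    and away2: "\<And>t. t \<ge> 0 \<Longrightarrow> AE x in lebesgue. norm (x - x0) < d \<longrightarrow> F2 x t = 0"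
    and m1: "\<And>t. t \<ge> 0 \<Longrightarrow> (\<lambda>x. F1 x t) \<in> borel_measurable lebesgue"
    and m2: "\<And>t. t \<ge> 0 \<Longrightarrow> (\<lambda>x. F2 x t) \<in> borel_measurable lebesgue"
  shows "((\<lambda>t. cross3 x0 ((LINT x|lebesgue. (P (t + norm (x - x0)) / norm (x - x0)) *\<^sub>R F1 x t) -
     (LINT x|lebesgue. (P (t + norm (x - x0)) / norm (x - x0)) *\<^sub>R F2 x t))) has_integral 0) {0..\<tau>}"
proof -
  interpret c1: maxwell_curve F1 E1 E1t E1tt by fact
  interpret c2: maxwell_curve F2 E2 E2t E2tt by fact
  define q where "q \<delta> t x = (2 * deriv P (t + norm (x - x0)) * deriv (scaled_step \<delta>) (norm (x - x0)) +
      P (t + norm (x - x0)) * deriv (deriv (scaled_step \<delta>)) (norm (x - x0))) / norm (x - x0)" for \<delta> t x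
  define h where "h t = cross3 x0 ((LINT x|lebesgue. (P (t + norm (x - x0)) / norm (x - x0)) *\<^sub>R F1 x t) -
     (LINT x|lebesgue. (P (t + norm (x - x0)) / norm (x - x0)) *\<^sub>R F2 x t))" for t
  define err where "err \<delta> t = cross3 x0 ((LINT x|lebesgue. q \<delta> t x *\<^sub>R E1 x t) - (LINT x|lebesgue. q \<delta> t x *\<^sub>R E2 x t))" for \<delta> t
  obtain K where K: "\<And>\<delta> t x. 0 < \<delta> \<Longrightarrow> \<delta> \<le> 1 \<Longrightarrow> \<bar>q \<delta> t x\<bar> \<le> K / \<delta> ^ 3"
    using spherical_wave_commutator_bound[OF P, of x0] unfolding q_def by metis
  have K0: "K \<ge> 0" using K[of 1 0 0] by simp
  have q0: "q \<delta> t x = 0" if "\<delta> > 0" "norm (x - x0) > 2 * \<delta>" for \<delta> t x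
  proof -
    have "deriv (scaled_step \<delta>) (norm (x - x0)) = 0"
      by (rule deriv_eq_0_locally_const[of "{2 * \<delta><..}" _ _ 1]) (use that in \<open>auto simp: scaled_step_eq_1\<close>)
    moreover have "deriv (deriv (scaled_step \<delta>)) (norm (x - x0)) = 0"
      by (rule deriv_eq_0_locally_const[of "{2 * \<delta><..}" _ _ 0])
        (use that in \<open>auto simp: deriv_scaled_step field_simps intro!: deriv_step_eq_0\<close>)
    ultimately show ?thesis by (simp add: q_def)
  qed
  \<comment> \<open>The data cover only the open interval. At the final time the kernel itself
    vanishes, and at time 0 the fields do.\<close>
  have q\<tau>: "q \<delta> \<tau> x = 0" for \<delta> x
  proof (cases "norm (x - x0) > 0")
    case True
    have "deriv P (\<tau> + norm (x - x0)) = 0"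
      by (rule deriv_eq_0_locally_const[of "{\<tau><..}" _ _ 0]) (use True P0 in auto)
    then show ?thesis using P0 by (simp add: q_def)
  qed (simp add: q_def)
  have wave: "spherical_wave P \<delta> x0 t x *\<^sub>R F x t = (P (t + norm (x - x0)) / norm (x - x0)) *\<^sub>R F x t"
    if "0 < \<delta>" "2 * \<delta> < d" "norm (x - x0) < d \<longrightarrow> F x t = 0" for \<delta> t x and F :: "real^3 \<Rightarrow> real \<Rightarrow> real^3"
    using that by (cases "norm (x - x0) < d") (auto simp: spherical_wave_def scaled_step_eq_1)
  have waveI: "(LINT x|lebesgue. spherical_wave P \<delta> x0 t x *\<^sub>R F x t) =
     (LINT x|lebesgue. (P (t + norm (x - x0)) / norm (x - x0)) *\<^sub>R F x t)"
    if \<delta>: "0 < \<delta>" "2 * \<delta> < d" "t \<ge> 0"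
      and ae: "AE x in lebesgue. norm (x - x0) < d \<longrightarrow> F x t = 0"
      and m: "(\<lambda>x. F x t) \<in> borel_measurable lebesgue"
      for \<delta> t and F :: "real^3 \<Rightarrow> real \<Rightarrow> real^3"
  proof (rule integral_cong_AE)
    show "AE x in lebesgue. spherical_wave P \<delta> x0 t x *\<^sub>R F x t = (P (t + norm (x - x0)) / norm (x - x0)) *\<^sub>R F x t"
      using ae by eventually_elim (rule wave[OF \<delta>(1,2)])
    have [measurable]: "P \<in> borel_measurable borel" "scaled_step \<delta> \<in> borel_measurable borel"
      using smooth_measurable[OF annular_smooth[OF P]] smooth_measurable[OF smooth_scaled_step] by auto
    have "(\<lambda>x. P (t + norm (x - x0)) / norm (x - x0)) \<in> borel_measurable lborel"
      "spherical_wave P \<delta> x0 t \<in> borel_measurable lborel"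
      unfolding spherical_wave_def[abs_def] by measurable
    then show "(\<lambda>x. spherical_wave P \<delta> x0 t x *\<^sub>R F x t) \<in> borel_measurable lebesgue"
      "(\<lambda>x. (P (t + norm (x - x0)) / norm (x - x0)) *\<^sub>R F x t) \<in> borel_measurable lebesgue"
      using m by (auto intro!: borel_measurable_scaleR intro: measurable_completion)
  qed
  have id: "((\<lambda>t. h t + err \<delta> t) has_integral 0) {0..\<tau>}" if \<delta>: "0 < \<delta>" "2 * \<delta> < d" for \<delta>
  proof -
    have "((\<lambda>t. ((LINT x|lebesgue. q \<delta> t x *\<^sub>R E1 x t) + (LINT x|lebesgue. spherical_wave P \<delta> x0 t x *\<^sub>R F1 x t)) -
       ((LINT x|lebesgue. q \<delta> t x *\<^sub>R E2 x t) + (LINT x|lebesgue. spherical_wave P \<delta> x0 t x *\<^sub>R F2 x t))) has_integral 0 - 0) {0..\<tau>}"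
      unfolding q_def
      by (intro has_integral_diff c1.spherical_wave_identity[OF P \<delta>(1) \<tau> P0] c2.spherical_wave_identity[OF P \<delta>(1) \<tau> P0])
    from has_integral_linear[OF this bounded_linear_cross3[of x0]]
    have "((\<lambda>t. cross3 x0 (((LINT x|lebesgue. q \<delta> t x *\<^sub>R E1 x t) + (LINT x|lebesgue. spherical_wave P \<delta> x0 t x *\<^sub>R F1 x t)) -
       ((LINT x|lebesgue. q \<delta> t x *\<^sub>R E2 x t) + (LINT x|lebesgue. spherical_wave P \<delta> x0 t x *\<^sub>R F2 x t)))) has_integral 0) {0..\<tau>}"
      by (simp add: o_def)
    then show ?thesis
    proof (rule has_integral_eq[rotated])
      fix t assume "t \<in> {0..\<tau>}"
      then have t: "t \<ge> 0" by simp
      show "cross3 x0 (((LINT x|lebesgue. q \<delta> t x *\<^sub>R E1 x t) + (LINT x|lebesgue. spherical_wave P \<delta> x0 t x *\<^sub>R F1 x t)) -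
       ((LINT x|lebesgue. q \<delta> t x *\<^sub>R E2 x t) + (LINT x|lebesgue. spherical_wave P \<delta> x0 t x *\<^sub>R F2 x t))) = h t + err \<delta> t"
        using waveI[where F = F1, OF \<delta> t away1[OF t] m1[OF t]] waveI[where F = F2, OF \<delta> t away2[OF t] m2[OF t]]
        by (simp add: h_def err_def cross_add_right Cross3.right_diff_distrib)
    qed
  qed
  have small: "\<exists>\<delta>. 0 < \<delta> \<and> 2 * \<delta> < d \<and> (\<forall>t\<in>{0..\<tau>}. norm (err \<delta> t) \<le> e)" if e: "e > 0" for e
  proof -
    define V where "V = 8 * unit_ball_vol 3 * K + 1"
    have V: "V > 0" using K0 unit_ball_vol_nonneg[of 3] by (simp add: V_def add_nonneg_pos)
    \<comment> \<open>Uniform continuity on a compact set gives one \<delta> for all times, which is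
      what the limit of the time integrals requires.\<close>
    define w where "w = (\<lambda>(x, t). cross3 x0 (E1 x t - E2 x t))"
    have "continuous_on (cball x0 1 \<times> {0..\<tau>}) (\<lambda>p. (case p of (x, t) \<Rightarrow> E1 x t) - (case p of (x, t) \<Rightarrow> E2 x t))"
      by (intro continuous_on_diff continuous_on_subset[OF c1.continuous_E] continuous_on_subset[OF c2.continuous_E]) auto
    then have "continuous_on (cball x0 1 \<times> {0..\<tau>}) (\<lambda>p. cross3 x0 ((case p of (x, t) \<Rightarrow> E1 x t) - (case p of (x, t) \<Rightarrow> E2 x t)))"
      by (rule bounded_linear.continuous_on[OF bounded_linear_cross3])
    then have "continuous_on (cball x0 1 \<times> {0..\<tau>}) w" by (simp add: w_def case_prod_unfold)
    then have "uniformly_continuous_on (cball x0 1 \<times> {0..\<tau>}) w"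
      by (rule compact_uniformly_continuous) (intro compact_Times compact_cball compact_Icc)
    then obtain \<rho> where \<rho>: "\<rho> > 0" "\<And>p p'. p \<in> cball x0 1 \<times> {0..\<tau>} \<Longrightarrow> p' \<in> cball x0 1 \<times> {0..\<tau>} \<Longrightarrow>
        dist p' p < \<rho> \<Longrightarrow> dist (w p') (w p) < e / V"
      unfolding uniformly_continuous_on_def using e V by (metis divide_pos_pos)
    define \<delta> where "\<delta> = min (min (1 / 2) (\<rho> / 4)) (d / 4)"
    have \<delta>: "0 < \<delta>" "\<delta> \<le> 1" "2 * \<delta> \<le> 1" "2 * \<delta> < \<rho>" "2 * \<delta> < d" using \<rho>(1) d by (auto simp: \<delta>_def)
    have "norm (err \<delta> t) \<le> e" if t: "t \<in> {0..\<tau>}" for t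
    proof (cases "t = \<tau>")
      case True
      then show ?thesis using e by (simp add: err_def q\<tau>)
    next
      case False
      have w0: "w (x0, t) = 0"
        using data[of t] t False by (cases "t = 0") (auto simp: w_def c1.initial c2.initial Cross3.right_diff_distrib)
      have qr: "radial x0 (q \<delta> t)"
      proof -
        have sh: "smooth (\<lambda>r. P (t + r))" "smooth (\<lambda>r. deriv P (t + r))"
          using smooth_shift[OF annular_smooth[OF P], of t] smooth_shift[OF smooth_deriv[OF annular_smooth[OF P]], of t]
          by (simp_all add: add.commute)
        have "annular (\<lambda>r. 2 * deriv P (t + r) * deriv (scaled_step \<delta>) r + P (t + r) * deriv (deriv (scaled_step \<delta>)) r)"
          by (intro annular_add annular_mult_left annular_deriv annular_deriv_scaled_step \<delta> smooth_mult sh smooth_const)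
        from radial.base[OF annular_divide[OF this, of 1], of x0] show ?thesis by (simp add: q_def[abs_def])
      qed
      have t0: "t \<ge> 0" using t by simp
      have i: "integrable lebesgue (\<lambda>x. q \<delta> t x *\<^sub>R E1 x t)" "integrable lebesgue (\<lambda>x. q \<delta> t x *\<^sub>R E2 x t)"
        by (intro L2_integrable_scaleR radial_L2[OF qr] c1.E_L2 c2.E_L2 t0)+
      then have i': "integrable lebesgue (\<lambda>x. q \<delta> t x *\<^sub>R (E1 x t - E2 x t))"
        by (simp add: scaleR_diff_right)
      have "err \<delta> t = cross3 x0 (LINT x|lebesgue. q \<delta> t x *\<^sub>R (E1 x t - E2 x t))"
        using i by (simp add: err_def scaleR_diff_right)
      also have "\<dots> = (LINT x|lebesgue. q \<delta> t x *\<^sub>R w (x, t))"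
        using integral_bounded_linear[OF bounded_linear_cross3[of x0] i'] by (simp add: w_def cross_mult_right)
      finally have "norm (err \<delta> t) = norm (LINT x|lebesgue. q \<delta> t x *\<^sub>R w (x, t))" by simp
      also have "\<dots> \<le> 8 * unit_ball_vol 3 * K * (e / V)"
      proof (rule concentrated_integral_bound[OF \<delta>(1)])
        fix x assume x: "x \<in> cball x0 (2 * \<delta>)"
        have "dist (w (x, t)) (w (x0, t)) < e / V"
          by (rule \<rho>(2)) (use x \<delta> t in \<open>auto simp: dist_Pair_Pair dist_commute\<close>)
        then show "norm (w (x, t)) \<le> e / V" by (simp add: w0)
        show "\<bar>q \<delta> t x\<bar> \<le> K / \<delta> ^ 3" by (rule K[OF \<delta>(1,2)])
      next
        fix x assume "x \<notin> cball x0 (2 * \<delta>)"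
        then show "q \<delta> t x = 0" by (intro q0 \<delta>) (simp add: dist_norm norm_minus_commute)
      qed
      also have "\<dots> \<le> e" using e V K0 unit_ball_vol_nonneg[of 3] by (simp add: V_def field_simps)
      finally show ?thesis .
    qed
    then show ?thesis using \<delta> by blast
  qed
  \<comment> \<open>Integrability of the limit is inherited from the integrable functions
    \<open>h + err\<close>, which converge to it uniformly.\<close>
  have hi: "h integrable_on cbox 0 \<tau>"
  proof (rule integrable_uniform_limit)
    fix e :: real assume "e > 0"
    then obtain \<delta> where \<delta>: "0 < \<delta>" "2 * \<delta> < d" "\<And>t. t \<in> {0..\<tau>} \<Longrightarrow> norm (err \<delta> t) \<le> e" using small by blast
    show "\<exists>g. (\<forall>x\<in>cbox 0 \<tau>. norm (h x - g x) \<le> e) \<and> g integrable_on cbox 0 \<tau>"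
      using \<delta>(3) id[OF \<delta>(1,2)] by (intro exI[of _ "\<lambda>t. h t + err \<delta> t"]) (auto simp: integrable_on_def)
  qed
  have "norm (integral {0..\<tau>} h) \<le> 0 + e'" if e': "e' > 0" for e'
  proof -
    have "e' / \<tau> > 0" using e' \<tau> by simp
    then obtain \<delta> where \<delta>: "0 < \<delta>" "2 * \<delta> < d" "\<And>t. t \<in> {0..\<tau>} \<Longrightarrow> norm (err \<delta> t) \<le> e' / \<tau>" using small by blast
    have "((\<lambda>t. h t - (h t + err \<delta> t)) has_integral (integral {0..\<tau>} h - 0)) {0..\<tau>}"
      using hi by (intro has_integral_diff id \<delta>(1,2) integrable_integral) (simp add: cbox_interval)
    then have "norm (integral {0..\<tau>} h - 0) \<le> e' / \<tau> * measure lborel (cbox 0 \<tau>)"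
      using \<delta>(3) e' \<tau> by (intro has_integral_bound) (auto simp: cbox_interval)
    then show ?thesis using \<tau> by (simp add: cbox_interval)
  qed
  then have "norm (integral {0..\<tau>} h) \<le> 0" by (rule field_le_epsilon)
  then have "integral {0..\<tau>} h = 0" by simp
  then have "(h has_integral 0) {0..\<tau>}" using hi integrable_integral[of h "{0..\<tau>}"] by (simp add: cbox_interval)
  then show ?thesis by (simp add: h_def[abs_def])
qed

section \<open>Yukawa potentials\<close>

text \<open>Cauchy's inequality turns the bound on \<open>h\<close> into a bound on its derivative,
  hence on difference quotients, and dominated convergence applies.\<close>

lemma holomorphic_parameter_integral:
  fixes h :: "complex \<Rightarrow> 'a \<Rightarrow> complex"
  assumes S: "open S"
    and hol: "\<And>y. (\<lambda>z. h z y) holomorphic_on S"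
    and meas: "\<And>z. z \<in> S \<Longrightarrow> h z \<in> borel_measurable M"
    and bound: "\<And>z y. z \<in> S \<Longrightarrow> norm (h z y) \<le> w y"
    and w: "integrable M w"
  shows "(\<lambda>z. LINT y|M. h z y) holomorphic_on S"
proof (unfold holomorphic_on_open[OF S], intro ballI)
  fix z0 assume z0: "z0 \<in> S"
  obtain e where e: "e > 0" "cball z0 e \<subseteq> S" using S z0 open_contains_cball_eq by blast
  \<comment> \<open>Half the radius, so that discs of radius \<open>r\<close> around points of
    \<open>ball z0 r\<close> stay inside \<open>S\<close>.\<close>
  define r where "r = e / 2"
  have r: "r > 0" "cball z0 (2 * r) \<subseteq> S" using e by (auto simp: r_def)
  have lip: "norm (h z y - h z0 y) \<le> w y / r * norm (z - z0)" if z: "z \<in> ball z0 r" for z y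
  proof (rule field_differentiable_bound[where f = "\<lambda>z. h z y" and f' = "deriv (\<lambda>z. h z y)"])
    show "convex (ball z0 r)" by simp
    fix u assume u: "u \<in> ball z0 r"
    have sub: "cball u r \<subseteq> S"
    proof
      fix v assume "v \<in> cball u r"
      then have "dist z0 v \<le> 2 * r" using u dist_triangle[of z0 v u] by simp
      then show "v \<in> S" using r(2) by auto
    qed
    then have "u \<in> S" using r(1) by auto
    show "((\<lambda>z. h z y) has_field_derivative deriv (\<lambda>z. h z y) u) (at u within ball z0 r)"
      using holomorphic_derivI[OF hol S \<open>u \<in> S\<close>] by (rule has_field_derivative_at_within)
    have "norm ((deriv ^^ 1) (\<lambda>z. h z y) u) \<le> fact 1 * w y / r ^ 1"
    proof (rule Cauchy_inequality)
      show "(\<lambda>z. h z y) holomorphic_on ball u r" using hol sub ball_subset_cball holomorphic_on_subset by (metis subset_trans)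
      show "continuous_on (cball u r) (\<lambda>z. h z y)" using holomorphic_on_imp_continuous_on[OF hol] sub continuous_on_subset by blast
      show "norm (h v y) \<le> w y" if "norm (u - v) = r" for v
        using sub that by (intro bound) (auto simp: dist_norm)
    qed (rule r(1))
    then show "norm (deriv (\<lambda>z. h z y) u) \<le> w y / r" by simp
  qed (use z r in auto)
  define D where "D y = deriv (\<lambda>z. h z y) z0" for y
  have int: "integrable M (h z)" if "z \<in> S" for z
    by (rule Bochner_Integration.integrable_bound[OF w meas[OF that]])
      (use bound[OF that] in \<open>auto intro!: AE_I2 order_trans[OF _ abs_ge_self]\<close>)
  have dq: "((\<lambda>z. (h z y - h z0 y) / (z - z0)) \<longlongrightarrow> D y) (at z0)" for y
    using holomorphic_derivI[OF hol S z0] unfolding D_def has_field_derivative_iff .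
  have "((\<lambda>z. ((LINT y|M. h z y) - (LINT y|M. h z0 y)) / (z - z0)) \<longlongrightarrow> (LINT y|M. D y)) (at z0)"
    unfolding tendsto_at_iff_sequentially
  proof (intro allI impI)
    fix X :: "nat \<Rightarrow> complex" assume X: "\<forall>i. X i \<in> UNIV - {z0}" "X \<longlonglongrightarrow> z0"
    have "\<forall>\<^sub>F i in sequentially. dist (X i) z0 < r" using X(2) r(1) by (rule tendstoD)
    then obtain N where N: "\<And>i. i \<ge> N \<Longrightarrow> X i \<in> ball z0 r" by (auto simp: eventually_sequentially dist_commute)
    define Y where "Y i = X (i + N)" for i
    have Y: "Y i \<noteq> z0" "Y i \<in> ball z0 r" for i using X(1) N by (auto simp: Y_def)
    have YS: "Y i \<in> S" for i using Y(2)[of i] r by auto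
    have Ylim: "Y \<longlonglongrightarrow> z0" unfolding Y_def using X(2) by (rule LIMSEQ_ignore_initial_segment)
    have pt: "(\<lambda>i. (h (Y i) y - h z0 y) / (Y i - z0)) \<longlonglongrightarrow> D y" for y
    proof (rule filterlim_compose[OF dq])
      show "filterlim Y (at z0) sequentially" using Ylim Y(1) by (auto simp: filterlim_at)
    qed
    have qm: "(\<lambda>y. (h (Y i) y - h z0 y) / (Y i - z0)) \<in> borel_measurable M" for i
      using meas[OF YS] meas[OF z0] by measurable
    have "(\<lambda>i. LINT y|M. (h (Y i) y - h z0 y) / (Y i - z0)) \<longlonglongrightarrow> (LINT y|M. D y)"
    proof (rule integral_dominated_convergence[where w = "\<lambda>y. w y / r"])
      show "D \<in> borel_measurable M" by (rule borel_measurable_LIMSEQ_metric[where f = "\<lambda>i y. (h (Y i) y - h z0 y) / (Y i - z0)", OF qm]) (use pt in auto)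
      show "integrable M (\<lambda>y. w y / r)" using w by simp
      show "AE y in M. norm ((h (Y i) y - h z0 y) / (Y i - z0)) \<le> w y / r" for i
      proof (intro AE_I2)
        fix y
        show "norm ((h (Y i) y - h z0 y) / (Y i - z0)) \<le> w y / r"
          using lip[OF Y(2), of i y] Y(1)[of i] by (simp add: norm_divide divide_le_eq)
      qed
    qed (use pt qm in auto)
    moreover have "(LINT y|M. (h (Y i) y - h z0 y) / (Y i - z0)) = ((LINT y|M. h (Y i) y) - (LINT y|M. h z0 y)) / (Y i - z0)" for i
      unfolding integral_divide_zero Bochner_Integration.integral_diff[OF int[OF YS] int[OF z0]] ..
    ultimately have "(\<lambda>i. ((LINT y|M. h (Y i) y) - (LINT y|M. h z0 y)) / (Y i - z0)) \<longlonglongrightarrow> (LINT y|M. D y)"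
      by (simp only:)
    from LIMSEQ_offset[OF this[unfolded Y_def]]
    show "((\<lambda>z. ((LINT y|M. h z y) - (LINT y|M. h z0 y)) / (z - z0)) \<circ> X) \<longlonglongrightarrow> (LINT y|M. D y)"
      by (simp add: o_def)
  qed
  then show "\<exists>f'. ((\<lambda>z. LINT y|M. h z y) has_field_derivative f') (at z0)"
    unfolding has_field_derivative_iff by blast
qed

section \<open>Great circles and analytic continuation along them\<close>

lemma great_circle_inner:
  fixes p q :: "'a::real_inner"
  assumes "norm p = R" "norm q = 1" "p \<bullet> q = 0"
  shows "(cos \<theta> *\<^sub>R p + (R * sin \<theta>) *\<^sub>R q) \<bullet> (cos \<theta> *\<^sub>R p + (R * sin \<theta>) *\<^sub>R q) = R\<^sup>2"
proof -
  have pq: "p \<bullet> p = R\<^sup>2" "q \<bullet> q = 1" "q \<bullet> p = 0" using assms by (simp_all add: dot_square_norm inner_commute)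
  have "(cos \<theta> *\<^sub>R p + (R * sin \<theta>) *\<^sub>R q) \<bullet> (cos \<theta> *\<^sub>R p + (R * sin \<theta>) *\<^sub>R q) =
     R\<^sup>2 * ((sin \<theta>)\<^sup>2 + (cos \<theta>)\<^sup>2)"
    unfolding inner_add_left inner_add_right inner_scaleR_left inner_scaleR_right pq assms(3)
    by (simp only: power2_eq_square algebra_simps)
  then show ?thesis by simp
qed

lemma great_circle_coordinates:
  fixes p x :: "real^3"
  assumes "norm p = R" "norm x = R" "R > 0"
  obtains q \<theta> where "norm q = 1" "p \<bullet> q = 0" "x = cos \<theta> *\<^sub>R p + (R * sin \<theta>) *\<^sub>R q"
proof -
  define a where "a = (x \<bullet> p) / R\<^sup>2"
  define v where "v = x - a *\<^sub>R p"
  have pp: "p \<bullet> p = R\<^sup>2" "x \<bullet> x = R\<^sup>2" using assms by (simp_all add: dot_square_norm)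
  have pv: "p \<bullet> v = 0" using assms by (simp add: v_def a_def pp inner_diff_right inner_commute)
  have "v \<bullet> v = x \<bullet> v" using pv by (simp add: v_def inner_diff_left)
  also have "\<dots> = R\<^sup>2 - a * (x \<bullet> p)" by (simp add: v_def inner_diff_right pp)
  also have "\<dots> = R\<^sup>2 * (1 - a\<^sup>2)" using assms(3) by (simp add: a_def field_simps power2_eq_square)
  finally have vv: "(norm v)\<^sup>2 = R\<^sup>2 * (1 - a\<^sup>2)" by (simp add: dot_square_norm)
  show ?thesis
  proof (cases "v = 0")
    \<comment> \<open>The point is \<open>p\<close> or its antipode, and any great circle through
      \<open>p\<close> serves.\<close>
    case True
    obtain q0 :: "real^3" where q0: "q0 \<noteq> 0" "orthogonal p q0"
      using orthogonal_to_vector_exists[of p] by auto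
    have "a\<^sup>2 = 1" using vv True assms(3) by simp
    then obtain \<theta> where th: "a = cos \<theta>" "0 = sin \<theta>" using sincos_total_2pi[of a 0] by auto
    show ?thesis
      by (rule that[of "q0 /\<^sub>R norm q0" \<theta>])
        (use q0 True th in \<open>auto simp: orthogonal_def v_def\<close>)
  next
    case False
    have "a\<^sup>2 + (norm v / R)\<^sup>2 = 1" using assms(3) by (simp add: power_divide vv)
    then obtain \<theta> where th: "a = cos \<theta>" "norm v / R = sin \<theta>" using sincos_total_2pi by metis
    then have "R * sin \<theta> = norm v" using assms(3) by (simp add: field_simps)
    then show ?thesis
      by (intro that[of "v /\<^sub>R norm v" \<theta>])
        (use False pv in \<open>auto simp: v_def simp flip: th(1)\<close>)
  qed
qed

text \<open>The fundamental solution of \<sigma>^2 - Laplacian in dimension three, up to the factor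
  4\<pi>.\<close>

definition yukawa :: "real \<Rightarrow> real \<Rightarrow> real" where
  "yukawa \<sigma> r = exp (- \<sigma> * r) / r"

lemma yukawa_bound: "\<sigma> > 0 \<Longrightarrow> d > 0 \<Longrightarrow> d \<le> r \<Longrightarrow> \<bar>yukawa \<sigma> r\<bar> \<le> 1 / d"
  unfolding yukawa_def abs_divide by (intro frac_le) auto

lemma kernel_integrable:
  fixes c :: "real^3 \<Rightarrow> real^3"
  assumes c: "integrable lebesgue c" "\<And>y. norm y > r1 \<Longrightarrow> c y = 0"
    and d: "d > 0" "norm x \<ge> r1 + d"
    and m: "K \<in> borel_measurable borel"
    and B: "\<And>z. d > 0 \<Longrightarrow> d \<le> norm z \<Longrightarrow> \<bar>K z\<bar> \<le> B"
  shows "integrable lebesgue (\<lambda>y. K (x - y) *\<^sub>R c y)"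
proof (rule Bochner_Integration.integrable_bound)
  show "integrable lebesgue (\<lambda>y. B *\<^sub>R c y)" using c(1) by (rule integrable_scaleR_right)
  have "(\<lambda>y. K (x - y)) \<in> borel_measurable borel" by (rule measurable_compose[OF _ m]) simp
  then have "(\<lambda>y. K (x - y)) \<in> borel_measurable lebesgue" by (simp add: measurable_completion)
  then show "(\<lambda>y. K (x - y) *\<^sub>R c y) \<in> borel_measurable lebesgue"
    using borel_measurable_integrable[OF c(1)] by (rule borel_measurable_scaleR)
  show "AE y in lebesgue. norm (K (x - y) *\<^sub>R c y) \<le> norm (B *\<^sub>R c y)"
  proof (intro AE_I2)
    fix y
    show "norm (K (x - y) *\<^sub>R c y) \<le> norm (B *\<^sub>R c y)"
    proof (cases "norm y > r1")
      case False
      then have "d \<le> norm (x - y)" using d norm_triangle_ineq2[of x y] by linarith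
      then have "\<bar>K (x - y)\<bar> \<le> \<bar>B\<bar>" using B[OF d(1)] by fastforce
      then show ?thesis by (simp add: mult_right_mono)
    qed (simp add: c(2))
  qed
qed

definition yukawa_potential :: "real \<Rightarrow> (real^3 \<Rightarrow> real^3) \<Rightarrow> real^3 \<Rightarrow> real^3" where
  "yukawa_potential \<sigma> c x = (LINT y|lebesgue. yukawa \<sigma> (norm (x - y)) *\<^sub>R c y)"

text \<open>Along a great circle \<open>x(\<theta>)\<close> the square distance \<open>|x(\<theta>) - y|\<^sup>2\<close> extends to complex
  \<open>\<theta>\<close> and keeps a positive real part in a strip, so the potential extends holomorphically.\<close>

lemma yukawa_great_circle_extension:
  fixes c :: "real^3 \<Rightarrow> real^3"
  assumes c: "integrable lebesgue c" "\<And>y. norm y > r1 \<Longrightarrow> c y = 0" and r1: "0 \<le> r1" "r1 < R" and \<sigma>: "\<sigma> > 0"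
    and p: "norm p = R" and q: "norm q = 1" "p \<bullet> q = 0"
  obtains \<beta> \<Phi> where "\<beta> > 0" "\<And>j. \<Phi> j holomorphic_on {z. \<bar>Im z\<bar> < \<beta>}"
    "\<And>j \<theta>. \<Phi> j (of_real \<theta>) = of_real (yukawa_potential \<sigma> c (cos \<theta> *\<^sub>R p + (R * sin \<theta>) *\<^sub>R q) $ j)"
proof -
  \<comment> \<open>Leaving the real axis by b replaces cos and sin by multiples of cosh b in the
    real part of the square distance. The constant \<open>C\<close> is the largest cosh b for which
    half of (R - r1)^2 survives, up to the summand 1 that keeps the denominator positive for r1 = 0.
    The strip is then chosen with cosh b \<le> C.\<close>
  define m where "m = (R - r1)\<^sup>2 / 2"
  have m: "m > 0" using r1 by (simp add: m_def)
  define C where "C = 1 + (R - r1)\<^sup>2 / (4 * R * r1 + 1)"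
  have den: "4 * R * r1 + 1 > 0" using r1 by (simp add: add_nonneg_pos)
  have "C > 1" using r1 den by (simp add: C_def)
  have "isCont cosh (0::real)" by (intro continuous_intros)
  then have "\<forall>\<^sub>F b in at 0. cosh b < C" 
    using order_tendstoD(2)[of "cosh :: real \<Rightarrow> real" "cosh 0" "at 0" C] \<open>C > 1\<close> by (simp add: isCont_def)
  then obtain \<beta> where \<beta>: "\<beta> > 0" "\<And>b::real. b \<noteq> 0 \<Longrightarrow> dist b 0 < \<beta> \<Longrightarrow> cosh b < C"
    unfolding eventually_at by blast
  have cosh: "cosh b \<le> C" if "\<bar>b\<bar> < \<beta>" for b
    using \<beta>(2)[of b] that \<open>C > 1\<close> by (cases "b = 0") auto
  define S where "S = {z. \<bar>Im z\<bar> < \<beta>}"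
  have S: "open S" unfolding S_def by (intro open_Collect_less continuous_intros)
  define Q where "Q z y = of_real (R\<^sup>2 + (norm y)\<^sup>2) - 2 * (cos z * of_real (p \<bullet> y) + sin z * of_real (R * (q \<bullet> y)))" for z :: complex and y :: "real^3"
  have ReQ: "Re (Q z y) \<ge> m" if z: "z \<in> S" and y: "norm y \<le> r1" for z y
  proof -
    have R: "R > 0" using r1 by simp
    define a b where "a = Re z" and "b = Im z"
    have cs: "Re (cos z) = cos a * cosh b" "Re (sin z) = sin a * cosh b"
      by (simp_all add: Re_cos Re_sin a_def b_def cosh_field_def field_simps)
    have "norm (cos a *\<^sub>R p + (R * sin a) *\<^sub>R q) = R"
      using great_circle_inner[OF p q, of a] R by (simp add: norm_eq_sqrt_inner)
    then have ip: "cos a * (p \<bullet> y) + sin a * (R * (q \<bullet> y)) \<le> R * norm y"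
      using norm_cauchy_schwarz[of "cos a *\<^sub>R p + (R * sin a) *\<^sub>R q" y] by (simp add: inner_add_left mult_ac)
    have ch: "1 \<le> cosh b" "cosh b \<le> C" using z cosh by (auto simp: S_def b_def cosh_real_ge_1)
    have "Re (Q z y) = R\<^sup>2 + (norm y)\<^sup>2 - 2 * cosh b * (cos a * (p \<bullet> y) + sin a * (R * (q \<bullet> y)))"
      by (simp add: Q_def cs algebra_simps)
    also have "\<dots> \<ge> R\<^sup>2 + (norm y)\<^sup>2 - 2 * cosh b * (R * norm y)"
      using ip ch by simp
    also have "R\<^sup>2 + (norm y)\<^sup>2 - 2 * cosh b * (R * norm y) \<ge> R\<^sup>2 + (norm y)\<^sup>2 - 2 * C * (R * norm y)"
      using ch R by (simp add: mult_right_mono)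
    also have "R\<^sup>2 + (norm y)\<^sup>2 - 2 * C * (R * norm y) = (R - norm y)\<^sup>2 - 2 * R * norm y * (C - 1)"
      by (simp add: power2_diff algebra_simps)
    also have "\<dots> \<ge> (R - r1)\<^sup>2 - 2 * R * r1 * (C - 1)"
    proof -
      have "(R - r1)\<^sup>2 \<le> (R - norm y)\<^sup>2" using y r1 by (intro power_mono) auto
      moreover have "2 * R * norm y * (C - 1) \<le> 2 * R * r1 * (C - 1)"
        using y R \<open>C > 1\<close> by (intro mult_right_mono mult_left_mono) auto
      ultimately show ?thesis by linarith
    qed
    also have "(R - r1)\<^sup>2 - 2 * R * r1 * (C - 1) \<ge> m"
    proof -
      have "2 * R * r1 * (C - 1) = (R - r1)\<^sup>2 * (2 * R * r1 / (4 * R * r1 + 1))" by (simp add: C_def)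
      also have "\<dots> \<le> (R - r1)\<^sup>2 * (1 / 2)"
        using den r1 by (intro mult_left_mono) (auto simp: field_simps)
      finally show ?thesis by (simp add: m_def)
    qed
    finally show ?thesis by simp
  qed
  define k where "k z y = exp (- of_real \<sigma> * csqrt (Q z y)) / csqrt (Q z y)" for z y
  \<comment> \<open>The principal square root has nonnegative real part, so the exponential never
    exceeds 1 in modulus.\<close>
  have kb: "norm (k z y) \<le> 1 / sqrt m" if "z \<in> S" "norm y \<le> r1" for z y
  proof -
    have "m \<le> norm (Q z y)" using ReQ[OF that] complex_Re_le_cmod order_trans by blast
    then have "sqrt m \<le> norm (csqrt (Q z y))" by (simp add: norm_csqrt)
    moreover have "norm (exp (- of_real \<sigma> * csqrt (Q z y))) \<le> 1"
      using Re_csqrt[of "Q z y"] \<sigma> by (simp add: norm_exp_eq_Re)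
    ultimately show ?thesis unfolding k_def norm_divide using m by (intro frac_le) auto
  qed
  have Qneg: "Q z y \<notin> \<real>\<^sub>\<le>\<^sub>0" if "z \<in> S" "norm y \<le> r1" for z y
    using ReQ[OF that] m by (auto simp: complex_nonpos_Reals_iff)
  define h where "h j z y = (indicator (cball 0 r1) y *\<^sub>R k z y) * of_real (c y $ j)" for j z and y :: "real^3"
  define \<Phi> where "\<Phi> j z = (LINT y|lebesgue. h j z y)" for j z
  have hol: "\<Phi> j holomorphic_on S" for j
    unfolding \<Phi>_def[abs_def]
  proof (rule holomorphic_parameter_integral[OF S])
    show "(\<lambda>z. h j z y) holomorphic_on S" for y
    proof (cases "y \<in> cball 0 r1")
      case True
      have hQ: "(\<lambda>z. Q z y) holomorphic_on S" unfolding Q_def by (intro holomorphic_intros)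
      have hs: "(\<lambda>z. csqrt (Q z y)) holomorphic_on S"
        by (rule holomorphic_on_csqrt'[OF hQ]) (use True Qneg in auto)
      have nz: "csqrt (Q z y) \<noteq> 0" if "z \<in> S" for z
        using Qneg[OF that, of y] True by auto
      have "(\<lambda>z. k z y) holomorphic_on S"
        unfolding k_def by (intro holomorphic_intros hs) (use nz in auto)
      then show ?thesis using True unfolding h_def by (intro holomorphic_intros) auto
    qed (simp add: h_def)
    have cj: "integrable lebesgue (\<lambda>y. c y $ j)"
      using integrable_bounded_linear[OF bounded_linear_vec_nth c(1)] .
    show "h j z \<in> borel_measurable lebesgue" if z: "z \<in> S" for z
    proof -
      have "continuous_on (cball 0 r1) (k z)"
      proof -
        have "continuous_on (cball 0 r1) (Q z)" unfolding Q_def by (intro continuous_intros)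
        then have "continuous_on (cball 0 r1) (\<lambda>y. csqrt (Q z y))"
          by (rule continuous_on_compose2[OF holomorphic_on_imp_continuous_on[OF holomorphic_on_csqrt]])
            (use Qneg[OF z] in auto)
        moreover have "csqrt (Q z y) \<noteq> 0" if "y \<in> cball 0 r1" for y
          using Qneg[OF z, of y] that by auto
        ultimately show "continuous_on (cball 0 r1) (k z)"
          unfolding k_def[abs_def] by (intro continuous_intros) auto
      qed
      then have "(\<lambda>y. indicator (cball 0 r1) y *\<^sub>R k z y) \<in> borel_measurable borel"
        by (intro borel_measurable_continuous_on_indicator) auto
      then have "(\<lambda>y. indicator (cball 0 r1) y *\<^sub>R k z y) \<in> borel_measurable lebesgue"
        by (simp add: measurable_completion)
      moreover have "(\<lambda>y. complex_of_real (c y $ j)) \<in> borel_measurable lebesgue"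
        using borel_measurable_integrable[OF cj] by measurable
      ultimately show ?thesis unfolding h_def[abs_def] by (rule borel_measurable_times)
    qed
    show "integrable lebesgue (\<lambda>y. 1 / sqrt m * \<bar>c y $ j\<bar>)" using cj by simp
    show "norm (h j z y) \<le> 1 / sqrt m * \<bar>c y $ j\<bar>" if "z \<in> S" for z y
      using kb[OF that, of y] m by (cases "y \<in> cball 0 r1") (auto simp: h_def norm_mult intro!: mult_right_mono simp del: times_divide_eq_left)
  qed
  have val: "\<Phi> j (of_real \<theta>) = of_real (yukawa_potential \<sigma> c (cos \<theta> *\<^sub>R p + (R * sin \<theta>) *\<^sub>R q) $ j)" for j \<theta>
  proof -
    define x where "x = cos \<theta> *\<^sub>R p + (R * sin \<theta>) *\<^sub>R q"
    have nx: "x \<bullet> x = R\<^sup>2"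
      unfolding x_def by (rule great_circle_inner[OF p q])
    then have "norm x = R" using r1 by (simp add: norm_eq_sqrt_inner)
    have "h j (of_real \<theta>) y = of_real (yukawa \<sigma> (norm (x - y)) * c y $ j)" for y
    proof (cases "norm y \<le> r1")
      case True
      have "(norm (x - y))\<^sup>2 = R\<^sup>2 + (norm y)\<^sup>2 - 2 * (x \<bullet> y)"
        by (simp add: power2_norm_eq_inner inner_diff_left inner_diff_right nx inner_commute)
      then have "Q (of_real \<theta>) y = of_real ((norm (x - y))\<^sup>2)"
        by (simp add: Q_def x_def inner_add_left cos_of_real sin_of_real mult_ac)
      then have "csqrt (Q (of_real \<theta>) y) = of_real (norm (x - y))" by simp
      then show ?thesis using True by (simp add: h_def k_def yukawa_def flip: exp_of_real)
    qed (use c(2) in \<open>simp add: h_def\<close>)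
    then have "\<Phi> j (of_real \<theta>) = of_real (LINT y|lebesgue. yukawa \<sigma> (norm (x - y)) * c y $ j)"
      by (simp add: \<Phi>_def del: of_real_mult)
    moreover have "(LINT y|lebesgue. yukawa \<sigma> (norm (x - y)) * c y $ j) = yukawa_potential \<sigma> c x $ j"
    proof -
      have "integrable lebesgue (\<lambda>y. yukawa \<sigma> (norm (x - y)) *\<^sub>R c y)"
        by (rule kernel_integrable[where ?r1.0 = r1 and K = "\<lambda>z. yukawa \<sigma> (norm z)" and d = "R - r1", OF c _ _ _ yukawa_bound[OF \<sigma>]])
          (use r1 \<open>norm x = R\<close> in \<open>auto simp: yukawa_def\<close>)
      from integral_bounded_linear[OF bounded_linear_vec_nth[of j] this] show ?thesis
        by (simp add: yukawa_potential_def)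
    qed
    ultimately show ?thesis by (simp add: x_def)
  qed
  show ?thesis using that[OF \<beta>(1), of \<Phi>] hol val by (simp add: S_def)
qed


text \<open>Join a point \<open>p\<close> of \<Gamma> to \<open>x\<close> by a great circle. Since
  \<Gamma> is relatively open, the circle stays in \<Gamma> for small angles, and a holomorphic
  function that vanishes on a real interval vanishes on the whole strip.\<close>

lemma yukawa_analytic_continuation:
  fixes c :: "real^3 \<Rightarrow> real^3"
  assumes c: "integrable lebesgue c" "\<And>y. norm y > r1 \<Longrightarrow> c y = 0" and r1: "0 \<le> r1" "r1 < R" and \<sigma>: "\<sigma> > 0"
    and \<Gamma>: "openin (top_of_set (sphere 0 R)) \<Gamma>" "\<Gamma> \<noteq> {}"
    and zero: "\<And>x. x \<in> \<Gamma> \<Longrightarrow> cross3 x (yukawa_potential \<sigma> c x) = 0"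
    and x: "norm x = R"
  shows "cross3 x (yukawa_potential \<sigma> c x) = 0"
proof -
  obtain p where p: "p \<in> \<Gamma>" using \<Gamma>(2) by blast
  then have np: "norm p = R" using openin_imp_subset[OF \<Gamma>(1)] by auto
  obtain q \<theta>1 where q: "norm q = 1" "p \<bullet> q = 0" and x1: "x = cos \<theta>1 *\<^sub>R p + (R * sin \<theta>1) *\<^sub>R q"
    by (rule great_circle_coordinates[OF np x _ that]) (use r1 in auto)
  obtain \<beta> \<Phi> where \<beta>: "\<beta> > 0" and hol: "\<And>j. \<Phi> j holomorphic_on {z. \<bar>Im z\<bar> < \<beta>}"
    and val: "\<And>j \<theta>. \<Phi> j (of_real \<theta>) = of_real (yukawa_potential \<sigma> c (cos \<theta> *\<^sub>R p + (R * sin \<theta>) *\<^sub>R q) $ j)"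
    by (rule yukawa_great_circle_extension[OF c r1 \<sigma> np q that])
  define S where "S = {z. \<bar>Im z\<bar> < \<beta>}"
  define X where "X \<theta> = cos \<theta> *\<^sub>R p + (R * sin \<theta>) *\<^sub>R q" for \<theta> :: real
  have nX: "norm (X \<theta>) = R" for \<theta>
    using great_circle_inner[OF np q, of \<theta>] r1 by (simp add: norm_eq_sqrt_inner X_def)
  obtain T where T: "open T" "\<Gamma> = sphere 0 R \<inter> T" using \<Gamma>(1) by (auto simp: openin_open)
  have "continuous_on UNIV X" unfolding X_def[abs_def] by (intro continuous_intros)
  then have opn: "open (X -` T)" using T(1) by (rule open_vimage[rotated])
  have "X 0 = p" by (simp add: X_def)
  then have "0 \<in> X -` T" using p T by auto
  then obtain e where e: "e > 0" "\<And>\<theta>. \<bar>\<theta>\<bar> < e \<Longrightarrow> X \<theta> \<in> T"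
  proof -
    obtain e where "e > 0" "ball 0 e \<subseteq> X -` T"
      using opn \<open>0 \<in> X -` T\<close> open_contains_ball_eq by blast
    then show ?thesis by (intro that[of e]) (auto simp: subset_eq dist_real_def)
  qed
  then have X\<Gamma>: "X \<theta> \<in> \<Gamma>" if "\<bar>\<theta>\<bar> < e" for \<theta> using that nX T(2) by auto
  define Xc where "Xc j z = cos z * of_real (p $ j) + of_real R * sin z * of_real (q $ j)" for j :: 3 and z :: complex
  have Xc: "Xc j (of_real \<theta>) = of_real (X \<theta> $ j)" for j \<theta>
    by (simp add: Xc_def X_def cos_of_real sin_of_real)
  \<comment> \<open>The components of the cross product as 2 by 2 minors, which extend
    holomorphically together with their entries.\<close>
  define G where "G i j z = Xc i z * \<Phi> j z - Xc j z * \<Phi> i z" for i j z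
  have Gval: "G i j (of_real \<theta>) = of_real (X \<theta> $ i * yukawa_potential \<sigma> c (X \<theta>) $ j - X \<theta> $ j * yukawa_potential \<sigma> c (X \<theta>) $ i)" for i j \<theta>
    unfolding G_def Xc val by (simp add: X_def)
  have cr: "cross3 v w = 0 \<longleftrightarrow> (\<forall>i j. v $ i * w $ j - v $ j * w $ i = 0)" for v w :: "real^3"
    by (auto simp: cross3_def vec_eq_iff forall_3)
  have G0: "G i j (of_real \<theta>) = 0" if "\<bar>\<theta>\<bar> < e" for i j \<theta>
    using zero[OF X\<Gamma>[OF that]] unfolding cr Gval by simp
  have "G i j (of_real \<theta>1) = 0" for i j
  proof (rule analytic_continuation[where f = "G i j" and U = "of_real ` {-e<..<e}" and S = S and \<xi> = 0])
    show "G i j holomorphic_on S" unfolding G_def[abs_def] Xc_def S_def by (intro holomorphic_intros hol)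
    show "open S" unfolding S_def by (intro open_Collect_less continuous_intros)
    have "S = {z. Im z < \<beta>} \<inter> {z. Im z > - \<beta>}" by (auto simp: S_def)
    then show "connected S" by (simp add: convex_connected convex_Int convex_halfspace_Im_lt convex_halfspace_Im_gt)
    show "of_real ` {-e<..<e} \<subseteq> S" "0 \<in> S" "of_real \<theta>1 \<in> S" using \<beta> by (auto simp: S_def)
    show "G i j z = 0" if "z \<in> of_real ` {-e<..<e}" for z using that G0 by auto
    show "0 islimpt (of_real ` {-e<..<e} :: complex set)"
      unfolding islimpt_approachable
    proof (intro allI impI)
      fix d :: real assume "d > 0"
      then show "\<exists>z\<in>of_real ` {-e<..<e}. z \<noteq> (0::complex) \<and> dist z 0 < d"
        using e(1) by (intro bexI[of _ "of_real (min d e / 2)"] imageI) auto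
    qed
  qed
  then show ?thesis unfolding cr Gval of_real_eq_0_iff using x1 by (simp add: X_def)
qed

section \<open>Convolution with kernels that are singular only at the origin\<close>

definition conv :: "(real^3 \<Rightarrow> real) \<Rightarrow> (real^3 \<Rightarrow> real) \<Rightarrow> real^3 \<Rightarrow> real" where
  "conv K f x = (LINT y|lebesgue. K (x - y) * f y)"

definition has_exterior_derivative :: "real^3 \<Rightarrow> (real^3 \<Rightarrow> real) \<Rightarrow> (real^3 \<Rightarrow> real) \<Rightarrow> bool" where
  "has_exterior_derivative e K DK \<longleftrightarrow>
     (\<forall>z. z \<noteq> 0 \<longrightarrow> ((\<lambda>t. K (z + t *\<^sub>R e)) has_real_derivative DK z) (at 0))"

text \<open>At points outside the ball that carries the density, the convolution meets the kernel
  only away from the origin. Continuity and boundedness there are what dominated convergence asks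
  for.\<close>

definition exterior_kernel :: "(real^3 \<Rightarrow> real) \<Rightarrow> bool" where
  "exterior_kernel K \<longleftrightarrow> continuous_on (- {0}) K \<and> (\<forall>\<delta>>0. \<exists>B. \<forall>z. norm z \<ge> \<delta> \<longrightarrow> \<bar>K z\<bar> \<le> B)"

lemma exterior_kernel_measurable:
  assumes "exterior_kernel K" shows "K \<in> borel_measurable borel"
proof -
  have "(\<lambda>z. indicator (- {0}) z *\<^sub>R K z) \<in> borel_measurable borel"
    using assms by (intro borel_measurable_continuous_on_indicator) (auto simp: exterior_kernel_def)
  then have "(\<lambda>z. indicator (- {0}) z *\<^sub>R K z + indicator {0} z *\<^sub>R K 0) \<in> borel_measurable borel" by measurable
  also have "(\<lambda>z. indicator (- {0}) z *\<^sub>R K z + indicator {0} z *\<^sub>R K 0) = K"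
    by (auto simp: fun_eq_iff indicator_def)
  finally show ?thesis .
qed

context
  fixes f :: "real^3 \<Rightarrow> real" and r1 :: real
  assumes f: "integrable lebesgue f" "\<And>y. norm y > r1 \<Longrightarrow> f y = 0"
begin

lemma conv_integrand:
  assumes K: "exterior_kernel K" and d: "\<delta> > 0" "norm x \<ge> r1 + \<delta>"
    and B: "\<And>z. norm z \<ge> \<delta> \<Longrightarrow> \<bar>K z\<bar> \<le> B"
  shows "(\<lambda>y. K (x - y) * f y) \<in> borel_measurable lebesgue" "\<bar>K (x - y) * f y\<bar> \<le> B * \<bar>f y\<bar>"
    "integrable lebesgue (\<lambda>y. K (x - y) * f y)"
    "\<bar>conv K f x\<bar> \<le> B * (LINT y|lebesgue. \<bar>f y\<bar>)"
proof -
  have "(\<lambda>y. K (x - y)) \<in> borel_measurable borel"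
    by (rule measurable_compose[OF _ exterior_kernel_measurable[OF K]]) simp
  then have "(\<lambda>y. K (x - y)) \<in> borel_measurable lebesgue" by (simp add: measurable_completion)
  then show m: "(\<lambda>y. K (x - y) * f y) \<in> borel_measurable lebesgue"
    using borel_measurable_integrable[OF f(1)] by (rule borel_measurable_times)
  show b: "\<bar>K (x - y) * f y\<bar> \<le> B * \<bar>f y\<bar>" for y
  proof (cases "norm y > r1")
    case False
    then have "\<delta> \<le> norm (x - y)" using d norm_triangle_ineq2[of x y] by linarith
    then show ?thesis using B by (simp add: abs_mult mult_right_mono)
  qed (simp add: f(2))
  have i: "integrable lebesgue (\<lambda>y. B * \<bar>f y\<bar>)" using f(1) by simp
  show int: "integrable lebesgue (\<lambda>y. K (x - y) * f y)"
    by (rule Bochner_Integration.integrable_bound[OF i m]) (use b in \<open>auto intro!: AE_I2 order_trans[OF _ abs_ge_self]\<close>)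
  have "\<bar>conv K f x\<bar> \<le> (LINT y|lebesgue. \<bar>K (x - y) * f y\<bar>)"
    unfolding conv_def using integral_norm_bound[of lebesgue "\<lambda>y. K (x - y) * f y"] by simp
  also have "\<dots> \<le> (LINT y|lebesgue. B * \<bar>f y\<bar>)"
    by (rule integral_mono) (use int i b in auto)
  finally show "\<bar>conv K f x\<bar> \<le> B * (LINT y|lebesgue. \<bar>f y\<bar>)" by simp
qed

lemma conv_continuous_on:
  assumes K: "exterior_kernel K"
  shows "continuous_on {x. norm x > r1} (conv K f)"
proof (intro continuous_at_imp_continuous_on ballI)
  fix x :: "real^3" assume "x \<in> {x. norm x > r1}"
  then have x: "norm x > r1" by simp
  \<comment> \<open>Half the distance to the ball that carries \<open>f\<close>: points within
    \<delta> of \<open>x\<close> are still at distance \<delta> from it.\<close>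
  define \<delta> where "\<delta> = (norm x - r1) / 2"
  have "\<delta> > 0" using x by (simp add: \<delta>_def)
  moreover have "norm x = r1 + 2 * \<delta>" by (simp add: \<delta>_def field_simps)
  ultimately have \<delta>: "\<delta> > 0" "norm x = r1 + 2 * \<delta>" by auto
  obtain B where B: "\<And>z. norm z \<ge> \<delta> \<Longrightarrow> \<bar>K z\<bar> \<le> B" using K \<delta> unfolding exterior_kernel_def by metis
  show "isCont (conv K f) x"
    unfolding isCont_def tendsto_at_iff_sequentially
  proof (intro allI impI)
    fix X assume "\<forall>i. X i \<in> UNIV - {x}" and X: "X \<longlonglongrightarrow> x"
    have "\<forall>\<^sub>F i in sequentially. dist (X i) x < \<delta>" using X \<delta>(1) by (rule tendstoD)
    then obtain N where N: "\<And>i. i \<ge> N \<Longrightarrow> dist (X i) x < \<delta>" by (auto simp: eventually_sequentially)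
    define Y where "Y i = X (i + N)" for i
    have Y: "norm (Y i) \<ge> r1 + \<delta>" for i
      using N[of "i + N"] norm_triangle_ineq3[of "Y i" x] \<delta> by (simp add: Y_def dist_norm)
    have Ylim: "Y \<longlonglongrightarrow> x" unfolding Y_def using X by (rule LIMSEQ_ignore_initial_segment)
    have "(\<lambda>i. LINT y|lebesgue. K (Y i - y) * f y) \<longlonglongrightarrow> (LINT y|lebesgue. K (x - y) * f y)"
    proof (rule integral_dominated_convergence[where w = "\<lambda>y. B * \<bar>f y\<bar>"])
      show "(\<lambda>y. K (x - y) * f y) \<in> borel_measurable lebesgue"
        by (rule conv_integrand(1)[OF K \<delta>(1) _ B]) (use \<delta> in auto)
      show "(\<lambda>y. K (Y i - y) * f y) \<in> borel_measurable lebesgue" for i by (rule conv_integrand(1)[OF K \<delta>(1) Y B])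
      show "integrable lebesgue (\<lambda>y. B * \<bar>f y\<bar>)" using f(1) by simp
      show "AE y in lebesgue. norm (K (Y i - y) * f y) \<le> B * \<bar>f y\<bar>" for i
        using conv_integrand(2)[OF K \<delta>(1) Y B] by simp
      show "AE y in lebesgue. (\<lambda>i. K (Y i - y) * f y) \<longlonglongrightarrow> K (x - y) * f y"
      proof (intro AE_I2)
        fix y
        show "(\<lambda>i. K (Y i - y) * f y) \<longlonglongrightarrow> K (x - y) * f y"
        proof (cases "norm y > r1")
          case False
          then have "x - y \<noteq> 0" using x by auto
          then have "isCont K (x - y)"
            using K continuous_on_eq_continuous_at[OF open_Compl[OF closed_singleton[of 0]], of K] by (auto simp: exterior_kernel_def)
          moreover have "(\<lambda>i. Y i - y) \<longlonglongrightarrow> x - y" by (intro tendsto_intros Ylim)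
          ultimately have "(\<lambda>i. K (Y i - y)) \<longlonglongrightarrow> K (x - y)" by (rule isCont_tendsto_compose)
          then show ?thesis by (rule tendsto_mult[OF _ tendsto_const])
        qed (simp add: f(2))
      qed
    qed
    then have "(\<lambda>i. conv K f (X (i + N))) \<longlonglongrightarrow> conv K f x" by (simp add: conv_def Y_def)
    from LIMSEQ_offset[OF this] show "(conv K f \<circ> X) \<longlonglongrightarrow> conv K f x" by (simp add: o_def)
  qed
qed

text \<open>Difference quotients of the kernel are bounded through the mean value theorem by the
  supremum of \<open>DK\<close> on the segment. For increments up to \<delta> this segment keeps
  distance \<delta> from the singularity.\<close>

lemma conv_line_derivative:
  assumes K: "exterior_kernel K" and DK: "exterior_kernel DK" "has_exterior_derivative e K DK"
    and e: "norm e = 1" and x: "norm x > r1"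
  shows "((\<lambda>t. conv K f (x + t *\<^sub>R e)) has_real_derivative conv DK f x) (at 0)"
proof -
  define \<delta> where "\<delta> = (norm x - r1) / 2"
  have "\<delta> > 0" using x by (simp add: \<delta>_def)
  moreover have "norm x = r1 + 2 * \<delta>" by (simp add: \<delta>_def field_simps)
  ultimately have \<delta>: "\<delta> > 0" "norm x = r1 + 2 * \<delta>" by auto
  obtain B where B: "\<And>z. norm z \<ge> \<delta> \<Longrightarrow> \<bar>K z\<bar> \<le> B" using K \<delta> unfolding exterior_kernel_def by metis
  obtain B' where B': "\<And>z. norm z \<ge> \<delta> \<Longrightarrow> \<bar>DK z\<bar> \<le> B'" using DK(1) \<delta> unfolding exterior_kernel_def by metis
  have nz: "norm (x + t *\<^sub>R e) \<ge> r1 + \<delta>" if "\<bar>t\<bar> \<le> \<delta>" for t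
    using norm_triangle_ineq4[of "x + t *\<^sub>R e" "t *\<^sub>R e"] that \<delta> e by simp
  have line: "((\<lambda>t. K (z + t *\<^sub>R e)) has_real_derivative DK (z + u *\<^sub>R e)) (at u)" if "z + u *\<^sub>R e \<noteq> 0" for z u
  proof -
    have "((\<lambda>t. K ((z + u *\<^sub>R e) + (t - u) *\<^sub>R e)) has_real_derivative DK (z + u *\<^sub>R e) * 1) (at u)"
      by (rule DERIV_chain2[where g = "\<lambda>t. t - u"])
        (use DK(2) that in \<open>auto intro!: derivative_eq_intros simp: has_exterior_derivative_def\<close>)
    then show ?thesis by (simp add: algebra_simps)
  qed
  have lip: "\<bar>(K (x + t *\<^sub>R e - y) - K (x - y)) / t * f y\<bar> \<le> B' * \<bar>f y\<bar>" if t: "\<bar>t\<bar> \<le> \<delta>" "t \<noteq> 0" for t y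
  proof (cases "norm y > r1")
    case False
    have far: "norm (x - y + u *\<^sub>R e) \<ge> \<delta>" if "\<bar>u\<bar> \<le> \<delta>" for u
      using nz[OF that] False norm_triangle_ineq2[of "x + u *\<^sub>R e" y] by (simp add: algebra_simps)
    have "norm (K (x - y + t *\<^sub>R e) - K (x - y + 0 *\<^sub>R e)) \<le> B' * norm (t - 0)"
    proof (rule field_differentiable_bound[where f = "\<lambda>u. K (x - y + u *\<^sub>R e)" and f' = "\<lambda>u. DK (x - y + u *\<^sub>R e)"])
      show "convex {-\<delta>..\<delta>}" by simp
      fix u assume "u \<in> {-\<delta>..\<delta>}"
      then have u: "\<delta> \<le> norm (x - y + u *\<^sub>R e)" using far by auto
      then show "norm (DK (x - y + u *\<^sub>R e)) \<le> B'" using B' by simp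
      have "x - y + u *\<^sub>R e \<noteq> 0" using u \<delta>(1) by auto
      then show "((\<lambda>u. K (x - y + u *\<^sub>R e)) has_field_derivative DK (x - y + u *\<^sub>R e)) (at u within {-\<delta>..\<delta>})"
        by (rule has_field_derivative_at_within[OF line])
    qed (use t \<delta> in auto)
    then have "\<bar>(K (x + t *\<^sub>R e - y) - K (x - y)) / t\<bar> \<le> B'"
      using t by (simp add: abs_divide divide_le_eq algebra_simps)
    then show ?thesis unfolding abs_mult by (rule mult_right_mono) simp
  qed (simp add: f(2))
  have "((\<lambda>t. (conv K f (x + t *\<^sub>R e) - conv K f x) / t) \<longlongrightarrow> conv DK f x) (at 0)"
    unfolding tendsto_at_iff_sequentially
  proof (intro allI impI)
    fix X :: "nat \<Rightarrow> real" assume X: "\<forall>i. X i \<in> UNIV - {0}" "X \<longlonglongrightarrow> 0"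
    have "\<forall>\<^sub>F i in sequentially. dist (X i) 0 < \<delta>" using X(2) \<delta>(1) by (rule tendstoD)
    then obtain N where N: "\<And>i. i \<ge> N \<Longrightarrow> \<bar>X i\<bar> < \<delta>" by (auto simp: eventually_sequentially)
    define Y where "Y i = X (i + N)" for i
    have Y: "Y i \<noteq> 0" "\<bar>Y i\<bar> \<le> \<delta>" for i using X(1) N[of "i + N"] by (auto simp: Y_def)
    have Ylim: "Y \<longlonglongrightarrow> 0" unfolding Y_def using X(2) by (rule LIMSEQ_ignore_initial_segment)
    note ci = conv_integrand(1,3)[OF K \<delta>(1) nz[OF Y(2)] B] conv_integrand(1,3)[OF K \<delta>(1) _ B, of x]
    have "(\<lambda>i. LINT y|lebesgue. (K (x + Y i *\<^sub>R e - y) - K (x - y)) / Y i * f y) \<longlonglongrightarrow> (LINT y|lebesgue. DK (x - y) * f y)"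
    proof (rule integral_dominated_convergence[where w = "\<lambda>y. B' * \<bar>f y\<bar>"])
      show "(\<lambda>y. DK (x - y) * f y) \<in> borel_measurable lebesgue"
        by (rule conv_integrand(1)[OF DK(1) \<delta>(1) _ B']) (use \<delta> in auto)
      show "(\<lambda>y. (K (x + Y i *\<^sub>R e - y) - K (x - y)) / Y i * f y) \<in> borel_measurable lebesgue" for i
      proof -
        have "(\<lambda>y. (K (x + Y i *\<^sub>R e - y) * f y - K (x - y) * f y) / Y i) \<in> borel_measurable lebesgue"
          using ci \<delta> by (intro borel_measurable_divide borel_measurable_diff) auto
        then show ?thesis by (simp add: algebra_simps)
      qed
      show "integrable lebesgue (\<lambda>y. B' * \<bar>f y\<bar>)" using f(1) by simp
      show "AE y in lebesgue. norm ((K (x + Y i *\<^sub>R e - y) - K (x - y)) / Y i * f y) \<le> B' * \<bar>f y\<bar>" for i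
        using lip[OF Y(2,1)] by simp
      show "AE y in lebesgue. (\<lambda>i. (K (x + Y i *\<^sub>R e - y) - K (x - y)) / Y i * f y) \<longlonglongrightarrow> DK (x - y) * f y"
      proof (intro AE_I2)
        fix y
        show "(\<lambda>i. (K (x + Y i *\<^sub>R e - y) - K (x - y)) / Y i * f y) \<longlonglongrightarrow> DK (x - y) * f y"
        proof (cases "norm y > r1")
          case False
          then have "x - y \<noteq> 0" using x by auto
          then have "((\<lambda>h. (K (x - y + h *\<^sub>R e) - K (x - y)) / h) \<longlongrightarrow> DK (x - y)) (at 0)"
            using DK(2) unfolding has_exterior_derivative_def DERIV_def by auto
          moreover have "filterlim Y (at 0) sequentially" using Ylim Y(1) by (auto simp: filterlim_at)
          ultimately have "(\<lambda>i. (K (x - y + Y i *\<^sub>R e) - K (x - y)) / Y i) \<longlonglongrightarrow> DK (x - y)"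
            by (rule filterlim_compose)
          then have "(\<lambda>i. (K (x - y + Y i *\<^sub>R e) - K (x - y)) / Y i * f y) \<longlonglongrightarrow> DK (x - y) * f y"
            by (intro tendsto_mult tendsto_const)
          then show ?thesis by (simp add: algebra_simps)
        qed (simp add: f(2))
      qed
    qed
    moreover have "(LINT y|lebesgue. (K (x + Y i *\<^sub>R e - y) - K (x - y)) / Y i * f y) = (conv K f (x + Y i *\<^sub>R e) - conv K f x) / Y i" for i
    proof -
      have "(LINT y|lebesgue. (K (x + Y i *\<^sub>R e - y) - K (x - y)) / Y i * f y) =
        (LINT y|lebesgue. (K (x + Y i *\<^sub>R e - y) * f y - K (x - y) * f y) / Y i)"
        by (simp add: algebra_simps)
      also have "\<dots> = ((LINT y|lebesgue. K (x + Y i *\<^sub>R e - y) * f y) - (LINT y|lebesgue. K (x - y) * f y)) / Y i"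
        unfolding integral_divide_zero using ci \<delta> by (subst Bochner_Integration.integral_diff) auto
      finally show ?thesis by (simp add: conv_def)
    qed
    ultimately have "(\<lambda>i. (conv K f (x + X (i + N) *\<^sub>R e) - conv K f x) / X (i + N)) \<longlonglongrightarrow> conv DK f x"
      by (simp only: conv_def Y_def)
    from LIMSEQ_offset[OF this]
    show "((\<lambda>t. (conv K f (x + t *\<^sub>R e) - conv K f x) / t) \<circ> X) \<longlonglongrightarrow> conv DK f x" by (simp add: o_def)
  qed
  then show ?thesis by (simp add: DERIV_def)
qed

end

section \<open>The Yukawa kernel, its gradient and its Hessian\<close>

definition yukawa1 :: "real \<Rightarrow> real \<Rightarrow> real" where
  "yukawa1 \<sigma> r = - exp (- \<sigma> * r) * (\<sigma> / r ^ 2 + 1 / r ^ 3)"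

definition yukawa2 :: "real \<Rightarrow> real \<Rightarrow> real" where
  "yukawa2 \<sigma> r = exp (- \<sigma> * r) * (\<sigma>\<^sup>2 / r ^ 3 + 3 * \<sigma> / r ^ 4 + 3 / r ^ 5)"

text \<open>Each radial derivative is divided by r. A Cartesian derivative of K(|z|) is then a
  coordinate times the next function in the list, without further quotients.\<close>

lemma yukawa_DERIV:
  assumes "r > 0"
  shows "(yukawa \<sigma> has_real_derivative r * yukawa1 \<sigma> r) (at r)"
    "(yukawa1 \<sigma> has_real_derivative r * yukawa2 \<sigma> r) (at r)"
proof -
  show "(yukawa \<sigma> has_real_derivative r * yukawa1 \<sigma> r) (at r)"
    unfolding yukawa_def[abs_def] yukawa1_def using assms
    by (auto intro!: derivative_eq_intros simp: field_simps eval_nat_numeral)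
  show "(yukawa1 \<sigma> has_real_derivative r * yukawa2 \<sigma> r) (at r)"
    unfolding yukawa1_def[abs_def] yukawa2_def using assms
    by (auto intro!: derivative_eq_intros simp: field_simps eval_nat_numeral)
qed

text \<open>The equation Laplacian K = \<sigma>^2 K in radial form: the trace of the Hessian, with
  \<open>yukawa1\<close> on the diagonal and z_i z_l \<open>yukawa2\<close> in every entry.\<close>

lemma yukawa_laplace: "r > 0 \<Longrightarrow> 3 * yukawa1 \<sigma> r + r\<^sup>2 * yukawa2 \<sigma> r = \<sigma>\<^sup>2 * yukawa \<sigma> r"
  by (simp add: yukawa_def yukawa1_def yukawa2_def field_simps eval_nat_numeral)

lemma radial_line_derivative:
  fixes z e :: "real^3"
  assumes "(h has_real_derivative norm z * k) (at (norm z))" "z \<noteq> 0"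
  shows "((\<lambda>t. h (norm (z + t *\<^sub>R e))) has_real_derivative (z \<bullet> e) * k) (at 0)"
proof -
  have "((\<lambda>t. norm (z + t *\<^sub>R e)) has_derivative (\<lambda>t. (t *\<^sub>R e) \<bullet> sgn (z + 0 *\<^sub>R e))) (at 0)"
    by (rule has_derivative_compose[OF _ has_derivative_norm]) (use assms in \<open>auto intro!: derivative_eq_intros\<close>)
  then have "((\<lambda>t. norm (z + t *\<^sub>R e)) has_real_derivative (z \<bullet> e) / norm z) (at 0)"
  proof -
    have "(\<lambda>t. (t *\<^sub>R e) \<bullet> sgn (z + 0 *\<^sub>R e)) = (*) ((z \<bullet> e) / norm z)"
      by (simp add: fun_eq_iff sgn_div_norm inner_commute divide_inverse mult_ac)
    then show ?thesis
      using \<open>((\<lambda>t. norm (z + t *\<^sub>R e)) has_derivative (\<lambda>t. (t *\<^sub>R e) \<bullet> sgn (z + 0 *\<^sub>R e))) (at 0)\<close>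
      by (simp only: has_field_derivative_def)
  qed
  from DERIV_chain2[where f = h, OF _ this, of "norm z * k"] assms show ?thesis by (simp add: mult.commute)
qed

definition ker0 :: "real \<Rightarrow> real^3 \<Rightarrow> real" where "ker0 \<sigma> z = yukawa \<sigma> (norm z)"
definition ker1 :: "real \<Rightarrow> 3 \<Rightarrow> real^3 \<Rightarrow> real" where "ker1 \<sigma> i z = z $ i * yukawa1 \<sigma> (norm z)"
definition ker2 :: "real \<Rightarrow> 3 \<Rightarrow> 3 \<Rightarrow> real^3 \<Rightarrow> real" where
  "ker2 \<sigma> l i z = (if l = i then yukawa1 \<sigma> (norm z) else 0) + z $ i * (z $ l * yukawa2 \<sigma> (norm z))"

lemma ker_derivatives:
  "has_exterior_derivative (axis i 1) (ker0 \<sigma>) (ker1 \<sigma> i)"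
  "has_exterior_derivative (axis l 1) (ker1 \<sigma> i) (ker2 \<sigma> l i)"
  unfolding has_exterior_derivative_def
proof (safe)
  fix z :: "real^3" assume z: "z \<noteq> 0"
  have ax: "z \<bullet> axis j 1 = z $ j" for j by (simp add: inner_axis)
  show "((\<lambda>t. ker0 \<sigma> (z + t *\<^sub>R axis i 1)) has_real_derivative ker1 \<sigma> i z) (at 0)"
    unfolding ker0_def ker1_def
    using radial_line_derivative[OF yukawa_DERIV(1) z, of \<sigma> "axis i 1"] z by (simp add: ax)
  have 1: "((\<lambda>t. yukawa1 \<sigma> (norm (z + t *\<^sub>R axis l 1))) has_real_derivative z $ l * yukawa2 \<sigma> (norm z)) (at 0)"
    using radial_line_derivative[OF yukawa_DERIV(2) z, of \<sigma> "axis l 1"] z by (simp add: ax)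
  have 2: "((\<lambda>t. (z + t *\<^sub>R axis l 1) $ i) has_real_derivative (if l = i then 1 else 0)) (at 0)"
    by (auto simp: axis_def intro!: derivative_eq_intros)
  show "((\<lambda>t. ker1 \<sigma> i (z + t *\<^sub>R axis l 1)) has_real_derivative ker2 \<sigma> l i z) (at 0)"
    unfolding ker1_def ker2_def using DERIV_mult[OF 2 1]
    by (rule DERIV_cong) (simp add: mult_ac)
qed

lemma ker2_commute: "ker2 \<sigma> l i = ker2 \<sigma> i l"
  by (auto simp: ker2_def fun_eq_iff)

lemma ker2_trace:
  assumes "z \<noteq> 0" shows "ker2 \<sigma> 1 1 z + ker2 \<sigma> 2 2 z + ker2 \<sigma> 3 3 z = \<sigma>\<^sup>2 * ker0 \<sigma> z"
proof -
  have n: "(norm z)\<^sup>2 = z $ 1 * z $ 1 + z $ 2 * z $ 2 + z $ 3 * z $ 3"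
    by (simp add: power2_norm_eq_inner inner_vec_def sum_3)
  show ?thesis
    using yukawa_laplace[of "norm z" \<sigma>] assms unfolding n by (simp add: ker2_def ker0_def algebra_simps)
qed

text \<open>The exponential is traded for one extra power of 1/r. The potential and its gradient are
  then of order r^(-2), which suffices for the flux through large spheres to tend to 0.\<close>

lemma exp_decay:
  fixes \<sigma> r :: real
  assumes "\<sigma> > 0" "r > 0" shows "exp (- \<sigma> * r) \<le> 1 / (\<sigma> * r)"
proof -
  have "\<sigma> * r \<le> exp (\<sigma> * r)" using exp_ge_add_one_self[of "\<sigma> * r"] by linarith
  then have "1 / exp (\<sigma> * r) \<le> 1 / (\<sigma> * r)" using assms by (intro divide_left_mono) auto
  then show ?thesis by (simp add: exp_minus inverse_eq_divide)
qed

lemma yukawa_bounds: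
  assumes "\<sigma> > 0" "\<delta> > 0" "r \<ge> \<delta>"
  shows "\<bar>yukawa \<sigma> r\<bar> \<le> (1 / \<sigma>) / r ^ 2" "\<bar>r * yukawa1 \<sigma> r\<bar> \<le> (1 + 1 / (\<sigma> * \<delta>)) / r ^ 2"
    "\<bar>yukawa1 \<sigma> r\<bar> \<le> \<sigma> / \<delta> ^ 2 + 1 / \<delta> ^ 3" "\<bar>r\<^sup>2 * yukawa2 \<sigma> r\<bar> \<le> \<sigma>\<^sup>2 / \<delta> + 3 * \<sigma> / \<delta>\<^sup>2 + 3 / \<delta> ^ 3"
proof -
  have r: "r > 0" using assms by linarith
  have e: "exp (- \<sigma> * r) \<le> 1 / (\<sigma> * r)" using exp_decay assms r by blast
  have e1: "exp (- \<sigma> * r) \<le> 1" using assms r by simp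
  have "\<bar>yukawa \<sigma> r\<bar> = exp (- \<sigma> * r) / r" using r by (simp add: yukawa_def)
  also have "\<dots> \<le> 1 / (\<sigma> * r) / r" using e r by (intro divide_right_mono) auto
  finally show "\<bar>yukawa \<sigma> r\<bar> \<le> (1 / \<sigma>) / r ^ 2" by (simp add: power2_eq_square mult.assoc)
  have "r * yukawa1 \<sigma> r = - (exp (- \<sigma> * r) * (\<sigma> / r + 1 / r ^ 2))"
    using r by (simp add: yukawa1_def field_simps eval_nat_numeral)
  then have "\<bar>r * yukawa1 \<sigma> r\<bar> = exp (- \<sigma> * r) * (\<sigma> / r + 1 / r ^ 2)"
    using r assms by (simp only: abs_minus_cancel) simp
  also have "\<dots> \<le> 1 / (\<sigma> * r) * (\<sigma> / r + 1 / r ^ 2)" using e r assms by (intro mult_right_mono) auto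
  also have "\<dots> = (1 + 1 / (\<sigma> * r)) / r ^ 2" using r assms by (simp add: field_simps eval_nat_numeral)
  also have "\<dots> \<le> (1 + 1 / (\<sigma> * \<delta>)) / r ^ 2"
    using assms r by (intro divide_right_mono add_left_mono frac_le mult_left_mono) auto
  finally show "\<bar>r * yukawa1 \<sigma> r\<bar> \<le> (1 + 1 / (\<sigma> * \<delta>)) / r ^ 2" .
  have "\<bar>yukawa1 \<sigma> r\<bar> = exp (- \<sigma> * r) * (\<sigma> / r ^ 2 + 1 / r ^ 3)"
    using r assms by (simp add: yukawa1_def abs_mult)
  also have "\<dots> \<le> 1 * (\<sigma> / \<delta> ^ 2 + 1 / \<delta> ^ 3)"
    using assms r e1 by (intro mult_mono add_mono frac_le power_mono) auto
  finally show "\<bar>yukawa1 \<sigma> r\<bar> \<le> \<sigma> / \<delta> ^ 2 + 1 / \<delta> ^ 3" by simp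
  have "r\<^sup>2 * yukawa2 \<sigma> r = exp (- \<sigma> * r) * (\<sigma>\<^sup>2 / r + 3 * \<sigma> / r\<^sup>2 + 3 / r ^ 3)"
    using r by (simp add: yukawa2_def field_simps eval_nat_numeral)
  then have "\<bar>r\<^sup>2 * yukawa2 \<sigma> r\<bar> = exp (- \<sigma> * r) * (\<sigma>\<^sup>2 / r + 3 * \<sigma> / r\<^sup>2 + 3 / r ^ 3)"
    using r assms by simp
  also have "\<dots> \<le> 1 * (\<sigma>\<^sup>2 / \<delta> + 3 * \<sigma> / \<delta>\<^sup>2 + 3 / \<delta> ^ 3)"
    using assms r e1 by (intro mult_mono add_mono frac_le power_mono) auto
  finally show "\<bar>r\<^sup>2 * yukawa2 \<sigma> r\<bar> \<le> \<sigma>\<^sup>2 / \<delta> + 3 * \<sigma> / \<delta>\<^sup>2 + 3 / \<delta> ^ 3" by simp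
qed

lemma ker_bounds:
  assumes "\<sigma> > 0" "\<delta> > 0" "norm z \<ge> \<delta>"
  shows "\<bar>ker0 \<sigma> z\<bar> \<le> (1 / \<sigma>) / (norm z)\<^sup>2" "\<bar>ker1 \<sigma> i z\<bar> \<le> (1 + 1 / (\<sigma> * \<delta>)) / (norm z)\<^sup>2"
    "\<bar>ker2 \<sigma> l i z\<bar> \<le> (\<sigma> / \<delta> ^ 2 + 1 / \<delta> ^ 3) + (\<sigma>\<^sup>2 / \<delta> + 3 * \<sigma> / \<delta>\<^sup>2 + 3 / \<delta> ^ 3)"
proof -
  note b = yukawa_bounds[OF assms]
  have zi: "\<bar>z $ j\<bar> \<le> norm z" for j by (rule component_le_norm_cart)
  show "\<bar>ker0 \<sigma> z\<bar> \<le> (1 / \<sigma>) / (norm z)\<^sup>2" using b(1) by (simp add: ker0_def)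
  have "\<bar>ker1 \<sigma> i z\<bar> \<le> norm z * \<bar>yukawa1 \<sigma> (norm z)\<bar>"
    unfolding ker1_def abs_mult by (intro mult_right_mono zi) simp
  then show "\<bar>ker1 \<sigma> i z\<bar> \<le> (1 + 1 / (\<sigma> * \<delta>)) / (norm z)\<^sup>2" using b(2) by (simp add: abs_mult)
  have "\<bar>z $ i * (z $ l * yukawa2 \<sigma> (norm z))\<bar> \<le> norm z * (norm z * \<bar>yukawa2 \<sigma> (norm z)\<bar>)"
    unfolding abs_mult by (intro mult_mono zi order_refl) auto
  also have "\<dots> = \<bar>(norm z)\<^sup>2 * yukawa2 \<sigma> (norm z)\<bar>" by (simp add: abs_mult power2_eq_square)
  finally have 2: "\<bar>z $ i * (z $ l * yukawa2 \<sigma> (norm z))\<bar> \<le> \<sigma>\<^sup>2 / \<delta> + 3 * \<sigma> / \<delta>\<^sup>2 + 3 / \<delta> ^ 3" using b(4) by linarith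
  have 1: "\<bar>if l = i then yukawa1 \<sigma> (norm z) else 0\<bar> \<le> \<sigma> / \<delta> ^ 2 + 1 / \<delta> ^ 3" using b(3) assms by auto
  show "\<bar>ker2 \<sigma> l i z\<bar> \<le> (\<sigma> / \<delta> ^ 2 + 1 / \<delta> ^ 3) + (\<sigma>\<^sup>2 / \<delta> + 3 * \<sigma> / \<delta>\<^sup>2 + 3 / \<delta> ^ 3)"
    unfolding ker2_def by (rule order_trans[OF abs_triangle_ineq add_mono[OF 1 2]])
qed

lemma exterior_kernel_ker:
  assumes \<sigma>: "\<sigma> > 0"
  shows "exterior_kernel (ker0 \<sigma>)" "exterior_kernel (ker1 \<sigma> i)" "exterior_kernel (ker2 \<sigma> l i)"
proof -
  have c: "continuous_on (- {0}) (\<lambda>z::real^3. yukawa \<sigma> (norm z))" "continuous_on (- {0}) (\<lambda>z::real^3. yukawa1 \<sigma> (norm z))"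
    "continuous_on (- {0}) (\<lambda>z::real^3. yukawa2 \<sigma> (norm z))"
    unfolding yukawa_def yukawa1_def yukawa2_def by (intro continuous_intros; auto)+
  have sq: "C / (norm z)\<^sup>2 \<le> C / \<delta>\<^sup>2" if "norm z \<ge> \<delta>" "\<delta> > 0" "C \<ge> 0" for C \<delta> and z :: "real^3"
    using that by (intro frac_le power_mono) auto
  show "exterior_kernel (ker0 \<sigma>)"
    unfolding exterior_kernel_def
  proof (intro conjI allI impI)
    show "continuous_on (- {0}) (ker0 \<sigma>)" unfolding ker0_def[abs_def] by (rule c)
    show "\<exists>B. \<forall>z. \<delta> \<le> norm z \<longrightarrow> \<bar>ker0 \<sigma> z\<bar> \<le> B" if "\<delta> > 0" for \<delta>
      using order_trans[OF ker_bounds(1)[OF \<sigma> that] sq] \<sigma> that by (intro exI[of _ "(1 / \<sigma>) / \<delta>\<^sup>2"]) auto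
  qed
  show "exterior_kernel (ker1 \<sigma> i)"
    unfolding exterior_kernel_def
  proof (intro conjI allI impI)
    show "continuous_on (- {0}) (ker1 \<sigma> i)" unfolding ker1_def[abs_def] by (intro continuous_on_mult c continuous_intros)
    show "\<exists>B. \<forall>z. \<delta> \<le> norm z \<longrightarrow> \<bar>ker1 \<sigma> i z\<bar> \<le> B" if "\<delta> > 0" for \<delta>
      using order_trans[OF ker_bounds(2)[OF \<sigma> that] sq] \<sigma> that by (intro exI[of _ "(1 + 1 / (\<sigma> * \<delta>)) / \<delta>\<^sup>2"]) auto
  qed
  show "exterior_kernel (ker2 \<sigma> l i)"
    unfolding exterior_kernel_def
  proof (intro conjI allI impI)
    show "continuous_on (- {0}) (ker2 \<sigma> l i)" unfolding ker2_def[abs_def]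
      by (cases "l = i") (auto intro!: continuous_on_add continuous_on_mult c continuous_intros)
    show "\<exists>B. \<forall>z. \<delta> \<le> norm z \<longrightarrow> \<bar>ker2 \<sigma> l i z\<bar> \<le> B" if "\<delta> > 0" for \<delta>
      using ker_bounds(3)[OF \<sigma> that] by blast
  qed
qed

section \<open>The exterior problem\<close>

text \<open>Here \<open>c\<close> stands for the difference of the two Laplace-averaged sources. Its
  divergence is controlled only in the weak sense, and the boundary condition is the continued one,
  on the whole sphere.\<close>

locale exterior_problem =
  fixes \<sigma> r1 R :: real and c :: "real^3 \<Rightarrow> real^3"
  assumes c: "integrable lebesgue c" and supp: "\<And>y. norm y > r1 \<Longrightarrow> c y = 0"
    and r1: "0 \<le> r1" "r1 < R" and \<sigma>: "\<sigma> > 0"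
    and div_free: "\<And>x0 \<psi>. radial x0 \<psi> \<Longrightarrow> (\<Sum>k\<in>UNIV. LINT y|lebesgue. iter_pderiv [k] \<psi> y * c y $ k) = 0"
    and boundary: "\<And>x. norm x = R \<Longrightarrow> cross3 x (yukawa_potential \<sigma> c x) = 0"
begin

lemma c_component: "integrable lebesgue (\<lambda>y. c y $ j)" "norm y > r1 \<Longrightarrow> c y $ j = 0"
  using integrable_bounded_linear[OF bounded_linear_vec_nth c] supp by auto

text \<open>The last index is the component of the field; the indices before it are directions of
  differentiation. Thus \<open>A i j\<close> is the derivative of \<open>N j\<close> in direction
  \<open>i\<close>, and \<open>B l i j\<close> that of \<open>A i j\<close> in direction
  \<open>l\<close>.\<close>

definition "N j = conv (ker0 \<sigma>) (\<lambda>y. c y $ j)"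
definition "A i j = conv (ker1 \<sigma> i) (\<lambda>y. c y $ j)"
definition "B l i j = conv (ker2 \<sigma> l i) (\<lambda>y. c y $ j)"

lemma N_potential:
  assumes "norm x > r1" shows "N j x = yukawa_potential \<sigma> c x $ j"
proof -
  define d where "d = norm x - r1"
  have d: "d > 0" "norm x \<ge> r1 + d" using assms by (auto simp: d_def)
  have "integrable lebesgue (\<lambda>y. yukawa \<sigma> (norm (x - y)) *\<^sub>R c y)"
  proof (rule kernel_integrable[where ?r1.0 = r1 and K = "\<lambda>z. yukawa \<sigma> (norm z)" and d = d, OF c supp d])
    show "(\<lambda>z::real^3. yukawa \<sigma> (norm z)) \<in> borel_measurable borel" by (simp add: yukawa_def)
    show "\<bar>yukawa \<sigma> (norm z)\<bar> \<le> 1 / d" if "d > 0" "d \<le> norm z" for z :: "real^3"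
      by (rule yukawa_bound[OF \<sigma> that])
  qed
  from integral_bounded_linear[OF bounded_linear_vec_nth[of j] this]
  show ?thesis by (simp add: N_def conv_def ker0_def yukawa_potential_def)
qed

lemma axis_norm: "norm (axis i 1 :: real^3) = 1"
  by simp

lemma N_deriv: "norm x > r1 \<Longrightarrow> ((\<lambda>t. N j (x + t *\<^sub>R axis i 1)) has_real_derivative A i j x) (at 0)"
  unfolding N_def A_def
  by (rule conv_line_derivative[OF c_component exterior_kernel_ker(1)[OF \<sigma>] exterior_kernel_ker(2)[OF \<sigma>] ker_derivatives(1) axis_norm])

lemma A_deriv: "norm x > r1 \<Longrightarrow> ((\<lambda>t. A i j (x + t *\<^sub>R axis l 1)) has_real_derivative B l i j x) (at 0)"
  unfolding A_def B_def
  by (rule conv_line_derivative[OF c_component exterior_kernel_ker(2)[OF \<sigma>] exterior_kernel_ker(3)[OF \<sigma>] ker_derivatives(2) axis_norm])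

lemma B_commute: "B l i j = B i l j"
  by (simp add: B_def ker2_commute)

lemma conv_exists:
  assumes K: "exterior_kernel K" and x: "norm x > r1"
  shows "integrable lebesgue (\<lambda>y. K (x - y) * c y $ j)"
proof -
  have d: "norm x - r1 > 0" using x by simp
  obtain b where b: "\<And>z. norm z \<ge> norm x - r1 \<Longrightarrow> \<bar>K z\<bar> \<le> b" using K d unfolding exterior_kernel_def by metis
  have e: "norm x \<ge> r1 + (norm x - r1)" by simp
  show ?thesis by (rule conv_integrand(3)[OF c_component K d e b])
qed

lemma laplace_N:
  assumes x: "norm x > r1" shows "B 1 1 j x + B 2 2 j x + B 3 3 j x = \<sigma>\<^sup>2 * N j x"
proof -
  have "B 1 1 j x + B 2 2 j x + B 3 3 j x = (LINT y|lebesgue. ker2 \<sigma> 1 1 (x - y) * c y $ j +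
      ker2 \<sigma> 2 2 (x - y) * c y $ j + ker2 \<sigma> 3 3 (x - y) * c y $ j)"
    unfolding B_def conv_def using conv_exists[OF exterior_kernel_ker(3)[OF \<sigma>] x] by simp
  also have "\<dots> = (LINT y|lebesgue. \<sigma>\<^sup>2 * (ker0 \<sigma> (x - y) * c y $ j))"
  proof (rule Bochner_Integration.integral_cong[OF refl])
    fix y
    show "ker2 \<sigma> 1 1 (x - y) * c y $ j + ker2 \<sigma> 2 2 (x - y) * c y $ j + ker2 \<sigma> 3 3 (x - y) * c y $ j
       = \<sigma>\<^sup>2 * (ker0 \<sigma> (x - y) * c y $ j)"
    proof (cases "x = y")
      case True
      then show ?thesis using supp[of y] x by simp
    next
      case False
      then show ?thesis using ker2_trace[of "x - y" \<sigma>]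
        by (metis distrib_right eq_iff_diff_eq_0 mult.assoc)
    qed
  qed
  finally show ?thesis by (simp add: N_def conv_def)
qed

text \<open>The Yukawa kernel centred at \<open>x\<close> is not a test function, but a radial test
  function agrees with it at all distances between \<open>x\<close> and the support of
  \<open>c\<close>. Testing the divergence of \<open>c\<close> with it gives the claim; the minus
  sign below comes from differentiating in y instead of x.\<close>

lemma divergence_N:
  assumes x: "norm x > r1" shows "A 1 1 x + A 2 2 x + A 3 3 x = 0"
proof -
  define d where "d = norm x - r1"
  have d: "d > 0" using x by (simp add: d_def)
  define M where "M = norm x + r1 + 1"
  have M: "M > 0" using x r1 by (simp add: M_def add_nonneg_pos)
  \<comment> \<open>Both cut-offs are 1 on [d/2, M], an interval with the relevant distances d to
    norm x + r1 in its interior, so the derivatives agree there as well.\<close>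
  define w where "w r = exp (- \<sigma> * r) * (step (4 / d * r) * (1 - step (r / M)))" for r
  define h where "h r = w r / r ^ 1" for r
  have "annular w"
  proof (rule annularI[of _ "d / 4" "2 * M"])
    show "smooth w" unfolding w_def[abs_def]
      using smooth_affine[OF smooth_step, of "4 / d" 0] smooth_affine[OF smooth_step, of "1 / M" 0] smooth_exp[of "- \<sigma>"]
      by (intro smooth_mult smooth_diff smooth_const) simp_all
  qed (use d M in \<open>auto simp: w_def step_eq_0 step_eq_1 field_simps\<close>)
  then have h: "annular h" unfolding h_def[abs_def] by (rule annular_divide)
  have dh: "deriv h r = r * yukawa1 \<sigma> r" if r: "d \<le> r" "r \<le> norm x + r1" for r
  proof (rule DERIV_imp_deriv)
    have r0: "r > 0" using r d by linarith
    show "(h has_real_derivative r * yukawa1 \<sigma> r) (at r)"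
    proof (rule has_field_derivative_transform_within_open[OF yukawa_DERIV(1)[OF r0], of "{d / 2<..<M}"])
      show "yukawa \<sigma> s = h s" if "s \<in> {d / 2<..<M}" for s
      proof -
        have "step (4 / d * s) = 1" using that d by (intro step_eq_1) (auto simp: field_simps)
        moreover have "step (s / M) = 0" using that M by (intro step_eq_0) (auto simp: field_simps)
        ultimately show ?thesis by (simp add: h_def w_def yukawa_def)
      qed
    qed (use r d in \<open>auto simp: M_def\<close>)
  qed
  have "(\<Sum>k\<in>UNIV. LINT y|lebesgue. iter_pderiv [k] (\<lambda>y. h (norm (y - x))) y * c y $ k) = 0"
    by (rule div_free[OF radial.base[OF h]])
  moreover have "(LINT y|lebesgue. iter_pderiv [k] (\<lambda>y. h (norm (y - x))) y * c y $ k) = - A k k x" for k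
  proof -
    have "(LINT y|lebesgue. iter_pderiv [k] (\<lambda>y. h (norm (y - x))) y * c y $ k) =
      (LINT y|lebesgue. - (ker1 \<sigma> k (x - y) * c y $ k))"
    proof (rule Bochner_Integration.integral_cong[OF refl])
      fix y
      show "iter_pderiv [k] (\<lambda>y. h (norm (y - x))) y * c y $ k = - (ker1 \<sigma> k (x - y) * c y $ k)"
      proof (cases "norm y > r1")
        case False
        have n: "d \<le> norm (y - x)" "norm (y - x) \<le> norm x + r1"
          using False norm_triangle_ineq2[of x y] norm_triangle_ineq4[of y x] by (auto simp: d_def norm_minus_commute)
        then have "norm (y - x) > 0" using d by linarith
        then show ?thesis unfolding iter_pderiv_annular[OF h] ker1_def dh[OF n] norm_minus_commute[of x y]
          by simp (simp add: algebra_simps)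
      qed (simp add: supp)
    qed
    then show ?thesis by (simp add: A_def conv_def)
  qed
  ultimately show ?thesis by (simp add: sum_3)
qed

lemma divergence_B:
  assumes x: "norm x > r1" shows "B l 1 1 x + B l 2 2 x + B l 3 3 x = 0"
proof -
  have 1: "((\<lambda>t. A 1 1 (x + t *\<^sub>R axis l 1) + A 2 2 (x + t *\<^sub>R axis l 1) + A 3 3 (x + t *\<^sub>R axis l 1))
    has_real_derivative B l 1 1 x + B l 2 2 x + B l 3 3 x) (at 0)"
    by (intro DERIV_add A_deriv x)
  define d where "d = norm x - r1"
  have d: "d > 0" using x by (simp add: d_def)
  have "((\<lambda>t. A 1 1 (x + t *\<^sub>R axis l 1) + A 2 2 (x + t *\<^sub>R axis l 1) + A 3 3 (x + t *\<^sub>R axis l 1))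
    has_real_derivative 0) (at 0)"
  proof (rule has_field_derivative_transform_within_open[OF DERIV_const[of 0], of "{-d<..<d}"])
    fix t assume t: "t \<in> {-d<..<d}"
    have "norm x \<le> norm (x + t *\<^sub>R axis l 1) + \<bar>t\<bar>"
      using norm_triangle_ineq4[of "x + t *\<^sub>R axis l 1" "t *\<^sub>R axis l 1"] by simp
    then have "norm (x + t *\<^sub>R axis l 1) > r1" using t by (auto simp: d_def)
    then show "0 = A 1 1 (x + t *\<^sub>R axis l 1) + A 2 2 (x + t *\<^sub>R axis l 1) + A 3 3 (x + t *\<^sub>R axis l 1)"
      using divergence_N by simp
  qed (use d in auto)
  with 1 show ?thesis by (rule DERIV_unique)
qed

text \<open>The vector field \<open>X\<close> = N \<times> curl N is the one whose divergence is an
  energy density; \<open>dX i\<close> is the derivative of its component \<open>i\<close> in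
  direction \<open>i\<close>, written out by the product rule.\<close>

definition "curl1 x = A 2 3 x - A 3 2 x"
definition "curl2 x = A 3 1 x - A 1 3 x"
definition "curl3 x = A 1 2 x - A 2 1 x"
definition H :: "real^3 \<Rightarrow> real^3" where "H x = vector [curl1 x, curl2 x, curl3 x]"
definition Nv :: "real^3 \<Rightarrow> real^3" where "Nv x = vector [N 1 x, N 2 x, N 3 x]"
definition "X x = cross3 (Nv x) (H x)"
definition "dX1 x = A 1 2 x * curl3 x + N 2 x * (B 1 1 2 x - B 1 2 1 x) - (A 1 3 x * curl2 x + N 3 x * (B 1 3 1 x - B 1 1 3 x))"
definition "dX2 x = A 2 3 x * curl1 x + N 3 x * (B 2 2 3 x - B 2 3 2 x) - (A 2 1 x * curl3 x + N 1 x * (B 2 1 2 x - B 2 2 1 x))"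
definition "dX3 x = A 3 1 x * curl2 x + N 1 x * (B 3 3 1 x - B 3 1 3 x) - (A 3 2 x * curl1 x + N 2 x * (B 3 2 3 x - B 3 3 2 x))"
definition "dX i x = (if i = 1 then dX1 x else if i = 2 then dX2 x else dX3 x)" for i :: 3

lemma X_components: "X x $ 1 = N 2 x * curl3 x - N 3 x * curl2 x" "X x $ 2 = N 3 x * curl1 x - N 1 x * curl3 x"
  "X x $ 3 = N 1 x * curl2 x - N 2 x * curl1 x"
  by (simp_all add: X_def Nv_def H_def cross3_def)

lemma X_deriv:
  assumes x: "norm x > r1" shows "((\<lambda>t. X (x + t *\<^sub>R axis i 1) $ i) has_real_derivative dX i x) (at 0)"
proof -
  note n = N_deriv[OF x] and a = A_deriv[OF x]
  have at0: "x + 0 *\<^sub>R axis i 1 = x" by simp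
  have "i = 1 \<or> i = 2 \<or> i = 3" by (rule exhaust_3)
  then show ?thesis
  proof (elim disjE)
    assume i: "i = 1"
    show ?thesis unfolding i X_components curl2_def curl3_def dX_def dX1_def
      by (rule DERIV_cong[OF DERIV_diff[OF DERIV_mult[OF n DERIV_diff[OF a a]] DERIV_mult[OF n DERIV_diff[OF a a]]]]) simp
  next
    assume i: "i = 2"
    show ?thesis unfolding i X_components curl1_def curl3_def dX_def dX2_def
      by (rule DERIV_cong[OF DERIV_diff[OF DERIV_mult[OF n DERIV_diff[OF a a]] DERIV_mult[OF n DERIV_diff[OF a a]]]]) simp
  next
    assume i: "i = 3"
    show ?thesis unfolding i X_components curl1_def curl2_def dX_def dX3_def
      by (rule DERIV_cong[OF DERIV_diff[OF DERIV_mult[OF n DERIV_diff[OF a a]] DERIV_mult[OF n DERIV_diff[OF a a]]]]) simp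
  qed
qed

definition "q x = (curl1 x)\<^sup>2 + (curl2 x)\<^sup>2 + (curl3 x)\<^sup>2 + \<sigma>\<^sup>2 * ((N 1 x)\<^sup>2 + (N 2 x)\<^sup>2 + (N 3 x)\<^sup>2)"

text \<open>div(N \<times> curl N) = |curl N|^2 - N . curl curl N. Since N is divergence free, curl
  curl N is minus its Laplacian, that is -\<sigma>^2 N.\<close>

lemma divergence_X:
  assumes x: "norm x > r1" shows "(\<Sum>i\<in>UNIV. dX i x) = q x"
proof -
  have l: "\<sigma>\<^sup>2 * N j x = B 1 1 j x + B 2 2 j x + B 3 3 j x" for j using laplace_N[OF x] by simp
  have "(\<Sum>i\<in>UNIV. dX i x) = dX1 x + dX2 x + dX3 x" by (simp add: sum_3 dX_def)
  also have "\<dots> = (curl1 x)\<^sup>2 + (curl2 x)\<^sup>2 + (curl3 x)\<^sup>2 +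
     N 1 x * (B 2 2 1 x + B 3 3 1 x - B 2 1 2 x - B 3 1 3 x) +
     N 2 x * (B 1 1 2 x + B 3 3 2 x - B 1 2 1 x - B 3 2 3 x) +
     N 3 x * (B 1 1 3 x + B 2 2 3 x - B 1 3 1 x - B 2 3 2 x)"
    by (simp add: dX1_def dX2_def dX3_def curl1_def curl2_def curl3_def power2_eq_square algebra_simps)
  also have "B 2 2 1 x + B 3 3 1 x - B 2 1 2 x - B 3 1 3 x = \<sigma>\<^sup>2 * N 1 x"
    using divergence_B[OF x, of 1] unfolding l by (simp add: B_commute[of 2 1] B_commute[of 3 1])
  also have "B 1 1 2 x + B 3 3 2 x - B 1 2 1 x - B 3 2 3 x = \<sigma>\<^sup>2 * N 2 x"
    using divergence_B[OF x, of 2] unfolding l by (simp add: B_commute[of 1 2] B_commute[of 3 2])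
  also have "B 1 1 3 x + B 2 2 3 x - B 1 3 1 x - B 2 3 2 x = \<sigma>\<^sup>2 * N 3 x"
    using divergence_B[OF x, of 3] unfolding l by (simp add: B_commute[of 1 3] B_commute[of 2 3])
  finally show ?thesis by (simp add: q_def power2_eq_square algebra_simps)
qed

lemma conv_ker_bounded:
  assumes K: "exterior_kernel K"
  obtains b where "\<And>x j. norm x \<ge> R \<Longrightarrow> \<bar>conv K (\<lambda>y. c y $ j) x\<bar> \<le> b"
proof -
  have d: "R - r1 > 0" using r1 by simp
  obtain b where b: "\<And>z. norm z \<ge> R - r1 \<Longrightarrow> \<bar>K z\<bar> \<le> b" using K d unfolding exterior_kernel_def by metis
  have b0: "b \<ge> 0" using b[of "(R - r1) *\<^sub>R axis 1 1"] d by (auto intro: order_trans[OF abs_ge_zero])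
  show ?thesis
  proof (rule that)
    fix x :: "real^3" and j assume x: "norm x \<ge> R"
    have "\<bar>conv K (\<lambda>y. c y $ j) x\<bar> \<le> b * (LINT y|lebesgue. \<bar>c y $ j\<bar>)"
      by (rule conv_integrand(4)[OF c_component K d _ b]) (use x in auto)
    also have "\<dots> \<le> b * (LINT y|lebesgue. norm (c y))"
      using b0 c_component(1) c by (intro mult_left_mono integral_mono component_le_norm_cart) auto
    finally show "\<bar>conv K (\<lambda>y. c y $ j) x\<bar> \<le> b * (LINT y|lebesgue. norm (c y))" .
  qed
qed

lemma uniform_bound:
  obtains b where "b \<ge> 0" "\<And>x j. norm x \<ge> R \<Longrightarrow> \<bar>N j x\<bar> \<le> b" "\<And>x i j. norm x \<ge> R \<Longrightarrow> \<bar>A i j x\<bar> \<le> b"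
    "\<And>x l i j. norm x \<ge> R \<Longrightarrow> \<bar>B l i j x\<bar> \<le> b"
proof -
  obtain b0 where b0: "\<And>x j. norm x \<ge> R \<Longrightarrow> \<bar>N j x\<bar> \<le> b0"
    using conv_ker_bounded[OF exterior_kernel_ker(1)[OF \<sigma>]] unfolding N_def by metis
  have "\<forall>i. \<exists>b. \<forall>x j. norm x \<ge> R \<longrightarrow> \<bar>A i j x\<bar> \<le> b"
    using conv_ker_bounded[OF exterior_kernel_ker(2)[OF \<sigma>]] unfolding A_def by metis
  then obtain b1 where b1: "\<And>i x j. norm x \<ge> R \<Longrightarrow> \<bar>A i j x\<bar> \<le> b1 i" by metis
  have "\<forall>l i. \<exists>b. \<forall>x j. norm x \<ge> R \<longrightarrow> \<bar>B l i j x\<bar> \<le> b"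
    using conv_ker_bounded[OF exterior_kernel_ker(3)[OF \<sigma>]] unfolding B_def by metis
  then obtain b2 where b2: "\<And>l i x j. norm x \<ge> R \<Longrightarrow> \<bar>B l i j x\<bar> \<le> b2 l i" by metis
  define b where "b = \<bar>b0\<bar> + (\<Sum>i\<in>UNIV. \<bar>b1 i\<bar>) + (\<Sum>l\<in>UNIV. \<Sum>i\<in>UNIV. \<bar>b2 l i\<bar>)"
  have s1: "\<bar>b1 i\<bar> \<le> (\<Sum>i\<in>UNIV. \<bar>b1 i\<bar>)" for i by (rule member_le_sum) auto
  have s2: "\<bar>b2 l i\<bar> \<le> (\<Sum>l\<in>UNIV. \<Sum>i\<in>UNIV. \<bar>b2 l i\<bar>)" for l i
    by (rule order_trans[OF member_le_sum[of i UNIV "\<lambda>i. \<bar>b2 l i\<bar>"] member_le_sum[of l UNIV "\<lambda>l. \<Sum>i\<in>UNIV. \<bar>b2 l i\<bar>"]])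
      (auto intro: sum_nonneg)
  have nn: "0 \<le> (\<Sum>i\<in>UNIV. \<bar>b1 i\<bar>)" "0 \<le> (\<Sum>l\<in>UNIV. \<Sum>i\<in>UNIV. \<bar>b2 l i\<bar>)" by (auto intro!: sum_nonneg)
  show ?thesis
  proof (rule that[of b])
    show "b \<ge> 0" using nn unfolding b_def by linarith
    show "\<bar>N j x\<bar> \<le> b" if "norm x \<ge> R" for x j using b0[OF that, of j] nn unfolding b_def by linarith
    show "\<bar>A i j x\<bar> \<le> b" if "norm x \<ge> R" for x i j using b1[OF that, of i j] nn s1[of i] unfolding b_def by linarith
    show "\<bar>B l i j x\<bar> \<le> b" if "norm x \<ge> R" for x l i j using b2[OF that, of l i j] nn s2[of l i] unfolding b_def by linarith
  qed
qed

lemma continuous: "continuous_on {x. norm x > r1} (N j)" "continuous_on {x. norm x > r1} (A i j)"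
  unfolding N_def A_def
  by (auto intro!: conv_continuous_on c_component exterior_kernel_ker \<sigma>)

lemma continuous_H: "continuous_on {x. norm x > r1} curl1" "continuous_on {x. norm x > r1} curl2" "continuous_on {x. norm x > r1} curl3"
  unfolding curl1_def[abs_def] curl2_def[abs_def] curl3_def[abs_def] by (intro continuous_on_diff continuous)+

lemma continuous_X: "continuous_on {x. norm x > r1} (\<lambda>x. X x $ i)"
proof -
  have "i = 1 \<or> i = 2 \<or> i = 3" by (rule exhaust_3)
  then show ?thesis
    by (elim disjE) (simp_all add: X_components continuous continuous_H continuous_on_diff continuous_on_mult)
qed

lemma continuous_q: "continuous_on {x. norm x > r1} q"
  unfolding q_def[abs_def] by (intro continuous_intros continuous continuous_H)

lemma cutoff_measurable:
  fixes f :: "real^3 \<Rightarrow> real" and a :: "real \<Rightarrow> real"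
  assumes "continuous_on {x. norm x > r1} f" "a \<in> borel_measurable borel" "\<And>r. r < R \<Longrightarrow> a r = 0"
  shows "(\<lambda>x::real^3. a (norm x) * f x) \<in> borel_measurable borel"
proof -
  have op: "open {x::real^3. norm x > r1}" by (intro open_Collect_less continuous_intros)
  have "(\<lambda>x. indicator {x. norm x > r1} x *\<^sub>R f x) \<in> borel_measurable borel"
    by (rule borel_measurable_continuous_on_indicator[OF _ assms(1)]) (use op in simp)
  then have "(\<lambda>x. a (norm x) * (indicator {x. norm x > r1} x *\<^sub>R f x)) \<in> borel_measurable borel"
    using assms(2) by measurable
  also have "(\<lambda>x. a (norm x) * (indicator {x. norm x > r1} x *\<^sub>R f x)) = (\<lambda>x. a (norm x) * f x)"
    using assms(3) r1 by (auto simp: fun_eq_iff indicator_def)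
  finally show ?thesis .
qed

text \<open>The field a(|x|) X has integral of divergence 0, and its divergence is a q + a' (x . X)
  / |x|. The function \<open>a\<close> plays the role of the indicator of the exterior domain and
  \<open>a'\<close> that of the surface integrals over its boundary.\<close>

lemma energy_identity:
  assumes a: "annular a" and aR: "\<And>r. r \<le> R \<Longrightarrow> a r = 0"
  shows "integrable lebesgue (\<lambda>x. a (norm x) * q x)"
    "(LINT x|lebesgue. a (norm x) * q x) = - (LINT x|lebesgue. deriv a (norm x) * ((x \<bullet> X x) / norm x))"
proof -
  obtain b where b: "b \<ge> 0" "\<And>x j. norm x \<ge> R \<Longrightarrow> \<bar>N j x\<bar> \<le> b" "\<And>x i j. norm x \<ge> R \<Longrightarrow> \<bar>A i j x\<bar> \<le> b"
    "\<And>x l i j. norm x \<ge> R \<Longrightarrow> \<bar>B l i j x\<bar> \<le> b" by (rule uniform_bound[OF that])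
  have hb: "\<bar>curl1 x\<bar> \<le> 2 * b" "\<bar>curl2 x\<bar> \<le> 2 * b" "\<bar>curl3 x\<bar> \<le> 2 * b" if "norm x \<ge> R" for x
    using b(3)[OF that, of 2 3] b(3)[OF that, of 3 2] b(3)[OF that, of 3 1] b(3)[OF that, of 1 3]
      b(3)[OF that, of 1 2] b(3)[OF that, of 2 1]
    by (simp_all add: curl1_def curl2_def curl3_def)
  \<comment> \<open>Every product below has one factor bounded by \<open>b\<close> and one, a
    difference of two derivatives, bounded by 2 b. The constants 4 and 8 count two and four such
    products.\<close>
  have prod: "\<bar>u * v\<bar> \<le> b * (2 * b)" if "\<bar>u\<bar> \<le> b" "\<bar>v\<bar> \<le> 2 * b" for u v
    unfolding abs_mult using that by (intro mult_mono) auto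
  have Xb: "\<bar>X x $ i\<bar> \<le> 4 * b\<^sup>2" if x: "norm x \<ge> R" for x i
  proof -
    have "\<bar>u * v - u' * v'\<bar> \<le> 4 * b\<^sup>2" if "\<bar>u\<bar> \<le> b" "\<bar>v\<bar> \<le> 2 * b" "\<bar>u'\<bar> \<le> b" "\<bar>v'\<bar> \<le> 2 * b" for u v u' v'
      using prod[OF that(1,2)] prod[OF that(3,4)] by (simp add: power2_eq_square)
    moreover have "i = 1 \<or> i = 2 \<or> i = 3" by (rule exhaust_3)
    ultimately show ?thesis using b(2)[OF x] hb[OF x] by (auto simp: X_components)
  qed
  have dXb: "\<bar>dX i x\<bar> \<le> 8 * b\<^sup>2" if x: "norm x \<ge> R" for x i
  proof -
    have bb: "\<bar>B l i j x - B l' i' j' x\<bar> \<le> 2 * b" for l i j l' i' j'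
      using b(4)[OF x, of l i j] b(4)[OF x, of l' i' j'] by linarith
    have "\<bar>u1 * v1 + u2 * v2 - (u3 * v3 + u4 * v4)\<bar> \<le> 8 * b\<^sup>2"
      if "\<bar>u1\<bar> \<le> b" "\<bar>v1\<bar> \<le> 2 * b" "\<bar>u2\<bar> \<le> b" "\<bar>v2\<bar> \<le> 2 * b" "\<bar>u3\<bar> \<le> b" "\<bar>v3\<bar> \<le> 2 * b" "\<bar>u4\<bar> \<le> b" "\<bar>v4\<bar> \<le> 2 * b"
      for u1 u2 u3 u4 v1 v2 v3 v4
      using prod[OF that(1,2)] prod[OF that(3,4)] prod[OF that(5,6)] prod[OF that(7,8)] by (simp add: power2_eq_square)
    then show ?thesis unfolding dX_def dX1_def dX2_def dX3_def
      using b(2,3)[OF x] hb[OF x] bb by simp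
  qed
  have a': "annular (deriv a)" using a by (rule annular_deriv)
  have da: "deriv a r = 0" if "r < R" for r
    by (rule deriv_eq_0_locally_const[of "{..<R}" _ _ 0]) (use that aR in auto)
  obtain Ba where Ba: "\<And>r. \<bar>a r\<bar> \<le> Ba" using annular_bounded[OF a] by metis
  obtain Ba' where Ba': "\<And>r. \<bar>deriv a r\<bar> \<le> Ba'" using annular_bounded[OF a'] by metis
  have Bn: "Ba \<ge> 0" "Ba' \<ge> 0" using Ba[of 0] Ba'[of 0] by linarith+
  obtain d M where M: "d > 0" "d < M" "\<And>r. r < d \<Longrightarrow> a r = 0" "\<And>r. r > M \<Longrightarrow> a r = 0"
    by (rule annularE[OF a that])
  have da': "deriv a r = 0" if "r > M" for r
    by (rule deriv_eq_0_locally_const[of "{M<..}" _ _ 0]) (use that M in auto)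
  define F where "F i x = a (norm x) * (X x $ i)" for i x
  define D where "D i x = x $ i * (deriv a (norm x) / norm x) * (X x $ i) + a (norm x) * dX i x" for i x
  have am: "a \<in> borel_measurable borel" "deriv a \<in> borel_measurable borel"
    using smooth_measurable annular_smooth a a' by auto
  have Fm: "F i \<in> borel_measurable borel" for i
    unfolding F_def[abs_def] by (rule cutoff_measurable[OF continuous_X am(1)]) (use aR in auto)
  have Fb: "\<bar>F i x\<bar> \<le> Ba * (4 * b\<^sup>2)" for i x
  proof (cases "norm x \<ge> R")
    case True
    then show ?thesis unfolding F_def abs_mult using Ba Xb Bn by (intro mult_mono) auto
  next
    case False
    then show ?thesis using aR[of "norm x"] Bn by (simp add: F_def)
  qed
  have Fi: "integrable lebesgue (F i)" for i
    by (rule integrable_lebesgue_compact_support[OF Fm Fb, of M 0]) (use M in \<open>auto simp: F_def\<close>)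
  have DF: "((\<lambda>t. F i (x + t *\<^sub>R axis i 1)) has_real_derivative D i x) (at 0)" for i x
  proof (cases "norm x > r1")
    case True
    then have x0: "x \<noteq> 0" using r1 by auto
    have "((\<lambda>t. a (norm (x + t *\<^sub>R axis i 1))) has_real_derivative (x \<bullet> axis i 1) * (deriv a (norm x) / norm x)) (at 0)"
      by (rule radial_line_derivative[OF _ x0]) (use smooth_DERIV[OF annular_smooth[OF a], of "norm x"] x0 in simp)
    from DERIV_mult[OF this X_deriv[OF True, of i]] show ?thesis
      unfolding F_def D_def by (rule DERIV_cong) (simp add: inner_axis algebra_simps)
  next
    case False
    then have nx: "norm x < R" using r1 by simp
    have "D i x = 0" using da[OF nx] aR[of "norm x"] nx by (simp add: D_def)
    moreover have "((\<lambda>t. F i (x + t *\<^sub>R axis i 1)) has_real_derivative 0) (at 0)"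
    proof (rule has_field_derivative_transform_within_open[OF DERIV_const[of 0], of "{-(R - norm x)<..<R - norm x}"])
      fix t assume t: "t \<in> {-(R - norm x)<..<R - norm x}"
      have "norm (x + t *\<^sub>R axis i 1) \<le> norm x + \<bar>t\<bar>" using norm_triangle_ineq[of x "t *\<^sub>R axis i 1"] by simp
      then show "0 = F i (x + t *\<^sub>R axis i 1)" using t aR by (auto simp: F_def)
    qed (use nx in auto)
    ultimately show ?thesis by simp
  qed
  have Db: "\<bar>D i x\<bar> \<le> Ba' * (4 * b\<^sup>2) + Ba * (8 * b\<^sup>2)" for i x
  proof (cases "norm x \<ge> R")
    case True
    have "norm x > 0" using True r1 by linarith
    have "\<bar>x $ i * (deriv a (norm x) / norm x)\<bar> = \<bar>x $ i\<bar> / norm x * \<bar>deriv a (norm x)\<bar>" by (simp add: abs_mult)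
    also have "\<dots> \<le> 1 * Ba'" using Ba' component_le_norm_cart[of x i] \<open>norm x > 0\<close> by (intro mult_mono) auto
    finally have "\<bar>x $ i * (deriv a (norm x) / norm x)\<bar> \<le> Ba'" by simp
    then have "\<bar>x $ i * (deriv a (norm x) / norm x) * (X x $ i)\<bar> \<le> Ba' * (4 * b\<^sup>2)"
      unfolding abs_mult[of "x $ i * (deriv a (norm x) / norm x)"] using Xb[OF True] Bn by (intro mult_mono) auto
    moreover have "\<bar>a (norm x) * dX i x\<bar> \<le> Ba * (8 * b\<^sup>2)"
      unfolding abs_mult using Ba dXb[OF True] Bn by (intro mult_mono) auto
    ultimately show ?thesis unfolding D_def by linarith
  next
    case False
    then show ?thesis using da[of "norm x"] aR[of "norm x"] Bn by (simp add: D_def)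
  qed
  have M': "F i x = 0" if "norm x > M" for i x using M(4)[OF that] by (simp add: F_def)
  note D = integral_partial_derivative_eq_0[OF DF Db M' Fm Fi]
  have Dsum: "(\<Sum>i\<in>UNIV. D i x) = deriv a (norm x) * ((x \<bullet> X x) / norm x) + a (norm x) * q x" for x
  proof (cases "norm x > r1")
    case True
    have "(\<Sum>i\<in>UNIV. D i x) = (deriv a (norm x) / norm x) * (\<Sum>i\<in>UNIV. x $ i * X x $ i) + a (norm x) * (\<Sum>i\<in>UNIV. dX i x)"
      by (simp add: D_def sum.distrib sum_distrib_left mult_ac)
    then show ?thesis using divergence_X[OF True] by (simp add: inner_vec_def)
  next
    case False
    then show ?thesis using da[of "norm x"] aR[of "norm x"] r1 by (simp add: D_def)
  qed
  show qi: "integrable lebesgue (\<lambda>x. a (norm x) * q x)"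
  proof (rule integrable_lebesgue_compact_support[of _ "Ba * (12 * b\<^sup>2 + \<sigma>\<^sup>2 * (3 * b\<^sup>2))" M 0])
    show "(\<lambda>x. a (norm x) * q x) \<in> borel_measurable borel"
      by (rule cutoff_measurable[OF continuous_q am(1)]) (use aR in auto)
    show "\<bar>a (norm x) * q x\<bar> \<le> Ba * (12 * b\<^sup>2 + \<sigma>\<^sup>2 * (3 * b\<^sup>2))" for x
    proof (cases "norm x \<ge> R")
      case True
      have sq: "u\<^sup>2 \<le> C\<^sup>2" if "\<bar>u\<bar> \<le> C" for u C :: real using power_mono[OF that, of 2] by simp
      have "(curl1 x)\<^sup>2 + (curl2 x)\<^sup>2 + (curl3 x)\<^sup>2 \<le> 12 * b\<^sup>2"
        using sq[OF hb(1)[OF True]] sq[OF hb(2)[OF True]] sq[OF hb(3)[OF True]] by (simp add: power_mult_distrib)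
      moreover have "\<sigma>\<^sup>2 * ((N 1 x)\<^sup>2 + (N 2 x)\<^sup>2 + (N 3 x)\<^sup>2) \<le> \<sigma>\<^sup>2 * (3 * b\<^sup>2)"
        using sq[OF b(2)[OF True, of 1]] sq[OF b(2)[OF True, of 2]] sq[OF b(2)[OF True, of 3]] by (intro mult_left_mono) auto
      ultimately have "q x \<le> 12 * b\<^sup>2 + \<sigma>\<^sup>2 * (3 * b\<^sup>2)" by (simp add: q_def)
      moreover have "q x \<ge> 0" by (simp add: q_def)
      ultimately show ?thesis unfolding abs_mult using Ba Bn by (intro mult_mono) auto
    next
      case False
      then show ?thesis using aR[of "norm x"] Bn by simp
    qed
  qed (use M in auto)
  have "integrable lebesgue (\<lambda>x. (\<Sum>i\<in>UNIV. D i x))" using D(1) by (intro Bochner_Integration.integrable_sum) simp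
  from Bochner_Integration.integrable_diff[OF this qi]
  have gi: "integrable lebesgue (\<lambda>x. deriv a (norm x) * ((x \<bullet> X x) / norm x))" unfolding Dsum by simp
  have "0 = (LINT x|lebesgue. (\<Sum>i\<in>UNIV. D i x))" using D by (simp add: Bochner_Integration.integral_sum)
  also have "\<dots> = (LINT x|lebesgue. deriv a (norm x) * ((x \<bullet> X x) / norm x)) + (LINT x|lebesgue. a (norm x) * q x)"
    unfolding Dsum using gi qi by simp
  finally show "(LINT x|lebesgue. a (norm x) * q x) = - (LINT x|lebesgue. deriv a (norm x) * ((x \<bullet> X x) / norm x))" by simp
qed

end

section \<open>Estimates at the sphere and at infinity, and vanishing of the potential\<close>

context exterior_problem
begin

lemma norm_vec3_le:
  fixes v :: "real^3"
  assumes "\<And>j. \<bar>v $ j\<bar> \<le> b" shows "norm v \<le> 3 * b"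
  using norm_le_l1_cart[of v] assms[of 1] assms[of 2] assms[of 3] by (simp add: sum_3)

lemma Nv_component: "Nv x $ j = N j x"
proof -
  have "j = 1 \<or> j = 2 \<or> j = 3" by (rule exhaust_3)
  then show ?thesis by (auto simp: Nv_def)
qed

lemma Nv_potential: "norm x > r1 \<Longrightarrow> Nv x = yukawa_potential \<sigma> c x"
  by (simp add: vec_eq_iff Nv_component N_potential)

text \<open>At the radial projection x' of x onto the sphere the tangential part vanishes. Since x
  is parallel to x', the cross product of x with N(x') vanishes too, and the Lipschitz continuity of
  N gives the rest.\<close>

lemma tangential_trace_Lipschitz:
  obtains L where "L \<ge> 0" "\<And>x. norm x \<ge> R \<Longrightarrow> norm (cross3 x (Nv x)) \<le> norm x * (L * (norm x - R))"
proof -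
  define d where "d = R - r1"
  have d: "d > 0" using r1 by (simp add: d_def)
  \<comment> \<open>A bound for the derivative of \<open>yukawa \<sigma>\<close> on all distances
    from \<open>d\<close> on, where \<open>d\<close> is the gap between the sphere and the
    support.\<close>
  define L0 where "L0 = (1 + 1 / (\<sigma> * d)) / d\<^sup>2"
  have L0: "L0 \<ge> 0" using d \<sigma> by (simp add: L0_def)
  have yl: "\<bar>yukawa \<sigma> r - yukawa \<sigma> s\<bar> \<le> L0 * \<bar>r - s\<bar>" if "r \<ge> d" "s \<ge> d" for r s
  proof -
    have "norm (yukawa \<sigma> r - yukawa \<sigma> s) \<le> L0 * norm (r - s)"
    proof (rule field_differentiable_bound[of "{d..}" _ "\<lambda>r. r * yukawa1 \<sigma> r"])
      fix u assume u: "u \<in> {d..}"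
      then have "u > 0" using d by simp
      then show "(yukawa \<sigma> has_field_derivative u * yukawa1 \<sigma> u) (at u within {d..})"
        by (rule has_field_derivative_at_within[OF yukawa_DERIV(1)])
      have "\<bar>u * yukawa1 \<sigma> u\<bar> \<le> (1 + 1 / (\<sigma> * d)) / u ^ 2" using yukawa_bounds(2)[OF \<sigma> d] u by simp
      also have "\<dots> \<le> L0" unfolding L0_def using u d \<sigma> by (intro divide_left_mono power_mono) auto
      finally show "norm (u * yukawa1 \<sigma> u) \<le> L0" by simp
    qed (use that in auto)
    then show ?thesis by simp
  qed
  define I where "I = (LINT y|lebesgue. norm (c y))"
  have Nl: "\<bar>N j x - N j x'\<bar> \<le> L0 * I * norm (x - x')" if x: "norm x \<ge> R" "norm x' \<ge> R" for j x x'
  proof -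
    have r: "norm x > r1" "norm x' > r1" using x r1 by auto
    note i = conv_exists[OF exterior_kernel_ker(1)[OF \<sigma>] r(1), of j] conv_exists[OF exterior_kernel_ker(1)[OF \<sigma>] r(2), of j]
    have "N j x - N j x' = (LINT y|lebesgue. ker0 \<sigma> (x - y) * c y $ j - ker0 \<sigma> (x' - y) * c y $ j)"
      unfolding N_def conv_def using i by simp
    then have "\<bar>N j x - N j x'\<bar> \<le> (LINT y|lebesgue. norm (ker0 \<sigma> (x - y) * c y $ j - ker0 \<sigma> (x' - y) * c y $ j))"
      using integral_norm_bound[of lebesgue "\<lambda>y. ker0 \<sigma> (x - y) * c y $ j - ker0 \<sigma> (x' - y) * c y $ j"] by simp
    also have "\<dots> \<le> (LINT y|lebesgue. L0 * norm (x - x') * norm (c y))"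
    proof (rule integral_mono)
      show "integrable lebesgue (\<lambda>y. norm (ker0 \<sigma> (x - y) * c y $ j - ker0 \<sigma> (x' - y) * c y $ j))" using i by simp
      show "integrable lebesgue (\<lambda>y. L0 * norm (x - x') * norm (c y))" using c by simp
      fix y
      show "norm (ker0 \<sigma> (x - y) * c y $ j - ker0 \<sigma> (x' - y) * c y $ j) \<le> L0 * norm (x - x') * norm (c y)"
      proof (cases "norm y > r1")
        case False
        have "norm (x - y) \<ge> d" "norm (x' - y) \<ge> d"
          using False x norm_triangle_ineq2[of x y] norm_triangle_ineq2[of x' y] by (auto simp: d_def)
        then have "\<bar>ker0 \<sigma> (x - y) - ker0 \<sigma> (x' - y)\<bar> \<le> L0 * \<bar>norm (x - y) - norm (x' - y)\<bar>"
          unfolding ker0_def by (rule yl)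
        also have "\<dots> \<le> L0 * norm (x - x')"
          using norm_triangle_ineq3[of "x - y" "x' - y"] L0 by (intro mult_left_mono) auto
        finally have "\<bar>ker0 \<sigma> (x - y) - ker0 \<sigma> (x' - y)\<bar> * \<bar>c y $ j\<bar> \<le> L0 * norm (x - x') * norm (c y)"
          by (intro mult_mono component_le_norm_cart) (use L0 in auto)
        then show ?thesis by (simp add: abs_mult left_diff_distrib[symmetric] flip: abs_mult)
      qed (simp add: supp)
    qed
    finally show ?thesis by (simp add: I_def mult_ac)
  qed
  show ?thesis
  proof (rule that[of "3 * (L0 * I)"])
    have I: "I \<ge> 0" unfolding I_def by (rule integral_nonneg_AE) simp
    then show "3 * (L0 * I) \<ge> 0" using L0 by simp
    fix x :: "real^3" assume x: "norm x \<ge> R"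
    have R: "R > 0" using r1 by linarith
    define x' where "x' = (R / norm x) *\<^sub>R x"
    have nx: "norm x > 0" using x R by linarith
    have nx': "norm x' = R" using R nx by (simp add: x'_def)
    have "x - x' = (1 - R / norm x) *\<^sub>R x" by (simp add: x'_def algebra_simps)
    moreover have "1 - R / norm x \<ge> 0" using nx x by simp
    ultimately have "norm (x - x') = (1 - R / norm x) * norm x" by simp
    then have dist: "norm (x - x') = norm x - R" using nx by (simp add: left_diff_distrib)
    have "cross3 x' (Nv x') = 0" using boundary[OF nx'] Nv_potential[of x'] nx' r1 by simp
    then have "cross3 x (Nv x') = 0" using R nx by (simp add: x'_def cross_mult_left)
    then have "cross3 x (Nv x) = cross3 x (Nv x - Nv x')" by (simp add: Cross3.right_diff_distrib)
    then have "norm (cross3 x (Nv x)) \<le> norm x * norm (Nv x - Nv x')" using norm_cross3_le by simp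
    also have "norm (Nv x - Nv x') \<le> 3 * (L0 * I * norm (x - x'))"
      by (rule norm_vec3_le) (use Nl x nx' in \<open>simp add: Nv_component\<close>)
    finally show "norm (cross3 x (Nv x)) \<le> norm x * (3 * (L0 * I) * (norm x - R))"
      using nx by (simp add: dist mult_ac)
  qed
qed

text \<open>Beyond 2 R the support of \<open>c\<close> is at distance at least norm x / 2. The decay
  of the kernels carries over, and halving the distance costs the factor 4.\<close>

lemma potential_decay:
  obtains C where "C \<ge> 0" "\<And>x j. norm x \<ge> 2 * R \<Longrightarrow> \<bar>N j x\<bar> \<le> C / (norm x)\<^sup>2"
    "\<And>x i j. norm x \<ge> 2 * R \<Longrightarrow> \<bar>A i j x\<bar> \<le> C / (norm x)\<^sup>2"
proof -
  have R: "R > 0" using r1 by linarith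
  define I where "I = (LINT y|lebesgue. norm (c y))"
  have I: "I \<ge> 0" unfolding I_def by (rule integral_nonneg_AE) simp
  have gen: "\<bar>conv K (\<lambda>y. c y $ j) x\<bar> \<le> 4 * k * I / (norm x)\<^sup>2"
    if K: "exterior_kernel K" "\<And>z. norm z \<ge> R \<Longrightarrow> \<bar>K z\<bar> \<le> k / (norm z)\<^sup>2" and k: "k \<ge> 0" and x: "norm x \<ge> 2 * R" for K k j and x :: "real^3"
  proof -
    have d: "norm x / 2 > 0" "norm x \<ge> r1 + norm x / 2" using x R r1 by auto
    have "\<bar>conv K (\<lambda>y. c y $ j) x\<bar> \<le> (k / (norm x / 2)\<^sup>2) * (LINT y|lebesgue. \<bar>c y $ j\<bar>)"
    proof (rule conv_integrand(4)[OF c_component K(1) d])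
      fix z :: "real^3" assume z: "norm x / 2 \<le> norm z"
      have "\<bar>K z\<bar> \<le> k / (norm z)\<^sup>2" using z x by (intro K(2)) simp
      also have "\<dots> \<le> k / (norm x / 2)\<^sup>2"
        using z d k by (intro divide_left_mono power_mono mult_pos_pos zero_less_power) auto
      finally show "\<bar>K z\<bar> \<le> k / (norm x / 2)\<^sup>2" .
    qed
    also have "\<dots> \<le> (k / (norm x / 2)\<^sup>2) * I"
      unfolding I_def using k c_component(1) c by (intro mult_left_mono integral_mono component_le_norm_cart) auto
    finally show ?thesis by (simp add: power_divide mult_ac)
  qed
  define k where "k = 1 / \<sigma> + (1 + 1 / (\<sigma> * R))"
  have k: "k \<ge> 0" "1 / \<sigma> \<le> k" "1 + 1 / (\<sigma> * R) \<le> k" using \<sigma> R by (auto simp: k_def)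
  show ?thesis
  proof (rule that[of "4 * k * I"])
    show "4 * k * I \<ge> 0" using k I by simp
    show "\<bar>N j x\<bar> \<le> 4 * k * I / (norm x)\<^sup>2" if "norm x \<ge> 2 * R" for x j
      unfolding N_def
    proof (rule gen[OF exterior_kernel_ker(1)[OF \<sigma>] _ k(1) that])
      fix z :: "real^3" assume "norm z \<ge> R"
      from ker_bounds(1)[OF \<sigma> R this] show "\<bar>ker0 \<sigma> z\<bar> \<le> k / (norm z)\<^sup>2"
        by (rule order_trans) (intro divide_right_mono k, simp)
    qed
    show "\<bar>A i j x\<bar> \<le> 4 * k * I / (norm x)\<^sup>2" if "norm x \<ge> 2 * R" for x i j
      unfolding A_def
    proof (rule gen[OF exterior_kernel_ker(2)[OF \<sigma>] _ k(1) that])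
      fix z :: "real^3" assume "norm z \<ge> R"
      from ker_bounds(2)[OF \<sigma> R this] show "\<bar>ker1 \<sigma> i z\<bar> \<le> k / (norm z)\<^sup>2"
        by (rule order_trans) (intro divide_right_mono k, simp)
    qed
  qed
qed

lemma norm_H_le: "(\<And>i j. \<bar>A i j x\<bar> \<le> b) \<Longrightarrow> norm (H x) \<le> 6 * b"
proof -
  assume b: "\<And>i j. \<bar>A i j x\<bar> \<le> b"
  have "\<bar>H x $ j\<bar> \<le> 2 * b" for j
  proof -
    have "j = 1 \<or> j = 2 \<or> j = 3" by (rule exhaust_3)
    then show ?thesis
      using b[of 2 3] b[of 3 2] b[of 3 1] b[of 1 3] b[of 1 2] b[of 2 1]
      by (auto simp: H_def curl1_def curl2_def curl3_def)
  qed
  from norm_vec3_le[OF this] show ?thesis by simp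
qed

text \<open>Permuting the triple product gives x . (N \<times> H) = (x \<times> N) . H, so the
  radial flux is controlled by the tangential part of N.\<close>

lemma radial_flux_le: "\<bar>(x \<bullet> X x) / norm x\<bar> \<le> norm (cross3 x (Nv x)) * norm (H x) / norm x"
proof -
  have "x \<bullet> X x = cross3 x (Nv x) \<bullet> H x"
    unfolding X_def using cross_triple[of x "Nv x" "H x"] by (simp add: inner_commute)
  then have "\<bar>x \<bullet> X x\<bar> \<le> norm (cross3 x (Nv x)) * norm (H x)" by (simp add: Cauchy_Schwarz_ineq2)
  then show ?thesis by (simp add: abs_divide divide_right_mono)
qed

text \<open>It rises from 0 to 1 between R and R + 1/n and falls back to 0 between m and 2
  m.\<close>

definition cutoff :: "real \<Rightarrow> real \<Rightarrow> real \<Rightarrow> real" where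
  "cutoff n m r = step (1 + n * (r - R)) * (1 - step (r / m))"

lemma cutoff_properties:
  assumes n: "n > 0" and m: "m > 0"
  shows "annular (cutoff n m)" "r \<le> R \<Longrightarrow> cutoff n m r = 0" "cutoff n m r \<ge> 0"
    "\<bar>deriv (cutoff n m) r\<bar> \<le> n * deriv step (1 + n * (r - R)) + deriv step (r / m) / m"
proof -
  show z: "cutoff n m r = 0" if "r \<le> R" for r
    using that n by (simp add: cutoff_def step_eq_0 mult_nonneg_nonpos)
  have R: "R > 0" using r1 by linarith
  have s1: "smooth (\<lambda>r. step (1 + n * (r - R)))" using smooth_affine[OF smooth_step, of n "1 - n * R"] by (simp add: algebra_simps)
  have s2: "smooth (\<lambda>r. step (r / m))" using smooth_affine[OF smooth_step, of "1 / m" 0] by simp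
  show "annular (cutoff n m)"
  proof (rule annularI[of _ R "2 * m"])
    show "smooth (cutoff n m)" unfolding cutoff_def[abs_def] by (intro smooth_mult smooth_diff smooth_const s1 s2)
    show "cutoff n m r = 0" if "r > 2 * m" for r using that m by (simp add: cutoff_def step_eq_1 field_simps)
  qed (use z R in auto)
  show "cutoff n m r \<ge> 0" using step_bounds by (simp add: cutoff_def)
  have "(cutoff n m has_real_derivative deriv step (1 + n * (r - R)) * n * (1 - step (r / m)) +
     (- (deriv step (r / m) * (1 / m))) * step (1 + n * (r - R))) (at r)"
    unfolding cutoff_def[abs_def]
  proof (rule DERIV_mult)
    show "((\<lambda>r. step (1 + n * (r - R))) has_real_derivative deriv step (1 + n * (r - R)) * n) (at r)"
      by (rule DERIV_chain2[where g = "\<lambda>r. 1 + n * (r - R)", OF smooth_DERIV[OF smooth_step]]) (auto intro!: derivative_eq_intros)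
    have "((\<lambda>r. step (r / m)) has_real_derivative deriv step (r / m) * (1 / m)) (at r)"
      by (rule DERIV_chain2[where g = "\<lambda>r. r / m", OF smooth_DERIV[OF smooth_step] DERIV_cdivide[OF DERIV_ident]])
    from DERIV_diff[OF DERIV_const this, of 1]
    show "((\<lambda>r. 1 - step (r / m)) has_real_derivative - (deriv step (r / m) * (1 / m))) (at r)" by simp
  qed
  then have d: "deriv (cutoff n m) r = deriv step (1 + n * (r - R)) * n * (1 - step (r / m)) +
     (- (deriv step (r / m) * (1 / m))) * step (1 + n * (r - R))" by (rule DERIV_imp_deriv)
  have "\<bar>deriv step (1 + n * (r - R)) * n * (1 - step (r / m))\<bar> \<le> deriv step (1 + n * (r - R)) * n * 1"
    unfolding abs_mult using step_bounds[of "r / m"] deriv_step_nonneg n by (intro mult_mono) auto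
  moreover have "\<bar>(- (deriv step (r / m) * (1 / m))) * step (1 + n * (r - R))\<bar> \<le> deriv step (r / m) / m * 1"
    unfolding abs_mult using step_bounds[of "1 + n * (r - R)"] deriv_step_nonneg m by (intro mult_mono) auto
  ultimately show "\<bar>deriv (cutoff n m) r\<bar> \<le> n * deriv step (1 + n * (r - R)) + deriv step (r / m) / m"
    unfolding d by (simp only: mult_1_right mult.commute[of n])
qed

text \<open>A nonzero value at \<open>x\<close> gives a positive amount \<kappa> of energy in a
  small ball. By the energy identity this is at most the flux through the thin shell at the sphere
  plus that through the shell between m and 2 m. The first tends to 0 because the tangential trace
  vanishes on the sphere, the second because of decay.\<close>

lemma exterior_vanishing:
  assumes x: "norm x > R" shows "yukawa_potential \<sigma> c x = 0"
proof (rule ccontr)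
  assume "yukawa_potential \<sigma> c x \<noteq> 0"
  then obtain j0 where j0: "N j0 x \<noteq> 0" using N_potential[of x] x r1 by (auto simp: vec_eq_iff)
  have R: "R > 0" using r1 by linarith
  define s where "s = (N j0 x)\<^sup>2"
  have s: "s > 0" using j0 by (simp add: s_def)
  have op: "open {x::real^3. norm x > r1}" by (intro open_Collect_less continuous_intros)
  have "isCont (N j0) x"
    using continuous_on_eq_continuous_at[OF op, of "N j0"] continuous(1)[of j0] x r1 by auto
  then have "isCont (\<lambda>y. (N j0 y)\<^sup>2) x" by (intro continuous_intros)
  then obtain e where e: "e > 0" "\<And>y. dist y x < e \<Longrightarrow> dist ((N j0 y)\<^sup>2) s < s / 2"
    using s unfolding continuous_at_eps_delta s_def by (metis half_gt_zero)
  \<comment> \<open>The ball stays at distance \<rho> from the sphere, so the cut-off equals 1 on it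
    as soon as n \<rho> \<ge> 1.\<close>
  define \<rho> where "\<rho> = min (e / 2) ((norm x - R) / 2)"
  have \<rho>: "\<rho> > 0" "\<rho> < e" "2 * \<rho> \<le> norm x - R" using e(1) x by (auto simp: \<rho>_def min_def field_simps)
  have N2: "(N j0 y)\<^sup>2 \<ge> s / 2" if "y \<in> cball x \<rho>" for y
  proof -
    have "\<bar>(N j0 y)\<^sup>2 - s\<bar> < s / 2" using e(2)[of y, unfolded dist_real_def] that \<rho> by (simp add: dist_commute)
    then show ?thesis using abs_ge_minus_self[of "(N j0 y)\<^sup>2 - s"] by linarith
  qed
  have qs: "q y \<ge> \<sigma>\<^sup>2 * (s / 2)" if "y \<in> cball x \<rho>" for y
  proof -
    have "(N j0 y)\<^sup>2 \<le> (N 1 y)\<^sup>2 + (N 2 y)\<^sup>2 + (N 3 y)\<^sup>2"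
      using exhaust_3[of j0] by auto
    then have "\<sigma>\<^sup>2 * (s / 2) \<le> \<sigma>\<^sup>2 * ((N 1 y)\<^sup>2 + (N 2 y)\<^sup>2 + (N 3 y)\<^sup>2)"
      using N2[OF that] by (intro mult_left_mono) auto
    then show ?thesis unfolding q_def by (smt (verit) zero_le_power2)
  qed
  have q0: "q y \<ge> 0" for y by (simp add: q_def)
  define \<kappa> where "\<kappa> = \<sigma>\<^sup>2 * (s / 2) * measure lebesgue (cball x \<rho>)"
  have \<kappa>: "\<kappa> > 0" using \<rho>(1) \<sigma> s content_cball_pos[OF \<rho>(1), of x] by (simp add: \<kappa>_def)
  obtain b where b: "b \<ge> 0" "\<And>x i j. norm x \<ge> R \<Longrightarrow> \<bar>A i j x\<bar> \<le> b" using uniform_bound by metis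
  obtain L where L: "L \<ge> 0" "\<And>x. norm x \<ge> R \<Longrightarrow> norm (cross3 x (Nv x)) \<le> norm x * (L * (norm x - R))"
    by (rule tangential_trace_Lipschitz[OF that])
  obtain C where C: "C \<ge> 0" "\<And>x j. norm x \<ge> 2 * R \<Longrightarrow> \<bar>N j x\<bar> \<le> C / (norm x)\<^sup>2"
    "\<And>x i j. norm x \<ge> 2 * R \<Longrightarrow> \<bar>A i j x\<bar> \<le> C / (norm x)\<^sup>2" by (rule potential_decay[OF that])
  obtain M1 where M1: "\<And>r. \<bar>deriv step r\<bar> \<le> M1" using annular_bounded[OF annular_deriv_step] by metis
  have M10: "M1 \<ge> 0" using M1[of 0] by linarith
  define g where "g y = (y \<bullet> X y) / norm y" for y
  have near: "\<bar>g y\<bar> \<le> 6 * b * L * (norm y - R)" if y: "norm y \<ge> R" for y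
  proof -
    have ny: "norm y > 0" using y R by linarith
    have "\<bar>g y\<bar> \<le> norm (cross3 y (Nv y)) * norm (H y) / norm y" unfolding g_def by (rule radial_flux_le)
    also have "\<dots> \<le> (norm y * (L * (norm y - R))) * (6 * b) / norm y"
      using L y b by (intro divide_right_mono mult_mono norm_H_le) auto
    finally show ?thesis using ny by (simp add: mult_ac)
  qed
  have far: "\<bar>g y\<bar> \<le> 18 * C\<^sup>2 / m ^ 4" if y: "norm y \<ge> m" and m: "m \<ge> 2 * R" for y m
  proof -
    have y2: "norm y \<ge> 2 * R" using y m by linarith
    have ny: "norm y > 0" using y2 R by linarith
    have mp: "m > 0" using m R by linarith
    have "\<bar>g y\<bar> \<le> norm (cross3 y (Nv y)) * norm (H y) / norm y" unfolding g_def by (rule radial_flux_le)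
    also have "\<dots> \<le> (norm y * (3 * (C / (norm y)\<^sup>2))) * (6 * (C / (norm y)\<^sup>2)) / norm y"
      using C y2 by (intro divide_right_mono mult_mono norm_H_le order_trans[OF norm_cross3_le] mult_left_mono norm_vec3_le)
         (auto simp: Nv_component)
    also have "\<dots> = 18 * C\<^sup>2 / norm y ^ 4" using ny by (simp add: field_simps power2_eq_square eval_nat_numeral)
    also have "\<dots> \<le> 18 * C\<^sup>2 / m ^ 4" using y mp ny by (intro divide_left_mono power_mono mult_pos_pos zero_less_power) auto
    finally show ?thesis .
  qed
  \<comment> \<open>A majorant of the flux density in the inner shell. The factor n is compensated
    by norm y - R \<le> 1/n, so \<open>p\<close> stays bounded while its support shrinks to a null
    set.\<close>
  define p where "p n y = n * deriv step (1 + n * (norm y - R)) * (6 * b * L * max 0 (norm y - R))" for n and y :: "real^3"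
  define S where "S m = 18 * C\<^sup>2 * M1 / m ^ 5" for m
  have pb: "\<bar>p n y\<bar> \<le> indicator (cball 0 (R + 1)) y *\<^sub>R (M1 * (6 * b * L))" if n: "n \<ge> 1" for n y
  proof (cases "norm y > R \<and> n * (norm y - R) \<le> 1")
    case True
    have "norm y - R \<le> n * (norm y - R)" using n True mult_right_mono[of 1 n "norm y - R"] by simp
    then have yR: "norm y \<le> R + 1" using True by linarith
    have "\<bar>p n y\<bar> = (n * (norm y - R)) * (deriv step (1 + n * (norm y - R)) * (6 * b * L))"
      using True n b L deriv_step_nonneg by (simp add: p_def abs_mult)
    also have "\<dots> \<le> 1 * (M1 * (6 * b * L))"
      using True n b L M1 deriv_step_nonneg by (intro mult_mono mult_right_mono mult_nonneg_nonneg order_trans[OF abs_ge_self M1]) auto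
    finally show ?thesis using yR by simp
  next
    case False
    then have "p n y = 0" by (cases "norm y > R") (auto simp: p_def deriv_step_eq_0)
    then show ?thesis using M10 b L by simp
  qed
  have pm: "p n \<in> borel_measurable borel" for n
    using smooth_measurable[OF smooth_deriv[OF smooth_step]] unfolding p_def[abs_def] by measurable
  have pi: "integrable lebesgue (p n)" if "n \<ge> 1" for n
  proof (rule integrable_lebesgue_compact_support[OF pm, of _ "M1 * (6 * b * L)" "R + 1" 0])
    show "\<bar>p n y\<bar> \<le> M1 * (6 * b * L)" for y
      by (rule order_trans[OF pb[OF that]]) (use M10 b L in \<open>auto simp: indicator_def\<close>)
    show "p n y = 0" if "norm (y - 0) > R + 1" for y using pb[OF \<open>n \<ge> 1\<close>, of y] that by simp
  qed
  have plim: "(\<lambda>n. LINT y|lebesgue. p (real (Suc n)) y) \<longlonglongrightarrow> (LINT y::real^3|lebesgue. 0)"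
  proof (rule integral_dominated_convergence[where w = "\<lambda>y. indicator (cball 0 (R + 1)) y *\<^sub>R (M1 * (6 * b * L))"])
    show "integrable lebesgue (\<lambda>y. indicator (cball (0::real^3) (R + 1)) y *\<^sub>R (M1 * (6 * b * L)))" by (rule integrable_lebesgue_cball)
    show "p (real (Suc n)) \<in> borel_measurable lebesgue" for n using pm by (simp add: measurable_completion)
    show "AE y in lebesgue. norm (p (real (Suc n)) y) \<le> indicator (cball 0 (R + 1)) y *\<^sub>R (M1 * (6 * b * L))" for n
      using pb[of "real (Suc n)"] by simp
    show "AE y in lebesgue. (\<lambda>n. p (real (Suc n)) y) \<longlonglongrightarrow> 0"
    proof (intro AE_I2 tendsto_eventually)
      fix y :: "real^3"
      show "\<forall>\<^sub>F n in sequentially. p (real (Suc n)) y = 0"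
      proof (cases "norm y > R")
        case True
        obtain k :: nat where k: "real k * (norm y - R) > 1"
          using True reals_Archimedean3[of "norm y - R"] by (metis diff_gt_0_iff_gt)
        have "p (real (Suc n)) y = 0" if "n \<ge> k" for n
        proof -
          have "real k * (norm y - R) \<le> real (Suc n) * (norm y - R)" using that True by (intro mult_right_mono) auto
          then have "deriv step (1 + real (Suc n) * (norm y - R)) = 0" using k by (intro deriv_step_eq_0) auto
          then show ?thesis by (simp add: p_def)
        qed
        then show ?thesis by (auto simp: eventually_sequentially)
      qed (simp add: p_def)
    qed
  qed simp
  \<comment> \<open>The energy of the small ball against the two fluxes: \<open>p n\<close> bounds
    the inner one, and the constant \<open>S m\<close> bounds the outer one on the ball of radius 2
    m.\<close>
  have key: "\<kappa> \<le> (LINT y|lebesgue. p n y) + S m * measure lebesgue (cball (0::real^3) (2 * m))"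
    if n: "n \<ge> 1" "n * \<rho> \<ge> 1" and m: "m \<ge> 2 * R" "m \<ge> norm x + \<rho>" for n m
  proof -
    have np: "n > 0" "m > 0" using n m R by auto
    note cut = cutoff_properties[OF np]
    note en = energy_identity[OF cut(1,2)]
    have "\<kappa> = (LINT y|lebesgue. indicator (cball x \<rho>) y *\<^sub>R (\<sigma>\<^sup>2 * (s / 2)))"
      using lmeasurable_cball[of x \<rho>] by (simp add: \<kappa>_def fmeasurable_def)
    also have "\<dots> \<le> (LINT y|lebesgue. cutoff n m (norm y) * q y)"
    proof (rule integral_mono[OF integrable_lebesgue_cball en(1)])
      fix y
      show "indicator (cball x \<rho>) y *\<^sub>R (\<sigma>\<^sup>2 * (s / 2)) \<le> cutoff n m (norm y) * q y"
      proof (cases "y \<in> cball x \<rho>")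
        case True
        have "norm (x - y) \<le> \<rho>" using True by (simp add: dist_norm)
        then have ny: "norm y \<ge> norm x - \<rho>" "norm y \<le> norm x + \<rho>"
          using norm_triangle_ineq2[of x y] norm_triangle_ineq2[of y x] by (auto simp: norm_minus_commute)
        then have "n * (norm y - R) \<ge> n * \<rho>" using \<rho> np by (intro mult_left_mono) auto
        then have "step (1 + n * (norm y - R)) = 1" using n by (intro step_eq_1) linarith
        moreover have "step (norm y / m) = 0" using ny m np by (intro step_eq_0) (simp add: field_simps)
        ultimately have "cutoff n m (norm y) = 1" by (simp add: cutoff_def)
        then show ?thesis using True qs[OF True] by simp
      next
        case False
        then show ?thesis using cut(3) q0 by simp
      qed
    qed
    also have "\<dots> = - (LINT y|lebesgue. deriv (cutoff n m) (norm y) * g y)"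
      using en(2) by (simp add: g_def)
    also have "\<dots> \<le> (LINT y|lebesgue. p n y + indicator (cball 0 (2 * m)) y *\<^sub>R S m)"
    proof (cases "integrable lebesgue (\<lambda>y. deriv (cutoff n m) (norm y) * g y)")
      case True
      have "- (LINT y|lebesgue. deriv (cutoff n m) (norm y) * g y) = (LINT y|lebesgue. - (deriv (cutoff n m) (norm y) * g y))" by simp
      also have "\<dots> \<le> (LINT y|lebesgue. p n y + indicator (cball 0 (2 * m)) y *\<^sub>R S m)"
      proof (rule integral_mono)
        show "integrable lebesgue (\<lambda>y. - (deriv (cutoff n m) (norm y) * g y))" using True by simp
        show "integrable lebesgue (\<lambda>y. p n y + indicator (cball 0 (2 * m)) y *\<^sub>R S m)"
          by (intro Bochner_Integration.integrable_add pi n integrable_lebesgue_cball)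
        fix y :: "real^3"
        have Sm: "S m \<ge> 0" using M10 np by (simp add: S_def)
        have pn: "p n y \<ge> 0" unfolding p_def using np b L deriv_step_nonneg by (intro mult_nonneg_nonneg) auto
        show "- (deriv (cutoff n m) (norm y) * g y) \<le> p n y + indicator (cball 0 (2 * m)) y *\<^sub>R S m"
        proof (cases "norm y < R")
          case True
          have "deriv (cutoff n m) (norm y) = 0"
            by (rule deriv_eq_0_locally_const[of "{..<R}" _ _ 0]) (use True cut(2) in auto)
          then show ?thesis using pn Sm by (simp add: indicator_def)
        next
          case False
          then have yR: "norm y \<ge> R" by simp
          have "- (deriv (cutoff n m) (norm y) * g y) \<le> \<bar>deriv (cutoff n m) (norm y)\<bar> * \<bar>g y\<bar>"
            by (metis abs_ge_minus_self abs_mult)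
          also have "\<dots> \<le> (n * deriv step (1 + n * (norm y - R)) + deriv step (norm y / m) / m) * \<bar>g y\<bar>"
            by (intro mult_right_mono cut(4)) simp
          also have "\<dots> = n * deriv step (1 + n * (norm y - R)) * \<bar>g y\<bar> + deriv step (norm y / m) / m * \<bar>g y\<bar>"
            by (rule distrib_right)
          also have "n * deriv step (1 + n * (norm y - R)) * \<bar>g y\<bar> \<le> p n y"
            unfolding p_def using near[OF yR] yR np deriv_step_nonneg by (intro mult_left_mono) auto
          also have "deriv step (norm y / m) / m * \<bar>g y\<bar> \<le> indicator (cball 0 (2 * m)) y *\<^sub>R S m"
          proof (cases "m \<le> norm y \<and> norm y \<le> 2 * m")
            case True
            have "deriv step (norm y / m) / m * \<bar>g y\<bar> \<le> M1 / m * (18 * C\<^sup>2 / m ^ 4)"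
              using far[of m y] True m np M1 M10 by (intro mult_mono divide_right_mono order_trans[OF abs_ge_self M1]) auto
            also have "\<dots> = S m" by (simp add: S_def eval_nat_numeral)
            finally show ?thesis using True by simp
          next
            case False
            then have "deriv step (norm y / m) = 0" using np by (intro deriv_step_eq_0) (auto simp: field_simps)
            then show ?thesis using Sm by (simp add: indicator_def)
          qed
          finally show ?thesis by simp
        qed
      qed
      finally show ?thesis .
    next
      \<comment> \<open>A non-integrable flux density has integral 0 by convention, and the majorant
        is nonnegative.\<close>
      case False
      have "0 \<le> (LINT y|lebesgue. p n y + indicator (cball 0 (2 * m)) y *\<^sub>R S m)"
        using np b L M10 deriv_step_nonneg by (intro integral_nonneg_AE AE_I2) (auto simp: p_def S_def)
      then show ?thesis using False by (simp add: not_integrable_integral_eq)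
    qed
    also have "\<dots> = (LINT y|lebesgue. p n y) + S m * measure lebesgue (cball (0::real^3) (2 * m))"
      using pi[OF n(1)] integrable_lebesgue_cball[of 0 "2 * m" "S m"] lmeasurable_cball[of "0::real^3" "2 * m"]
      by (simp add: fmeasurable_def)
    finally show ?thesis .
  qed
  \<comment> \<open>The outer term equals V / m^2: S m is of order m^(-5), the volume of order m^3,
    and 144 = 18 * 8. For m \<ge> 1 it is at most V / m, and m > 2 V / \<kappa> makes it smaller
    than \<kappa> / 2.\<close>
  define V where "V = 144 * C\<^sup>2 * M1 * unit_ball_vol 3"
  have V: "V \<ge> 0" using M10 unit_ball_vol_nonneg[of 3] by (simp add: V_def)
  define m where "m = 2 * R + norm x + \<rho> + 1 + 2 * V / \<kappa>"
  have Vk: "2 * V / \<kappa> \<ge> 0" using V \<kappa> by simp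
  have m: "m \<ge> 2 * R" "m \<ge> norm x + \<rho>" "m \<ge> 1" "2 * V / \<kappa> < m" unfolding m_def using R \<rho> Vk norm_ge_zero[of x] by linarith+
  have mp: "m > 0" using m by linarith
  have "S m * measure lebesgue (cball (0::real^3) (2 * m)) = V / m\<^sup>2"
    using content_cball[of "2 * m" "0::real^3"] mp by (simp add: S_def V_def power_mult_distrib field_simps eval_nat_numeral)
  also have "\<dots> \<le> V / m" using V m mp by (intro divide_left_mono) (auto simp: power2_eq_square)
  also have "\<dots> < \<kappa> / 2" using m(4) \<kappa> mp by (simp add: field_simps)
  finally have Sm: "S m * measure lebesgue (cball (0::real^3) (2 * m)) < \<kappa> / 2" .
  have "\<forall>\<^sub>F n in sequentially. (LINT y|lebesgue. p (real (Suc n)) y) < \<kappa> / 2"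
    using plim \<kappa> by (intro order_tendstoD(2)) auto
  then obtain k where k: "\<And>n. n \<ge> k \<Longrightarrow> (LINT y|lebesgue. p (real (Suc n)) y) < \<kappa> / 2" by (auto simp: eventually_sequentially)
  obtain k' :: nat where k': "real k' * \<rho> > 1" using reals_Archimedean3[OF \<rho>(1)] by blast
  define n where "n = max k k'"
  have "real k' * \<rho> \<le> real (Suc n) * \<rho>" using \<rho>(1) by (intro mult_right_mono) (auto simp: n_def)
  then have "\<kappa> \<le> (LINT y|lebesgue. p (real (Suc n)) y) + S m * measure lebesgue (cball (0::real^3) (2 * m))"
    using k' by (intro key m) auto
  also have "\<dots> < \<kappa> / 2 + \<kappa> / 2" using k[of n] Sm by (intro add_strict_mono) (auto simp: n_def)
  finally show False by simp
qed

text \<open>The expansion |n d - y| = n - d . y + o(1). Rationalising gives n - |n d - y| as a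
  quotient with denominator t n + 1, where t n = |n d - y| / n tends to 1.\<close>

lemma far_field_tendsto:
  fixes d y :: "real^3"
  assumes d: "norm d = 1"
  shows "(\<lambda>n. real n * exp (\<sigma> * real n) * ker0 \<sigma> (real n *\<^sub>R d - y)) \<longlonglongrightarrow> exp (\<sigma> * (d \<bullet> y))"
proof -
  define t where "t n = norm (real n *\<^sub>R d - y) / real n" for n :: nat
  have inv: "(\<lambda>n. K / real n) \<longlonglongrightarrow> 0" for K by (rule lim_const_over_n)
  have t1: "t \<longlonglongrightarrow> 1"
  proof -
    have "(\<lambda>n. t n - 1) \<longlonglongrightarrow> 0"
    proof (rule Lim_null_comparison[OF _ inv[of "norm y"]])
      show "\<forall>\<^sub>F n in sequentially. norm (t n - 1) \<le> norm y / real n"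
        using eventually_gt_at_top[of 0]
      proof eventually_elim
        case (elim n)
        have "\<bar>norm (real n *\<^sub>R d - y) - norm (real n *\<^sub>R d)\<bar> \<le> norm y"
          using norm_triangle_ineq3[of "real n *\<^sub>R d - y" "real n *\<^sub>R d"] by simp
        then have "\<bar>norm (real n *\<^sub>R d - y) - real n\<bar> / real n \<le> norm y / real n" using d by (intro divide_right_mono) auto
        moreover have "t n - 1 = (norm (real n *\<^sub>R d - y) - real n) / real n" using elim by (simp add: t_def field_simps)
        ultimately show ?case by simp
      qed
    qed
    then show ?thesis by (simp add: LIM_zero_iff)
  qed
  have ph: "(\<lambda>n. (2 * (d \<bullet> y) - (norm y)\<^sup>2 / real n) / (t n + 1)) \<longlonglongrightarrow> (2 * (d \<bullet> y) - 0) / (1 + 1)"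
    by (intro tendsto_intros inv t1) simp
  have "(\<lambda>n. exp (\<sigma> * ((2 * (d \<bullet> y) - (norm y)\<^sup>2 / real n) / (t n + 1))) / t n) \<longlonglongrightarrow> exp (\<sigma> * ((2 * (d \<bullet> y) - 0) / (1 + 1))) / 1"
    by (intro tendsto_intros ph t1) simp
  moreover have "\<forall>\<^sub>F n in sequentially. exp (\<sigma> * ((2 * (d \<bullet> y) - (norm y)\<^sup>2 / real n) / (t n + 1))) / t n =
     real n * exp (\<sigma> * real n) * ker0 \<sigma> (real n *\<^sub>R d - y)"
    using eventually_gt_at_top[of 0]
  proof eventually_elim
    case (elim n)
    have t0: "t n \<ge> 0" by (simp add: t_def)
    have nt: "norm (real n *\<^sub>R d - y) = real n * t n" using elim by (simp add: t_def)
    have "(real n * t n)\<^sup>2 = (real n)\<^sup>2 - 2 * real n * (d \<bullet> y) + (norm y)\<^sup>2"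
    proof -
      have dd: "d \<bullet> d = 1" using d by (simp add: dot_square_norm)
      show ?thesis unfolding nt[symmetric]
        by (simp only: power2_norm_eq_inner inner_diff_left inner_diff_right inner_scaleR_left inner_scaleR_right dd inner_commute[of y d])
          (simp add: algebra_simps power2_eq_square)
    qed
    then have "(2 * (d \<bullet> y) - (norm y)\<^sup>2 / real n) = real n * (1 - t n) * (t n + 1)"
      using elim by (simp add: field_simps power2_eq_square)
    then have eq: "(2 * (d \<bullet> y) - (norm y)\<^sup>2 / real n) / (t n + 1) = real n - real n * t n"
      using t0 by (simp add: field_simps)
    show ?case unfolding eq using elim
      by (simp add: ker0_def yukawa_def nt right_diff_distrib exp_diff exp_minus field_simps)
  qed
  ultimately have "(\<lambda>n. real n * exp (\<sigma> * real n) * ker0 \<sigma> (real n *\<^sub>R d - y)) \<longlonglongrightarrow> exp (\<sigma> * ((2 * (d \<bullet> y) - 0) / (1 + 1))) / 1"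
    by (rule Lim_transform_eventually)
  then show ?thesis by simp
qed

text \<open>The potential vanishes along the ray in direction \<xi> / \<sigma>. Rescaled by n
  exp(\<sigma> n) its kernel tends to exp(\<xi> . y), and the limit is taken under the
  integral.\<close>

lemma far_field_vanishing:
  assumes \<xi>: "norm \<xi> = \<sigma>"
  shows "(LINT y|lebesgue. exp (\<xi> \<bullet> y) * c y $ j) = 0"
proof -
  define d where "d = \<xi> /\<^sub>R \<sigma>"
  have d: "norm d = 1" "\<sigma> * (d \<bullet> y) = \<xi> \<bullet> y" for y using \<xi> \<sigma> by (auto simp: d_def)
  obtain k :: nat where k: "real k > 2 * R" using reals_Archimedean2 by blast
  have R: "R > 0" using r1 by linarith
  let ?h = "\<lambda>n y. real n * exp (\<sigma> * real n) * ker0 \<sigma> (real n *\<^sub>R d - y) * c y $ j"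
  let ?n = "\<lambda>i. i + k"
  have big: "norm (real (?n i) *\<^sub>R d) > 2 * R" for i using k d by simp
  have far: "norm (real (?n i) *\<^sub>R d) > r1" "norm (real (?n i) *\<^sub>R d) > R" for i using big[of i] R r1 by linarith+
  have zero: "(LINT y|lebesgue. ?h (?n i) y) = 0" for i
  proof -
    have "(LINT y|lebesgue. ?h (?n i) y) = (LINT y|lebesgue. (real (?n i) * exp (\<sigma> * real (?n i))) * (ker0 \<sigma> (real (?n i) *\<^sub>R d - y) * c y $ j))"
      by (simp only: mult.assoc)
    also have "\<dots> = (real (?n i) * exp (\<sigma> * real (?n i))) * N j (real (?n i) *\<^sub>R d)"
      unfolding N_def conv_def by (rule integral_mult_right_zero)
    finally show ?thesis using N_potential[OF far(1)] exterior_vanishing[OF far(2)] by simp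
  qed
  have "(\<lambda>i. LINT y|lebesgue. ?h (?n i) y) \<longlonglongrightarrow> (LINT y|lebesgue. exp (\<xi> \<bullet> y) * c y $ j)"
  \<comment> \<open>At distance m > 2 R along the ray, the distance r to a point of the support
    satisfies m - r \<le> r1 and m / r \<le> 2, whence the two constants.\<close>
  proof (rule integral_dominated_convergence[where w = "\<lambda>y. 2 * exp (\<sigma> * r1) * \<bar>c y $ j\<bar>"])
    have cm: "(\<lambda>y. c y $ j) \<in> borel_measurable lebesgue" using c_component(1) by (rule borel_measurable_integrable)
    have "(\<lambda>y. exp (\<xi> \<bullet> y)) \<in> borel_measurable lborel" by measurable
    then have "(\<lambda>y. exp (\<xi> \<bullet> y)) \<in> borel_measurable lebesgue" by (rule measurable_completion)
    then show "(\<lambda>y. exp (\<xi> \<bullet> y) * c y $ j) \<in> borel_measurable lebesgue" using cm by (rule borel_measurable_times)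
    show "?h (?n i) \<in> borel_measurable lebesgue" for i
      using borel_measurable_times[OF borel_measurable_const[of "real (?n i) * exp (\<sigma> * real (?n i))"]
          borel_measurable_integrable[OF conv_exists[OF exterior_kernel_ker(1)[OF \<sigma>] far(1)[of i], of j]]]
      by (simp only: mult.assoc)
    show "integrable lebesgue (\<lambda>y. 2 * exp (\<sigma> * r1) * \<bar>c y $ j\<bar>)" using c_component(1) by simp
    show "AE y in lebesgue. (\<lambda>i. ?h (?n i) y) \<longlonglongrightarrow> exp (\<xi> \<bullet> y) * c y $ j"
    proof (intro AE_I2)
      fix y
      have "(\<lambda>i. ?h (?n i) y) \<longlonglongrightarrow> exp (\<sigma> * (d \<bullet> y)) * c y $ j"
        by (intro tendsto_mult tendsto_const LIMSEQ_ignore_initial_segment[OF far_field_tendsto[OF d(1)]])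
      then show "(\<lambda>i. ?h (?n i) y) \<longlonglongrightarrow> exp (\<xi> \<bullet> y) * c y $ j" by (simp add: d(2))
    qed
    show "AE y in lebesgue. norm (?h (?n i) y) \<le> 2 * exp (\<sigma> * r1) * \<bar>c y $ j\<bar>" for i
    proof (intro AE_I2)
      fix y
      show "norm (?h (?n i) y) \<le> 2 * exp (\<sigma> * r1) * \<bar>c y $ j\<bar>"
      proof (cases "norm y > r1")
        case False
        define m where "m = real (?n i)"
        define r where "r = norm (m *\<^sub>R d - y)"
        have m: "m > 2 * R" using k by (simp add: m_def)
        have "m - r1 \<le> r" using norm_triangle_ineq2[of "m *\<^sub>R d" y] False d m R by (simp add: r_def)
        then have r: "m \<le> 2 * r" "m - r \<le> r1" "r > 0" using m r1 by linarith+
        have "m * exp (\<sigma> * m) * (exp (- \<sigma> * r) / r) = (m / r) * exp (\<sigma> * (m - r))"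
          by (simp add: right_diff_distrib exp_diff exp_minus field_simps)
        also have "\<dots> \<le> 2 * exp (\<sigma> * r1)"
        proof (rule mult_mono)
          show "m / r \<le> 2" using r by (simp add: divide_le_eq)
          show "exp (\<sigma> * (m - r)) \<le> exp (\<sigma> * r1)" using r \<sigma> by (simp add: mult_left_mono)
        qed auto
        finally have "m * exp (\<sigma> * m) * (exp (- \<sigma> * r) / r) \<le> 2 * exp (\<sigma> * r1)" .
        then have "\<bar>m * exp (\<sigma> * m) * (exp (- \<sigma> * r) / r)\<bar> \<le> 2 * exp (\<sigma> * r1)" using r m R by simp
        then have "\<bar>m * exp (\<sigma> * m) * (exp (- \<sigma> * r) / r)\<bar> * \<bar>c y $ j\<bar> \<le> 2 * exp (\<sigma> * r1) * \<bar>c y $ j\<bar>"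
          by (rule mult_right_mono) simp
        then show ?thesis unfolding ker0_def yukawa_def m_def[symmetric] r_def[symmetric] real_norm_def
          by (simp only: abs_mult)
      qed (simp add: c_component(2))
    qed
  qed
  then show ?thesis unfolding zero by (simp add: LIMSEQ_const_iff)
qed

end

section \<open>Moments\<close>

lemma continuous_mult_integrable:
  fixes f h :: "real^3 \<Rightarrow> real"
  assumes f: "integrable lebesgue f" "\<And>z. norm z > \<rho> \<Longrightarrow> f z = 0" and h: "continuous_on UNIV h"
  shows "integrable lebesgue (\<lambda>z. h z * f z)"
proof -
  have "compact (h ` cball 0 \<rho>)" using h by (intro compact_continuous_image) (auto intro: continuous_on_subset)
  then have "bounded (h ` cball 0 \<rho>)" by (rule compact_imp_bounded)
  then obtain B where "\<forall>y \<in> h ` cball 0 \<rho>. norm y \<le> B" unfolding bounded_iff by blast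
  then have B: "\<bar>h z\<bar> \<le> B" if "norm z \<le> \<rho>" for z using that by auto
  show ?thesis
  proof (rule Bochner_Integration.integrable_bound)
    show "integrable lebesgue (\<lambda>z. B * f z)" using f(1) by simp
    have "h \<in> borel_measurable borel" using h by (rule borel_measurable_continuous_onI)
    then have "h \<in> borel_measurable lebesgue" by (simp add: measurable_completion)
    then show "(\<lambda>z. h z * f z) \<in> borel_measurable lebesgue"
      using borel_measurable_integrable[OF f(1)] by (rule borel_measurable_times)
    show "AE z in lebesgue. norm (h z * f z) \<le> norm (B * f z)"
    proof (intro AE_I2)
      fix z
      show "norm (h z * f z) \<le> norm (B * f z)"
      proof (cases "norm z > \<rho>")
        case False
        then have "\<bar>h z\<bar> \<le> \<bar>B\<bar>" using B[of z] by simp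
        then show ?thesis by (simp add: abs_mult mult_right_mono)
      qed (simp add: f(2))
    qed
  qed
qed

text \<open>On the line s -> \<xi>0 + s (\<xi> - \<xi>0) the moment extends holomorphically to
  complex s, because \<open>f\<close> has bounded support. It vanishes for small real s, hence also
  at s = 1.\<close>

lemma exponential_moments_local_imp_global:
  fixes f :: "real^3 \<Rightarrow> real"
  assumes f: "integrable lebesgue f" "\<And>z. norm z > \<rho> \<Longrightarrow> f z = 0"
    and e: "e > 0" and z: "\<And>\<xi>. norm (\<xi> - \<xi>0) < e \<Longrightarrow> (LINT z|lebesgue. exp (\<xi> \<bullet> z) * f z) = 0"
  shows "(LINT z|lebesgue. exp (\<xi> \<bullet> z) * f z) = 0"
proof -
  define \<eta> where "\<eta> = \<xi> - \<xi>0"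
  define h where "h s z = exp (of_real (\<xi>0 \<bullet> z) + s * of_real (\<eta> \<bullet> z)) * of_real (f z)" for s :: complex and z
  have val: "(LINT z|lebesgue. h (of_real s) z) = of_real (LINT z|lebesgue. exp ((\<xi>0 + s *\<^sub>R \<eta>) \<bullet> z) * f z)" for s
  proof -
    have "h (of_real s) z = of_real (exp ((\<xi>0 + s *\<^sub>R \<eta>) \<bullet> z) * f z)" for z
      by (simp add: h_def inner_add_left flip: exp_of_real)
    then show ?thesis by (simp del: of_real_mult)
  qed
  have hol: "(\<lambda>s. LINT z|lebesgue. h s z) holomorphic_on ball 0 2"
  proof (rule holomorphic_parameter_integral)
    show "(\<lambda>s. h s z) holomorphic_on ball 0 2" for z unfolding h_def by (intro holomorphic_intros)
    show "h s \<in> borel_measurable lebesgue" for s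
    proof -
      have "(\<lambda>z. exp (complex_of_real (\<xi>0 \<bullet> z) + s * of_real (\<eta> \<bullet> z))) \<in> borel_measurable borel"
        by (intro borel_measurable_continuous_onI continuous_intros)
      then have "(\<lambda>z. exp (complex_of_real (\<xi>0 \<bullet> z) + s * of_real (\<eta> \<bullet> z))) \<in> borel_measurable lebesgue"
        by (simp add: measurable_completion)
      moreover have "(\<lambda>z. complex_of_real (f z)) \<in> borel_measurable lebesgue"
        using borel_measurable_integrable[OF f(1)] by measurable
      ultimately show ?thesis unfolding h_def[abs_def] by (rule borel_measurable_times)
    qed
    show "integrable lebesgue (\<lambda>z. exp (norm \<xi>0 * \<rho> + 2 * (norm \<eta> * \<rho>)) * \<bar>f z\<bar>)" using f(1) by simp
    fix s z assume s: "s \<in> ball (0::complex) 2"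
    show "norm (h s z) \<le> exp (norm \<xi>0 * \<rho> + 2 * (norm \<eta> * \<rho>)) * \<bar>f z\<bar>"
    proof (cases "norm z > \<rho>")
      case False
      have "\<xi>0 \<bullet> z \<le> norm \<xi>0 * \<rho>"
        using norm_cauchy_schwarz[of \<xi>0 z] False mult_left_mono[of "norm z" \<rho> "norm \<xi>0"] by simp
      moreover have "Re s * (\<eta> \<bullet> z) \<le> 2 * (norm \<eta> * \<rho>)"
      proof -
        have "Re s * (\<eta> \<bullet> z) \<le> \<bar>Re s\<bar> * \<bar>\<eta> \<bullet> z\<bar>" by (metis abs_ge_self abs_mult)
        also have "\<dots> \<le> 2 * (norm \<eta> * \<rho>)"
        proof (rule mult_mono)
          show "\<bar>Re s\<bar> \<le> 2" using s abs_Re_le_cmod[of s] by simp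
          show "\<bar>\<eta> \<bullet> z\<bar> \<le> norm \<eta> * \<rho>"
            using Cauchy_Schwarz_ineq2[of \<eta> z] False mult_left_mono[of "norm z" \<rho> "norm \<eta>"] by simp
        qed auto
        finally show ?thesis .
      qed
      ultimately have "exp (\<xi>0 \<bullet> z + Re s * (\<eta> \<bullet> z)) \<le> exp (norm \<xi>0 * \<rho> + 2 * (norm \<eta> * \<rho>))" by simp
      then show ?thesis by (simp add: h_def norm_mult norm_exp_eq_Re mult_right_mono)
    qed (simp add: h_def f(2))
  qed simp
  \<comment> \<open>For |s| < r the point on the line stays within \<open>e\<close> of \<xi>0; the
    summand 1 avoids division by 0 when \<eta> = 0.\<close>
  define r where "r = min 1 (e / (norm \<eta> + 1))"
  have r: "r > 0" "r \<le> 1" using e by (auto simp: r_def add_nonneg_pos)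
  have zero: "(LINT z|lebesgue. h (of_real s) z) = 0" if s: "\<bar>s\<bar> < r" for s
  proof -
    have "\<bar>s\<bar> * norm \<eta> \<le> \<bar>s\<bar> * (norm \<eta> + 1)" by (intro mult_left_mono) auto
    also have "\<dots> < e"
    proof -
      have "\<bar>s\<bar> < e / (norm \<eta> + 1)" using s by (simp add: r_def)
      then show ?thesis by (simp add: pos_less_divide_eq add_nonneg_pos)
    qed
    finally have "norm (\<xi>0 + s *\<^sub>R \<eta> - \<xi>0) < e" by simp
    from z[OF this] show ?thesis unfolding val by simp
  qed
  have "(LINT z|lebesgue. h 1 z) = 0"
  proof (rule analytic_continuation[OF hol, where U = "of_real ` {-r<..<r}" and \<xi> = 0])
    show "of_real ` {-r<..<r} \<subseteq> ball (0::complex) 2" using r by auto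
    show "(LINT z|lebesgue. h s z) = 0" if "s \<in> of_real ` {-r<..<r}" for s using that zero by auto
    show "0 islimpt (of_real ` {-r<..<r} :: complex set)"
      unfolding islimpt_approachable
    proof (intro allI impI)
      fix d :: real assume "d > 0"
      then show "\<exists>z\<in>of_real ` {-r<..<r}. z \<noteq> (0::complex) \<and> dist z 0 < d"
        using r(1) by (intro bexI[of _ "of_real (min d r / 2)"] imageI) auto
    qed
  qed auto
  then show ?thesis using val[of 1] by (simp add: \<eta>_def)
qed

text \<open>In the variables w_i = exp(z_i) suitable exponentials are monomials, so all polynomials
  in w integrate to 0 against \<open>f\<close>. The Stone-Weierstrass theorem extends this to
  continuous functions, and a limit to indicators of open sets.\<close>

lemma exponential_moments_imp_AE_0:
  fixes f :: "real^3 \<Rightarrow> real"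
  assumes f: "integrable lebesgue f" "\<And>z. norm z > \<rho> \<Longrightarrow> f z = 0"
    and z: "\<And>\<xi>. (LINT z|lebesgue. exp (\<xi> \<bullet> z) * f z) = 0"
  shows "AE z in lebesgue. f z = 0"
proof -
  define E where "E z = (\<chi> i. exp (z $ i))" for z :: "real^3"
  define Lg where "Lg w = (\<chi> i. ln (w $ i))" for w :: "real^3"
  have contE: "continuous_on UNIV E" unfolding E_def[abs_def] by (intro continuous_intros)
  \<comment> \<open>All \<xi> are kept in the predicate because multiplication by exp(z_i) shifts
    \<xi> by a unit vector. This is what makes the induction over polynomials go through.\<close>
  define Q where "Q h \<longleftrightarrow> continuous_on UNIV h \<and> (\<forall>\<xi>. (LINT z|lebesgue. exp (\<xi> \<bullet> z) * h z * f z) = 0)" for h :: "real^3 \<Rightarrow> real"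
  have Qi: "integrable lebesgue (\<lambda>z. exp (\<xi> \<bullet> z) * h z * f z)" if "continuous_on UNIV h" for h \<xi>
  proof (rule continuous_mult_integrable[OF f(1)])
    show "f z = 0" if "norm z > \<rho>" for z using f(2) that .
    show "continuous_on UNIV (\<lambda>z. exp (\<xi> \<bullet> z) * h z)" by (intro continuous_intros that)
  qed
  have poly: "Q h \<Longrightarrow> Q (\<lambda>z. p (E z) * h z)" if "real_polynomial_function p" for p h
    using that
  proof (induction arbitrary: h rule: real_polynomial_function.induct)
    case (linear p)
    have h: "continuous_on UNIV h" using linear(2) by (simp add: Q_def)
    have pE: "p (E z) = (\<Sum>i\<in>UNIV. p (axis i 1) * exp (z $ i))" for z
    proof -
      have "E z = (\<Sum>i\<in>UNIV. exp (z $ i) *\<^sub>R axis i 1)"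
        using basis_expansion[of "E z"] by (simp add: E_def scalar_mult_eq_scaleR)
      then show ?thesis
        by (simp add: bounded_linear.linear[OF linear(1)] linear_sum linear_scale mult.commute)
    qed
    have ex: "exp (\<xi> \<bullet> z) * (p (axis i 1) * exp (z $ i) * h z) * f z = p (axis i 1) * (exp ((\<xi> + axis i 1) \<bullet> z) * h z * f z)" for \<xi> z i
      by (simp add: inner_add_left inner_axis' exp_add)
    show ?case unfolding Q_def
    proof (intro conjI allI)
      show "continuous_on UNIV (\<lambda>z. p (E z) * h z)" unfolding pE by (intro continuous_intros h)
      fix \<xi>
      have "(LINT z|lebesgue. exp (\<xi> \<bullet> z) * (p (E z) * h z) * f z) =
        (LINT z|lebesgue. (\<Sum>i\<in>UNIV. p (axis i 1) * (exp ((\<xi> + axis i 1) \<bullet> z) * h z * f z)))"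
        unfolding pE ex[symmetric] by (simp add: sum_distrib_left sum_distrib_right mult_ac)
      also have "\<dots> = (\<Sum>i\<in>UNIV. p (axis i 1) * (LINT z|lebesgue. exp ((\<xi> + axis i 1) \<bullet> z) * h z * f z))"
        using Qi[OF h] by (subst Bochner_Integration.integral_sum) auto
      also have "\<dots> = 0" using linear(2) by (simp add: Q_def)
      finally show "(LINT z|lebesgue. exp (\<xi> \<bullet> z) * (p (E z) * h z) * f z) = 0" .
    qed
  next
    case (const k)
    have "(LINT z|lebesgue. exp (\<xi> \<bullet> z) * (k * h z) * f z) = k * (LINT z|lebesgue. exp (\<xi> \<bullet> z) * h z * f z)" for \<xi>
      by (subst integral_mult_right_zero[symmetric]) (simp add: mult_ac)
    then show ?case using const by (auto simp: Q_def intro!: continuous_intros)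
  next
    case (add p1 p2)
    have h: "Q (\<lambda>z. p1 (E z) * h z)" "Q (\<lambda>z. p2 (E z) * h z)" using add by auto
    have "(LINT z|lebesgue. exp (\<xi> \<bullet> z) * ((p1 (E z) + p2 (E z)) * h z) * f z) =
      (LINT z|lebesgue. exp (\<xi> \<bullet> z) * (p1 (E z) * h z) * f z) + (LINT z|lebesgue. exp (\<xi> \<bullet> z) * (p2 (E z) * h z) * f z)" for \<xi>
    proof -
      have "(LINT z|lebesgue. exp (\<xi> \<bullet> z) * ((p1 (E z) + p2 (E z)) * h z) * f z) =
        (LINT z|lebesgue. exp (\<xi> \<bullet> z) * (p1 (E z) * h z) * f z + exp (\<xi> \<bullet> z) * (p2 (E z) * h z) * f z)"
        by (simp add: algebra_simps)
      also have "\<dots> = (LINT z|lebesgue. exp (\<xi> \<bullet> z) * (p1 (E z) * h z) * f z) + (LINT z|lebesgue. exp (\<xi> \<bullet> z) * (p2 (E z) * h z) * f z)"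
        using h by (intro Bochner_Integration.integral_add Qi) (auto simp: Q_def)
      finally show ?thesis .
    qed
    then show ?case using h by (auto simp: Q_def distrib_right intro!: continuous_on_add)
  next
    case (mult p1 p2)
    then show ?case by (simp add: mult.assoc)
  qed
  have Q1: "Q (\<lambda>z. 1)" using z by (simp add: Q_def)
  have cont0: "(LINT z|lebesgue. h z * f z) = 0" if h: "continuous_on UNIV h" for h
  proof -
    define I where "I = (LINT z|lebesgue. \<bar>f z\<bar>)"
    have I: "I \<ge> 0" unfolding I_def by (rule integral_nonneg_AE) simp
    have "\<bar>LINT z|lebesgue. h z * f z\<bar> \<le> 0 + e" if e: "e > 0" for e
    proof -
      define e' where "e' = e / (I + 1)"
      have e': "e' > 0" using e I by (simp add: e'_def)
      have K: "compact (E ` cball 0 \<rho>)" by (intro compact_continuous_image continuous_on_subset[OF contE]) auto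
      have "continuous_on (E ` cball 0 \<rho>) Lg"
        unfolding Lg_def[abs_def] by (intro continuous_intros) (auto simp: E_def)
      then have "continuous_on (E ` cball 0 \<rho>) (\<lambda>w. h (Lg w))"
        by (rule continuous_on_compose2[OF h]) auto
      then obtain p where p: "real_polynomial_function p" "\<And>w. w \<in> E ` cball 0 \<rho> \<Longrightarrow> \<bar>h (Lg w) - p w\<bar> < e'"
        using Stone_Weierstrass_real_polynomial_function[OF K _ e', of "\<lambda>w. h (Lg w)"] by blast
      have "Lg (E z) = z" for z by (simp add: Lg_def E_def vec_eq_iff)
      then have close: "\<bar>h z - p (E z)\<bar> \<le> e'" if "norm z \<le> \<rho>" for z using p(2)[of "E z"] that by auto
      have Qp: "Q (\<lambda>z. p (E z) * 1)" by (rule poly[OF p(1) Q1])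
      have pz: "(LINT z|lebesgue. p (E z) * f z) = 0" using Qp spec[of _ 0] by (auto simp: Q_def dest: spec[of _ 0])
      have pc: "continuous_on UNIV (\<lambda>z. p (E z))" using Qp by (simp add: Q_def)
      note i = continuous_mult_integrable[OF f h] continuous_mult_integrable[OF f pc]
      have "(LINT z|lebesgue. h z * f z) = (LINT z|lebesgue. h z * f z - p (E z) * f z)"
        using i pz by simp
      then have "\<bar>LINT z|lebesgue. h z * f z\<bar> \<le> (LINT z|lebesgue. norm (h z * f z - p (E z) * f z))"
        using integral_norm_bound[of lebesgue "\<lambda>z. h z * f z - p (E z) * f z"] by simp
      also have "\<dots> \<le> (LINT z|lebesgue. e' * \<bar>f z\<bar>)"
      proof (rule integral_mono)
        show "integrable lebesgue (\<lambda>z. norm (h z * f z - p (E z) * f z))" using i by simp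
        show "integrable lebesgue (\<lambda>z. e' * \<bar>f z\<bar>)" using f(1) by simp
        fix z
        show "norm (h z * f z - p (E z) * f z) \<le> e' * \<bar>f z\<bar>"
        proof (cases "norm z > \<rho>")
          case False
          then have "\<bar>h z - p (E z)\<bar> * \<bar>f z\<bar> \<le> e' * \<bar>f z\<bar>" using close by (intro mult_right_mono) auto
          then show ?thesis by (simp add: abs_mult[symmetric] left_diff_distrib)
        qed (simp add: f(2))
      qed
      also have "\<dots> = e' * I" by (simp add: I_def)
      also have "\<dots> \<le> e" using e I by (simp add: e'_def field_simps)
      finally show ?thesis by simp
    qed
    then have "\<bar>LINT z|lebesgue. h z * f z\<bar> \<le> 0" by (rule field_le_epsilon)
    then show ?thesis by simp
  qed
  show ?thesis
  proof (rule integral_open_sets_0_imp_AE_0[OF f(1)])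
    fix U :: "(real^3) set" assume U: "open U"
    show "(LINT z|lebesgue. indicator U z *\<^sub>R f z) = 0"
    \<comment> \<open>The distance to the empty complement is 0 by convention, so the approximation
      by distances would fail for the whole space.\<close>
    proof (cases "U = UNIV")
      case True
      then show ?thesis using cont0[of "\<lambda>_. 1"] by simp
    next
      case False
      define h where "h k z = min 1 (real k * infdist z (- U))" for k z
      have lim: "(\<lambda>k. LINT z|lebesgue. h k z * f z) \<longlonglongrightarrow> (LINT z|lebesgue. indicator U z *\<^sub>R f z)"
      proof (rule integral_dominated_convergence[where w = "\<lambda>z. \<bar>f z\<bar>"])
        show "(\<lambda>z. indicator U z *\<^sub>R f z) \<in> borel_measurable lebesgue"
          using U f(1) by (intro borel_measurable_scaleR borel_measurable_indicator borel_measurable_integrable) (auto simp: borel_open)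
        show "(\<lambda>z. h k z * f z) \<in> borel_measurable lebesgue" for k
        proof (rule borel_measurable_integrable[OF continuous_mult_integrable[OF f(1)]])
          show "f z = 0" if "norm z > \<rho>" for z using f(2) that .
          show "continuous_on UNIV (h k)" unfolding h_def[abs_def] by (intro continuous_intros)
        qed
        show "integrable lebesgue (\<lambda>z. \<bar>f z\<bar>)" using f(1) by simp
        show "AE z in lebesgue. norm (h k z * f z) \<le> \<bar>f z\<bar>" for k
        proof (intro AE_I2)
          fix z
          have "\<bar>h k z\<bar> \<le> 1" using infdist_nonneg[of z "- U"] by (simp add: h_def)
          then show "norm (h k z * f z) \<le> \<bar>f z\<bar>" using mult_right_mono[of "\<bar>h k z\<bar>" 1 "\<bar>f z\<bar>"] by (simp add: abs_mult)
        qed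
        show "AE z in lebesgue. (\<lambda>k. h k z * f z) \<longlonglongrightarrow> indicator U z *\<^sub>R f z"
        proof (intro AE_I2 tendsto_eventually)
          fix z
          show "\<forall>\<^sub>F k in sequentially. h k z * f z = indicator U z *\<^sub>R f z"
          proof (cases "z \<in> U")
            case True
            have "infdist z (- U) \<noteq> 0"
              using in_closed_iff_infdist_zero[of "- U" z] U False True by (auto simp: closed_Compl)
            then have pos: "infdist z (- U) > 0" using infdist_nonneg[of z "- U"] by simp
            obtain N :: nat where N: "real N * infdist z (- U) > 1" using reals_Archimedean3[OF pos] by blast
            have "h k z = 1" if "k \<ge> N" for k
            proof -
              have "real N * infdist z (- U) \<le> real k * infdist z (- U)" using that pos by (intro mult_right_mono) auto
              then show ?thesis using N by (simp add: h_def)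
            qed
            then show ?thesis using True by (auto simp: eventually_sequentially)
          next
            case False
            then show ?thesis by (simp add: h_def)
          qed
        qed
      qed
      have "(LINT z|lebesgue. h k z * f z) = 0" for k
        by (rule cont0) (unfold h_def, intro continuous_intros)
      then show ?thesis using lim by (simp add: LIMSEQ_const_iff)
    qed
  qed
qed

text \<open>Equal moments give equal integrals of g p(A) and g p(B) for polynomials p, then for
  continuous functions on [0, 1] by approximation, then for indicators of half-lines as limits of
  ramps.\<close>

lemma moments_imp_level_set_integrals:
  fixes A B g :: "real \<Rightarrow> real"
  assumes A: "continuous_on {0..T} A" "\<And>s. s \<in> {0..T} \<Longrightarrow> A s \<in> {0..1}"
    and B: "continuous_on {0..T} B" "\<And>s. s \<in> {0..T} \<Longrightarrow> B s \<in> {0..1}"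
    and g: "continuous_on {0..T} g"
    and mom: "\<And>n. n \<ge> 1 \<Longrightarrow> integral {0..T} (\<lambda>s. g s * (A s ^ n - B s ^ n)) = 0"
  shows "integral {0..T} (\<lambda>s. g s * (if A s \<ge> v then 1 else 0)) = integral {0..T} (\<lambda>s. g s * (if B s \<ge> v then 1 else 0))"
proof -
  have ci: "(\<lambda>s. g s * h (C s)) integrable_on {0..T}" if "continuous_on {0..1} h" "continuous_on {0..T} C" "\<And>s. s \<in> {0..T} \<Longrightarrow> C s \<in> {0..1}" for h C
    by (intro integrable_continuous_real continuous_on_mult g continuous_on_compose2[OF that(1,2)]) (use that(3) in auto)
  have poly: "integral {0..T} (\<lambda>s. g s * (p (A s) - p (B s))) = 0" if p: "real_polynomial_function p" for p
  proof -
    obtain a n where p: "p = (\<lambda>x. \<Sum>i\<le>n. a i * x ^ i)" using p unfolding real_polynomial_function_iff_sum by blast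
    have "(\<lambda>s. g s * (p (A s) - p (B s))) = (\<lambda>s. \<Sum>i\<le>n. a i * (g s * (A s ^ i - B s ^ i)))"
      by (auto simp: fun_eq_iff p sum_subtractf[symmetric] sum_distrib_left algebra_simps)
    then have "integral {0..T} (\<lambda>s. g s * (p (A s) - p (B s))) = (\<Sum>i\<le>n. a i * integral {0..T} (\<lambda>s. g s * (A s ^ i - B s ^ i)))"
      by (simp add: integral_sum integrable_continuous_real continuous_on_mult continuous_on_diff continuous_on_power g A(1) B(1) continuous_on_const)
    also have "\<dots> = 0"
    proof (rule sum.neutral, intro ballI)
      \<comment> \<open>No moment of order 0 is assumed: there the difference of the powers is
        already 0.\<close>
      fix i show "a i * integral {0..T} (\<lambda>s. g s * (A s ^ i - B s ^ i)) = 0"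
        using mom[of i] by (cases "i = 0") auto
    qed
    finally show ?thesis .
  qed
  have cont: "integral {0..T} (\<lambda>s. g s * h (A s)) = integral {0..T} (\<lambda>s. g s * h (B s))" if h: "continuous_on {0..1} h" for h
  proof -
    define I where "I = integral {0..T} (\<lambda>s. \<bar>g s\<bar>)"
    have gi: "(\<lambda>s. \<bar>g s\<bar>) integrable_on {0..T}" by (intro integrable_continuous_real continuous_intros g)
    have I: "I \<ge> 0" unfolding I_def by (rule integral_nonneg[OF gi]) simp
    have "\<bar>integral {0..T} (\<lambda>s. g s * h (A s)) - integral {0..T} (\<lambda>s. g s * h (B s))\<bar> \<le> 0 + e" if e: "e > 0" for e
    proof -
      define e' where "e' = e / (2 * I + 1)"
      have e': "e' > 0" using e I by (simp add: e'_def)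
      obtain p where p: "real_polynomial_function p" "\<And>w. w \<in> {0..1} \<Longrightarrow> \<bar>h w - p w\<bar> < e'"
        using Stone_Weierstrass_real_polynomial_function[OF compact_Icc h e'] by blast
      have pc: "continuous_on {0..1} p" using p(1) continuous_on_polymonial_function real_polynomial_function_eq by blast
      have 1: "\<bar>integral {0..T} (\<lambda>s. g s * h (C s)) - integral {0..T} (\<lambda>s. g s * p (C s))\<bar> \<le> e' * I"
        if C: "continuous_on {0..T} C" "\<And>s. s \<in> {0..T} \<Longrightarrow> C s \<in> {0..1}" for C
      proof -
        note i = ci[OF h C] ci[OF pc C]
        have "integral {0..T} (\<lambda>s. g s * h (C s)) - integral {0..T} (\<lambda>s. g s * p (C s)) = integral {0..T} (\<lambda>s. g s * h (C s) - g s * p (C s))"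
          by (rule Henstock_Kurzweil_Integration.integral_diff[symmetric, OF i])
        also have "norm \<dots> \<le> integral {0..T} (\<lambda>s. e' * \<bar>g s\<bar>)"
        proof (rule integral_norm_bound_integral)
          show "(\<lambda>s. g s * h (C s) - g s * p (C s)) integrable_on {0..T}" by (rule integrable_diff[OF i])
          show "(\<lambda>s. e' * \<bar>g s\<bar>) integrable_on {0..T}" using gi by (intro integrable_continuous_real continuous_intros g)
          fix s assume "s \<in> {0..T}"
          then have "\<bar>h (C s) - p (C s)\<bar> * \<bar>g s\<bar> \<le> e' * \<bar>g s\<bar>" using p(2)[OF C(2)] by (intro mult_right_mono) (auto simp: less_imp_le)
          then show "norm (g s * h (C s) - g s * p (C s)) \<le> e' * \<bar>g s\<bar>"
            by (simp add: abs_mult[symmetric] right_diff_distrib mult.commute)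
        qed
        also have "\<dots> = e' * I" by (simp add: I_def)
        finally show ?thesis by simp
      qed
      have 2: "integral {0..T} (\<lambda>s. g s * p (A s)) - integral {0..T} (\<lambda>s. g s * p (B s)) = 0"
        using poly[OF p(1)] Henstock_Kurzweil_Integration.integral_diff[OF ci[OF pc A] ci[OF pc B]] by (simp add: right_diff_distrib)
      have "\<bar>integral {0..T} (\<lambda>s. g s * h (A s)) - integral {0..T} (\<lambda>s. g s * h (B s))\<bar> \<le> e' * I + e' * I"
        using 1[OF A] 1[OF B] 2 by linarith
      also have "\<dots> \<le> e' * (2 * I + 1)" using e' by (simp add: algebra_simps)
      also have "\<dots> = e" using I by (simp add: e'_def)
      finally show ?thesis by simp
    qed
    then have "\<bar>integral {0..T} (\<lambda>s. g s * h (A s)) - integral {0..T} (\<lambda>s. g s * h (B s))\<bar> \<le> 0" by (rule field_le_epsilon)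
    then show ?thesis by simp
  qed
  \<comment> \<open>Ramps that climb just below \<open>v\<close> and equal 1 from \<open>v\<close>
    on, so the limit is the indicator of the closed half-line.\<close>
  define h where "h k u = max 0 (min 1 (1 + real k * (u - v)))" for k u
  have hc: "continuous_on S (h k)" for S k unfolding h_def[abs_def] by (intro continuous_intros)
  have hlim: "(\<lambda>k. h k u) \<longlonglongrightarrow> (if u \<ge> v then 1 else 0)" for u
  proof (rule tendsto_eventually, cases "u \<ge> v")
    case False
    obtain N :: nat where N: "real N * (v - u) > 1" using False reals_Archimedean3[of "v - u"] by (metis diff_gt_0_iff_gt not_le)
    have "h k u = 0" if "k \<ge> N" for k
    proof -
      have "real N * (v - u) \<le> real k * (v - u)" using that False by (intro mult_right_mono) auto
      then have "1 + real k * (u - v) \<le> 0" using N by (simp add: algebra_simps)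
      then show ?thesis by (simp add: h_def)
    qed
    then show "\<forall>\<^sub>F k in sequentially. h k u = (if u \<ge> v then 1 else 0)" using False by (auto simp: eventually_sequentially)
  qed (simp add: h_def)
  have lim: "(\<lambda>k. integral {0..T} (\<lambda>s. g s * h k (C s))) \<longlonglongrightarrow> integral {0..T} (\<lambda>s. g s * (if C s \<ge> v then 1 else 0))"
    if C: "continuous_on {0..T} C" "\<And>s. s \<in> {0..T} \<Longrightarrow> C s \<in> {0..1}" for C
  proof (rule dominated_convergence(2))
    show "(\<lambda>s. g s * h k (C s)) integrable_on {0..T}" for k by (rule ci[OF hc C])
    show "(\<lambda>s. \<bar>g s\<bar>) integrable_on {0..T}" by (intro integrable_continuous_real continuous_intros g)
    show "norm (g s * h k (C s)) \<le> \<bar>g s\<bar>" for k s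
    proof -
      have "\<bar>h k (C s)\<bar> \<le> 1" by (simp add: h_def)
      then show ?thesis using mult_left_mono[of "\<bar>h k (C s)\<bar>" 1 "\<bar>g s\<bar>"] by (simp add: abs_mult)
    qed
    show "(\<lambda>k. g s * h k (C s)) \<longlonglongrightarrow> g s * (if C s \<ge> v then 1 else 0)" for s
      by (intro tendsto_mult tendsto_const hlim)
  qed
  show ?thesis using LIMSEQ_unique[OF lim[OF A]] lim[OF B] cont[OF hc] by simp
qed

text \<open>Both curves push the measure \<open>g(s) ds\<close> forward to the same measure.  If \<open>A > B\<close> just after
  the last coincidence \<open>p\<close>, then matching levels moves a point \<open>t > p\<close> strictly to the left without
  changing \<open>\<integral>\<^sub>0\<^sup>t g\<close>, so this integral is constant near \<open>p\<close>.\<close>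

lemma equal_moments_imp_le:
  fixes A B g :: "real \<Rightarrow> real"
  assumes A: "continuous_on {0..T} A" "\<And>s. s \<in> {0..T} \<Longrightarrow> A s \<in> {0..1}"
      "\<And>s t. 0 \<le> s \<Longrightarrow> s < t \<Longrightarrow> t \<le> T \<Longrightarrow> A t < A s"
    and B: "continuous_on {0..T} B" "\<And>s. s \<in> {0..T} \<Longrightarrow> B s \<in> {0..1}"
      "\<And>s t. 0 \<le> s \<Longrightarrow> s < t \<Longrightarrow> t \<le> T \<Longrightarrow> B t < B s"
    and g: "continuous_on {0..T} g"
    and mom: "\<And>n. n \<ge> 1 \<Longrightarrow> integral {0..T} (\<lambda>s. g s * (A s ^ n - B s ^ n)) = 0"
    and start: "A 0 = B 0"
    and nz: "\<And>s t. 0 \<le> s \<Longrightarrow> s < t \<Longrightarrow> t \<le> T \<Longrightarrow> \<exists>u. s < u \<and> u < t \<and> g u \<noteq> 0"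
    and t: "t \<in> {0..T}"
  shows "A t \<le> B t"
proof (rule ccontr)
  assume "\<not> ?thesis"
  then have AB: "B t < A t" by simp
  define G where "G t = integral {0..t} g" for t
  \<comment> \<open>For strictly decreasing \<open>C\<close> the set where C s \<ge> C u is [0, u],
    so level integrals are values of the primitive \<open>G\<close>.\<close>
  have level: "integral {0..T} (\<lambda>s. g s * (if C s \<ge> C u then 1 else 0)) = G u"
    if u: "u \<in> {0..T}" and C: "\<And>s t. 0 \<le> s \<Longrightarrow> s < t \<Longrightarrow> t \<le> T \<Longrightarrow> C t < C s" for C :: "real \<Rightarrow> real" and u
  proof -
    have iff: "C s \<ge> C u \<longleftrightarrow> s \<in> {0..u}" if s: "s \<in> {0..T}" for s
    proof (cases s u rule: linorder_cases)
      case less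
      then have "C u < C s" using C[of s u] s u by auto
      then show ?thesis using less s by (simp add: less_imp_le)
    next
      case greater
      then show ?thesis using C[of u s] s u by auto
    qed (use s in auto)
    have "integral {0..T} (\<lambda>s. g s * (if C s \<ge> C u then 1 else 0)) = integral {0..T} (\<lambda>s. if s \<in> {0..u} then g s else 0)"
      by (rule Henstock_Kurzweil_Integration.integral_cong) (simp add: iff)
    also have "\<dots> = integral ({0..u} \<inter> {0..T}) g" by (rule integral_restrict_Int)
    also have "{0..u} \<inter> {0..T} = {0..u}" using u by auto
    finally show ?thesis by (simp add: G_def)
  qed
  have match: "G u = G u'" if u: "u \<in> {0..T}" "u' \<in> {0..T}" "A u = B u'" for u u'
  proof -
    have "integral {0..T} (\<lambda>s. g s * (if A s \<ge> A u then 1 else 0)) = G u" by (rule level[OF u(1)]) (rule A(3))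
    moreover have "integral {0..T} (\<lambda>s. g s * (if B s \<ge> B u' then 1 else 0)) = G u'" by (rule level[OF u(2)]) (rule B(3))
    ultimately show ?thesis using moments_imp_level_set_integrals[OF A(1,2) B(1,2) g mom, of "A u"] u(3) by simp
  qed
  have contG: "continuous_on {0..T} G"
    unfolding G_def by (rule indefinite_integral_continuous_1[OF integrable_continuous_real[OF g]])
  define Z where "Z = {s \<in> {0..t}. A s - B s = 0}"
  have cAB: "continuous_on {0..t} (\<lambda>s. A s - B s)"
    using t by (intro continuous_on_diff continuous_on_subset[OF A(1)] continuous_on_subset[OF B(1)]) auto
  have "closed Z" unfolding Z_def by (rule continuous_closed_preimage_constant[OF cAB]) simp
  moreover have "bounded Z" unfolding Z_def by (rule bounded_subset[OF bounded_closed_interval[of 0 t]]) auto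
  moreover have "Z \<noteq> {}" using start t by (auto simp: Z_def)
  ultimately obtain p where p: "p \<in> Z" "\<And>s. s \<in> Z \<Longrightarrow> s \<le> p"
    using compact_attains_sup[of Z] compact_eq_bounded_closed by blast
  have p': "0 \<le> p" "p < t" "A p = B p" using p(1) AB by (auto simp: Z_def order.strict_iff_order)
  \<comment> \<open>Otherwise the intermediate value theorem would give a coincidence later than
    \<open>p\<close>.\<close>
  have gt: "B u < A u" if u: "p < u" "u \<le> t" for u
  proof (rule ccontr)
    assume n: "\<not> B u < A u"
    have "\<exists>x\<ge>u. x \<le> t \<and> A x - B x = 0"
    proof (rule IVT')
      show "A u - B u \<le> 0" "0 \<le> A t - B t" using n AB by auto
      show "continuous_on {u..t} (\<lambda>s. A s - B s)" using p'(1) u by (intro continuous_on_subset[OF cAB]) auto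
    qed (use u in auto)
    then obtain x where "u \<le> x" "x \<le> t" "A x - B x = 0" by blast
    then have "x \<in> Z" using u p'(1) by (auto simp: Z_def)
    then show False using p(2)[of x] u \<open>u \<le> x\<close> by auto
  qed
  have const: "G u = G p" if u: "p < u" "u \<le> t" for u
  proof -
    \<comment> \<open>Take the earliest \<tau> in [p, u] with the same value of \<open>G\<close>. If
      p < \<tau>, then B \<tau> < A \<tau> < A p = B p, so \<open>B\<close> takes the value A \<tau>
      at some x in [p, \<tau>), and \<open>match\<close> gives G x = G \<tau>, against
      minimality.\<close>
    define S where "S = {s \<in> {p..u}. G s = G u}"
    have cG: "continuous_on {p..u} G" using p'(1) u t by (intro continuous_on_subset[OF contG]) auto
    have "closed S" unfolding S_def by (rule continuous_closed_preimage_constant[OF cG]) simp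
    moreover have "bounded S" unfolding S_def by (rule bounded_subset[OF bounded_closed_interval[of p u]]) auto
    moreover have "S \<noteq> {}" using u by (auto simp: S_def)
    ultimately obtain \<tau> where \<tau>: "\<tau> \<in> S" "\<And>s. s \<in> S \<Longrightarrow> \<tau> \<le> s"
      using compact_attains_inf[of S] compact_eq_bounded_closed by blast
    have \<tau>': "p \<le> \<tau>" "\<tau> \<le> u" "G \<tau> = G u" using \<tau>(1) by (auto simp: S_def)
    have "\<tau> = p"
    proof (rule ccontr)
      assume "\<tau> \<noteq> p"
      then have pt: "p < \<tau>" using \<tau>' by simp
      have "B \<tau> \<le> A \<tau>" using gt[of \<tau>] pt \<tau>' u by simp
      moreover have "A \<tau> \<le> B p" using A(3)[of p \<tau>] p' pt \<tau>' u t by simp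
      ultimately have "\<exists>x\<ge>p. x \<le> \<tau> \<and> B x = A \<tau>"
        using pt p' \<tau>' u t by (intro IVT2' continuous_on_subset[OF B(1)]) auto
      then obtain x where x: "p \<le> x" "x \<le> \<tau>" "B x = A \<tau>" by blast
      have "x \<noteq> \<tau>" using x(3) gt[of \<tau>] pt \<tau>' u by auto
      then have "x < \<tau>" using x by simp
      have "G \<tau> = G x" using x p' \<tau>' u t by (intro match) auto
      then have "x \<in> S" using x \<tau>' by (auto simp: S_def)
      then show False using \<tau>(2) \<open>x < \<tau>\<close> by force
    qed
    then show ?thesis using \<tau>' by simp
  qed
  obtain u where u: "p < u" "u < t" "g u \<noteq> 0" using nz[of p t] p' t by auto
  have "(G has_real_derivative g u) (at u within {0..T})"
    unfolding G_def using u p' t by (intro integral_has_real_derivative[OF g]) auto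
  then have d1: "(G has_real_derivative g u) (at u)"
    using at_within_interior[of u "{0..T}"] u p' t by simp
  have "(G has_real_derivative 0) (at u)"
    by (rule has_field_derivative_transform_within_open[OF DERIV_const[of "G p"], of "{p<..<t}"]) (use u const in auto)
  then show False using DERIV_unique[OF d1] u(3) by blast
qed

section \<open>Moving sources\<close>

lemma lborel_integral_compact_support:
  fixes h :: "real \<Rightarrow> 'a::euclidean_space"
  assumes h: "continuous_on UNIV h" "\<And>s. s \<notin> {0..T} \<Longrightarrow> h s = 0"
  shows "integrable lborel h" "(h has_integral (LINT s|lborel. h s)) {0..T}"
proof -
  have e: "(\<lambda>s. indicator {0..T} s *\<^sub>R h s) = h" using h(2) by (auto simp: indicator_def fun_eq_iff)
  have "integrable lborel (\<lambda>s. indicator {0..T} s *\<^sub>R h s)"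
    by (rule borel_integrable_compact) (auto intro: continuous_on_subset[OF h(1)])
  then show i: "integrable lborel h" unfolding e .
  have "(h has_integral (LINT s|lborel. h s)) UNIV" by (rule has_integral_integral_lborel[OF i])
  moreover have "(\<lambda>s. if s \<in> {0..T} then h s else 0) = h" using h(2) by (auto simp: fun_eq_iff)
  ultimately show "(h has_integral (LINT s|lborel. h s)) {0..T}" using has_integral_restrict_UNIV[of "{0..T}" h] by metis
qed

text \<open>For \<gamma>(s) = g(s) exp(-\<sigma> s) this is the Laplace transform in time of the
  moving source.\<close>

definition moving_average :: "(real \<Rightarrow> real) \<Rightarrow> (real \<Rightarrow> real^3) \<Rightarrow> (real^3 \<Rightarrow> real^3) \<Rightarrow> real^3 \<Rightarrow> real^3" where
  "moving_average \<gamma> \<alpha> J y = (LINT s|lborel. \<gamma> s *\<^sub>R J (y - \<alpha> s))"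

text \<open>Fubini's theorem needs (s, y) -> J (y - \<alpha> s) to be jointly measurable, which is
  why \<open>J\<close> is Borel here. All translates live in the ball of radius \<rho> + m, where
  the weight \<theta> is bounded.\<close>

lemma moving_average_Fubini:
  fixes J :: "real^3 \<Rightarrow> real^3"
  assumes J: "J \<in> borel_measurable borel" "integrable lebesgue J" "\<And>y. norm y > \<rho> \<Longrightarrow> J y = 0"
    and \<gamma>: "\<gamma> \<in> borel_measurable borel" "integrable lborel \<gamma>"
    and \<alpha>: "\<alpha> \<in> borel_measurable borel" "\<And>s. norm (\<alpha> s) \<le> m"
    and \<theta>: "\<theta> \<in> borel_measurable borel" "\<And>y. norm y \<le> \<rho> + m \<Longrightarrow> \<bar>\<theta> y\<bar> \<le> B"
  shows "integrable lebesgue (\<lambda>y. \<theta> y *\<^sub>R moving_average \<gamma> \<alpha> J y)"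
    "integrable lborel (\<lambda>s. \<gamma> s *\<^sub>R (LINT y|lebesgue. \<theta> y *\<^sub>R J (y - \<alpha> s)))"
    "(LINT y|lebesgue. \<theta> y *\<^sub>R moving_average \<gamma> \<alpha> J y) = (LINT s|lborel. \<gamma> s *\<^sub>R (LINT y|lebesgue. \<theta> y *\<^sub>R J (y - \<alpha> s)))"
proof -
  note [measurable] = J(1) \<gamma>(1) \<alpha>(1) \<theta>(1)
  define f where "f s y = \<gamma> s *\<^sub>R \<theta> y *\<^sub>R J (y - \<alpha> s)" for s y
  define I where "I = (LINT y|lebesgue. norm (J y))"
  have fm [measurable]: "case_prod f \<in> borel_measurable (lborel \<Otimes>\<^sub>M lborel)"
    unfolding f_def by measurable
  have J1: "integrable lborel (\<lambda>y. J (y - \<alpha> s))" for s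
    using lebesgue_integrable_translate[OF J(2), of "- \<alpha> s"] by (simp add: integrable_completion)
  have I: "(LINT y|lborel. norm (J (y - \<alpha> s))) = I" for s
  proof -
    have "(LINT y|lebesgue. norm (J (y + - \<alpha> s))) = I" unfolding I_def
      using J(2) by (intro lebesgue_integral_translate[of "\<lambda>y. norm (J y)"]) auto
    then show ?thesis by (simp add: integral_completion)
  qed
  have B: "norm (f s y) \<le> \<bar>\<gamma> s\<bar> * (\<bar>B\<bar> * norm (J (y - \<alpha> s)))" for s y
  proof (cases "norm (y - \<alpha> s) > \<rho>")
    case False
    then have "norm y \<le> \<rho> + m" using norm_triangle_sub[of y "\<alpha> s"] \<alpha>(2)[of s] by linarith
    then have "\<bar>\<theta> y\<bar> \<le> \<bar>B\<bar>" using \<theta>(2)[of y] by linarith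
    then show ?thesis by (simp add: f_def abs_mult mult.assoc mult_left_mono mult_right_mono)
  qed (simp add: f_def J(3))
  have i2: "integrable lborel (f s)" for s
  proof (rule Bochner_Integration.integrable_bound)
    show "integrable lborel (\<lambda>y. \<bar>\<gamma> s\<bar> * (\<bar>B\<bar> * norm (J (y - \<alpha> s))))" using J1 by simp
    show "f s \<in> borel_measurable lborel" unfolding f_def by measurable
    show "AE y in lborel. norm (f s y) \<le> norm (\<bar>\<gamma> s\<bar> * (\<bar>B\<bar> * norm (J (y - \<alpha> s))))" using B by (intro AE_I2) simp
  qed
  have fi: "integrable (lborel \<Otimes>\<^sub>M lborel) (case_prod f)"
  proof (rule lborel_pair.Fubini_integrable[OF fm])
    show "AE s in lborel. integrable lborel (\<lambda>y. case (s, y) of (s, y) \<Rightarrow> f s y)" using i2 by simp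
    show "integrable lborel (\<lambda>s. LINT y|lborel. norm (case (s, y) of (s, y) \<Rightarrow> f s y))"
    proof (rule Bochner_Integration.integrable_bound)
      show "integrable lborel (\<lambda>s. \<bar>\<gamma> s\<bar> * (\<bar>B\<bar> * I))" using \<gamma>(2) by simp
      show "(\<lambda>s. LINT y|lborel. norm (case (s, y) of (s, y) \<Rightarrow> f s y)) \<in> borel_measurable lborel"
        by measurable
      show "AE s in lborel. norm (LINT y|lborel. norm (case (s, y) of (s, y) \<Rightarrow> f s y)) \<le> norm (\<bar>\<gamma> s\<bar> * (\<bar>B\<bar> * I))"
      proof (intro AE_I2)
        fix s
        have "(LINT y|lborel. norm (f s y)) \<le> (LINT y|lborel. \<bar>\<gamma> s\<bar> * (\<bar>B\<bar> * norm (J (y - \<alpha> s))))"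
          using J1 i2 B by (intro integral_mono) auto
        also have "\<dots> = \<bar>\<gamma> s\<bar> * (\<bar>B\<bar> * I)" by (simp add: I)
        finally show "norm (LINT y|lborel. norm (case (s, y) of (s, y) \<Rightarrow> f s y)) \<le> norm (\<bar>\<gamma> s\<bar> * (\<bar>B\<bar> * I))"
          by simp
      qed
    qed
  qed
  have 1: "(LINT s|lborel. f s y) = \<theta> y *\<^sub>R moving_average \<gamma> \<alpha> J y" for y
  proof -
    have e: "f s y = \<theta> y *\<^sub>R (\<gamma> s *\<^sub>R J (y - \<alpha> s))" for s by (simp add: f_def mult.commute)
    show ?thesis unfolding e moving_average_def by (rule integral_scaleR_right)
  qed
  have 2: "(LINT y|lborel. f s y) = \<gamma> s *\<^sub>R (LINT y|lebesgue. \<theta> y *\<^sub>R J (y - \<alpha> s))" for s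
  proof -
    have e: "f s = (\<lambda>y. \<gamma> s *\<^sub>R (\<theta> y *\<^sub>R J (y - \<alpha> s)))" by (simp add: f_def fun_eq_iff)
    have "(LINT y|lebesgue. \<theta> y *\<^sub>R J (y - \<alpha> s)) = (LINT y|lborel. \<theta> y *\<^sub>R J (y - \<alpha> s))"
      by (rule integral_completion) measurable
    then show ?thesis unfolding e by (simp only: integral_scaleR_right)
  qed
  have m: "(\<lambda>y. \<theta> y *\<^sub>R moving_average \<gamma> \<alpha> J y) \<in> borel_measurable lborel"
    unfolding 1[symmetric] by measurable
  show "integrable lebesgue (\<lambda>y. \<theta> y *\<^sub>R moving_average \<gamma> \<alpha> J y)"
    using lborel_pair.integrable_snd[OF fi] m unfolding 1 by (simp add: integrable_completion)
  show "integrable lborel (\<lambda>s. \<gamma> s *\<^sub>R (LINT y|lebesgue. \<theta> y *\<^sub>R J (y - \<alpha> s)))"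
    using lborel_pair.integrable_fst[OF fi] unfolding 2 .
  show "(LINT y|lebesgue. \<theta> y *\<^sub>R moving_average \<gamma> \<alpha> J y) = (LINT s|lborel. \<gamma> s *\<^sub>R (LINT y|lebesgue. \<theta> y *\<^sub>R J (y - \<alpha> s)))"
    using lborel_pair.Fubini_integral[OF fi] m unfolding 1 2 by (simp add: integral_completion)
qed

lemma radial_translate:
  fixes x0 :: "real^'n"
  assumes "radial x0 f" shows "radial (x0 - a) (\<lambda>x. f (x + a))"
  using assms
proof induction
  case (base h)
  then show ?case using radial.base[of h "x0 - a"] by (simp add: algebra_simps)
next
  case (add f g)
  then show ?case by (intro radial.add)
next
  case (coord f i)
  then show ?case using radial.coord[of "x0 - a" "\<lambda>x. f (x + a)" i] by (simp add: algebra_simps)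
qed

lemma iter_pderiv_translate:
  assumes "radial x0 f"
  shows "iter_pderiv [k] (\<lambda>x. f (x + a)) x = iter_pderiv [k] f (x + a)"
proof -
  have "((\<lambda>x. f (x + a)) has_derivative (\<lambda>v. \<Sum>j\<in>UNIV. v $ j * iter_pderiv [j] f (x + a))) (at x)" for x
  proof -
    have "((\<lambda>x. x + a) has_derivative (\<lambda>v. v)) (at x)" by (auto intro!: derivative_eq_intros)
    from has_derivative_compose[OF this radial_has_derivative_iter_pderiv[OF assms]] show ?thesis .
  qed
  then show ?thesis using iter_pderiv_eqI[of "\<lambda>x. f (x + a)" "\<lambda>j x. iter_pderiv [j] f (x + a)" k] by simp
qed

text \<open>The translation is passed to the test function, which remains radial about a shifted
  centre and may be used in the definition of the weak derivatives of \<open>J\<close>.\<close>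

lemma divergence_free_translate:
  fixes J :: "real^3 \<Rightarrow> real^3"
  assumes J: "J \<in> H2" and div: "AE x in lebesgue. weak_div J x = 0" and \<psi>: "radial x0 \<psi>"
  shows "(\<Sum>k\<in>UNIV. LINT x|lebesgue. iter_pderiv [k] \<psi> x * J (x - a) $ k) = 0"
proof -
  define f where "f x = \<psi> (x + a)" for x
  have f: "radial (x0 - a) f" unfolding f_def by (rule radial_translate[OF \<psi>])
  have pk: "has_weak_pderiv [k] J (weak_pderiv [k] J)" "weak_pderiv [k] J \<in> L2" for k
    using H2_weak_pderiv[OF J, of "[k]"] by auto
  have i: "integrable lebesgue (\<lambda>x. f x *\<^sub>R weak_pderiv [k] J x)" for k
    by (rule L2_integrable_scaleR[OF radial_L2[OF f] pk(2)])
  have ik: "integrable lebesgue (\<lambda>x. f x * weak_pderiv [k] J x $ k)" for k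
    using integrable_bounded_linear[OF bounded_linear_vec_nth[of k] i[of k]] by simp
  have "(LINT x|lebesgue. iter_pderiv [k] \<psi> x * J (x - a) $ k) = - (LINT x|lebesgue. f x * weak_pderiv [k] J x $ k)" for k
  proof -
    have Jk: "J \<in> borel_measurable lebesgue" using L2_measurable[OF H2_L2[OF J]] .
    have "(\<lambda>x. iter_pderiv [k] \<psi> x) \<in> borel_measurable lebesgue"
      using radial_measurable[OF radial_iter_pderiv1[OF \<psi>]] by (simp add: measurable_completion)
    moreover have "(\<lambda>x. J (x - a) $ k) \<in> borel_measurable lebesgue"
    proof -
      have "(\<lambda>v::real^3. v $ k) \<in> borel_measurable borel" by (intro borel_measurable_continuous_onI continuous_intros)
      from measurable_compose[OF measurable_compose[OF lebesgue_translation(1)[of "- a"] Jk] this] show ?thesis by simp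
    qed
    ultimately have m: "(\<lambda>x. iter_pderiv [k] \<psi> x * J (x - a) $ k) \<in> borel_measurable lebesgue" by (rule borel_measurable_times)
    have "(LINT x|lebesgue. iter_pderiv [k] \<psi> x * J (x - a) $ k) = (LINT x|lebesgue. iter_pderiv [k] f x * J x $ k)"
      using lebesgue_integral_translate[OF m, of a] by (simp add: f_def[abs_def] iter_pderiv_translate[OF \<psi>])
    also have "\<dots> = (LINT x|lebesgue. iter_pderiv [k] f x *\<^sub>R J x) $ k"
      using integral_bounded_linear[OF bounded_linear_vec_nth[of k]
        L2_integrable_scaleR[OF radial_L2[OF radial_iter_pderiv1[OF f]] H2_L2[OF J]], of k] by simp
    also have "(LINT x|lebesgue. iter_pderiv [k] f x *\<^sub>R J x) = - (LINT x|lebesgue. f x *\<^sub>R weak_pderiv [k] J x)"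
      using has_weak_pderiv_radial[OF pk(1) f] by simp
    also have "(- (LINT x|lebesgue. f x *\<^sub>R weak_pderiv [k] J x)) $ k = - (LINT x|lebesgue. f x * weak_pderiv [k] J x $ k)"
      using integral_bounded_linear[OF bounded_linear_vec_nth[of k] i[of k]] by simp
    finally show ?thesis .
  qed
  then have "(\<Sum>k\<in>UNIV. LINT x|lebesgue. iter_pderiv [k] \<psi> x * J (x - a) $ k) =
     - (LINT x|lebesgue. (\<Sum>k\<in>UNIV. f x * weak_pderiv [k] J x $ k))"
    using ik by (simp add: sum_negf)
  also have "(LINT x|lebesgue. (\<Sum>k\<in>UNIV. f x * weak_pderiv [k] J x $ k)) = 0"
  proof (rule integral_eq_zero_AE)
    show "AE x in lebesgue. (\<Sum>k\<in>UNIV. f x * weak_pderiv [k] J x $ k) = 0"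
      using div by eventually_elim (simp add: weak_div_def flip: sum_distrib_left)
  qed
  finally show ?thesis by simp
qed

lemma L2_translate:
  fixes J :: "real^3 \<Rightarrow> real^3"
  assumes "J \<in> L2" shows "(\<lambda>x. J (x - a)) \<in> L2"
  using measurable_compose[OF lebesgue_translation(1)[of "- a"] L2_measurable[OF assms]]
    lebesgue_integrable_translate[OF L2_integrable_square[OF assms], of "- a"]
  by (simp add: L2_def)

lemma maxwell_solution_imp_curve:
  assumes sol: "maxwell_solution (\<lambda>x t. g t *\<^sub>R J (x - a t)) E"
    and J: "J \<in> H2" "AE x in lebesgue. weak_div J x = 0"
  shows "\<exists>Et Ett. maxwell_curve (\<lambda>x t. g t *\<^sub>R J (x - a t)) E Et Ett"
proof -
  let ?F = "\<lambda>x t. g t *\<^sub>R J (x - a t)"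
  obtain Et Ett where E:
    "\<forall>\<tau>>0. cont_into_H2 {0..\<tau>} (\<lambda>t x. E x t) \<and> cont_into_L2 {0..\<tau>} (\<lambda>t x. E x t)
       \<and> cont_into_L2 {0..\<tau>} Et \<and> cont_into_L2 {0..\<tau>} Ett
       \<and> has_L2_time_deriv {0..\<tau>} (\<lambda>t x. E x t) Et \<and> has_L2_time_deriv {0..\<tau>} Et Ett"
    "\<forall>t>0. AE x in lebesgue. Ett t x + weak_curl (weak_curl (\<lambda>y. E y t)) x = ?F x t"
    "\<forall>x. E x 0 = 0" "AE x in lebesgue. Et 0 x = 0"
    using sol unfolding maxwell_solution_def by blast
  have c: "\<forall>t\<ge>0. continuous_on UNIV (\<lambda>x. E x t)" using sol unfolding maxwell_solution_def by blast
  have "maxwell_curve ?F E Et Ett"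
  proof
    show "(\<lambda>x. g t *\<^sub>R J (x - a t)) \<in> L2" for t by (intro L2_scaleR L2_translate H2_L2 J)
    show "(\<Sum>k\<in>UNIV. LINT x|lebesgue. iter_pderiv [k] \<psi> x * (g t *\<^sub>R J (x - a t)) $ k) = 0" if "radial x0 \<psi>" for t x0 \<psi>
    proof -
      have "(LINT x|lebesgue. iter_pderiv [k] \<psi> x * (g t *\<^sub>R J (x - a t)) $ k) =
         (LINT x|lebesgue. g t * (iter_pderiv [k] \<psi> x * J (x - a t) $ k))" for k by (simp add: mult.left_commute)
      then show ?thesis using divergence_free_translate[OF J that, of "a t"] by (simp flip: sum_distrib_left)
    qed
  qed (use E c in \<open>auto\<close>)
  then show ?thesis by blast
qed

text \<open>The far field of the averaged source difference factors into a moment M of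
  \<open>J\<close> and the time integral D. If D were nonzero at \<xi>, it would be so on a ball by
  continuity; M would vanish there, hence everywhere, and \<open>J\<close> would be null.\<close>

lemma laplace_source_vanishes:
  fixes J :: "real^3 \<Rightarrow> real^3"
  assumes J: "J \<in> borel_measurable borel" "integrable lebesgue J" "\<And>y. norm y > \<rho> \<Longrightarrow> J y = 0" "\<rho> \<ge> 0"
    and J0: "\<not> (AE x in lebesgue. J x = 0)"
    and div: "\<And>x0 \<psi> a. radial x0 \<psi> \<Longrightarrow> (\<Sum>k\<in>UNIV. LINT x|lebesgue. iter_pderiv [k] \<psi> x * J (x - a) $ k) = 0"
    and g: "continuous_on UNIV g" "\<And>s. s \<notin> {0..T} \<Longrightarrow> g s = 0"
    and \<alpha>: "continuous_on UNIV \<alpha>" "\<And>s. norm (\<alpha> s) \<le> m"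
    and \<beta>: "continuous_on UNIV \<beta>" "\<And>s. norm (\<beta> s) \<le> m"
    and R: "\<rho> + m < R"
    and \<Gamma>: "openin (top_of_set (sphere 0 R)) \<Gamma>" "\<Gamma> \<noteq> {}"
    and boundary: "\<And>\<sigma> x. \<sigma> > 0 \<Longrightarrow> x \<in> \<Gamma> \<Longrightarrow> cross3 x (LINT s|lborel. (g s * exp (- \<sigma> * s)) *\<^sub>R
       ((LINT y|lebesgue. yukawa \<sigma> (norm (x - y)) *\<^sub>R J (y - \<alpha> s)) -
        (LINT y|lebesgue. yukawa \<sigma> (norm (x - y)) *\<^sub>R J (y - \<beta> s)))) = 0"
    and \<xi>: "\<xi> \<noteq> 0"
  shows "integral {0..T} (\<lambda>s. g s * exp (- norm \<xi> * s) * (exp (\<xi> \<bullet> \<alpha> s) - exp (\<xi> \<bullet> \<beta> s))) = 0"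
proof -
  define D where "D \<xi> = integral {0..T} (\<lambda>s. g s * exp (- norm \<xi> * s) * (exp (\<xi> \<bullet> \<alpha> s) - exp (\<xi> \<bullet> \<beta> s)))" for \<xi> :: "real^3"
  define M where "M j \<xi> = (LINT y|lebesgue. exp (\<xi> \<bullet> y) * J y $ j)" for j and \<xi> :: "real^3"
  have m: "m \<ge> 0" using \<alpha>(2)[of 0] norm_ge_zero[of "\<alpha> 0"] by linarith
  have \<alpha>b: "\<alpha> \<in> borel_measurable borel" and \<beta>b: "\<beta> \<in> borel_measurable borel"
    using \<alpha>(1) \<beta>(1) by (auto intro: borel_measurable_continuous_onI)
  \<comment> \<open>The parameter \<sigma> is tied to \<xi> by \<sigma> = |\<xi>|, because the far
    field of the Yukawa potential shows exponential moments of exactly that length.\<close>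
  have prod: "D \<xi> * M j \<xi> = 0" if \<xi>: "\<xi> \<noteq> 0" for \<xi> j
  proof -
    define \<sigma> where "\<sigma> = norm \<xi>"
    define \<gamma> where "\<gamma> s = g s * exp (- \<sigma> * s)" for s
    define c where "c y = moving_average \<gamma> \<alpha> J y - moving_average \<gamma> \<beta> J y" for y
    have \<sigma>: "\<sigma> > 0" using \<xi> by (simp add: \<sigma>_def)
    have \<gamma>c: "continuous_on UNIV \<gamma>" unfolding \<gamma>_def by (intro continuous_intros g)
    have \<gamma>0: "\<gamma> s = 0" if "s \<notin> {0..T}" for s using g(2)[OF that] by (simp add: \<gamma>_def)
    have \<gamma>: "\<gamma> \<in> borel_measurable borel" "integrable lborel \<gamma>"
      using \<gamma>c lborel_integral_compact_support(1)[OF \<gamma>c \<gamma>0] by (auto intro: borel_measurable_continuous_onI)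
    have test: "integrable lebesgue (\<lambda>y. \<theta> y *\<^sub>R c y)"
      "integrable lborel (\<lambda>s. \<gamma> s *\<^sub>R ((LINT y|lebesgue. \<theta> y *\<^sub>R J (y - \<alpha> s)) - (LINT y|lebesgue. \<theta> y *\<^sub>R J (y - \<beta> s))))"
      "(LINT y|lebesgue. \<theta> y *\<^sub>R c y) = (LINT s|lborel. \<gamma> s *\<^sub>R
         ((LINT y|lebesgue. \<theta> y *\<^sub>R J (y - \<alpha> s)) - (LINT y|lebesgue. \<theta> y *\<^sub>R J (y - \<beta> s))))"
      if \<theta>: "\<theta> \<in> borel_measurable borel" "\<And>y. norm y \<le> \<rho> + m \<Longrightarrow> \<bar>\<theta> y\<bar> \<le> B" for \<theta> B
    proof -
      have mv: "integrable lebesgue (\<lambda>y. \<theta> y *\<^sub>R moving_average \<gamma> \<zeta> J y)"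
        "integrable lborel (\<lambda>s. \<gamma> s *\<^sub>R (LINT y|lebesgue. \<theta> y *\<^sub>R J (y - \<zeta> s)))"
        "(LINT y|lebesgue. \<theta> y *\<^sub>R moving_average \<gamma> \<zeta> J y) = (LINT s|lborel. \<gamma> s *\<^sub>R (LINT y|lebesgue. \<theta> y *\<^sub>R J (y - \<zeta> s)))"
        if "\<zeta> \<in> borel_measurable borel" "\<And>s. norm (\<zeta> s) \<le> m" for \<zeta>
        by (rule moving_average_Fubini[where \<rho> = \<rho> and m = m and B = B]; (rule J \<gamma> \<theta> that; assumption?))+
      note a = mv[OF \<alpha>b \<alpha>(2)] and b = mv[OF \<beta>b \<beta>(2)]
      show "integrable lebesgue (\<lambda>y. \<theta> y *\<^sub>R c y)"
        unfolding c_def scaleR_diff_right by (rule Bochner_Integration.integrable_diff[OF a(1) b(1)])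
      show "integrable lborel (\<lambda>s. \<gamma> s *\<^sub>R ((LINT y|lebesgue. \<theta> y *\<^sub>R J (y - \<alpha> s)) - (LINT y|lebesgue. \<theta> y *\<^sub>R J (y - \<beta> s))))"
        unfolding scaleR_diff_right by (rule Bochner_Integration.integrable_diff[OF a(2) b(2)])
      show "(LINT y|lebesgue. \<theta> y *\<^sub>R c y) = (LINT s|lborel. \<gamma> s *\<^sub>R
         ((LINT y|lebesgue. \<theta> y *\<^sub>R J (y - \<alpha> s)) - (LINT y|lebesgue. \<theta> y *\<^sub>R J (y - \<beta> s))))"
        unfolding c_def scaleR_diff_right Bochner_Integration.integral_diff[OF a(1) b(1)]
          Bochner_Integration.integral_diff[OF a(2) b(2)] a(3) b(3) ..
    qed
    have test_component: "(LINT y|lebesgue. \<theta> y * c y $ k) = (LINT s|lborel. \<gamma> s *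
         ((LINT y|lebesgue. \<theta> y * J (y - \<alpha> s) $ k) - (LINT y|lebesgue. \<theta> y * J (y - \<beta> s) $ k)))"
      "integrable lborel (\<lambda>s. \<gamma> s * ((LINT y|lebesgue. \<theta> y * J (y - \<alpha> s) $ k) - (LINT y|lebesgue. \<theta> y * J (y - \<beta> s) $ k)))"
      if \<theta>: "continuous_on UNIV \<theta>" for \<theta> k
    proof -
      have "compact (\<theta> ` cball 0 (\<rho> + m))" using \<theta> by (intro compact_continuous_image) (auto intro: continuous_on_subset)
      then have "bounded (\<theta> ` cball 0 (\<rho> + m))" by (rule compact_imp_bounded)
      then obtain B where "\<forall>y \<in> \<theta> ` cball 0 (\<rho> + m). norm y \<le> B" unfolding bounded_iff by blast
      then have B: "\<bar>\<theta> y\<bar> \<le> B" if "norm y \<le> \<rho> + m" for y using that by auto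
      have \<theta>m: "\<theta> \<in> borel_measurable borel" using \<theta> by (rule borel_measurable_continuous_onI)
      note t = test[OF \<theta>m B]
      have Ji: "integrable lebesgue (\<lambda>y. \<theta> y *\<^sub>R J (y - z))" if z: "norm z \<le> m" for z
      proof (rule Bochner_Integration.integrable_bound)
        show "integrable lebesgue (\<lambda>y. B *\<^sub>R J (y - z))" using lebesgue_integrable_translate[OF J(2), of "- z"] by simp
        show "(\<lambda>y. \<theta> y *\<^sub>R J (y - z)) \<in> borel_measurable lebesgue"
        proof (rule measurable_completion)
          note [measurable] = J(1) \<theta>m
          show "(\<lambda>y. \<theta> y *\<^sub>R J (y - z)) \<in> borel_measurable lborel" by measurable
        qed
        show "AE y in lebesgue. norm (\<theta> y *\<^sub>R J (y - z)) \<le> norm (B *\<^sub>R J (y - z))"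
        proof (intro AE_I2)
          fix y :: "real^3"
          show "norm (\<theta> y *\<^sub>R J (y - z)) \<le> norm (B *\<^sub>R J (y - z))"
          proof (cases "norm (y - z) > \<rho>")
            case False
            then have "norm y \<le> \<rho> + m" using norm_triangle_sub[of y z] z by linarith
            then have "\<bar>\<theta> y\<bar> \<le> \<bar>B\<bar>" using B[of y] by linarith
            then show ?thesis by (simp add: mult_right_mono)
          qed (simp add: J(3))
        qed
      qed
      have comp: "(LINT y|lebesgue. \<theta> y *\<^sub>R J (y - z)) $ k = (LINT y|lebesgue. \<theta> y * J (y - z) $ k)" if "norm z \<le> m" for z
        using integral_bounded_linear[OF bounded_linear_vec_nth[of k] Ji[OF that]] by simp
      show "(LINT y|lebesgue. \<theta> y * c y $ k) = (LINT s|lborel. \<gamma> s *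
         ((LINT y|lebesgue. \<theta> y * J (y - \<alpha> s) $ k) - (LINT y|lebesgue. \<theta> y * J (y - \<beta> s) $ k)))"
        using integral_bounded_linear[OF bounded_linear_vec_nth[of k] t(1)] integral_bounded_linear[OF bounded_linear_vec_nth[of k] t(2)] t(3)
        by (simp add: comp \<alpha>(2) \<beta>(2))
      show "integrable lborel (\<lambda>s. \<gamma> s * ((LINT y|lebesgue. \<theta> y * J (y - \<alpha> s) $ k) - (LINT y|lebesgue. \<theta> y * J (y - \<beta> s) $ k)))"
        using integrable_bounded_linear[OF bounded_linear_vec_nth[of k] t(2)] by (simp add: comp \<alpha>(2) \<beta>(2))
    qed
    have supp: "c y = 0" if "norm y > \<rho> + m" for y
    proof -
      have "norm (y - \<alpha> s) > \<rho>" "norm (y - \<beta> s) > \<rho>" for s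
        using norm_triangle_sub[of y "\<alpha> s"] norm_triangle_sub[of y "\<beta> s"] \<alpha>(2)[of s] \<beta>(2)[of s] that by linarith+
      then show ?thesis by (simp add: c_def moving_average_def J(3))
    qed
    have ci: "integrable lebesgue c" using test(1)[of "\<lambda>_. 1" 1] by simp
    have potential: "cross3 x (yukawa_potential \<sigma> c x) = 0" if x: "x \<in> \<Gamma>" for x
    proof -
      have nx: "norm x = R" using openin_imp_subset[OF \<Gamma>(1)] x by auto
      have "\<bar>yukawa \<sigma> (norm (x - y))\<bar> \<le> 1 / (R - (\<rho> + m))" if "norm y \<le> \<rho> + m" for y
      proof (rule yukawa_bound[OF \<sigma>])
        show "R - (\<rho> + m) \<le> norm (x - y)" using norm_triangle_sub[of x y] nx that by linarith
      qed (use R in simp)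
      moreover have "(\<lambda>y. yukawa \<sigma> (norm (x - y))) \<in> borel_measurable borel"
        unfolding yukawa_def by measurable
      ultimately show ?thesis using test(3)[of "\<lambda>y. yukawa \<sigma> (norm (x - y))" "1 / (R - (\<rho> + m))"] boundary[OF \<sigma> x]
        by (simp add: yukawa_potential_def \<gamma>_def)
    qed
    interpret exterior_problem \<sigma> "\<rho> + m" R c
    proof
      show "cross3 x (yukawa_potential \<sigma> c x) = 0" if "norm x = R" for x
        by (rule yukawa_analytic_continuation[OF ci supp _ R \<sigma> \<Gamma> potential that]) (use J(4) m in auto)
      show "(\<Sum>k\<in>UNIV. LINT y|lebesgue. iter_pderiv [k] \<psi> y * c y $ k) = 0" if \<psi>: "radial x0 \<psi>" for x0 \<psi>
      proof -
        note t = test_component[OF radial_continuous_on[OF radial_iter_pderiv1[OF \<psi>]]]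
        have "(\<Sum>k\<in>UNIV. LINT y|lebesgue. iter_pderiv [k] \<psi> y * c y $ k) = (LINT s|lborel. (\<Sum>k\<in>UNIV. \<gamma> s *
         ((LINT y|lebesgue. iter_pderiv [k] \<psi> y * J (y - \<alpha> s) $ k) - (LINT y|lebesgue. iter_pderiv [k] \<psi> y * J (y - \<beta> s) $ k))))"
          unfolding t(1) by (rule Bochner_Integration.integral_sum[symmetric]) (rule t(2))
        also have "\<dots> = 0"
          unfolding sum_distrib_left[symmetric] sum_subtractf div[OF \<psi>] by simp
        finally show ?thesis .
      qed
    qed (use ci supp R \<sigma> J(4) m in auto)
    have shift: "(LINT y|lebesgue. exp (\<xi> \<bullet> y) * J (y - z) $ j) = exp (\<xi> \<bullet> z) * M j \<xi>" for z
    proof -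
      have "(\<lambda>y. exp (\<xi> \<bullet> y) * J (y - z) $ j) \<in> borel_measurable borel"
      proof -
        have "(\<lambda>v::real^3. v $ j) \<in> borel_measurable borel" by (intro borel_measurable_continuous_onI continuous_intros)
        then show ?thesis using J(1) by measurable
      qed
      then have "(\<lambda>y. exp (\<xi> \<bullet> y) * J (y - z) $ j) \<in> borel_measurable lebesgue" by (simp add: measurable_completion)
      from lebesgue_integral_translate[OF this, of z]
      have "(LINT y|lebesgue. exp (\<xi> \<bullet> y) * J (y - z) $ j) = (LINT y|lebesgue. exp (\<xi> \<bullet> (y + z)) * J y $ j)" by simp
      also have "\<dots> = (LINT y|lebesgue. exp (\<xi> \<bullet> z) * (exp (\<xi> \<bullet> y) * J y $ j))"
        by (simp add: inner_add_right exp_add mult_ac)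
      finally show ?thesis unfolding M_def by (simp only: integral_mult_right_zero)
    qed
    have "0 = (LINT y|lebesgue. exp (\<xi> \<bullet> y) * c y $ j)"
      using far_field_vanishing[of \<xi> j] by (simp add: \<sigma>_def)
    also have "\<dots> = (LINT s|lborel. \<gamma> s * (exp (\<xi> \<bullet> \<alpha> s) * M j \<xi> - exp (\<xi> \<bullet> \<beta> s) * M j \<xi>))"
      by (subst test_component(1)) (auto simp: shift intro!: continuous_intros)
    also have "\<dots> = (LINT s|lborel. \<gamma> s * (exp (\<xi> \<bullet> \<alpha> s) - exp (\<xi> \<bullet> \<beta> s))) * M j \<xi>"
      by (subst integral_mult_left_zero[symmetric]) (simp add: algebra_simps)
    also have "(LINT s|lborel. \<gamma> s * (exp (\<xi> \<bullet> \<alpha> s) - exp (\<xi> \<bullet> \<beta> s))) = D \<xi>"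
    proof -
      have "((\<lambda>s. \<gamma> s * (exp (\<xi> \<bullet> \<alpha> s) - exp (\<xi> \<bullet> \<beta> s))) has_integral
          (LINT s|lborel. \<gamma> s * (exp (\<xi> \<bullet> \<alpha> s) - exp (\<xi> \<bullet> \<beta> s)))) {0..T}"
        by (rule lborel_integral_compact_support(2)) (auto simp: \<gamma>0 intro!: continuous_intros \<gamma>c \<alpha>(1) \<beta>(1))
      then show ?thesis by (simp add: D_def \<gamma>_def \<sigma>_def integral_unique)
    qed
    finally show ?thesis by simp
  qed
  have contD: "continuous_on UNIV D"
  proof -
    have "continuous_on (UNIV \<times> cbox 0 T) (\<lambda>(\<xi> :: real^3, s). g s * exp (- norm \<xi> * s) * (exp (\<xi> \<bullet> \<alpha> s) - exp (\<xi> \<bullet> \<beta> s)))"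
      unfolding case_prod_beta
      by (intro continuous_intros continuous_on_compose2[OF g(1)] continuous_on_compose2[OF \<alpha>(1)] continuous_on_compose2[OF \<beta>(1)]) auto
    from integral_continuous_on_param[OF this] show ?thesis unfolding D_def[abs_def] by simp
  qed
  show ?thesis
  proof (rule ccontr)
    assume "\<not> ?thesis"
    then have "D \<xi> \<noteq> 0" by (simp add: D_def)
    \<comment> \<open>The origin is removed because the factorisation is available only for nonzero
      frequencies.\<close>
    moreover have "open ({\<zeta>. D \<zeta> \<noteq> 0} \<inter> - {0})"
      by (intro open_Int open_Collect_neq contD continuous_on_const) auto
    ultimately obtain e where e: "e > 0" "ball \<xi> e \<subseteq> {\<zeta>. D \<zeta> \<noteq> 0} \<inter> - {0}"
      using \<xi> open_contains_ball[of "{\<zeta>. D \<zeta> \<noteq> 0} \<inter> - {0}"] by auto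
    have Jj: "integrable lebesgue (\<lambda>z. J z $ j)" "\<And>z. norm z > \<rho> \<Longrightarrow> J z $ j = 0" for j
      using integrable_bounded_linear[OF bounded_linear_vec_nth J(2)] J(3) by auto
    have M0: "M j \<zeta> = 0" if "norm (\<zeta> - \<xi>) < e" for j \<zeta>
    proof -
      have "\<zeta> \<in> ball \<xi> e" using that by (simp add: dist_norm norm_minus_commute)
      then have "D \<zeta> \<noteq> 0" "\<zeta> \<noteq> 0" using e(2) by auto
      then show ?thesis using prod[of \<zeta> j] by simp
    qed
    have M1: "M j \<zeta> = 0" for j \<zeta>
      unfolding M_def
    proof (rule exponential_moments_local_imp_global[OF Jj(1) _ e(1)])
      show "J z $ j = 0" if "norm z > \<rho>" for z by (rule Jj(2)[OF that])
      show "(LINT z|lebesgue. exp (\<xi>' \<bullet> z) * J z $ j) = 0" if "norm (\<xi>' - \<xi>) < e" for \<xi>'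
        using M0[OF that, of j] by (simp only: M_def)
    qed
    have "AE z in lebesgue. J z $ j = 0" for j
    proof (rule exponential_moments_imp_AE_0[OF Jj(1)])
      show "J z $ j = 0" if "norm z > \<rho>" for z by (rule Jj(2)[OF that])
      show "(LINT z|lebesgue. exp (\<zeta> \<bullet> z) * J z $ j) = 0" for \<zeta> using M1[of j \<zeta>] by (simp only: M_def)
    qed
    then have "AE z in lebesgue. \<forall>j. J z $ j = 0" by (subst AE_all_countable) simp
    then show False using J0 by (simp add: vec_eq_iff)
  qed
qed

text \<open>Seen from x0, the source acts at distances between \<open>d\<close> and R + \<rho> + m
  and at times in [0, T0], so t + r lies in [d, T']. There the truncated profile is exactly
  exponential and splits into a factor in t and one in r.\<close>

lemma tangential_data_imp_yukawa_data:
  fixes J J' :: "real^3 \<Rightarrow> real^3"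
  assumes c1: "maxwell_curve (\<lambda>x t. g t *\<^sub>R J (x - a t)) E1 E1t E1tt"
    and c2: "maxwell_curve (\<lambda>x t. g t *\<^sub>R J (x - b t)) E2 E2t E2tt"
    and J: "J \<in> borel_measurable lebesgue" "J' \<in> borel_measurable borel" "AE x in lebesgue. J x = J' x"
      "\<And>y. norm y > \<rho> \<Longrightarrow> J' y = 0"
    and ab: "\<And>t. t \<in> {0..T0} \<Longrightarrow> norm (a t) \<le> m" "\<And>t. t \<in> {0..T0} \<Longrightarrow> norm (b t) \<le> m"
    and g: "\<And>t. t \<notin> {0..T0} \<Longrightarrow> g t = 0"
    and x0: "norm x0 = R" and R: "\<rho> + m < R" and T: "T0 + R + \<rho> + m < T" "T > 0"
    and data: "\<And>t. 0 < t \<Longrightarrow> t < T \<Longrightarrow> cross3 x0 (E1 x0 t) = cross3 x0 (E2 x0 t)"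
  shows "((\<lambda>t. cross3 x0 ((g t * exp (- \<sigma> * t)) *\<^sub>R
       ((LINT y|lebesgue. yukawa \<sigma> (norm (x0 - y)) *\<^sub>R J' (y - a t)) -
        (LINT y|lebesgue. yukawa \<sigma> (norm (x0 - y)) *\<^sub>R J' (y - b t))))) has_integral 0) {0..T}"
proof -
  define d where "d = R - (\<rho> + m)"
  define T' where "T' = T0 + R + \<rho> + m"
  define k where "k = 2 / (T - T')"
  \<comment> \<open>The first cut-off is 1 from \<open>d\<close> on, and the second is 1 up to T'
    and 0 from T on. The strict inequality T' < T makes room for it.\<close>
  define P where "P t = exp (- \<sigma> * t) * step (2 / d * t) * step (k * (T - t))" for t
  have d: "d > 0" using R by (simp add: d_def)
  have TT: "T - T' > 0" using T by (simp add: T'_def)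
  have "2 / u > 0 \<and> 2 / u * u = 2" if "u > 0" for u :: real using that by simp
  from this[OF TT] have k: "k > 0" "k * (T - T') = 2" unfolding k_def by blast+
  have P_exp: "P t = exp (- \<sigma> * t)" if "d \<le> t" "t \<le> T'" for t
  proof -
    have "2 / d * t \<ge> 2" using d that by (simp add: field_simps)
    moreover have "k * (T - t) \<ge> 2" using mult_left_mono[of "T - T'" "T - t" k] k that by simp
    ultimately show ?thesis by (simp add: P_def step_eq_1)
  qed
  have P0: "P t = 0" if "t \<ge> T" for t
    using mult_nonneg_nonpos[of k "T - t"] k that by (simp add: P_def step_eq_0)
  have P: "annular P"
  proof (rule annularI)
    have "smooth (\<lambda>t. step (k * (T - t)))"
      using smooth_affine[OF smooth_step, of "- k" "k * T"] by (simp add: algebra_simps)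
    moreover have "smooth (\<lambda>t. step (2 / d * t))" using smooth_affine[OF smooth_step, of "2 / d" 0] by simp
    ultimately show "smooth P" unfolding P_def by (intro smooth_mult smooth_exp)
    show "d / 2 > 0" using d by simp
    show "P r = 0" if "r < d / 2" for r
      using that d by (simp add: P_def step_eq_0 field_simps)
    show "P r = 0" if "r > T" for r using P0 that by simp
  qed
  have Jt: "AE y in lebesgue. J (y - z) = J' (y - z)" for z
    using AE_lebesgue_translate[OF J(3), of "- z"] by simp
  have Jm: "(\<lambda>y. J (y - z)) \<in> borel_measurable lebesgue" for z
    using measurable_compose[OF lebesgue_translation(1)[of "- z"] J(1)] by simp
  have away: "AE x in lebesgue. norm (x - x0) < d \<longrightarrow> g t *\<^sub>R J (x - z t) = 0"
    if z: "\<And>t. t \<in> {0..T0} \<Longrightarrow> norm (z t) \<le> m" for t and z :: "real \<Rightarrow> real^3"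
  proof (cases "t \<in> {0..T0}")
    case True
    show ?thesis using Jt[of "z t"]
    proof eventually_elim
      case (elim x)
      show ?case
      proof
        assume "norm (x - x0) < d"
        then have "norm (x - z t) > \<rho>"
          using z[OF True] norm_triangle_sub[of x0 x] norm_triangle_sub[of x "z t"] x0
          by (simp add: d_def norm_minus_commute)
        then show "g t *\<^sub>R J (x - z t) = 0" using elim J(4) by simp
      qed
    qed
  qed (simp add: g)
  have meas: "(\<lambda>x. g t *\<^sub>R J (x - z)) \<in> borel_measurable lebesgue" for t z using Jm[of z] by simp
  have wave: "(LINT x|lebesgue. (P (t + norm (x - x0)) / norm (x - x0)) *\<^sub>R (g t *\<^sub>R J (x - z))) =
     (g t * exp (- \<sigma> * t)) *\<^sub>R (LINT y|lebesgue. yukawa \<sigma> (norm (x0 - y)) *\<^sub>R J' (y - z))"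
    if t: "t \<in> {0..T0}" and z: "norm z \<le> m" for t z
  proof -
    have "(LINT x|lebesgue. (P (t + norm (x - x0)) / norm (x - x0)) *\<^sub>R (g t *\<^sub>R J (x - z))) =
      (LINT x|lebesgue. (g t * exp (- \<sigma> * t)) *\<^sub>R (yukawa \<sigma> (norm (x0 - x)) *\<^sub>R J' (x - z)))"
    proof (rule integral_cong_AE)
      have "(\<lambda>x. P (t + norm (x - x0)) / norm (x - x0)) \<in> borel_measurable borel"
      proof -
        have [measurable]: "P \<in> borel_measurable borel" by (rule smooth_measurable[OF annular_smooth[OF P]])
        show ?thesis by measurable
      qed
      then show "(\<lambda>x. (P (t + norm (x - x0)) / norm (x - x0)) *\<^sub>R (g t *\<^sub>R J (x - z))) \<in> borel_measurable lebesgue"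
        by (intro borel_measurable_scaleR meas) (simp add: measurable_completion)
      have "(\<lambda>x. (g t * exp (- \<sigma> * t)) *\<^sub>R (yukawa \<sigma> (norm (x0 - x)) *\<^sub>R J' (x - z))) \<in> borel_measurable borel"
        using J(2) unfolding yukawa_def by measurable
      then show "(\<lambda>x. (g t * exp (- \<sigma> * t)) *\<^sub>R (yukawa \<sigma> (norm (x0 - x)) *\<^sub>R J' (x - z))) \<in> borel_measurable lebesgue"
        by (simp add: measurable_completion)
      show "AE x in lebesgue. (P (t + norm (x - x0)) / norm (x - x0)) *\<^sub>R (g t *\<^sub>R J (x - z)) =
          (g t * exp (- \<sigma> * t)) *\<^sub>R (yukawa \<sigma> (norm (x0 - x)) *\<^sub>R J' (x - z))"
        using Jt[of z]
      proof eventually_elim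
        case (elim x)
        show ?case
        proof (cases "norm (x - z) > \<rho>")
          case False
          then have nx: "norm x \<le> \<rho> + m" using norm_triangle_sub[of x z] z by linarith
          have "d \<le> norm (x - x0)" "norm (x - x0) \<le> R + \<rho> + m"
            using norm_triangle_sub[of x0 x] norm_triangle_ineq4[of x x0] nx x0 by (auto simp: d_def norm_minus_commute)
          then have "P (t + norm (x - x0)) = exp (- \<sigma> * (t + norm (x - x0)))"
            using t by (intro P_exp) (auto simp: T'_def)
          moreover have "exp (- \<sigma> * (t + norm (x - x0))) = exp (- \<sigma> * t) * exp (- \<sigma> * norm (x - x0))"
            by (simp add: algebra_simps flip: exp_add)
          ultimately show ?thesis using elim by (simp add: yukawa_def norm_minus_commute[of x0] mult_ac)
        qed (use elim in \<open>simp add: J(4)\<close>)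
      qed
    qed
    then show ?thesis unfolding integral_scaleR_right .
  qed
  have "((\<lambda>t. cross3 x0 ((LINT x|lebesgue. (P (t + norm (x - x0)) / norm (x - x0)) *\<^sub>R (g t *\<^sub>R J (x - a t))) -
     (LINT x|lebesgue. (P (t + norm (x - x0)) / norm (x - x0)) *\<^sub>R (g t *\<^sub>R J (x - b t))))) has_integral 0) {0..T}"
  proof (rule tangential_data_imp_source_integral[OF c1 c2 P T(2) P0 data d])
    show "AE x in lebesgue. norm (x - x0) < d \<longrightarrow> g t *\<^sub>R J (x - a t) = 0" for t by (rule away) (rule ab(1))
    show "AE x in lebesgue. norm (x - x0) < d \<longrightarrow> g t *\<^sub>R J (x - b t) = 0" for t by (rule away) (rule ab(2))
  qed (assumption | rule meas)+
  moreover have "cross3 x0 ((LINT x|lebesgue. (P (t + norm (x - x0)) / norm (x - x0)) *\<^sub>R (g t *\<^sub>R J (x - a t))) -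
     (LINT x|lebesgue. (P (t + norm (x - x0)) / norm (x - x0)) *\<^sub>R (g t *\<^sub>R J (x - b t)))) =
     cross3 x0 ((g t * exp (- \<sigma> * t)) *\<^sub>R
       ((LINT y|lebesgue. yukawa \<sigma> (norm (x0 - y)) *\<^sub>R J' (y - a t)) -
        (LINT y|lebesgue. yukawa \<sigma> (norm (x0 - y)) *\<^sub>R J' (y - b t))))" for t
  proof (cases "t \<in> {0..T0}")
    case True
    show ?thesis unfolding wave[OF True ab(1)[OF True]] wave[OF True ab(2)[OF True]] by (simp add: scaleR_diff_right)
  qed (simp add: g)
  ultimately show ?thesis by simp
qed

lemma laplace_moments_imp_component_eq:
  fixes p q :: "real \<Rightarrow> real"
  assumes g: "continuous_on {0..T} g"
    and nz: "\<And>s t. 0 \<le> s \<Longrightarrow> s < t \<Longrightarrow> t \<le> T \<Longrightarrow> \<exists>u. s < u \<and> u < t \<and> g u \<noteq> 0"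
    and p: "continuous_on {0..T} p" "\<And>s t. 0 \<le> s \<Longrightarrow> s < t \<Longrightarrow> t \<le> T \<Longrightarrow> s + p s < t + p t" "p 0 = 0"
    and q: "continuous_on {0..T} q" "\<And>s t. 0 \<le> s \<Longrightarrow> s < t \<Longrightarrow> t \<le> T \<Longrightarrow> s + q s < t + q t" "q 0 = 0"
    and mom: "\<And>n. n \<ge> 1 \<Longrightarrow> integral {0..T} (\<lambda>s. g s * exp (- real n * s) * (exp (- real n * p s) - exp (- real n * q s))) = 0"
    and t: "t \<in> {0..T}"
  shows "p t = q t"
proof -
  define A where "A p s = exp (- (s + p s))" for p and s :: real
  have A: "continuous_on {0..T} (A p)" "\<And>s. s \<in> {0..T} \<Longrightarrow> A p s \<in> {0..1}"
    "\<And>s t. 0 \<le> s \<Longrightarrow> s < t \<Longrightarrow> t \<le> T \<Longrightarrow> A p t < A p s" "A p 0 = 1"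
    if p: "continuous_on {0..T} p" "\<And>s t. 0 \<le> s \<Longrightarrow> s < t \<Longrightarrow> t \<le> T \<Longrightarrow> s + p s < t + p t" "p 0 = 0" for p
  proof -
    show "continuous_on {0..T} (A p)" unfolding A_def by (intro continuous_intros p)
    show "A p t < A p s" if "0 \<le> s" "s < t" "t \<le> T" for s t using p(2)[OF that] by (simp add: A_def)
    show "A p 0 = 1" by (simp add: A_def p)
    show "A p s \<in> {0..1}" if "s \<in> {0..T}" for s
      using p(2)[of 0 s] p(3) that by (cases "s = 0") (auto simp: A_def)
  qed
  have pow: "exp (- real n * s) * (exp (- real n * p s) - exp (- real n * q s)) = A p s ^ n - A q s ^ n" for n s
    by (simp add: A_def algebra_simps flip: exp_of_nat_mult exp_add)
  have mom1: "integral {0..T} (\<lambda>s. g s * (A p s ^ n - A q s ^ n)) = 0" if "n \<ge> 1" for n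
    using mom[OF that] by (simp only: mult.assoc pow)
  have mom2: "integral {0..T} (\<lambda>s. g s * (A q s ^ n - A p s ^ n)) = 0" if "n \<ge> 1" for n
  proof -
    have "integral {0..T} (\<lambda>s. g s * (A q s ^ n - A p s ^ n)) = integral {0..T} (\<lambda>s. - (g s * (A p s ^ n - A q s ^ n)))"
      by (simp add: algebra_simps)
    then show ?thesis using mom1[OF that] by simp
  qed
  \<comment> \<open>\<open>equal_moments_imp_le\<close> excludes one sign only, so it is applied a
    second time with the two functions exchanged.\<close>
  have "A p t \<le> A q t"
    by (rule equal_moments_imp_le[OF A(1-3)[OF p] A(1-3)[OF q] g mom1 _ nz t]) (simp_all add: A(4)[OF p] A(4)[OF q])
  moreover have "A q t \<le> A p t"
    by (rule equal_moments_imp_le[OF A(1-3)[OF q] A(1-3)[OF p] g mom2 _ nz t]) (simp_all add: A(4)[OF p] A(4)[OF q])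
  ultimately have "A p t = A q t" by simp
  then show ?thesis by (simp add: A_def)
qed

lemma C1_halfline_continuous:
  "C1_halfline f \<Longrightarrow> continuous_on {0..} f"
  unfolding C1_halfline_def by (auto intro: differentiable_imp_continuous_on)

lemma C1_halfline_has_vector_derivative:
  assumes "C1_halfline f" "t \<ge> 0"
  shows "(f has_vector_derivative halfline_deriv f t) (at t within {0..})"
  using assms by (auto simp: C1_halfline_def differentiable_on_def vector_derivative_works)

text \<open>The derivative of t + a_j(t) is 1 + a_j'(t), which the bound on the component speed
  keeps positive.\<close>

lemma speed_less_one_imp_increasing:
  fixes a :: "real \<Rightarrow> real^3"
  assumes a: "C1_halfline a" and speed: "\<And>t. t \<in> {0..T} \<Longrightarrow> \<bar>halfline_deriv a t $ j\<bar> < 1"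
    and st: "0 \<le> s" "s < t" "t \<le> T"
  shows "s + a s $ j < t + a t $ j"
proof -
  have d: "((\<lambda>u. u + a u $ j) has_vector_derivative 1 + halfline_deriv a u $ j) (at u within {s..t})" if u: "u \<in> {s..t}" for u
  proof -
    have "(a has_vector_derivative halfline_deriv a u) (at u within {s..t})"
      using C1_halfline_has_vector_derivative[OF a, of u] st u by (auto intro: has_vector_derivative_within_subset)
    from bounded_linear.has_vector_derivative[OF bounded_linear_vec_nth this]
    show ?thesis by (intro has_vector_derivative_add has_vector_derivative_id)
  qed
  have "\<exists>u\<in>{s<..<t}. (t + a t $ j) - (s + a s $ j) = (t - s) *\<^sub>R (1 + halfline_deriv a u $ j)"
    by (rule mvt_simple[OF st(2)]) (use d in \<open>simp add: has_vector_derivative_def\<close>)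
  then obtain u where u: "s < u" "u < t" "(t + a t $ j) - (s + a s $ j) = (t - s) * (1 + halfline_deriv a u $ j)" by auto
  have "1 + halfline_deriv a u $ j > 0" using speed[of u] u st by auto
  then have "(t - s) * (1 + halfline_deriv a u $ j) > 0" using st by simp
  then show ?thesis using u(3) by linarith
qed

text \<open>On a compact time interval the strict bound improves to one with a gap. The gap gives
  the cut-off in time room before T.\<close>

lemma compact_curve_bound:
  fixes a :: "real \<Rightarrow> real^3"
  assumes "continuous_on {0..T} a" "T \<ge> 0" "\<And>t. t \<in> {0..T} \<Longrightarrow> norm (a t) < R"
  obtains m where "0 \<le> m" "m < R" "\<And>t. t \<in> {0..T} \<Longrightarrow> norm (a t) \<le> m"
proof -
  have "continuous_on {0..T} (\<lambda>t. norm (a t))" by (intro continuous_intros assms)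
  then obtain t where "t \<in> {0..T}" "\<forall>s\<in>{0..T}. norm (a s) \<le> norm (a t)"
    using continuous_attains_sup[of "{0..T}" "\<lambda>t. norm (a t)"] assms(2) by auto
  then show ?thesis using that[of "norm (a t)"] assms(3)[of t] by auto
qed

text \<open>\<open>J\<close> is given up to null sets and is only Lebesgue measurable. Fubini's
  theorem along a moving curve calls for a Borel version that vanishes everywhere outside a compact
  set.\<close>

lemma L2_borel_representative:
  fixes J :: "real^3 \<Rightarrow> real^3"
  assumes J: "J \<in> L2" and K: "compact K" "AE x in lebesgue. x \<notin> K \<longrightarrow> J x = 0"
  obtains J' where "J' \<in> borel_measurable borel" "integrable lebesgue J'" "AE x in lebesgue. J x = J' x" "\<And>x. x \<notin> K \<Longrightarrow> J' x = 0"
proof -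
  have "\<exists>f. f \<in> borel_measurable lborel \<and> (AE x in lborel. J x $ i = f x)" for i
  proof -
    have "(\<lambda>v::real^3. v $ i) \<in> borel_measurable borel" by (intro borel_measurable_continuous_onI continuous_intros)
    then have "(\<lambda>x. J x $ i) \<in> borel_measurable lebesgue" by (rule measurable_compose[OF L2_measurable[OF J]])
    then show ?thesis using completion_ex_borel_measurable_real[of "\<lambda>x. J x $ i" lborel] by metis
  qed
  then obtain f where f: "\<And>i. f i \<in> borel_measurable lborel" "\<And>i. AE x in lborel. J x $ i = f i x" by metis
  define J' where "J' x = indicator K x *\<^sub>R (\<chi> i. f i x)" for x
  have "(\<lambda>x. \<chi> i. f i x) \<in> borel_measurable borel"
  proof (subst borel_measurable_euclidean_space, intro ballI)
    fix b :: "real^3" assume "b \<in> Basis"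
    then obtain i where "b = axis i 1" by (auto simp: Basis_vec_def)
    then show "(\<lambda>x. (\<chi> i. f i x) \<bullet> b) \<in> borel_measurable borel" using f(1)[of i] by (simp add: inner_axis)
  qed
  moreover have "K \<in> sets borel" using K(1) by (simp add: borel_closed compact_imp_closed)
  ultimately have b: "J' \<in> borel_measurable borel"
    unfolding J'_def by (intro borel_measurable_scaleR borel_measurable_indicator) auto
  have "AE x in lborel. \<forall>i. J x $ i = f i x" using f(2) by (subst AE_all_countable) simp
  then have "AE x in lebesgue. \<forall>i. J x $ i = f i x" by (rule AE_completion)
  then have eq: "AE x in lebesgue. J x = J' x"
    using K(2) by eventually_elim (auto simp: J'_def vec_eq_iff indicator_def)
  have "integrable lebesgue (\<lambda>x. indicator K x *\<^sub>R J x)"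
    using L2_locally_integrable[OF J] K(1) by (auto simp: locally_integrable_def set_integrable_def)
  moreover have "AE x in lebesgue. J' x = indicator K x *\<^sub>R J x"
    using eq by eventually_elim (auto simp: J'_def indicator_def)
  moreover have "J' \<in> borel_measurable lebesgue" using b by (simp add: measurable_completion)
  ultimately have "integrable lebesgue J'" by (intro integrable_cong_AE_imp[of _ "\<lambda>x. indicator K x *\<^sub>R J x" J']) (auto elim: eventually_mono)
  then show ?thesis using that b eq by (auto simp: J'_def)
qed

theorem theorem4p2:
  fixes Rhat R1 T0 R T :: real
    and \<Gamma> :: "(real^3) set"
    and J :: "real^3 \<Rightarrow> real^3"
    and g :: "real \<Rightarrow> real"
    and a b :: "real \<Rightarrow> real^3"
    and E1 E2 :: "real^3 \<Rightarrow> real \<Rightarrow> real^3"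
  assumes "Rhat > 0" and "R1 > 0" and "T0 > 0"
    and "R > Rhat + R1"
    and "T = T0 + Rhat + R1 + R"
    and "openin (top_of_set (sphere 0 R)) \<Gamma>"
    and "sphere_area R \<Gamma> > 0"
    and "J \<in> H2"
    and "\<not> (AE x in lebesgue. J x = 0)"
    and "\<exists>K. compact K \<and> K \<subseteq> ball 0 Rhat \<and> (AE x in lebesgue. x \<notin> K \<longrightarrow> J x = 0)"
    and "AE x in lebesgue. weak_div J x = 0"
    and "C1_halfline g"
    and "\<And>t. t \<ge> T0 \<Longrightarrow> g t = 0" and "\<And>t. t \<le> 0 \<Longrightarrow> g t = 0"
    and "closure {t. g t \<noteq> 0} = {0..T0}"
    and "C1_halfline a" and "C1_halfline b"
    and "\<And>t. t \<ge> 0 \<Longrightarrow> norm (a t) < R1" and "\<And>t. t \<ge> 0 \<Longrightarrow> norm (b t) < R1"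
    and "a 0 = 0" and "b 0 = 0"
    and "\<And>t j. t \<in> {0..T0} \<Longrightarrow> \<bar>halfline_deriv a t $ j\<bar> < 1"
    and "\<And>t j. t \<in> {0..T0} \<Longrightarrow> \<bar>halfline_deriv b t $ j\<bar> < 1"
    and "maxwell_solution (\<lambda>x t. g t *\<^sub>R J (x - a t)) E1"
    and "maxwell_solution (\<lambda>x t. g t *\<^sub>R J (x - b t)) E2"
    and "\<And>x t. x \<in> \<Gamma> \<Longrightarrow> t \<in> {0<..<T} \<Longrightarrow>
           cross3 (E1 x t) (x /\<^sub>R R) = cross3 (E2 x t) (x /\<^sub>R R)"
  shows "\<forall>t\<in>{0..T0}. a t = b t"
proof -
  note R1 = assms(1) and R2 = assms(2) and T0 = assms(3) and R = assms(4) and T = assms(5) and \<Gamma> = assms(6)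
    and J = assms(8) and J0 = assms(9) and div = assms(11) and g_late = assms(13) and g_early = assms(14)
    and C1a = assms(16) and C1b = assms(17)
  have R0: "R > 0" using R1 R2 R by linarith
  have \<Gamma>0: "\<Gamma> \<noteq> {}" using assms(7) by (auto simp: sphere_area_def)
  have g0: "g t = 0" if "t \<notin> {0..T0}" for t using that g_late[of t] g_early[of t] by auto
  from assms(10) obtain K where "compact K \<and> K \<subseteq> ball 0 Rhat \<and> (AE x in lebesgue. x \<notin> K \<longrightarrow> J x = 0)" ..
  note K = conjunct1[OF this] conjunct1[OF conjunct2[OF this]] conjunct2[OF conjunct2[OF this]]
  obtain J' where J': "J' \<in> borel_measurable borel" "integrable lebesgue J'" "AE x in lebesgue. J x = J' x" "\<And>x. x \<notin> K \<Longrightarrow> J' x = 0"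
    by (rule L2_borel_representative[OF H2_L2[OF J] K(1,3)]) (rule that)
  \<comment> \<open>Compactness of \<open>K\<close> leaves a gap below Rhat, just as compactness of
    the time interval does below R1.\<close>
  obtain \<rho> where \<rho>: "0 \<le> \<rho>" "\<rho> < Rhat" "\<And>y. y \<in> K \<Longrightarrow> norm y \<le> \<rho>"
  proof (cases "K = {}")
    case True
    show ?thesis by (rule that[of 0]) (use R1 True in auto)
  next
    case False
    have "continuous_on K (norm :: real^3 \<Rightarrow> real)" by (intro continuous_intros)
    from continuous_attains_sup[OF K(1) False this]
    obtain x where x: "x \<in> K" "\<forall>y\<in>K. norm y \<le> norm x" by (elim bexE)
    show ?thesis
    proof (rule that)
      show "norm x < Rhat" using x(1) K(2) by auto
      show "norm y \<le> norm x" if "y \<in> K" for y using x(2) that by (rule bspec)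
    qed simp
  qed
  have supp: "J' y = 0" if "norm y > \<rho>" for y
    using J'(4)[of y] \<rho>(3)[of y] that by (cases "y \<in> K") auto
  have ca: "continuous_on {0..} a" and cb: "continuous_on {0..} b"
    using C1_halfline_continuous[OF C1a] C1_halfline_continuous[OF C1b] by auto
  have ca0: "continuous_on {0..T0} a" and cb0: "continuous_on {0..T0} b"
    by (auto intro: continuous_on_subset[OF ca] continuous_on_subset[OF cb])
  obtain ma where ma: "0 \<le> ma" "ma < R1" "\<And>t. t \<in> {0..T0} \<Longrightarrow> norm (a t) \<le> ma"
    by (rule compact_curve_bound[OF ca0, of R1]) (use T0 assms(18) in auto)
  obtain mb where mb: "0 \<le> mb" "mb < R1" "\<And>t. t \<in> {0..T0} \<Longrightarrow> norm (b t) \<le> mb"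
    by (rule compact_curve_bound[OF cb0, of R1]) (use T0 assms(19) in auto)
  define m where "m = max ma mb"
  have m: "m < R1" "\<And>t. t \<in> {0..T0} \<Longrightarrow> norm (a t) \<le> m" "\<And>t. t \<in> {0..T0} \<Longrightarrow> norm (b t) \<le> m"
    using ma mb by (auto simp: m_def le_max_iff_disj)
  \<comment> \<open>Time is clamped to [0, T0], so that the curves become continuous and bounded by
    \<open>m\<close> on the whole line. Outside that interval \<open>g\<close> vanishes, so no
    integral changes.\<close>
  define cl where "cl s = max 0 (min T0 s)" for s
  have cl: "cl s \<in> {0..T0}" for s using T0 by (auto simp: cl_def)
  have cl_id: "cl s = s" if "s \<in> {0..T0}" for s using that by (auto simp: cl_def)
  have cont_cl: "continuous_on UNIV cl" unfolding cl_def[abs_def] by (intro continuous_intros)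
  have \<alpha>: "continuous_on UNIV (\<lambda>s. a (cl s))" and \<beta>: "continuous_on UNIV (\<lambda>s. b (cl s))"
    using cl by (auto intro!: continuous_on_compose2[OF ca0 cont_cl] continuous_on_compose2[OF cb0 cont_cl])
  \<comment> \<open>Regularity of \<open>g\<close> is given on the closed half-line only; it is
    glued to the zero function on the other half.\<close>
  have cg: "continuous_on UNIV g"
  proof -
    have "continuous_on {..0} g"
      by (rule continuous_on_eq[OF continuous_on_const[of _ 0]]) (use g_early in auto)
    then have "continuous_on ({..0} \<union> {0..}) g"
      by (intro continuous_on_closed_Un C1_halfline_continuous[OF assms(12)]) auto
    moreover have "{..0} \<union> {0..} = (UNIV :: real set)" by auto
    ultimately show ?thesis by simp
  qed
  obtain E1t E1tt where c1: "maxwell_curve (\<lambda>x t. g t *\<^sub>R J (x - a t)) E1 E1t E1tt"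
    using maxwell_solution_imp_curve[OF assms(24) J div] by blast
  obtain E2t E2tt where c2: "maxwell_curve (\<lambda>x t. g t *\<^sub>R J (x - b t)) E2 E2t E2tt"
    using maxwell_solution_imp_curve[OF assms(25) J div] by blast
  have data: "cross3 x (E1 x t) = cross3 x (E2 x t)" if "x \<in> \<Gamma>" "0 < t" "t < T" for x t
  proof -
    have "cross3 (E1 x t) (x /\<^sub>R R) = cross3 (E2 x t) (x /\<^sub>R R)" using assms(26) that by simp
    then have "cross3 (E1 x t) x = cross3 (E2 x t) x" using R0 by (simp add: cross_mult_right)
    then show ?thesis using cross_skew[of x] by metis
  qed
  have boundary: "cross3 x (LINT s|lborel. (g s * exp (- \<sigma> * s)) *\<^sub>R
       ((LINT y|lebesgue. yukawa \<sigma> (norm (x - y)) *\<^sub>R J' (y - a (cl s))) -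
        (LINT y|lebesgue. yukawa \<sigma> (norm (x - y)) *\<^sub>R J' (y - b (cl s))))) = 0" if x: "x \<in> \<Gamma>" for \<sigma> x
  proof -
    define h where "h s = (g s * exp (- \<sigma> * s)) *\<^sub>R
       ((LINT y|lebesgue. yukawa \<sigma> (norm (x - y)) *\<^sub>R J' (y - a (cl s))) -
        (LINT y|lebesgue. yukawa \<sigma> (norm (x - y)) *\<^sub>R J' (y - b (cl s))))" for s
    have nx: "norm x = R" using openin_imp_subset[OF \<Gamma>] x by auto
    have "((\<lambda>t. cross3 x ((g t * exp (- \<sigma> * t)) *\<^sub>R
       ((LINT y|lebesgue. yukawa \<sigma> (norm (x - y)) *\<^sub>R J' (y - a t)) -
        (LINT y|lebesgue. yukawa \<sigma> (norm (x - y)) *\<^sub>R J' (y - b t))))) has_integral 0) {0..T}"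
    proof (rule tangential_data_imp_yukawa_data[OF c1 c2 L2_measurable[OF H2_L2[OF J]] J'(1,3) _ m(2,3) g0 nx])
      show "\<rho> + m < R" "T0 + R + \<rho> + m < T" "T > 0" using \<rho>(2) m(1) R T T0 R0 R1 R2 by linarith+
    qed (use supp data[OF x] in auto)
    moreover have "cross3 x ((g t * exp (- \<sigma> * t)) *\<^sub>R
       ((LINT y|lebesgue. yukawa \<sigma> (norm (x - y)) *\<^sub>R J' (y - a t)) -
        (LINT y|lebesgue. yukawa \<sigma> (norm (x - y)) *\<^sub>R J' (y - b t)))) = cross3 x (h t)" for t
      by (cases "t \<in> {0..T0}") (simp_all add: h_def cl_id g0)
    ultimately have h0: "((\<lambda>t. cross3 x (h t)) has_integral 0) {0..T}" by simp
    show ?thesis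
    \<comment> \<open>If \<open>h\<close> is not integrable its integral is 0 by convention and the
      claim is immediate; otherwise it agrees with the gauge integral.\<close>
    proof (cases "integrable lborel h")
      case True
      have "(h has_integral (LINT s|lborel. h s)) UNIV" by (rule has_integral_integral_lborel[OF True])
      from has_integral_linear[OF this bounded_linear_cross3]
      have "((\<lambda>t. cross3 x (h t)) has_integral cross3 x (LINT s|lborel. h s)) UNIV" by (simp add: o_def)
      moreover have "(\<lambda>t. if t \<in> {0..T} then cross3 x (h t) else 0) = (\<lambda>t. cross3 x (h t))"
      proof
        fix t
        have "h t = 0" if "t \<notin> {0..T}" using g0[of t] that T R0 R1 R2 by (auto simp: h_def)
        then show "(if t \<in> {0..T} then cross3 x (h t) else 0) = cross3 x (h t)" by simp
      qed
      ultimately have "((\<lambda>t. cross3 x (h t)) has_integral cross3 x (LINT s|lborel. h s)) {0..T}"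
        using has_integral_restrict_UNIV[of "{0..T}" "\<lambda>t. cross3 x (h t)"] by metis
      from has_integral_unique[OF this h0] show ?thesis by (simp add: h_def)
    next
      case False
      then have "(LINT s|lborel. h s) = 0" by (rule not_integrable_integral_eq)
      then show ?thesis by (simp add: h_def)
    qed
  qed
  have div': "(\<Sum>k\<in>UNIV. LINT x|lebesgue. iter_pderiv [k] \<psi> x * J' (x - z) $ k) = 0" if \<psi>: "radial x0 \<psi>" for x0 \<psi> z
  proof -
    have comp: "(\<lambda>v::real^3. v $ k) \<in> borel_measurable borel" for k by (intro borel_measurable_continuous_onI continuous_intros)
    have m: "(\<lambda>x. iter_pderiv [k] \<psi> x * H (x - z) $ k) \<in> borel_measurable lebesgue" if "H \<in> borel_measurable lebesgue" for H :: "real^3 \<Rightarrow> real^3" and k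
    proof (rule borel_measurable_times)
      show "iter_pderiv [k] \<psi> \<in> borel_measurable lebesgue"
        using radial_measurable[OF radial_iter_pderiv1[OF \<psi>]] by (simp add: measurable_completion)
      show "(\<lambda>x. H (x - z) $ k) \<in> borel_measurable lebesgue"
        using measurable_compose[OF measurable_compose[OF lebesgue_translation(1)[of "- z"] that] comp] by simp
    qed
    have "(LINT x|lebesgue. iter_pderiv [k] \<psi> x * J' (x - z) $ k) = (LINT x|lebesgue. iter_pderiv [k] \<psi> x * J (x - z) $ k)" for k
    proof (rule integral_cong_AE)
      have "J' \<in> borel_measurable lebesgue" using J'(1) by (simp add: measurable_completion)
      then show "(\<lambda>x. iter_pderiv [k] \<psi> x * J' (x - z) $ k) \<in> borel_measurable lebesgue" by (rule m)
      show "(\<lambda>x. iter_pderiv [k] \<psi> x * J (x - z) $ k) \<in> borel_measurable lebesgue" by (rule m[OF L2_measurable[OF H2_L2[OF J]]])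
      have "AE x in lebesgue. J (x - z) = J' (x - z)" using AE_lebesgue_translate[OF J'(3), of "- z"] by simp
      then show "AE x in lebesgue. iter_pderiv [k] \<psi> x * J' (x - z) $ k = iter_pderiv [k] \<psi> x * J (x - z) $ k"
        by eventually_elim simp
    qed
    then show ?thesis using divergence_free_translate[OF J div \<psi>, of z] by simp
  qed
  have J'0: "\<not> (AE x in lebesgue. J' x = 0)"
  proof
    assume "AE x in lebesgue. J' x = 0"
    then have "AE x in lebesgue. J x = 0" using J'(3) by eventually_elim simp
    then show False using J0 by simp
  qed
  have \<rho>m: "\<rho> + m < R" using \<rho>(2) m(1) R by linarith
  have moments: "integral {0..T0} (\<lambda>s. g s * exp (- norm \<xi> * s) * (exp (\<xi> \<bullet> a (cl s)) - exp (\<xi> \<bullet> b (cl s)))) = 0" if "\<xi> \<noteq> 0" for \<xi>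
    by (rule laplace_source_vanishes[where \<rho> = \<rho> and m = m and \<Gamma> = \<Gamma> and R = R and J = J'])
      (use J'(1,2) supp \<rho>(1) J'0 div' cg g0 \<alpha> \<beta> m(2,3)[OF cl] \<rho>m \<Gamma> \<Gamma>0 boundary that in auto)
  have nz: "\<exists>u. s < u \<and> u < t \<and> g u \<noteq> 0" if st: "0 \<le> s" "s < t" "t \<le> T0" for s t
  proof -
    \<comment> \<open>The support of \<open>g\<close> is all of [0, T0], so points with g \<noteq> 0
      come arbitrarily close to the midpoint of (s, t).\<close>
    have "(s + t) / 2 \<in> closure {t. g t \<noteq> 0}" unfolding assms(15) using st by simp
    moreover have "(t - s) / 2 > 0" using st by simp
    ultimately obtain u where u: "g u \<noteq> 0" "dist u ((s + t) / 2) < (t - s) / 2" unfolding closure_approachable by blast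
    then have "s < u" "u < t" by (simp_all add: dist_real_def abs_less_iff field_simps)
    then show ?thesis using u(1) by blast
  qed
  have "a t $ j = b t $ j" if t: "t \<in> {0..T0}" for t j
  proof (rule laplace_moments_imp_component_eq[OF continuous_on_subset[OF cg] nz, where p = "\<lambda>t. a t $ j" and q = "\<lambda>t. b t $ j" and t = t and T = T0])
    show "continuous_on {0..T0} (\<lambda>t. a t $ j)" "continuous_on {0..T0} (\<lambda>t. b t $ j)"
      by (intro continuous_intros ca0 cb0)+
    show "s + a s $ j < t + a t $ j" if "0 \<le> s" "s < t" "t \<le> T0" for s t
      by (rule speed_less_one_imp_increasing[OF C1a assms(22) that])
    show "s + b s $ j < t + b t $ j" if "0 \<le> s" "s < t" "t \<le> T0" for s t
      by (rule speed_less_one_imp_increasing[OF C1b assms(23) that])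
    show "a 0 $ j = 0" "b 0 $ j = 0" using assms(20,21) by auto
    fix n :: nat assume n: "n \<ge> 1"
    \<comment> \<open>This \<xi> has norm n, so the Laplace weight exp(-n s) and the factor exp(-n
      a_j(s)) combine into the n-th power of exp(-(s + a_j(s))).\<close>
    have "- real n *\<^sub>R axis j (1::real) \<noteq> 0" using n by simp
    from moments[OF this]
    have "integral {0..T0} (\<lambda>s. g s * exp (- real n * s) * (exp (- real n * a (cl s) $ j) - exp (- real n * b (cl s) $ j))) = 0"
      by (simp add: inner_axis')
    moreover have "integral {0..T0} (\<lambda>s. g s * exp (- real n * s) * (exp (- real n * a (cl s) $ j) - exp (- real n * b (cl s) $ j))) =
      integral {0..T0} (\<lambda>s. g s * exp (- real n * s) * (exp (- real n * a s $ j) - exp (- real n * b s $ j)))"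
      by (rule Henstock_Kurzweil_Integration.integral_cong) (simp add: cl_id)
    ultimately show "integral {0..T0} (\<lambda>s. g s * exp (- real n * s) * (exp (- real n * a s $ j) - exp (- real n * b s $ j))) = 0" by simp
  qed (use t in auto)
  then show ?thesis by (simp add: vec_eq_iff)
qed

end
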